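(* Let $r(a,x)$ be a symmetric noncommutative rational function in $a=(a_1,\dots,a_h)$, $x=(x_1,\dots,x_g)$, regular at the origin, given by a symmetric minimal realization. With $\operatorname{dom}_{\rm ver} r$ and $\operatorname{dom}_{\rm ver}^+ r$ as defined in the context: (1) $\operatorname{dom}_{\rm ver}^+ r$ is a vertebral domain of convexity for $r$. (2) If $\mathcal D$ is a full vertebral domain of convexity for $r$, then $\mathcal D\subseteq\operatorname{dom}_{\rm ver}^+ r$ and $\operatorname{dom}_{\rm ver}^+ r$ is also a full vertebral domain of convexity for $r$. (3) There exist a positive integer $k$, a tuple $\widehat T=(\widehat T_1,\dots,\widehat T_g)\in M_k(\mathbb C)^g$, and a symmetric $k\times k$ matrix-valued nc rational function $w(a)$ defined on $\pi_a(\operatorname{dom}_{\rm ver} r)$ such that $$\operatorname{dom}_{\rm ver}^+ r=\Big\{(A,X)\in\operatorname{dom}_{\rm ver} r:\ w(A)\succeq 0,\ \ I-\sqrt{w(A)}\Big[\sum_{i=1}^g\widehat T_i\otimes X_i\Big]\sqrt{w(A)}\succ 0\Big\}.$$ (4) There exist a $k\times 1$ matrix-valued nc rational function $\ell(a,x)$, defined on $\operatorname{dom}_{\rm ver} r$ and linear in $x$, and a symmetric nc rational function $f(a,x)$, defined on $\operatorname{dom}_{\rm ver} r$ and affine linear in $x$, such that (with $k,\widehat T,w$ from (3)) $r$ admits the following realization, valid on $\operatorname{dom}_{\rm ver}^+ r$: $$r=\ell(a,x)^*\sqrt{w(a)}\Big(I-\sum_{i=1}^g\sqrt{w(a)}\,\widehat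 T_ix_i\sqrt{w(a)}\Big)^{-1}\sqrt{w(a)}\,\ell(a,x)+f(a,x).$$
   Context: Let $h,g$ be positive integers. $\mathbb S_n^k$ is the set of $k$-tuples of $n\times n$ complex hermitian matrices. A subset $\mathcal D$ of $\mathbb S^h\times\mathbb S^g=(\mathbb S^h_n\times\mathbb S^g_n)_{n\ge 1}$ is a sequence $(\mathcal D_n)_n$ with $\mathcal D_n\subseteq \mathbb S^h_n\times\mathbb S^g_n$; elements are written $(A,X)$. It is open if each $\mathcal D_n$ is open. It is free if it is closed under (componentwise) direct sums and under simultaneous unitary conjugation $(A,X)\mapsto U^*(A,X)U$. A noncommutative (nc) rational function in the freely noncommuting variables $a,x$ is given by a syntactically valid expression in $a,x,+,\cdot,(\,)^{-1}$ and complex scalars, evaluated on tuples of matrices of any size in the natural way (matrix-valued ones are evaluated entrywise); $r$ is symmetric if $r(A,X)=r(A,X)^*$ for hermitian tuples in its domain, and regular at the origin if $0$ is in its domain. Such an $r$ (symmetric and regular at the origin) has a symmetric minimal realization (SMR) $$r(a,x)=c^*\Big(J-\sum_{i=1}^g T_ix_i-\sum_{j=1}^h S_ja_j\Big)^{-1}c,$$ where for some positive integer $e$, $J$ is an $e\times e$ matrix with $J^2=I$, $J^*=J$, the $S_j,T_i$ are hermitian $e\times e$ matrices, $c\in\mathbb C^e$, and $e$ is the smallest possible. Define $$\operatorname{dom} r=\Big\{(A,X)\in\mathbb S^h\times\mathbb S^g:\det\Big(J\otimes I-\sum_i T_i\otimes X_i-\sum_j S_j\otimes A_j\Big)\neq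 0\Big\}.$$ Let $V_T$ be the inclusion into $\mathbb C^e$ of the span of the ranges of the $T_i$, let $R_T(a,x)=V_T^*\big(J-\sum_i T_ix_i-\sum_j S_ja_j\big)^{-1}V_T$ (so $R_T(A,X)=(V_T\otimes I)^*(J\otimes I-\sum_i T_i\otimes X_i-\sum_j S_j\otimes A_j)^{-1}(V_T\otimes I)$), and $$\operatorname{dom}^+ r=\{(A,X)\in\operatorname{dom} r: R_T(A,X)\succeq 0\},$$ $$\operatorname{dom}_{\rm ver} r=\{(A,X)\in\operatorname{dom} r:(A,0)\in\operatorname{dom} r\},\qquad \operatorname{dom}_{\rm ver}^+ r=\{(A,X)\in\operatorname{dom}^+ r:(A,0)\in\operatorname{dom}^+ r\}.$$ These definitions do not depend on the choice of SMR. For $\mathcal D\subseteq\mathbb S^h\times\mathbb S^g$ and $A\in\mathbb S^h_k$ let $\mathcal D[A]=\{X\in\mathbb S^g_k:(A,X)\in\mathcal D\}$, and $\pi_a(\mathcal D)=\{A\in\mathbb S^h:(A,X)\in\mathcal D\text{ for some }X\in\mathbb S^g\}$. A free set $\mathcal D$ is convex (resp. open) in $x$ if $\mathcal D[A]$ is convex (resp. open) for each $A\in\mathbb S^h$. For $\mathcal D\subseteq\operatorname{dom} r$, $r$ is convex in $x$ on $\mathcal D$ if $r(A,\frac{X+Y}2)\preceq\frac12(r(A,X)+r(A,Y))$ whenever $(A,X),(A,Y),(A,\frac{X+Y}2)\in\mathcal D$. A free set $\mathcal D$ is vertebral if $(A,X)\in\mathcal D$ implies $(A,0)\in\mathcal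 D$. A vertebral free set $\mathcal D$ is a vertebral domain of convexity for $r$ if it is open in $x$, convex in $x$, and $r$ is convex in $x$ on $\mathcal D$; it is a full vertebral domain of convexity if in addition it contains a free open set $\mathcal U$ with $\mathcal U_1\neq\emptyset$. $\sqrt P$ is the positive semidefinite square root of a positive semidefinite matrix $P$.
   Formalization: For the zero function the minimal realization is taken with e = 0 instead of a positive integer e, because with e = 1 the domains depend on the realization and part (2) fails (J = S = T = 1, c = 0); nothing changes for nonzero r. *)

theory Defs
  imports "Jordan_Normal_Form.Schur_Decomposition" "Jordan_Normal_Form.Gauss_Jordan_Elimination"
begin

section \<open>Matrices\<close>

definition hermitian :: "complex mat \<Rightarrow> bool" where
  "hermitian M \<longleftrightarrow> square_mat M \<and> mat_adjoint M = M"

definition psd :: "complex mat \<Rightarrow> bool" where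
  "psd M \<longleftrightarrow> hermitian M \<and> (\<forall>v \<in> carrier_vec (dim_row M). 0 \<le> Re ((M *\<^sub>v v) \<bullet>c v))"

definition pd :: "complex mat \<Rightarrow> bool" where
  "pd M \<longleftrightarrow> hermitian M \<and>
     (\<forall>v \<in> carrier_vec (dim_row M). v \<noteq> 0\<^sub>v (dim_row M) \<longrightarrow> 0 < Re ((M *\<^sub>v v) \<bullet>c v))"

text \<open>The Loewner order; the library order \<open>\<le>\<close> on matrices is entrywise.\<close>
definition loewner_le :: "complex mat \<Rightarrow> complex mat \<Rightarrow> bool" where
  "loewner_le M N \<longleftrightarrow> psd (N - M)"

definition psd_sqrt :: "complex mat \<Rightarrow> complex mat" where
  "psd_sqrt P = (THE Q. psd Q \<and> Q * Q = P)"

text \<open>Meaningful only for invertible \<open>M\<close>.\<close>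
definition minv :: "complex mat \<Rightarrow> complex mat" where
  "minv M = the (mat_inverse M)"

definition unitary :: "nat \<Rightarrow> complex mat \<Rightarrow> bool" where
  "unitary n U \<longleftrightarrow> U \<in> carrier_mat n n \<and> mat_adjoint U * U = 1\<^sub>m n \<and> U * mat_adjoint U = 1\<^sub>m n"

definition dsum :: "complex mat \<Rightarrow> complex mat \<Rightarrow> complex mat" where
  "dsum M N = four_block_mat M (0\<^sub>m (dim_row M) (dim_col N)) (0\<^sub>m (dim_row N) (dim_col M)) N"

definition kron :: "complex mat \<Rightarrow> complex mat \<Rightarrow> complex mat" where
  "kron M N = mat (dim_row M * dim_row N) (dim_col M * dim_col N)
     (\<lambda>(i, j). M $$ (i div dim_row N, j div dim_col N) * N $$ (i mod dim_row N, j mod dim_col N))"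

text \<open>\<open>lin_pencil e n T X\<close> is \<open>\<Sum>\<^sub>i T\<^sub>i \<otimes> X\<^sub>i\<close> for a tuple \<open>T\<close> of \<open>e \<times> e\<close> matrices and
  a tuple \<open>X\<close> of \<open>n \<times> n\<close> matrices.\<close>
definition lin_pencil :: "nat \<Rightarrow> nat \<Rightarrow> complex mat list \<Rightarrow> complex mat list \<Rightarrow> complex mat" where
  "lin_pencil e n T X = foldr (+) (map2 kron T X) (0\<^sub>m (e * n) (e * n))"

definition mat_range :: "complex mat \<Rightarrow> complex vec set" where
  "mat_range M = (\<lambda>v. M *\<^sub>v v) ` carrier_vec (dim_col M)"


section \<open>Tuples of hermitian matrices and free sets\<close>

definition herm_tuples :: "nat \<Rightarrow> nat \<Rightarrow> complex mat list set" where
  "herm_tuples n k = {X. length X = k \<and> (\<forall>M \<in> set X. M \<in> carrier_mat n n \<and> hermitian M)}"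

text \<open>\<open>tuple_comb s t X Y\<close> is \<open>s X + t Y\<close>, componentwise.\<close>
definition tuple_comb :: "real \<Rightarrow> real \<Rightarrow> complex mat list \<Rightarrow> complex mat list \<Rightarrow> complex mat list" where
  "tuple_comb s t X Y = map2 (\<lambda>M N. complex_of_real s \<cdot>\<^sub>m M + complex_of_real t \<cdot>\<^sub>m N) X Y"

definition zero_tuple :: "nat \<Rightarrow> nat \<Rightarrow> complex mat list" where
  "zero_tuple n k = replicate k (0\<^sub>m n n)"

definition tuple_conj :: "complex mat \<Rightarrow> complex mat list \<Rightarrow> complex mat list" where
  "tuple_conj U X = map (\<lambda>M. mat_adjoint U * M * U) X"

text \<open>The topology on tuples of \<open>n \<times> n\<close> matrices is the usual one; it is given here by the
  maximum of the moduli of the entries.\<close>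
definition tuple_close :: "nat \<Rightarrow> real \<Rightarrow> complex mat list \<Rightarrow> complex mat list \<Rightarrow> bool" where
  "tuple_close n \<epsilon> X Y \<longleftrightarrow>
     (\<forall>i < length X. \<forall>p < n. \<forall>q < n. cmod ((X ! i) $$ (p, q) - (Y ! i) $$ (p, q)) < \<epsilon>)"

text \<open>A sequence \<open>(D\<^sub>n)\<close> indexed by \<open>n \<ge> 1\<close>; the value at \<open>0\<close> is never used.\<close>
type_synonym nc_set = "nat \<Rightarrow> (complex mat list \<times> complex mat list) set"

definition nc_subset :: "nc_set \<Rightarrow> nc_set \<Rightarrow> bool" where
  "nc_subset D E \<longleftrightarrow> (\<forall>n \<ge> 1. D n \<subseteq> E n)"

definition nc_space :: "nat \<Rightarrow> nat \<Rightarrow> nc_set" where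
  "nc_space h g n = herm_tuples n h \<times> herm_tuples n g"

definition nc_open :: "nat \<Rightarrow> nat \<Rightarrow> nc_set \<Rightarrow> bool" where
  "nc_open h g D \<longleftrightarrow>
     (\<forall>n \<ge> 1. \<forall>(A, X) \<in> D n. \<exists>\<epsilon> > 0. \<forall>(B, Y) \<in> nc_space h g n.
        tuple_close n \<epsilon> A B \<and> tuple_close n \<epsilon> X Y \<longrightarrow> (B, Y) \<in> D n)"

definition free_set :: "nat \<Rightarrow> nat \<Rightarrow> nc_set \<Rightarrow> bool" where
  "free_set h g D \<longleftrightarrow>
     nc_subset D (nc_space h g) \<and>
     (\<forall>m \<ge> 1. \<forall>n \<ge> 1. \<forall>(A, X) \<in> D m. \<forall>(B, Y) \<in> D n. (map2 dsum A B, map2 dsum X Y) \<in> D (m + n)) \<and>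
     (\<forall>n \<ge> 1. \<forall>(A, X) \<in> D n. \<forall>U. unitary n U \<longrightarrow> (tuple_conj U A, tuple_conj U X) \<in> D n)"

definition slice :: "nc_set \<Rightarrow> nat \<Rightarrow> complex mat list \<Rightarrow> complex mat list set" where
  "slice D n A = {X. (A, X) \<in> D n}"

definition proj_a :: "nc_set \<Rightarrow> nat \<Rightarrow> complex mat list set" where
  "proj_a D n = {A. \<exists>X. (A, X) \<in> D n}"

definition convex_in_x :: "nat \<Rightarrow> nc_set \<Rightarrow> bool" where
  "convex_in_x h D \<longleftrightarrow>
     (\<forall>n \<ge> 1. \<forall>A \<in> herm_tuples n h. \<forall>X \<in> slice D n A. \<forall>Y \<in> slice D n A.
        \<forall>t. 0 \<le> t \<and> t \<le> 1 \<longrightarrow> tuple_comb (1 - t) t X Y \<in> slice D n A)"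

definition open_in_x :: "nat \<Rightarrow> nat \<Rightarrow> nc_set \<Rightarrow> bool" where
  "open_in_x h g D \<longleftrightarrow>
     (\<forall>n \<ge> 1. \<forall>A \<in> herm_tuples n h. \<forall>X \<in> slice D n A. \<exists>\<epsilon> > 0.
        \<forall>Y \<in> herm_tuples n g. tuple_close n \<epsilon> X Y \<longrightarrow> Y \<in> slice D n A)"

definition vertebral :: "nat \<Rightarrow> nc_set \<Rightarrow> bool" where
  "vertebral g D \<longleftrightarrow> (\<forall>n \<ge> 1. \<forall>(A, X) \<in> D n. (A, zero_tuple n g) \<in> D n)"


section \<open>Noncommutative rational functions\<close>

datatype 'v nc_expr =
    Scal complex
  | Var 'v
  | Add "'v nc_expr" "'v nc_expr"
  | Mul "'v nc_expr" "'v nc_expr"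
  | Inv "'v nc_expr"

text \<open>Value on \<open>n \<times> n\<close> matrices; \<open>None\<close> outside the domain of the expression.\<close>
primrec nc_eval :: "nat \<Rightarrow> ('v \<Rightarrow> complex mat) \<Rightarrow> 'v nc_expr \<Rightarrow> complex mat option" where
  "nc_eval n \<rho> (Scal z) = Some (z \<cdot>\<^sub>m 1\<^sub>m n)"
| "nc_eval n \<rho> (Var v) = Some (\<rho> v)"
| "nc_eval n \<rho> (Add p q) =
     Option.bind (nc_eval n \<rho> p) (\<lambda>M. Option.bind (nc_eval n \<rho> q) (\<lambda>N. Some (M + N)))"
| "nc_eval n \<rho> (Mul p q) =
     Option.bind (nc_eval n \<rho> p) (\<lambda>M. Option.bind (nc_eval n \<rho> q) (\<lambda>N. Some (M * N)))"
| "nc_eval n \<rho> (Inv p) = Option.bind (nc_eval n \<rho> p) mat_inverse"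

text \<open>Matrix-valued functions are matrices of expressions. The \<open>(i, j)\<close> block of the value is the
  value of the \<open>(i, j)\<close> entry, which is the block layout of \<^const>\<open>kron\<close>.\<close>
definition nc_mat_defined :: "nat \<Rightarrow> ('v \<Rightarrow> complex mat) \<Rightarrow> 'v nc_expr mat \<Rightarrow> bool" where
  "nc_mat_defined n \<rho> W \<longleftrightarrow> (\<forall>i < dim_row W. \<forall>j < dim_col W. nc_eval n \<rho> (W $$ (i, j)) \<noteq> None)"

definition nc_mat_eval :: "nat \<Rightarrow> ('v \<Rightarrow> complex mat) \<Rightarrow> 'v nc_expr mat \<Rightarrow> complex mat" where
  "nc_mat_eval n \<rho> W = mat (dim_row W * n) (dim_col W * n)
     (\<lambda>(p, q). the (nc_eval n \<rho> (W $$ (p div n, q div n))) $$ (p mod n, q mod n))"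

text \<open>Functions of \<open>a\<close> alone use variables of type \<^typ>\<open>nat\<close>; functions of \<open>(a, x)\<close> use
  the following variables. Indices start at \<open>0\<close>.\<close>
datatype ax_var = AVar nat | XVar nat

definition env_a :: "complex mat list \<Rightarrow> nat \<Rightarrow> complex mat" where
  "env_a A j = A ! j"

fun env_ax :: "complex mat list \<Rightarrow> complex mat list \<Rightarrow> ax_var \<Rightarrow> complex mat" where
  "env_ax A X (AVar j) = A ! j"
| "env_ax A X (XVar i) = X ! i"

definition vars_a :: "nat \<Rightarrow> nat set" where
  "vars_a h = {..<h}"

definition vars_ax :: "nat \<Rightarrow> nat \<Rightarrow> ax_var set" where
  "vars_ax h g = AVar ` {..<h} \<union> XVar ` {..<g}"

definition nc_mat_over :: "'v set \<Rightarrow> nat \<Rightarrow> nat \<Rightarrow> 'v nc_expr mat \<Rightarrow> bool" where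
  "nc_mat_over V k l W \<longleftrightarrow> W \<in> carrier_mat k l \<and> (\<forall>p \<in> elements_mat W. set_nc_expr p \<subseteq> V)"

definition nc_symmetric_ax :: "nat \<Rightarrow> nat \<Rightarrow> ax_var nc_expr \<Rightarrow> bool" where
  "nc_symmetric_ax h g r \<longleftrightarrow>
     (\<forall>n \<ge> 1. \<forall>(A, X) \<in> nc_space h g n. \<forall>M. nc_eval n (env_ax A X) r = Some M \<longrightarrow> mat_adjoint M = M)"

definition nc_mat_symmetric_a :: "nat \<Rightarrow> nat nc_expr mat \<Rightarrow> bool" where
  "nc_mat_symmetric_a h W \<longleftrightarrow>
     (\<forall>n \<ge> 1. \<forall>A \<in> herm_tuples n h. nc_mat_defined n (env_a A) W \<longrightarrow>
        mat_adjoint (nc_mat_eval n (env_a A) W) = nc_mat_eval n (env_a A) W)"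

definition regular_at_origin :: "nat \<Rightarrow> nat \<Rightarrow> ax_var nc_expr \<Rightarrow> bool" where
  "regular_at_origin h g r \<longleftrightarrow> nc_eval 1 (env_ax (zero_tuple 1 h) (zero_tuple 1 g)) r \<noteq> None"

text \<open>(Affine) linearity in \<open>x\<close>: for each fixed \<open>A\<close>, the map \<open>X \<mapsto> L(A, X)\<close> is (affine) linear over
  the reals on hermitian tuples, wherever it is defined.\<close>
definition linear_in_x :: "nat \<Rightarrow> nat \<Rightarrow> ax_var nc_expr mat \<Rightarrow> bool" where
  "linear_in_x h g L \<longleftrightarrow>
     (\<forall>n \<ge> 1. \<forall>A \<in> herm_tuples n h. \<forall>X \<in> herm_tuples n g. \<forall>Y \<in> herm_tuples n g. \<forall>s t.
        nc_mat_defined n (env_ax A X) L \<and> nc_mat_defined n (env_ax A Y) L \<and>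
        nc_mat_defined n (env_ax A (tuple_comb s t X Y)) L \<longrightarrow>
        nc_mat_eval n (env_ax A (tuple_comb s t X Y)) L =
          complex_of_real s \<cdot>\<^sub>m nc_mat_eval n (env_ax A X) L
          + complex_of_real t \<cdot>\<^sub>m nc_mat_eval n (env_ax A Y) L)"

definition affine_in_x :: "nat \<Rightarrow> nat \<Rightarrow> ax_var nc_expr \<Rightarrow> bool" where
  "affine_in_x h g f \<longleftrightarrow>
     (\<forall>n \<ge> 1. \<forall>A \<in> herm_tuples n h. \<forall>X \<in> herm_tuples n g. \<forall>Y \<in> herm_tuples n g. \<forall>t M N K.
        nc_eval n (env_ax A X) f = Some M \<and> nc_eval n (env_ax A Y) f = Some N \<and>
        nc_eval n (env_ax A (tuple_comb (1 - t) t X Y)) f = Some K \<longrightarrow>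
        K = complex_of_real (1 - t) \<cdot>\<^sub>m M + complex_of_real t \<cdot>\<^sub>m N)"


section \<open>Symmetric minimal realizations\<close>

record realization =
  rdim :: nat
  rJ :: "complex mat"
  rT :: "complex mat list"
  rS :: "complex mat list"
  rc :: "complex vec"

definition wf_realization :: "nat \<Rightarrow> nat \<Rightarrow> realization \<Rightarrow> bool" where
  "wf_realization h g R \<longleftrightarrow>
     rJ R \<in> carrier_mat (rdim R) (rdim R) \<and> rJ R * rJ R = 1\<^sub>m (rdim R) \<and> hermitian (rJ R) \<and>
     rT R \<in> herm_tuples (rdim R) g \<and> rS R \<in> herm_tuples (rdim R) h \<and> rc R \<in> carrier_vec (rdim R)"

text \<open>\<open>J \<otimes> I - \<Sum>\<^sub>i T\<^sub>i \<otimes> X\<^sub>i - \<Sum>\<^sub>j S\<^sub>j \<otimes> A\<^sub>j\<close>\<close>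
definition pencil :: "realization \<Rightarrow> nat \<Rightarrow> complex mat list \<Rightarrow> complex mat list \<Rightarrow> complex mat" where
  "pencil R n A X =
     kron (rJ R) (1\<^sub>m n) - lin_pencil (rdim R) n (rT R) X - lin_pencil (rdim R) n (rS R) A"

definition dom_r :: "nat \<Rightarrow> nat \<Rightarrow> realization \<Rightarrow> nc_set" where
  "dom_r h g R n = {(A, X) \<in> nc_space h g n. det (pencil R n A X) \<noteq> 0}"

text \<open>\<open>compressed V R n A X\<close> is \<open>(V \<otimes> I)\<^sup>* (J \<otimes> I - \<Sum>\<^sub>i T\<^sub>i \<otimes> X\<^sub>i - \<Sum>\<^sub>j S\<^sub>j \<otimes> A\<^sub>j)\<^sup>-\<^sup>1 (V \<otimes> I)\<close>.\<close>
definition compressed ::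
    "complex mat \<Rightarrow> realization \<Rightarrow> nat \<Rightarrow> complex mat list \<Rightarrow> complex mat list \<Rightarrow> complex mat" where
  "compressed V R n A X =
     mat_adjoint (kron V (1\<^sub>m n)) * minv (pencil R n A X) * kron V (1\<^sub>m n)"

definition realization_eval :: "realization \<Rightarrow> nat \<Rightarrow> complex mat list \<Rightarrow> complex mat list \<Rightarrow> complex mat" where
  "realization_eval R n A X = compressed (mat_of_cols (rdim R) [rc R]) R n A X"

text \<open>Equality of rational functions is equality of values wherever both sides are defined; for
  \<open>r\<close> regular at the origin, both sides are defined near the origin at every level.\<close>
definition symmetric_realization :: "nat \<Rightarrow> nat \<Rightarrow> ax_var nc_expr \<Rightarrow> realization \<Rightarrow> bool" where
  "symmetric_realization h g r R \<longleftrightarrow> wf_realization h g R \<and>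
     (\<forall>n \<ge> 1. \<forall>(A, X) \<in> dom_r h g R n. \<forall>M.
        nc_eval n (env_ax A X) r = Some M \<longrightarrow> M = realization_eval R n A X)"

text \<open>The zero function is realized with \<open>e = 0\<close>, so \<open>rdim R\<close> is positive exactly when \<open>r\<close> is not the
  zero function. Insisting on \<open>e \<ge> 1\<close> would give the zero function realizations with
  \<open>e = 1\<close>, \<open>c = 0\<close> and arbitrary \<open>T\<close>, \<open>S\<close>, for which the domains below do depend on the
  realization.\<close>
definition SMR :: "nat \<Rightarrow> nat \<Rightarrow> ax_var nc_expr \<Rightarrow> realization \<Rightarrow> bool" where
  "SMR h g r R \<longleftrightarrow> symmetric_realization h g r R \<and>
     (\<forall>R'. symmetric_realization h g r R' \<longrightarrow> rdim R \<le> rdim R')"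

text \<open>The inclusion of the span of the ranges of the \<open>T\<^sub>i\<close> into \<open>\<complex>\<^sup>e\<close>, as a matrix with respect to
  an orthonormal basis of the span; positivity of the compression does not depend on that basis.\<close>
definition is_inclusion_T :: "realization \<Rightarrow> complex mat \<Rightarrow> bool" where
  "is_inclusion_T R V \<longleftrightarrow>
     dim_row V = rdim R \<and> mat_adjoint V * V = 1\<^sub>m (dim_col V) \<and>
     mat_range V = LinearCombinations.module.span class_ring (module_vec TYPE(complex) (rdim R))
                     (\<Union>M \<in> set (rT R). mat_range M)"

definition V_T :: "realization \<Rightarrow> complex mat" where
  "V_T R = (SOME V. is_inclusion_T R V)"

definition R_T :: "realization \<Rightarrow> nat \<Rightarrow> complex mat list \<Rightarrow> complex mat list \<Rightarrow> complex mat" where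
  "R_T R n A X = compressed (V_T R) R n A X"

definition dom_plus :: "nat \<Rightarrow> nat \<Rightarrow> realization \<Rightarrow> nc_set" where
  "dom_plus h g R n = {(A, X) \<in> dom_r h g R n. psd (R_T R n A X)}"

definition dom_ver :: "nat \<Rightarrow> nat \<Rightarrow> realization \<Rightarrow> nc_set" where
  "dom_ver h g R n = {(A, X) \<in> dom_r h g R n. (A, zero_tuple n g) \<in> dom_r h g R n}"

definition dom_ver_plus :: "nat \<Rightarrow> nat \<Rightarrow> realization \<Rightarrow> nc_set" where
  "dom_ver_plus h g R n = {(A, X) \<in> dom_plus h g R n. (A, zero_tuple n g) \<in> dom_plus h g R n}"


section \<open>Domains of convexity\<close>

definition convex_in_x_on :: "nat \<Rightarrow> nat \<Rightarrow> realization \<Rightarrow> nc_set \<Rightarrow> bool" where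
  "convex_in_x_on h g R D \<longleftrightarrow>
     nc_subset D (dom_r h g R) \<and>
     (\<forall>n \<ge> 1. \<forall>A X Y.
        (A, X) \<in> D n \<and> (A, Y) \<in> D n \<and> (A, tuple_comb (1/2) (1/2) X Y) \<in> D n \<longrightarrow>
        loewner_le (realization_eval R n A (tuple_comb (1/2) (1/2) X Y))
          ((1/2) \<cdot>\<^sub>m (realization_eval R n A X + realization_eval R n A Y)))"

definition vertebral_domain_of_convexity :: "nat \<Rightarrow> nat \<Rightarrow> realization \<Rightarrow> nc_set \<Rightarrow> bool" where
  "vertebral_domain_of_convexity h g R D \<longleftrightarrow>
     free_set h g D \<and> vertebral g D \<and> open_in_x h g D \<and> convex_in_x h D \<and> convex_in_x_on h g R D"

definition full_vertebral_domain_of_convexity :: "nat \<Rightarrow> nat \<Rightarrow> realization \<Rightarrow> nc_set \<Rightarrow> bool" where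
  "full_vertebral_domain_of_convexity h g R D \<longleftrightarrow>
     vertebral_domain_of_convexity h g R D \<and>
     (\<exists>U. free_set h g U \<and> nc_open h g U \<and> nc_subset U D \<and> U 1 \<noteq> {})"

end

theory Submission
  imports Defs "Jordan_Normal_Form.Spectral_Radius"
begin

text \<open>For fixed \<open>a\<close> let \<open>P\<close> be the pencil at \<open>(a, 0)\<close> and \<open>w = V\<^sub>T\<^sup>* P\<^sup>-\<^sup>1 V\<^sub>T\<close>, so that \<open>w\<close> is
  \<open>R\<^sub>T(a, 0)\<close>. Since the \<open>T\<^sub>i\<close> are compressed to the range of \<open>V\<^sub>T\<close>, the resolvent identity gives
  \<open>R\<^sub>T = \<surd>w (1 - \<surd>w T(x) \<surd>w)\<^sup>-\<^sup>1 \<surd>w\<close> wherever \<open>w \<ge> 0\<close>, and \<open>R\<^sub>T \<ge> 0\<close> becomes positive definiteness of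
  the affine pencil in the middle. Openness and convexity in \<open>x\<close>, convexity of \<open>r\<close>, and the
  realization in (4) are read off from this formula.

  For (2), convexity makes second differences of \<open>r\<close> nonnegative. At the direct sum of a point
  \<open>(A, X)\<close> of the domain and a point \<open>(B, Y)\<close> of the open set, in an off-diagonal direction \<open>H\<close>, they
  converge to the quadratic form of \<open>(J - T(X) - S(A))\<^sup>-\<^sup>1\<close> at vectors \<open>T(H) \<zeta>\<close>, where \<open>\<zeta>\<close> is the
  inverse pencil at \<open>(B, Y)\<close> applied to a multiple of \<open>c\<close>. The components of such \<open>\<zeta>\<close> form a
  subspace of \<open>\<complex>\<^sup>e\<close>, stable under the realization, so by minimality they exhaust \<open>\<complex>\<^sup>e\<close>; hence the
  vectors \<open>T(H) \<zeta>\<close> exhaust the range of \<open>V\<^sub>T \<otimes> I\<close> and \<open>R\<^sub>T(A, X) \<ge> 0\<close>.\<close>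

text \<open>Three obstacles shape the proof. An expression can invert a single entry only, so the
  inverse of a matrix of expressions is assembled by block elimination, and a pivot may be singular
  although the matrix is not; squaring the hermitian pencil avoids this, so that \<open>w\<close> is
  defined exactly where the pencil at \<open>(A, 0)\<close> is invertible. Next, minimality compares
  only realizations with a signature matrix that agree with \<open>r\<close> on their own whole
  domain. Compressing to an invariant subspace replaces \<open>J\<close> by a Gram matrix that may
  be degenerate, and the smaller pencil may be invertible where the larger is not. The first is met
  by rescaling the eigenvectors of the Gram matrix and giving null ones the sign 1, the second by a
  limit along real multiples of a point. Finally, the open set need not contain the origin, so the
  reachable subspace is at first stable under \<open>minv M\<close> times the coefficients, with
  \<open>M\<close> the pencil at a scalar point of the open set; stability under \<open>J\<close>
  times the coefficients has to be derived before minimality applies.\<close>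

text \<open>Dimensions equal to \<open>1\<close> must not be rewritten to \<open>Suc 0\<close>.\<close>
declare One_nat_def [simp del]

section \<open>Matrix algebra\<close>

abbreviation adj :: "complex mat \<Rightarrow> complex mat" where "adj \<equiv> mat_adjoint"

lemma adj_dim [simp]: "dim_row (adj A) = dim_col A" "dim_col (adj A) = dim_row A"
  by (auto simp: mat_adjoint_def)

lemma adj_index [simp]: "i < dim_col A \<Longrightarrow> j < dim_row A \<Longrightarrow> adj A $$ (i, j) = cnj (A $$ (j, i))"
  by (auto simp: mat_adjoint_def mat_of_rows_index)

lemma adj_carrier [simp]: "A \<in> carrier_mat n m \<Longrightarrow> adj A \<in> carrier_mat m n"
  by auto

lemma times_mat_index:
  assumes "i < dim_row A" "j < dim_col B" "dim_col A = dim_row B"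
  shows "(A * B) $$ (i, j) = (\<Sum>k<dim_row B. A $$ (i, k) * B $$ (k, j))"
  using assms by (auto simp: scalar_prod_def lessThan_atLeast0 intro!: sum.cong)

lemma adj_adj [simp]: "adj (adj A) = A"
  by (rule eq_matI) auto

lemma adj_mult [simp]:
  assumes "dim_col A = dim_row B"
  shows "adj (A * B) = adj B * adj A"
  by (rule eq_matI) (use assms in \<open>auto simp: times_mat_index mult.commute simp del: index_mult_mat(1) intro!: sum.cong\<close>)

lemma adj_add [simp]:
  assumes "dim_row A = dim_row B" "dim_col A = dim_col B"
  shows "adj (A + B) = adj A + adj B"
  by (rule eq_matI) (use assms in auto)

lemma adj_minus [simp]:
  assumes "dim_row A = dim_row B" "dim_col A = dim_col B"
  shows "adj (A - B) = adj A - adj B"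
  by (rule eq_matI) (use assms in auto)

lemma adj_smult [simp]: "adj (z \<cdot>\<^sub>m A) = cnj z \<cdot>\<^sub>m adj A"
  by (rule eq_matI) auto

lemma adj_one [simp]: "adj (1\<^sub>m n) = 1\<^sub>m n"
  by (rule eq_matI) auto

lemma adj_zero [simp]: "adj (0\<^sub>m n m) = 0\<^sub>m m n"
  by (rule eq_matI) auto

lemma smult_dim [simp]: "dim_row (z \<cdot>\<^sub>m (A::complex mat)) = dim_row A" "dim_col (z \<cdot>\<^sub>m A) = dim_col A"
  by auto

text \<open>Ring laws whose side conditions are equations between dimensions, which the simplifier
  can discharge.\<close>

lemma mm_assoc:
  fixes A B C :: "complex mat"
  assumes "dim_col A = dim_row B" "dim_col B = dim_row C"
  shows "A * B * C = A * (B * C)"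
  by (rule assoc_mult_mat[of _ "dim_row A" "dim_row B" _ "dim_row C" _ "dim_col C"]) (use assms in auto)

lemma mm_add_right:
  fixes A B C :: "complex mat"
  assumes "dim_col A = dim_row B" "dim_row B = dim_row C" "dim_col B = dim_col C"
  shows "A * (B + C) = A * B + A * C"
  by (rule mult_add_distrib_mat[of _ "dim_row A" "dim_row B" _ "dim_col B"]) (use assms in auto)

lemma mm_add_left:
  fixes A B C :: "complex mat"
  assumes "dim_row A = dim_row B" "dim_col A = dim_col B" "dim_col A = dim_row C"
  shows "(A + B) * C = A * C + B * C"
  by (rule add_mult_distrib_mat[of _ "dim_row A" "dim_row C" _ _ "dim_col C"]) (use assms in auto)

lemma mm_minus_right:
  fixes A B C :: "complex mat"
  assumes "dim_col A = dim_row B" "dim_row B = dim_row C" "dim_col B = dim_col C"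
  shows "A * (B - C) = A * B - A * C"
  by (rule mult_minus_distrib_mat[of _ "dim_row A" "dim_row B" _ "dim_col B"]) (use assms in auto)

lemma mm_minus_left:
  fixes A B C :: "complex mat"
  assumes "dim_row A = dim_row B" "dim_col A = dim_col B" "dim_col A = dim_row C"
  shows "(A - B) * C = A * C - B * C"
  by (rule minus_mult_distrib_mat[of _ "dim_row A" "dim_row C" _ _ "dim_col C"]) (use assms in auto)

lemma mm_smult_left:
  fixes A B :: "complex mat"
  assumes "dim_col A = dim_row B"
  shows "(z \<cdot>\<^sub>m A) * B = z \<cdot>\<^sub>m (A * B)"
  by (rule mult_smult_assoc_mat[of _ "dim_row A" "dim_row B" _ "dim_col B"]) (use assms in auto)

lemma mm_smult_right:
  fixes A B :: "complex mat"
  assumes "dim_col A = dim_row B"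
  shows "A * (z \<cdot>\<^sub>m B) = z \<cdot>\<^sub>m (A * B)"
  by (rule mult_smult_distrib[of _ "dim_row A" "dim_row B" _ "dim_col B"]) (use assms in auto)

lemma mm_one_left: "dim_row A = n \<Longrightarrow> 1\<^sub>m n * A = (A :: complex mat)"
  by (rule left_mult_one_mat[of _ _ "dim_col A"]) auto

lemma mm_one_right: "dim_col A = n \<Longrightarrow> A * 1\<^sub>m n = (A :: complex mat)"
  by (rule right_mult_one_mat[of _ "dim_row A"]) auto

lemma mm_zero_left: "dim_row A = m \<Longrightarrow> 0\<^sub>m n m * (A :: complex mat) = 0\<^sub>m n (dim_col A)"
  by (rule left_mult_zero_mat[of _ m "dim_col A"]) auto

lemma mm_zero_right: "dim_col A = n \<Longrightarrow> (A :: complex mat) * 0\<^sub>m n m = 0\<^sub>m (dim_row A) m"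
  by (rule right_mult_zero_mat[of _ "dim_row A"]) auto

lemmas mat_ring = mm_assoc mm_add_right mm_add_left mm_minus_right mm_minus_left
  mm_smult_left mm_smult_right mm_one_left mm_one_right mm_zero_left mm_zero_right

lemma mm_assoc_eq:
  fixes A B C D :: "complex mat"
  assumes "A * B = C" "dim_col A = dim_row B" "dim_col B = dim_row D"
  shows "A * (B * D) = C * D"
  using assms mm_assoc by metis

lemma smult_add_mm:
  fixes A B :: "complex mat"
  assumes "dim_row A = dim_row B" "dim_col A = dim_col B"
  shows "z \<cdot>\<^sub>m (A + B) = z \<cdot>\<^sub>m A + z \<cdot>\<^sub>m B"
  by (rule eq_matI) (use assms in \<open>auto simp: algebra_simps\<close>)

section \<open>Kronecker products and their index arithmetic\<close>

lemma sum_div_mod: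
  fixes f :: "nat \<Rightarrow> nat \<Rightarrow> 'a::comm_monoid_add"
  shows "(\<Sum>k<a * b. f (k div b) (k mod b)) = (\<Sum>i<a. \<Sum>j<b. f i j)"
proof (cases "b = 0")
  case False
  have "(\<Sum>k<a * b. f (k div b) (k mod b)) =
      (\<Sum>i<a. sum (\<lambda>k. f (k div b) (k mod b)) {i * b..<i * b + b})"
    by (rule sum.nat_group[symmetric])
  also have "\<dots> = (\<Sum>i<a. \<Sum>j<b. f i j)"
  proof (rule sum.cong[OF refl])
    fix i
    have "sum (\<lambda>k. f (k div b) (k mod b)) {i * b..<i * b + b} =
        (\<Sum>j\<in>{0..<b}. f ((j + i * b) div b) ((j + i * b) mod b))"
      using sum.shift_bounds_nat_ivl[of "\<lambda>k. f (k div b) (k mod b)" 0 "i * b" b]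
      by (simp add: add.commute)
    also have "\<dots> = (\<Sum>j<b. f i j)"
      using False by (intro sum.cong) auto
    finally show "sum (\<lambda>k. f (k div b) (k mod b)) {i * b..<i * b + b} = (\<Sum>j<b. f i j)" .
  qed
  finally show ?thesis .
qed simp

lemma div_lt_of_lt_mult: "i < a * b \<Longrightarrow> i div b < (a::nat)"
  by (metis less_mult_imp_div_less)

lemma mod_lt_of_lt_mult: "i < a * b \<Longrightarrow> i mod b < (b::nat)"
  by (cases "b = 0") auto

lemma kron_dim [simp]: "dim_row (kron M N) = dim_row M * dim_row N" "dim_col (kron M N) = dim_col M * dim_col N"
  by (auto simp: kron_def)

lemma kron_index [simp]:
  "i < dim_row M * dim_row N \<Longrightarrow> j < dim_col M * dim_col N \<Longrightarrow>
   kron M N $$ (i, j) = M $$ (i div dim_row N, j div dim_col N) * N $$ (i mod dim_row N, j mod dim_col N)"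
  by (auto simp: kron_def)

lemma kron_mult:
  assumes "dim_col A = dim_row C" "dim_col B = dim_row D"
  shows "kron A B * kron C D = kron (A * C) (B * D)"
proof (rule eq_matI)
  fix i j assume "i < dim_row (kron (A * C) (B * D))" "j < dim_col (kron (A * C) (B * D))"
  then have ij: "i < dim_row A * dim_row B" "j < dim_col C * dim_col D" by auto
  note dm = ij[THEN div_lt_of_lt_mult] ij[THEN mod_lt_of_lt_mult]
  have "(kron A B * kron C D) $$ (i, j) = (\<Sum>k<dim_row C * dim_row D.
      (A $$ (i div dim_row B, k div dim_row D) * C $$ (k div dim_row D, j div dim_col D)) *
      (B $$ (i mod dim_row B, k mod dim_row D) * D $$ (k mod dim_row D, j mod dim_col D)))"
    using ij assms by (subst times_mat_index) (auto simp: mult_ac intro!: sum.cong)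
  also have "\<dots> = (\<Sum>p<dim_row C. \<Sum>q<dim_row D.
      (A $$ (i div dim_row B, p) * C $$ (p, j div dim_col D)) *
      (B $$ (i mod dim_row B, q) * D $$ (q, j mod dim_col D)))"
    by (rule sum_div_mod)
  also have "\<dots> = (\<Sum>p<dim_row C. A $$ (i div dim_row B, p) * C $$ (p, j div dim_col D)) *
      (\<Sum>q<dim_row D. B $$ (i mod dim_row B, q) * D $$ (q, j mod dim_col D))"
    by (rule sum_product[symmetric])
  also have "\<dots> = (A * C) $$ (i div dim_row B, j div dim_col D) * (B * D) $$ (i mod dim_row B, j mod dim_col D)"
    using assms dm by (simp only: times_mat_index)
  also have "\<dots> = kron (A * C) (B * D) $$ (i, j)"
    using ij by (subst kron_index) (simp_all del: index_mult_mat(1))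
  finally show "(kron A B * kron C D) $$ (i, j) = kron (A * C) (B * D) $$ (i, j)" .
qed (use assms in auto)

lemma adj_kron [simp]: "adj (kron A B) = kron (adj A) (adj B)"
proof (rule eq_matI)
  fix i j assume "i < dim_row (kron (adj A) (adj B))" "j < dim_col (kron (adj A) (adj B))"
  then have ij: "i < dim_col A * dim_col B" "j < dim_row A * dim_row B" by auto
  note dm = ij[THEN div_lt_of_lt_mult] ij[THEN mod_lt_of_lt_mult]
  show "adj (kron A B) $$ (i, j) = kron (adj A) (adj B) $$ (i, j)"
    using ij dm by auto
qed auto

lemma kron_add_right:
  assumes "dim_row B = dim_row C" "dim_col B = dim_col C"
  shows "kron A (B + C) = kron A B + kron A C"
  by (rule eq_matI)
    (use assms in \<open>auto simp: algebra_simps mod_lt_of_lt_mult\<close>)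

lemma kron_add_left:
  assumes "dim_row B = dim_row C" "dim_col B = dim_col C"
  shows "kron (B + C) A = kron B A + kron C A"
  by (rule eq_matI)
    (use assms in \<open>auto simp: algebra_simps div_lt_of_lt_mult\<close>)

lemma kron_smult_right: "kron A (z \<cdot>\<^sub>m B) = z \<cdot>\<^sub>m kron A B"
  by (rule eq_matI) (auto simp: algebra_simps mod_lt_of_lt_mult)

lemma kron_smult_left: "kron (z \<cdot>\<^sub>m A) B = z \<cdot>\<^sub>m kron A B"
  by (rule eq_matI) (auto simp: algebra_simps div_lt_of_lt_mult)

lemma kron_one: "kron (1\<^sub>m a) (1\<^sub>m b) = 1\<^sub>m (a * b)"
proof (rule eq_matI)
  fix i j assume "i < dim_row (1\<^sub>m (a * b) :: complex mat)" "j < dim_col (1\<^sub>m (a * b) :: complex mat)"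
  then have ij: "i < a * b" "j < a * b" by auto
  note dm = ij[THEN div_lt_of_lt_mult] ij[THEN mod_lt_of_lt_mult]
  have "i = j \<longleftrightarrow> i div b = j div b \<and> i mod b = j mod b"
    by (metis div_mult_mod_eq)
  then show "kron (1\<^sub>m a) (1\<^sub>m b) $$ (i, j) = 1\<^sub>m (a * b) $$ (i, j)"
    using ij dm by auto
qed auto

lemma kron_zero_right [simp]: "kron A (0\<^sub>m n m) = 0\<^sub>m (dim_row A * n) (dim_col A * m)"
  by (rule eq_matI) (auto simp: mod_lt_of_lt_mult)

lemma kron_zero_left [simp]: "kron (0\<^sub>m n m) A = 0\<^sub>m (n * dim_row A) (m * dim_col A)"
  by (rule eq_matI) (auto simp: div_lt_of_lt_mult)

lemma hermitian_iff: "hermitian A \<longleftrightarrow> dim_row A = dim_col A \<and> adj A = A"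
  by (auto simp: hermitian_def)

text \<open>Vectors are treated as one-column matrices, so that the quadratic form of \<open>M\<close> at \<open>x\<close> is the
  \<open>1 \<times> 1\<close> matrix \<open>x\<^sup>* M x\<close>.\<close>

definition colmat :: "complex vec \<Rightarrow> complex mat" where
  "colmat v = mat (dim_vec v) 1 (\<lambda>(i, j). v $ i)"

lemma colmat_dim [simp]: "dim_row (colmat v) = dim_vec v" "dim_col (colmat v) = 1"
  by (auto simp: colmat_def)

lemma colmat_index [simp]: "i < dim_vec v \<Longrightarrow> colmat v $$ (i, 0) = v $ i"
  by (auto simp: colmat_def)

lemma mat_of_cols_colmat: "dim_vec v = n \<Longrightarrow> mat_of_cols n [v] = colmat v"
  by (rule eq_matI) (auto simp: mat_of_cols_index)

lemma colmat_mult: "dim_col M = dim_vec v \<Longrightarrow> colmat (M *\<^sub>v v) = M * colmat v"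
  by (rule eq_matI) (auto simp: times_mat_index scalar_prod_def lessThan_atLeast0 simp del: index_mult_mat(1) intro!: sum.cong)

lemma colmat_zero: "colmat v = 0\<^sub>m n 1 \<longleftrightarrow> v = 0\<^sub>v n"
proof
  assume *: "colmat v = 0\<^sub>m n 1"
  then have n: "dim_vec v = n" by (metis colmat_dim(1) index_zero_mat(2))
  then show "v = 0\<^sub>v n"
  proof (intro eq_vecI)
    fix i assume i: "i < dim_vec (0\<^sub>v n :: complex vec)"
    have "colmat v $$ (i, 0) = 0" unfolding * using i by simp
    then show "v $ i = 0\<^sub>v n $ i" using i n by simp
  qed (use n in simp)
qed (auto intro!: eq_matI)

lemma colmat_col: "dim_col x = 1 \<Longrightarrow> colmat (col x 0) = x"
  by (rule eq_matI) auto

lemma colmat_inner: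
  assumes "dim_row M = dim_vec v" "dim_col M = dim_vec v"
  shows "(M *\<^sub>v v) \<bullet>c v = (adj (colmat v) * (M * colmat v)) $$ (0, 0)"
  using assms by (subst times_mat_index)
    (auto simp: colmat_mult[symmetric] scalar_prod_def lessThan_atLeast0 mult.commute simp del: index_mult_mat intro!: sum.cong)

text \<open>For hermitian \<open>M\<close> this entry is real; taking the real part makes every sign
  condition a statement about reals from the start.\<close>

definition qf :: "complex mat \<Rightarrow> complex mat \<Rightarrow> real" where
  "qf M x = Re ((adj x * (M * x)) $$ (0, 0))"

lemma psd_iff:
  "psd M \<longleftrightarrow> hermitian M \<and> (\<forall>x \<in> carrier_mat (dim_row M) 1. 0 \<le> qf M x)"
proof -
  { assume h: "hermitian M"
    then have d: "dim_row M = dim_col M" by (auto simp: hermitian_iff)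
    have "(\<forall>v \<in> carrier_vec (dim_row M). 0 \<le> Re ((M *\<^sub>v v) \<bullet>c v)) \<longleftrightarrow>
        (\<forall>x \<in> carrier_mat (dim_row M) 1. 0 \<le> qf M x)"
    proof safe
      fix x :: "complex mat" assume x: "x \<in> carrier_mat (dim_row M) 1"
        and *: "\<forall>v\<in>carrier_vec (dim_row M). 0 \<le> Re ((M *\<^sub>v v) \<bullet>c v)"
      have "col x 0 \<in> carrier_vec (dim_row M)" using x by (auto intro: carrier_vecI)
      from *[rule_format, OF this] show "0 \<le> qf M x"
        using x d by (subst (asm) colmat_inner) (auto simp: colmat_col qf_def)
    next
      fix v :: "complex vec" assume v: "v \<in> carrier_vec (dim_row M)"
        and *: "\<forall>x \<in> carrier_mat (dim_row M) 1. 0 \<le> qf M x"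
      have "colmat v \<in> carrier_mat (dim_row M) 1" using v by auto
      from *[rule_format, OF this] show "0 \<le> Re ((M *\<^sub>v v) \<bullet>c v)"
        using v d by (subst colmat_inner) (auto simp: qf_def)
    qed }
  then show ?thesis by (auto simp: psd_def)
qed

lemma pd_iff:
  "pd M \<longleftrightarrow> hermitian M \<and> (\<forall>x \<in> carrier_mat (dim_row M) 1. x \<noteq> 0\<^sub>m (dim_row M) 1 \<longrightarrow> 0 < qf M x)"
proof -
  { assume h: "hermitian M"
    then have d: "dim_row M = dim_col M" by (auto simp: hermitian_iff)
    have "(\<forall>v \<in> carrier_vec (dim_row M). v \<noteq> 0\<^sub>v (dim_row M) \<longrightarrow> 0 < Re ((M *\<^sub>v v) \<bullet>c v)) \<longleftrightarrow>
        (\<forall>x \<in> carrier_mat (dim_row M) 1. x \<noteq> 0\<^sub>m (dim_row M) 1 \<longrightarrow> 0 < qf M x)"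
    proof safe
      fix x :: "complex mat" assume x: "x \<in> carrier_mat (dim_row M) 1" "x \<noteq> 0\<^sub>m (dim_row M) 1"
        and *: "\<forall>v\<in>carrier_vec (dim_row M). v \<noteq> 0\<^sub>v (dim_row M) \<longrightarrow> 0 < Re ((M *\<^sub>v v) \<bullet>c v)"
      have "col x 0 \<in> carrier_vec (dim_row M)" using x by (auto intro: carrier_vecI)
      moreover have "col x 0 \<noteq> 0\<^sub>v (dim_row M)" using x colmat_zero[of "col x 0"] by (auto simp: colmat_col)
      ultimately show "0 < qf M x" using *[rule_format, of "col x 0"]
        using x d by (subst (asm) colmat_inner) (auto simp: colmat_col qf_def)
    next
      fix v :: "complex vec" assume v: "v \<in> carrier_vec (dim_row M)" "v \<noteq> 0\<^sub>v (dim_row M)"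
        and *: "\<forall>x \<in> carrier_mat (dim_row M) 1. x \<noteq> 0\<^sub>m (dim_row M) 1 \<longrightarrow> 0 < qf M x"
      have "colmat v \<in> carrier_mat (dim_row M) 1" using v by auto
      with * v show "0 < Re ((M *\<^sub>v v) \<bullet>c v)"
        using v d by (subst colmat_inner) (auto simp: qf_def colmat_zero)
    qed }
  then show ?thesis by (auto simp: pd_def)
qed

lemma det_nonzeroI:
  fixes A :: "complex mat"
  assumes A: "A \<in> carrier_mat n n" and inj: "\<And>x. x \<in> carrier_mat n 1 \<Longrightarrow> A * x = 0\<^sub>m n 1 \<Longrightarrow> x = 0\<^sub>m n 1"
  shows "det A \<noteq> 0"
proof
  assume "det A = 0"
  then obtain v where v: "v \<in> carrier_vec n" "v \<noteq> 0\<^sub>v n" "A *\<^sub>v v = 0\<^sub>v n"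
    using det_0_iff_vec_prod_zero[OF A] by auto
  have "A * colmat v = colmat (A *\<^sub>v v)" using A v by (subst colmat_mult) auto
  also have "\<dots> = 0\<^sub>m n 1" unfolding v using colmat_zero by blast
  finally have *: "A * colmat v = 0\<^sub>m n 1" .
  have "colmat v = 0\<^sub>m n 1" by (rule inj[OF _ *]) (use v in auto)
  then show False using v colmat_zero by blast
qed

lemma minv_props:
  fixes A :: "complex mat"
  assumes A: "A \<in> carrier_mat n n" and d: "det A \<noteq> 0"
  shows "minv A \<in> carrier_mat n n" "A * minv A = 1\<^sub>m n" "minv A * A = 1\<^sub>m n"
    "mat_inverse A = Some (minv A)"
proof -
  have "A \<in> Units (ring_mat TYPE(complex) n ())" by (rule det_non_zero_imp_unit[OF A d])
  then obtain B where B: "mat_inverse A = Some B"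
    using mat_inverse(1)[OF A, of "()"] by (cases "mat_inverse A") auto
  with mat_inverse(2)[OF A B]
  show "minv A \<in> carrier_mat n n" "A * minv A = 1\<^sub>m n" "minv A * A = 1\<^sub>m n" "mat_inverse A = Some (minv A)"
    by (auto simp: minv_def)
qed

lemma mat_inverse_SomeD:
  fixes A :: "complex mat"
  assumes "A \<in> carrier_mat n n" "mat_inverse A = Some B"
  shows "det A \<noteq> 0" "B = minv A"
proof -
  have "A * B = 1\<^sub>m n" "B \<in> carrier_mat n n" using mat_inverse(2)[OF assms] by auto
  then have "det A * det B = 1" using det_mult[OF assms(1), of B] by simp
  then show "det A \<noteq> 0" by auto
  show "B = minv A" using assms by (simp add: minv_def)
qed

lemma det_nonzero_of_inverse:
  fixes A :: "complex mat"
  assumes "A \<in> carrier_mat n n" "B \<in> carrier_mat n n" "A * B = 1\<^sub>m n \<or> B * A = 1\<^sub>m n"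
  shows "det A \<noteq> 0"
proof -
  have "det A * det B = 1" using assms(3) det_mult[OF assms(1,2)] det_mult[OF assms(2,1)]
    by (auto simp: mult.commute)
  then show ?thesis by auto
qed

lemma minv_unique:
  fixes A :: "complex mat"
  assumes A: "A \<in> carrier_mat n n" and B: "B \<in> carrier_mat n n" and AB: "A * B = 1\<^sub>m n"
  shows "minv A = B" "det A \<noteq> 0"
proof -
  show d: "det A \<noteq> 0" using det_nonzero_of_inverse[OF A B] AB by auto
  note m = minv_props[OF A d]
  have "minv A = minv A * (A * B)" using AB m by (simp add: mat_ring)
  also have "\<dots> = minv A * A * B" using A B m by (subst mm_assoc) auto
  also have "\<dots> = B" using m B by (simp add: mat_ring)
  finally show "minv A = B" .
qed

lemma inverse_comm:
  fixes A B :: "complex mat"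
  assumes A: "A \<in> carrier_mat n n" and B: "B \<in> carrier_mat n n" and AB: "A * B = 1\<^sub>m n"
  shows "B * A = 1\<^sub>m n"
  using minv_unique[OF A B AB] minv_props(3)[OF A] by auto

lemma hermitian_minv:
  assumes A: "A \<in> carrier_mat n n" and d: "det A \<noteq> 0" and h: "adj A = A"
  shows "adj (minv A) = minv A"
proof -
  note m = minv_props[OF A d]
  have "adj (minv A * A) = 1\<^sub>m n" unfolding m by simp
  then have "A * adj (minv A) = 1\<^sub>m n"
    using carrier_matD[OF A] carrier_matD[OF m(1)] h by simp
  then show ?thesis using minv_unique(1)[OF A, of "adj (minv A)"] m by auto
qed

lemma mult_right_cancel_inj:
  fixes A B :: "complex mat"
  assumes A: "A \<in> carrier_mat n m" and B: "B \<in> carrier_mat n m"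
    and eq: "\<And>x. x \<in> carrier_mat m 1 \<Longrightarrow> A * x = B * x"
  shows "A = B"
proof (rule eq_matI)
  fix i j assume "i < dim_row B" "j < dim_col B"
  then have i: "i < n" and j: "j < m" using B by auto
  define x :: "complex mat" where "x = mat m 1 (\<lambda>(k, _). if k = j then 1 else 0)"
  have x: "x \<in> carrier_mat m 1" by (auto simp: x_def)
  have *: "(C * x) $$ (i, 0) = C $$ (i, j)" if "C \<in> carrier_mat n m" for C :: "complex mat"
  proof -
    have "(C * x) $$ (i, 0) = (\<Sum>k<m. C $$ (i, k) * (if k = j then 1 else 0))"
      using that i x by (subst times_mat_index) (auto simp: x_def)
    also have "\<dots> = (\<Sum>k<m. if k = j then C $$ (i, k) else 0)" by (rule sum.cong) auto
    also have "\<dots> = C $$ (i, j)" using j by simp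
    finally show ?thesis .
  qed
  show "A $$ (i, j) = B $$ (i, j)" using *[OF A] *[OF B] eq[OF x] by simp
qed (use carrier_matD[OF A] carrier_matD[OF B] in simp_all)

lemma adj_four_block [simp]:
  assumes "A \<in> carrier_mat a c" "B \<in> carrier_mat a d" "C \<in> carrier_mat b c" "D \<in> carrier_mat b d"
  shows "adj (four_block_mat A B C D) = four_block_mat (adj A) (adj C) (adj B) (adj D)"
  by (rule eq_matI) (use assms in auto)

section \<open>Real diagonal matrices and the spectral theorem\<close>

definition dg :: "nat \<Rightarrow> (nat \<Rightarrow> real) \<Rightarrow> complex mat" where
  "dg n d = mat n n (\<lambda>(i, j). if i = j then complex_of_real (d i) else 0)"

lemma dg_dim [simp]: "dim_row (dg n d) = n" "dim_col (dg n d) = n" "dg n d \<in> carrier_mat n n"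
  by (auto simp: dg_def)

lemma dg_index: "i < n \<Longrightarrow> j < n \<Longrightarrow> dg n d $$ (i, j) = (if i = j then complex_of_real (d i) else 0)"
  by (auto simp: dg_def)

lemma adj_dg [simp]: "adj (dg n d) = dg n d"
  by (rule eq_matI) (auto simp: dg_index)

lemma dg_mult: "dg n d * dg n d' = dg n (\<lambda>i. d i * d' i)"
proof (rule eq_matI)
  fix i j assume "i < dim_row (dg n (\<lambda>i. d i * d' i))" "j < dim_col (dg n (\<lambda>i. d i * d' i))"
  then have ij: "i < n" "j < n" by auto
  have "(dg n d * dg n d') $$ (i, j) = (\<Sum>k<n. if k = i then dg n d $$ (i, k) * dg n d' $$ (k, j) else 0)"
    using ij by (subst times_mat_index) (auto simp: dg_index simp del: sum.delta intro!: sum.cong)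
  also have "\<dots> = dg n (\<lambda>i. d i * d' i) $$ (i, j)" using ij by (simp add: dg_index)
  finally show "(dg n d * dg n d') $$ (i, j) = dg n (\<lambda>i. d i * d' i) $$ (i, j)" .
qed auto

lemma dg_one: "dg n (\<lambda>_. 1) = 1\<^sub>m n"
  by (rule eq_matI) (auto simp: dg_index)

lemma dg_cong: "(\<And>i. i < n \<Longrightarrow> d i = d' i) \<Longrightarrow> dg n d = dg n d'"
  by (rule eq_matI) (auto simp: dg_index)

text \<open>Gram-Schmidt keeps \<open>v\<close> as its first vector and yields orthogonal columns of
  arbitrary length. Dividing each column by its length makes the matrix unitary and turns the first
  column into the multiple \<open>z * v\<close>.\<close>

lemma orthonormal_completion:
  fixes v :: "complex vec"
  assumes v: "v \<in> carrier_vec n" "v \<noteq> 0\<^sub>v n"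
  obtains U z where "unitary n U" "z \<noteq> 0" "\<And>i. i < n \<Longrightarrow> U $$ (i, 0) = z * v $ i"
proof -
  interpret cof_vec_space n "TYPE(complex)" .
  define b where "b = basis_completion v"
  define ws where "ws = gram_schmidt n b"
  define W where "W = mat_of_cols n ws"
  note bc = basis_completion[OF v, folded b_def]
  have n: "n > 0" using v by (cases n) auto
  from bc n obtain vs where bv: "b = v # vs" by (cases b) auto
  note gs = gram_schmidt_result[OF bc(2) bc(4) bc(5) ws_def]
  have lw: "length ws = n" using gs bc by auto
  have W: "W \<in> carrier_mat n n" using lw mat_of_cols_carrier(1)[of n ws] by (auto simp: W_def)
  have hd: "hd ws = v" using gram_schmidt_hd[OF v(1), of vs] by (simp add: ws_def bv)
  have "ws \<noteq> []" using lw n by auto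
  then have hd0: "ws ! 0 = v" using hd by (simp add: hd_conv_nth)
  have W0: "W $$ (i, 0) = v $ i" if "i < n" for i
    using that hd0 lw n by (auto simp: W_def mat_of_cols_index)
  have orth: "corthogonal_mat W"
    unfolding W_def by (rule orthogonal_mat_of_cols) (use gs lw in auto)
  define N where "N i = (\<Sum>k<n. (cmod (W $$ (k, i)))\<^sup>2)" for i
  have WWs: "(adj W * W) $$ (i, i) = complex_of_real (N i)" if "i < n" for i
  proof -
    have *: "cnj z * z = (complex_of_real (cmod z))\<^sup>2" for z
      using complex_norm_square[of z] by (simp add: mult.commute)
    show ?thesis
      using that carrier_matD[OF W] by (subst times_mat_index) (auto simp: N_def * intro!: sum.cong)
  qed
  have WW: "(adj W * W) $$ (i, j) = (if i = j then complex_of_real (N i) else 0)" if "i < n" "j < n" for i j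
    using that WWs orth carrier_matD[OF W]
    by (auto simp: corthogonal_mat_def Let_def diagonal_mat_def)
  have Npos: "N i > 0" if "i < n" for i
  proof -
    have "(adj W * W) $$ (i, i) \<noteq> 0" using orth carrier_matD[OF W] that
      by (auto simp: corthogonal_mat_def Let_def)
    then have "N i \<noteq> 0" using WWs[OF that] by auto
    moreover have "N i \<ge> 0" by (auto simp: N_def intro!: sum_nonneg)
    ultimately show ?thesis by auto
  qed
  have WdW: "adj W * W = dg n N"
    by (rule eq_matI) (use WW carrier_matD[OF W] in \<open>auto simp: dg_index simp del: index_mult_mat(1)\<close>)
  define U where "U = W * dg n (\<lambda>i. 1 / sqrt (N i))"
  have U: "U \<in> carrier_mat n n" using W by (auto simp: U_def)
  have "adj U * U = dg n (\<lambda>i. 1 / sqrt (N i)) * ((adj W * W) * dg n (\<lambda>i. 1 / sqrt (N i)))"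
    using carrier_matD[OF W] by (simp add: U_def mat_ring)
  also have "\<dots> = dg n (\<lambda>i. 1)"
    unfolding WdW dg_mult
  proof (rule dg_cong)
    fix i assume "i < n"
    then show "1 / sqrt (N i) * (N i * (1 / sqrt (N i))) = 1"
      using Npos[of i] by (simp add: field_simps)
  qed
  finally have UU: "adj U * U = 1\<^sub>m n" by (simp add: dg_one)
  have "unitary n U" using U UU inverse_comm[OF _ _ UU] by (auto simp: unitary_def)
  moreover have "U $$ (i, 0) = complex_of_real (1 / sqrt (N 0)) * v $ i" if "i < n" for i
  proof -
    have "U $$ (i, 0) = (\<Sum>k<n. if k = 0 then W $$ (i, k) * dg n (\<lambda>i. 1 / sqrt (N i)) $$ (k, 0) else 0)"
      unfolding U_def using that n carrier_matD[OF W]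
      by (subst times_mat_index) (auto simp: dg_index simp del: sum.delta sum.delta' intro!: sum.cong)
    also have "\<dots> = complex_of_real (1 / sqrt (N 0)) * v $ i"
      using n W0[OF that] by (simp add: dg_index)
    finally show ?thesis .
  qed
  moreover have "complex_of_real (1 / sqrt (N 0)) \<noteq> 0" using Npos[OF n] by simp
  ultimately show ?thesis using that by blast
qed

text \<open>Deflation: conjugating by a unitary matrix whose first column is an eigenvector clears
  the first column below the eigenvalue, and hermiticity clears the first row too, so the lower
  right block is hermitian of size \<open>n\<close> and the induction hypothesis applies to
  it.\<close>

lemma hermitian_spectral:
  assumes "A \<in> carrier_mat n n" "adj A = A"
  shows "\<exists>U d. unitary n U \<and> A = U * (dg n d * adj U)"
  using assms
proof (induction n arbitrary: A)
  case 0
  then show ?case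
    by (intro exI[of _ "1\<^sub>m 0"]) (auto simp: unitary_def intro!: eq_matI)
next
  case (Suc n)
  note A = Suc.prems(1) and h = Suc.prems(2)
  have "spectrum A \<noteq> {}" by (rule spectrum_non_empty[OF A]) auto
  then obtain e where "eigenvalue A e" by (auto simp: spectrum_def)
  then obtain v where "eigenvector A v e" by (auto simp: eigenvalue_def)
  then have v: "v \<in> carrier_vec (Suc n)" "v \<noteq> 0\<^sub>v (Suc n)" and ev: "A *\<^sub>v v = e \<cdot>\<^sub>v v"
    using A by (auto simp: eigenvector_def)
  obtain U z where Un: "unitary (Suc n) U" and U0: "\<And>i. i < Suc n \<Longrightarrow> U $$ (i, 0) = z * v $ i"
    using orthonormal_completion[OF v] by metis
  then have U: "U \<in> carrier_mat (Suc n) (Suc n)" and UU: "adj U * U = 1\<^sub>m (Suc n)" "U * adj U = 1\<^sub>m (Suc n)"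
    by (auto simp: unitary_def)
  note dims = carrier_matD[OF U] carrier_matD[OF A]
  define B where "B = adj U * (A * U)"
  have B: "B \<in> carrier_mat (Suc n) (Suc n)" using dims by (auto simp: B_def)
  have hB: "adj B = B" using dims h by (simp add: B_def mat_ring)
  have AU0: "(A * U) $$ (i, 0) = e * U $$ (i, 0)" if i: "i < Suc n" for i
  proof -
    have "(A * U) $$ (i, 0) = (\<Sum>k<Suc n. A $$ (i, k) * (z * v $ k))"
      using i dims U0 by (subst times_mat_index) (auto simp del: sum.lessThan_Suc)
    also have "\<dots> = z * (\<Sum>k<Suc n. A $$ (i, k) * v $ k)"
      unfolding sum_distrib_left by (rule sum.cong) auto
    also have "(\<Sum>k<Suc n. A $$ (i, k) * v $ k) = (A *\<^sub>v v) $ i"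
      using i dims v by (auto simp: scalar_prod_def lessThan_atLeast0 intro!: sum.cong)
    finally show ?thesis using ev i v U0 by simp
  qed
  have B0: "B $$ (i, 0) = (if i = 0 then e else 0)" if i: "i < Suc n" for i
  proof -
    have "B $$ (i, 0) = (\<Sum>k<Suc n. e * (adj U $$ (i, k) * U $$ (k, 0)))"
      unfolding B_def using i dims AU0
      by (subst times_mat_index) (auto simp del: index_mult_mat(1) sum.lessThan_Suc intro!: sum.cong)
    also have "\<dots> = e * (adj U * U) $$ (i, 0)"
      using i dims by (subst times_mat_index) (auto simp: sum_distrib_left simp del: sum.lessThan_Suc)
    finally show ?thesis using i by (auto simp: UU)
  qed
  have B0': "B $$ (0, i) = (if i = 0 then e else 0)" if i: "i < Suc n" for i
  proof -
    have "B $$ (0, i) = adj B $$ (0, i)" by (simp add: hB)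
    also have "\<dots> = cnj (B $$ (i, 0))" using i B by simp
    finally have *: "B $$ (0, i) = cnj (B $$ (i, 0))" .
    show ?thesis
    proof (cases "i = 0")
      case True
      then show ?thesis using B0[OF i] by simp
    qed (use B0[OF i] * in simp)
  qed
  \<comment> \<open>The eigenvalue is a diagonal entry of the hermitian matrix \<open>B\<close>,
    hence real; this is what makes \<open>d\<close> real-valued.\<close>
  have er: "e = complex_of_real (Re e)"
  proof -
    have "B $$ (0, 0) = adj B $$ (0, 0)" by (simp add: hB)
    then have "e = cnj e" using B0[of 0] B by simp
    then show ?thesis by (metis Reals_cnj_iff of_real_Re)
  qed
  define B3 where "B3 = mat n n (\<lambda>(i, j). B $$ (Suc i, Suc j))"
  have B3: "B3 \<in> carrier_mat n n" by (auto simp: B3_def)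
  have "adj B3 = B3"
  proof (rule eq_matI)
    fix i j assume "i < dim_row B3" "j < dim_col B3"
    then have ij: "i < n" "j < n" by (auto simp: B3_def)
    have "cnj (B $$ (Suc j, Suc i)) = adj B $$ (Suc i, Suc j)" using ij B by simp
    then show "adj B3 $$ (i, j) = B3 $$ (i, j)" using ij B3 by (simp add: hB B3_def)
  qed (auto simp: B3_def)
  from Suc.IH[OF B3 this] obtain U3 d where Un3: "unitary n U3" and eq3: "B3 = U3 * (dg n d * adj U3)" by auto
  have U3: "U3 \<in> carrier_mat n n" "adj U3 * U3 = 1\<^sub>m n" "U3 * adj U3 = 1\<^sub>m n"
    using Un3 by (auto simp: unitary_def)
  define d' where "d' = case_nat (Re e) d"
  define U' where "U' = four_block_mat (1\<^sub>m 1) (0\<^sub>m 1 n) (0\<^sub>m n 1) U3"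
  have U': "U' \<in> carrier_mat (Suc n) (Suc n)"
    using U3 by (auto simp: U'_def intro!: carrier_matI)
  have aU': "adj U' = four_block_mat (1\<^sub>m 1) (0\<^sub>m 1 n) (0\<^sub>m n 1) (adj U3)"
    unfolding U'_def by (subst adj_four_block[of _ 1 1 _ n _ n]) (use U3 in auto)
  have dgs: "dg (Suc n) d' = four_block_mat (dg 1 (\<lambda>_. Re e)) (0\<^sub>m 1 n) (0\<^sub>m n 1) (dg n d)"
    by (rule eq_matI) (auto simp: dg_index d'_def split: nat.splits)
  have fb: "four_block_mat A1 (0\<^sub>m 1 n) (0\<^sub>m n 1) A2 * four_block_mat C1 (0\<^sub>m 1 n) (0\<^sub>m n 1) C2
      = four_block_mat (A1 * C1) (0\<^sub>m 1 n) (0\<^sub>m n 1) (A2 * C2)"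
    if "A1 \<in> carrier_mat 1 1" "C1 \<in> carrier_mat 1 1" "A2 \<in> carrier_mat n n" "C2 \<in> carrier_mat n n"
    for A1 A2 C1 C2 :: "complex mat"
    using that
    by (subst mult_four_block_mat[of _ 1 1 _ n _ n _ _ 1 _ n]) (auto simp: mat_ring)
  have UU': "adj U' * U' = 1\<^sub>m (Suc n)"
    unfolding aU' unfolding U'_def using U3 by (subst fb) (auto simp: mm_one_left)
  have "U' * (dg (Suc n) d' * adj U') = four_block_mat (dg 1 (\<lambda>_. Re e)) (0\<^sub>m 1 n) (0\<^sub>m n 1) B3"
    unfolding aU' dgs unfolding U'_def eq3 using U3 mult_carrier_mat[of "dg n d" n n "adj U3" n] by (simp add: fb mm_one_left mm_one_right)
  also have "\<dots> = B"
    by (rule eq_matI) (use B B0 B0' er in \<open>auto simp: B3_def dg_index\<close>)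
  finally have Beq: "B = U' * (dg (Suc n) d' * adj U')" by simp
  note dims' = carrier_matD[OF U']
  have "(U * U') * (dg (Suc n) d' * adj (U * U')) = U * (B * adj U)"
    unfolding Beq using dims dims' by (simp add: mat_ring)
  also have "\<dots> = (U * adj U) * (A * (U * adj U))"
    unfolding B_def using dims by (simp add: mat_ring del: UU)
  also have "\<dots> = A" using dims by (simp add: UU mat_ring)
  finally have "A = (U * U') * (dg (Suc n) d' * adj (U * U'))" by simp
  moreover have "adj (U * U') * (U * U') = adj U' * ((adj U * U) * U')"
    using dims dims' by (simp add: mat_ring)
  then have a: "adj (U * U') * (U * U') = 1\<^sub>m (Suc n)" using dims' by (simp add: UU UU' mat_ring)
  moreover have "(U * U') * adj (U * U') = 1\<^sub>m (Suc n)"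
    by (rule inverse_comm[OF _ _ a]) (use U U' in auto)
  ultimately show ?case using U U' by (intro exI[of _ "U * U'"] exI[of _ d']) (auto simp: unitary_def)
qed

section \<open>Positive semidefinite matrices\<close>

lemma qf_cong_mult:
  assumes "dim_row M = dim_row B" "dim_col M = dim_row B" "dim_col B = dim_row x"
  shows "qf (adj B * (M * B)) x = qf M (B * x)"
  using assms by (simp add: qf_def mat_ring)

lemma qf_add:
  assumes "M \<in> carrier_mat n n" "N \<in> carrier_mat n n" "x \<in> carrier_mat n 1"
  shows "qf (M + N) x = qf M x + qf N x"
  using carrier_matD[OF assms(1)] carrier_matD[OF assms(2)] carrier_matD[OF assms(3)]
  by (simp add: qf_def mat_ring del: index_mult_mat(1))

lemma qf_smult:
  assumes "M \<in> carrier_mat n n" "x \<in> carrier_mat n 1"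
  shows "qf (complex_of_real t \<cdot>\<^sub>m M) x = t * qf M x"
  using carrier_matD[OF assms(1)] carrier_matD[OF assms(2)]
  by (simp add: qf_def mat_ring del: index_mult_mat(1))

lemma gram_index:
  assumes "x \<in> carrier_mat n 1"
  shows "(adj x * x) $$ (0, 0) = complex_of_real (\<Sum>k<n. (cmod (x $$ (k, 0)))\<^sup>2)"
proof -
  have *: "cnj z * z = (complex_of_real (cmod z))\<^sup>2" for z
    using complex_norm_square[of z] by (simp add: mult.commute)
  show ?thesis
    using carrier_matD[OF assms] by (subst times_mat_index) (auto simp: * intro!: sum.cong)
qed

lemma qf_one:
  assumes "x \<in> carrier_mat n 1"
  shows "qf (1\<^sub>m n) x = (\<Sum>k<n. (cmod (x $$ (k, 0)))\<^sup>2)"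
  using gram_index[OF assms] carrier_matD[OF assms] by (simp add: qf_def mat_ring)

lemma qf_one_nonneg:
  assumes "x \<in> carrier_mat n 1"
  shows "0 \<le> qf (1\<^sub>m n) x"
  unfolding qf_one[OF assms] by (auto intro!: sum_nonneg)

lemma qf_one_zero:
  assumes "x \<in> carrier_mat n 1" "qf (1\<^sub>m n) x = 0"
  shows "x = 0\<^sub>m n 1"
proof (rule eq_matI)
  fix i j assume "i < dim_row (0\<^sub>m n 1 :: complex mat)" "j < dim_col (0\<^sub>m n 1 :: complex mat)"
  then have ij: "i < n" "j = 0" by auto
  have "\<forall>k\<in>{..<n}. (cmod (x $$ (k, 0)))\<^sup>2 = 0"
    using assms(2) unfolding qf_one[OF assms(1)] by (subst (asm) sum_nonneg_eq_0_iff) auto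
  then show "x $$ (i, j) = 0\<^sub>m n 1 $$ (i, j)" using ij by simp
qed (use assms in auto)

lemma psdD:
  assumes "psd M"
  shows "dim_col M = dim_row M" "adj M = M" "x \<in> carrier_mat (dim_row M) 1 \<Longrightarrow> 0 \<le> qf M x"
  using assms by (auto simp: psd_iff hermitian_iff)

lemma psdI:
  assumes "M \<in> carrier_mat n n" "adj M = M" "\<And>x. x \<in> carrier_mat n 1 \<Longrightarrow> 0 \<le> qf M x"
  shows "psd M"
  using assms by (auto simp: psd_iff hermitian_iff)

lemma pdI:
  assumes "M \<in> carrier_mat n n" "adj M = M" "\<And>x. x \<in> carrier_mat n 1 \<Longrightarrow> x \<noteq> 0\<^sub>m n 1 \<Longrightarrow> 0 < qf M x"
  shows "pd M"
  using assms by (auto simp: pd_iff hermitian_iff)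

lemma pdD:
  assumes "pd M"
  shows "dim_col M = dim_row M" "adj M = M"
    "x \<in> carrier_mat (dim_row M) 1 \<Longrightarrow> x \<noteq> 0\<^sub>m (dim_row M) 1 \<Longrightarrow> 0 < qf M x"
  using assms by (auto simp: pd_iff hermitian_iff)

lemma qf_zero [simp]: "dim_row M = dim_col M \<Longrightarrow> qf M (0\<^sub>m (dim_col M) 1) = 0"
  by (simp add: qf_def mat_ring del: index_mult_mat(1))

lemma pd_imp_psd:
  assumes "pd M"
  shows "psd M"
proof (rule psdI[of _ "dim_row M"])
  fix x :: "complex mat" assume "x \<in> carrier_mat (dim_row M) 1"
  then show "0 \<le> qf M x"
    using pdD(3)[OF assms, of x] pdD(1)[OF assms] qf_zero[of M] by (cases "x = 0\<^sub>m (dim_row M) 1") auto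
qed (use pdD[OF assms] in auto)

lemma psd_sandwich:
  assumes "psd M" "dim_row B = dim_row M"
  shows "psd (adj B * (M * B))"
proof (rule psdI[of _ "dim_col B"])
  fix x :: "complex mat" assume x: "x \<in> carrier_mat (dim_col B) 1"
  have "0 \<le> qf M (B * x)"
    by (rule psdD(3)[OF assms(1)]) (use x assms psdD[OF assms(1)] in auto)
  then show "0 \<le> qf (adj B * (M * B)) x"
    using x assms psdD[OF assms(1)] by (subst qf_cong_mult) auto
qed (use assms psdD[OF assms(1)] in \<open>auto simp: mat_ring\<close>)

lemma psd_add:
  assumes "psd M" "psd N" "dim_row M = dim_row N"
  shows "psd (M + N)"
proof (rule psdI[of _ "dim_row M"])
  note d = psdD[OF assms(1)] psdD[OF assms(2)]
  fix x :: "complex mat" assume x: "x \<in> carrier_mat (dim_row M) 1"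
  have "qf (M + N) x = qf M x + qf N x"
    by (rule qf_add[of _ "dim_row M"]) (use d x assms in \<open>auto intro!: carrier_matI\<close>)
  then show "0 \<le> qf (M + N) x" using psdD(3)[OF assms(1), of x] psdD(3)[OF assms(2), of x] x assms by auto
qed (use psdD[OF assms(1)] psdD[OF assms(2)] assms in auto)

lemma psd_one: "psd (1\<^sub>m n)"
  by (rule psdI[of _ n]) (auto intro: qf_one_nonneg)

lemma pd_one: "pd (1\<^sub>m n)"
proof (rule pdI[of _ n])
  fix x :: "complex mat" assume x: "x \<in> carrier_mat n 1" "x \<noteq> 0\<^sub>m n 1"
  show "0 < qf (1\<^sub>m n) x"
    using qf_one_nonneg[OF x(1)] qf_one_zero[OF x(1)] x(2) by fastforce
qed auto

lemma psd_gram: "psd (adj B * B)"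
proof -
  have "psd (adj B * (1\<^sub>m (dim_row B) * B))" by (rule psd_sandwich[OF psd_one]) simp
  then show ?thesis by (simp add: mat_ring)
qed

lemma psd_dg:
  assumes "\<And>i. i < n \<Longrightarrow> 0 \<le> d i"
  shows "psd (dg n d)"
proof -
  have "adj (dg n (\<lambda>i. sqrt (d i))) * dg n (\<lambda>i. sqrt (d i)) = dg n d"
    unfolding adj_dg dg_mult by (rule dg_cong) (use assms in auto)
  then show ?thesis using psd_gram[of "dg n (\<lambda>i. sqrt (d i))"] by simp
qed

lemma psd_diag_nonneg:
  assumes "psd M" "i < dim_row M"
  shows "0 \<le> Re (M $$ (i, i))"
proof -
  let ?n = "dim_row M"
  define x :: "complex mat" where "x = mat ?n 1 (\<lambda>(k, _). if k = i then 1 else 0)"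
  have x: "x \<in> carrier_mat ?n 1" by (auto simp: x_def)
  have Mx: "(M * x) $$ (k, 0) = M $$ (k, i)" if "k < ?n" for k
  proof -
    have "(M * x) $$ (k, 0) = (\<Sum>l<?n. if l = i then M $$ (k, l) else 0)"
      using that psdD[OF assms(1)] by (subst times_mat_index) (auto simp: x_def simp del: sum.delta intro!: sum.cong)
    then show ?thesis using assms by simp
  qed
  have "(adj x * (M * x)) $$ (0, 0) = (\<Sum>k<?n. if k = i then M $$ (k, i) else 0)"
    using psdD[OF assms(1)] x Mx by (subst times_mat_index) (auto simp: x_def simp del: sum.delta index_mult_mat(1) intro!: sum.cong)
  then have "qf M x = Re (M $$ (i, i))" using assms by (simp add: qf_def)
  then show ?thesis using psdD(3)[OF assms(1) x] by simp
qed

text \<open>The roots of the eigenvalues exist because the eigenvalues are the diagonal entries of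
  \<open>adj U * (P * U)\<close>, which is again positive semidefinite.\<close>

lemma psd_sqrt_exists:
  assumes "psd P"
  shows "\<exists>Q. psd Q \<and> Q * Q = P"
proof -
  let ?n = "dim_row P"
  have P: "P \<in> carrier_mat ?n ?n" "adj P = P" using psdD[OF assms] by auto
  obtain U d where Un: "unitary ?n U" and eq: "P = U * (dg ?n d * adj U)"
    using hermitian_spectral[OF P] by auto
  have U: "U \<in> carrier_mat ?n ?n" "adj U * U = 1\<^sub>m ?n"
    using Un by (auto simp: unitary_def)
  note dims = carrier_matD[OF U(1)]
  have "adj U * (P * U) = adj U * ((U * (dg ?n d * adj U)) * U)" using eq by simp
  also have "\<dots> = (adj U * U) * (dg ?n d * (adj U * U))"
    using dims by (simp add: mat_ring)
  also have "\<dots> = dg ?n d" by (simp add: U mat_ring)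
  finally have D: "adj U * (P * U) = dg ?n d" .
  have dpos: "0 \<le> d i" if "i < ?n" for i
    using psd_diag_nonneg[OF psd_sandwich[OF assms dims(1)], of i] that unfolding D
    by (simp add: dg_index)
  define Q where "Q = U * (dg ?n (\<lambda>i. sqrt (d i)) * adj U)"
  have "psd Q"
    using psd_sandwich[OF psd_dg[of ?n "\<lambda>i. sqrt (d i)"], of "adj U"] dims dpos by (simp add: Q_def)
  moreover have "Q * Q = U * (dg ?n (\<lambda>i. sqrt (d i)) * ((adj U * U) * (dg ?n (\<lambda>i. sqrt (d i)) * adj U)))"
    using dims by (simp add: Q_def mat_ring)
  then have "Q * Q = U * ((dg ?n (\<lambda>i. sqrt (d i)) * dg ?n (\<lambda>i. sqrt (d i))) * adj U)"
    using dims by (simp add: U mat_ring)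
  moreover have "dg ?n (\<lambda>i. sqrt (d i)) * dg ?n (\<lambda>i. sqrt (d i)) = dg ?n d"
    unfolding dg_mult by (rule dg_cong) (use dpos in auto)
  ultimately show ?thesis using eq by auto
qed

text \<open>If \<open>Q\<close> is a positive square root of \<open>P\<close>, the form at
  \<open>x\<close> is the squared length of \<open>Q * x\<close>, so it vanishes only if
  \<open>Q * x\<close>, and with it \<open>P * x\<close>, is zero.\<close>

lemma psd_kernel:
  assumes "psd P" "x \<in> carrier_mat (dim_row P) 1" "qf P x = 0"
  shows "P * x = 0\<^sub>m (dim_row P) 1"
proof -
  obtain Q where Q: "psd Q" "Q * Q = P" using psd_sqrt_exists[OF assms(1)] by auto
  note q = psdD[OF Q(1)]
  have dr: "dim_row P = dim_row Q" using Q by auto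
  have "qf P x = qf (1\<^sub>m (dim_row Q)) (Q * x)"
    using q assms(2) unfolding Q(2)[symmetric] by (simp add: qf_def mat_ring)
  moreover have "Q * x \<in> carrier_mat (dim_row Q) 1" using carrier_matD[OF assms(2)] by auto
  ultimately have "Q * x = 0\<^sub>m (dim_row Q) 1"
    using qf_one_zero[of "Q * x" "dim_row Q"] assms(3) by auto
  then have "Q * (Q * x) = 0\<^sub>m (dim_row Q) 1" using q by (simp add: mat_ring)
  then show ?thesis using assms(2) q dr unfolding Q(2)[symmetric] by (simp add: mat_ring)
qed

text \<open>Write \<open>D = Q - Q'\<close>. Then \<open>Q D + D Q' = 0\<close>, so for an eigenvector \<open>D x = \<lambda> x\<close> with
  \<open>\<lambda> \<noteq> 0\<close> both forms vanish at \<open>x\<close>, whence \<open>D x = 0\<close>.\<close>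

lemma psd_sqrt_unique:
  assumes "psd Q" "psd Q'" "Q * Q = Q' * Q'"
  shows "Q = Q'"
proof -
  define n where "n = dim_row Q"
  note q = psdD[OF assms(1)] psdD[OF assms(2)]
  have dn: "dim_row Q = n" "dim_col Q = n" "dim_row Q' = n" "dim_col Q' = n"
    using q assms(3) index_mult_mat(2)[of Q Q] index_mult_mat(2)[of Q' Q'] by (auto simp: n_def)
  define D where "D = Q - Q'"
  have D: "D \<in> carrier_mat n n" "adj D = D" using dn q by (auto simp: D_def)
  obtain U d where Un: "unitary n U" and eq: "D = U * (dg n d * adj U)"
    using hermitian_spectral[OF D] by auto
  have U: "U \<in> carrier_mat n n" "adj U * U = 1\<^sub>m n"
    using Un by (auto simp: unitary_def)
  note dims = carrier_matD[OF U(1)] carrier_matD[OF D(1)] dn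
  have DU: "D * U = U * dg n d"
  proof -
    have "D * U = U * (dg n d * (adj U * U))" unfolding eq using dims by (simp add: mat_ring)
    then show ?thesis using dims by (simp add: U mat_ring)
  qed
  have QD: "Q * D + D * Q' = 0\<^sub>m n n"
  proof -
    have "Q * D + D * Q' = (Q * Q - Q * Q') + (Q * Q' - Q' * Q')"
      unfolding D_def using dn by (simp add: mat_ring)
    also have "\<dots> = 0\<^sub>m n n" unfolding assms(3)
      by (rule eq_matI) (use dn in \<open>auto simp del: index_mult_mat(1)\<close>)
    finally show ?thesis .
  qed
  have d0: "d i = 0" if i: "i < n" for i
  proof (rule ccontr)
    assume di: "d i \<noteq> 0"
    define e :: "complex mat" where "e = mat n 1 (\<lambda>(k, _). if k = i then 1 else 0)"
    have e: "dim_row e = n" "dim_col e = 1" by (auto simp: e_def)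
    have de: "dg n d * e = complex_of_real (d i) \<cdot>\<^sub>m e"
    proof (rule eq_matI)
      fix k l assume "k < dim_row (complex_of_real (d i) \<cdot>\<^sub>m e)" "l < dim_col (complex_of_real (d i) \<cdot>\<^sub>m e)"
      then have kl: "k < n" "l = 0" using e by auto
      have "(dg n d * e) $$ (k, 0) = (\<Sum>m<n. if m = k then complex_of_real (d k) * e $$ (m, 0) else 0)"
        using kl e by (subst times_mat_index) (auto simp: dg_index simp del: sum.delta intro!: sum.cong)
      then show "(dg n d * e) $$ (k, l) = (complex_of_real (d i) \<cdot>\<^sub>m e) $$ (k, l)"
        using kl by (simp add: e_def)
    qed (use e in auto)
    define x where "x = U * e"
    have x: "dim_row x = n" "dim_col x = 1" using e dims by (auto simp: x_def)
    have xc: "x \<in> carrier_mat n 1" using x by auto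
    have Dx: "D * x = complex_of_real (d i) \<cdot>\<^sub>m x"
    proof -
      have "D * x = (D * U) * e" using dims e by (simp add: x_def mat_ring)
      also have "\<dots> = U * (dg n d * e)" unfolding DU using dims e by (simp add: mat_ring)
      finally show ?thesis unfolding de using dims e by (simp add: x_def mat_ring)
    qed
    have xD: "adj x * D = complex_of_real (d i) \<cdot>\<^sub>m adj x"
    proof -
      have "adj x * D = adj (D * x)" using dims x D(2) by simp
      then show ?thesis by (simp add: Dx)
    qed
    have "adj x * ((Q * D + D * Q') * x) = adj x * (Q * (D * x)) + (adj x * D) * (Q' * x)"
      using dims x by (simp add: mat_ring)
    also have "\<dots> = complex_of_real (d i) \<cdot>\<^sub>m (adj x * (Q * x)) + complex_of_real (d i) \<cdot>\<^sub>m (adj x * (Q' * x))"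
      unfolding Dx xD using dims x by (simp add: mat_ring)
    finally have "complex_of_real (d i) \<cdot>\<^sub>m (adj x * (Q * x)) + complex_of_real (d i) \<cdot>\<^sub>m (adj x * (Q' * x)) = 0\<^sub>m 1 1"
      unfolding QD using x by (simp add: mat_ring)
    from arg_cong[OF this, of "\<lambda>M. Re (M $$ (0,0))"]
    have "d i * (qf Q x + qf Q' x) = 0"
      using dims x by (simp add: qf_def algebra_simps del: index_mult_mat(1))
    then have "qf Q x = 0" "qf Q' x = 0"
      using di q(3)[of x] q(6)[of x] xc dn by auto
    then have "Q * x = 0\<^sub>m n 1" "Q' * x = 0\<^sub>m n 1"
      using psd_kernel[OF assms(1), of x] psd_kernel[OF assms(2), of x] xc dn by auto
    then have "D * x = 0\<^sub>m n 1" using dims x by (simp add: D_def mat_ring)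
    then have 0: "complex_of_real (d i) \<cdot>\<^sub>m x = 0\<^sub>m n 1" using Dx by simp
    have x0: "x = 0\<^sub>m n 1"
    proof (rule eq_matI)
      fix k l assume "k < dim_row (0\<^sub>m n 1 :: complex mat)" "l < dim_col (0\<^sub>m n 1 :: complex mat)"
      then show "x $$ (k, l) = 0\<^sub>m n 1 $$ (k, l)"
        using arg_cong[OF 0, of "\<lambda>M. M $$ (k, l)"] di x by simp
    qed (use x in auto)
    have "adj U * x = (adj U * U) * e" using dims e by (simp add: x_def mat_ring)
    then have "e = adj U * x" using e by (simp add: U mat_ring)
    then have "e = 0\<^sub>m n 1" using x0 dims by (simp add: mat_ring)
    then have "e $$ (i, 0) = 0" using i by simp
    then show False using i by (simp add: e_def)
  qed
  have "dg n d = 0\<^sub>m n n" by (rule eq_matI) (auto simp: dg_index d0)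
  then have D0: "D = 0\<^sub>m n n" unfolding eq using dims by (simp add: mat_ring)
  show ?thesis
  proof (rule eq_matI)
    fix i j assume "i < dim_row Q'" "j < dim_col Q'"
    then show "Q $$ (i, j) = Q' $$ (i, j)"
      using arg_cong[OF D0, of "\<lambda>M. M $$ (i, j)"] dn by (simp add: D_def)
  qed (use dn in auto)
qed

text \<open>\<open>psd_sqrt\<close> is a definite description; existence and uniqueness together
  make its defining property available.\<close>

lemma psd_sqrt:
  assumes "psd P"
  shows "psd (psd_sqrt P)" "psd_sqrt P * psd_sqrt P = P" "dim_row (psd_sqrt P) = dim_row P"
    "dim_col (psd_sqrt P) = dim_row P" "adj (psd_sqrt P) = psd_sqrt P"
proof -
  have "\<exists>!Q. psd Q \<and> Q * Q = P"
    using psd_sqrt_exists[OF assms] psd_sqrt_unique by auto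
  from theI'[OF this, folded psd_sqrt_def] have *: "psd (psd_sqrt P)" "psd_sqrt P * psd_sqrt P = P" by auto
  show "dim_row (psd_sqrt P) = dim_row P" using arg_cong[OF *(2), of dim_row] by simp
  then show "dim_col (psd_sqrt P) = dim_row P" using psdD[OF *(1)] by simp
  show "psd (psd_sqrt P)" "psd_sqrt P * psd_sqrt P = P" "adj (psd_sqrt P) = psd_sqrt P"
    using * psdD[OF *(1)] by auto
qed

lemma pd_det:
  assumes "pd M"
  shows "det M \<noteq> 0"
proof (rule det_nonzeroI[of _ "dim_row M"])
  note m = pdD[OF assms]
  show "M \<in> carrier_mat (dim_row M) (dim_row M)" using m by auto
  fix x :: "complex mat" assume x: "x \<in> carrier_mat (dim_row M) 1" "M * x = 0\<^sub>m (dim_row M) 1"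
  have "qf M x = 0" using x m carrier_matD[OF x(1)] by (simp add: qf_def mat_ring del: index_mult_mat(1))
  then show "x = 0\<^sub>m (dim_row M) 1" using m(3)[OF x(1)] by force
qed

lemma psd_det_pd:
  assumes "psd M" "det M \<noteq> 0"
  shows "pd M"
proof (rule pdI[of _ "dim_row M"])
  note m = psdD[OF assms(1)]
  show M: "M \<in> carrier_mat (dim_row M) (dim_row M)" "adj M = M" using m by auto
  fix x :: "complex mat" assume x: "x \<in> carrier_mat (dim_row M) 1" "x \<noteq> 0\<^sub>m (dim_row M) 1"
  note i = minv_props[OF M(1) assms(2)]
  have "qf M x \<noteq> 0"
  proof
    assume "qf M x = 0"
    then have "minv M * (M * x) = minv M * 0\<^sub>m (dim_row M) 1" using psd_kernel[OF assms(1) x(1)] by simp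
    moreover have "minv M * (M * x) = (minv M * M) * x"
      using carrier_matD[OF i(1)] x m by (simp add: mm_assoc)
    ultimately show False using x carrier_matD[OF i(1)] by (simp add: i mat_ring)
  qed
  then show "0 < qf M x" using m(3)[OF x(1)] by simp
qed

lemma psd_minv:
  assumes "psd M" "det M \<noteq> 0"
  shows "psd (minv M)"
proof -
  note m = psdD[OF assms(1)]
  have M: "M \<in> carrier_mat (dim_row M) (dim_row M)" using m by auto
  note i = minv_props[OF M assms(2)]
  have "adj (minv M) * (M * minv M) = minv M"
    using hermitian_minv[OF M assms(2) m(2)] carrier_matD[OF i(1)] by (simp add: i mat_ring)
  then show ?thesis using psd_sandwich[OF assms(1), of "minv M"] carrier_matD[OF i(1)] by simp
qed

text \<open>The reciprocals of the eigenvalues serve for \<open>p\<close>: as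
  \<open>1 / 0 = 0\<close>, the identity \<open>d * (d * (1 / d)) = d\<close> holds at zero
  eigenvalues too. The lemma is what separates the range of a singular square root from its
  kernel.\<close>

lemma hermitian_pseudo_inverse:
  assumes "s \<in> carrier_mat n n" "adj s = s"
  shows "\<exists>p \<in> carrier_mat n n. s * (s * p) = s"
proof -
  obtain U d where Un: "unitary n U" and eq: "s = U * (dg n d * adj U)"
    using hermitian_spectral[OF assms] by auto
  have U: "U \<in> carrier_mat n n" "adj U * U = 1\<^sub>m n"
    using Un by (auto simp: unitary_def)
  note dims = carrier_matD[OF U(1)]
  define p where "p = U * (dg n (\<lambda>i. 1 / d i) * adj U)"
  have "s * (s * p) = U * (dg n d * ((adj U * U) * (dg n d * ((adj U * U) * (dg n (\<lambda>i. 1 / d i) * adj U)))))"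
    unfolding eq p_def using dims by (simp add: mat_ring)
  also have "\<dots> = U * ((dg n d * (dg n d * dg n (\<lambda>i. 1 / d i))) * adj U)"
    using dims by (simp add: U mat_ring)
  also have "dg n d * (dg n d * dg n (\<lambda>i. 1 / d i)) = dg n d"
    unfolding dg_mult by (rule dg_cong) auto
  finally have "s * (s * p) = s" using eq by simp
  moreover have "p \<in> carrier_mat n n" using U by (auto simp: p_def)
  ultimately show ?thesis by blast
qed

section \<open>Compressed inverses of a perturbed hermitian matrix\<close>

lemma mm_assoc_eq3:
  fixes A B C D X :: "complex mat"
  assumes "A * (B * C) = D" "dim_col A = dim_row B" "dim_col B = dim_row C" "dim_col C = dim_row X"
  shows "A * (B * (C * X)) = D * X"
  unfolding assms(1)[symmetric] using assms(2-) by (simp add: mm_assoc)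

text \<open>In the application \<open>P\<close> is the pencil at \<open>(A, 0)\<close>,
  \<open>t\<close> the compressed linear part at \<open>X\<close> and \<open>Q\<close> the padded
  inclusion tensored with the identity, so that \<open>L\<close> below is the pencil at
  \<open>(A, X)\<close> and \<open>w\<close> the value of the function \<open>w\<close> at
  \<open>A\<close>.\<close>

locale perturbation =
  fixes n k :: nat and P Q t :: "complex mat"
  assumes P: "P \<in> carrier_mat n n" "adj P = P" "det P \<noteq> 0"
    and Q: "Q \<in> carrier_mat n k"
    and t: "t \<in> carrier_mat k k" "adj t = t"
begin

definition L :: "complex mat" where "L = P - Q * (t * adj Q)"
definition w :: "complex mat" where "w = adj Q * (minv P * Q)"

lemma dims: "dim_row P = n" "dim_col P = n" "dim_row Q = n" "dim_col Q = k" "dim_row t = k" "dim_col t = k"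
    "dim_row (minv P) = n" "dim_col (minv P) = n" "dim_row L = n" "dim_col L = n" "dim_row w = k" "dim_col w = k"
  using P Q t minv_props(1)[OF P(1,3)] by (auto simp: L_def w_def)

lemma PP: "P * minv P = 1\<^sub>m n" "minv P * P = 1\<^sub>m n" "adj (minv P) = minv P"
  using minv_props[OF P(1,3)] hermitian_minv[OF P(1,3,2)] by auto

lemma PP': "dim_row X = n \<Longrightarrow> P * (minv P * X) = X" "dim_row X = n \<Longrightarrow> minv P * (P * X) = X"
  using dims by (simp_all add: mm_assoc[symmetric] PP mm_one_left)

lemma L_carrier: "L \<in> carrier_mat n n" "adj L = L"
  using dims P(2) t(2) by (auto simp: L_def mat_ring)

context
  fixes s :: "complex mat"
  assumes s: "adj s = s" "s * s = w" "dim_row s = k" "dim_col s = k"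
begin

text \<open>\<open>s\<close> is any hermitian root of \<open>w\<close>, possibly singular. By
  Sylvester's identity \<open>G\<close> and \<open>L\<close> are invertible together, and
  \<open>G\<close> is hermitian where \<open>1 - t w\<close> in general is not.\<close>

definition G :: "complex mat" where "G = 1\<^sub>m k - s * (t * s)"

lemma G_carrier: "G \<in> carrier_mat k k" "adj G = G"
  using dims s t by (auto simp: G_def mat_ring)

lemma ww: "adj Q * (minv P * Q) = s * s" "dim_row X = k \<Longrightarrow> adj Q * (minv P * (Q * X)) = s * (s * X)"
proof -
  show 1: "adj Q * (minv P * Q) = s * s" using s by (simp add: w_def)
  show "adj Q * (minv P * (Q * X)) = s * (s * X)" if "dim_row X = k"
    using mm_assoc_eq3[OF 1, of X] that dims s(3,4) by (simp add: mm_assoc)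
qed

text \<open>A kernel vector \<open>x\<close> of \<open>G\<close> lifts to the kernel vector
  \<open>y\<close> of \<open>L\<close> below. Injectivity of \<open>L\<close> gives
  \<open>y = 0\<close>, hence \<open>s * x = adj Q * y = 0\<close>, and then \<open>x\<close>, which
  equals \<open>s * (t * (s * x))\<close>, vanishes.\<close>

lemma det_G:
  assumes "det L \<noteq> 0"
  shows "det G \<noteq> 0"
proof (rule det_nonzeroI[OF G_carrier(1)])
  fix x assume x: "x \<in> carrier_mat k 1" and Gx: "G * x = 0\<^sub>m k 1"
  note xd = carrier_matD[OF x]
  have eq: "s * (t * (s * x)) = x"
  proof (rule eq_matI)
    fix i j assume "i < dim_row x" "j < dim_col x"
    then show "(s * (t * (s * x))) $$ (i, j) = x $$ (i, j)"
      using arg_cong[OF Gx, of "\<lambda>M. M $$ (i, j)"] dims s xd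
      by (simp add: G_def mat_ring del: index_mult_mat(1))
  qed (use dims s xd in auto)
  define y where "y = minv P * (Q * (t * (s * x)))"
  have yd: "dim_row y = n" "dim_col y = 1" using dims xd by (auto simp: y_def)
  have "L * y = Q * (t * (s * x)) - Q * (t * (s * (s * (t * (s * x)))))"
    using dims s xd by (simp add: L_def y_def mat_ring PP' ww)
  also have "\<dots> = 0\<^sub>m n 1" unfolding eq using dims s xd by (auto intro!: eq_matI simp del: index_mult_mat(1))
  finally have "minv L * (L * y) = minv L * 0\<^sub>m n 1" by simp
  moreover have "minv L * (L * y) = y"
    using minv_props[OF L_carrier(1) assms] dims yd by (simp add: mm_assoc[symmetric] mm_one_left)
  ultimately have y0: "y = 0\<^sub>m n 1" using minv_props[OF L_carrier(1) assms] by (simp add: mat_ring)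
  have "s * (s * (t * (s * x))) = adj Q * y" using dims s xd by (simp add: y_def ww)
  then have sx: "s * x = 0\<^sub>m k 1" using dims by (simp add: eq y0 mat_ring)
  have "x = s * (t * (s * x))" using eq by simp
  also have "\<dots> = 0\<^sub>m k 1" unfolding sx using dims s by (simp add: mat_ring)
  finally show "x = 0\<^sub>m k 1" .
qed

context
  assumes dG: "det G \<noteq> 0"
begin

lemma Gi: "minv G \<in> carrier_mat k k" "dim_row (minv G) = k" "dim_col (minv G) = k" "adj (minv G) = minv G"
    "G * minv G = 1\<^sub>m k" "minv G * G = 1\<^sub>m k"
  using minv_props[OF G_carrier(1) dG] hermitian_minv[OF G_carrier(1) dG G_carrier(2)] by auto

text \<open>\<open>G * minv G = 1\<close> as a rewrite rule that removes a factor
  \<open>s t s\<close> in front of \<open>minv G\<close>; together with \<open>ww\<close> it drives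
  the cancellations below.\<close>

lemma sts_Gi: "dim_row X = k \<Longrightarrow> s * (t * (s * (minv G * X))) = minv G * X - X"
proof (rule eq_matI)
  fix i j assume X: "dim_row X = k" and "i < dim_row (minv G * X - X)" "j < dim_col (minv G * X - X)"
  then have ij: "i < k" "j < dim_col X" by auto
  have "X = G * (minv G * X)" using X dims Gi G_carrier by (simp add: mm_assoc[symmetric] mm_one_left)
  also have "\<dots> = minv G * X - s * (t * (s * (minv G * X)))"
    using X dims Gi s by (simp add: G_def mat_ring)
  finally have eq: "X = minv G * X - s * (t * (s * (minv G * X)))" .
  show "(s * (t * (s * (minv G * X)))) $$ (i, j) = (minv G * X - X) $$ (i, j)"
    using arg_cong[OF eq, of "\<lambda>M. M $$ (i, j)"] ij X dims Gi s by (simp del: index_mult_mat(1))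
qed (use dims s Gi in auto)

lemma sts_Gi': "s * (t * (s * minv G)) = minv G - 1\<^sub>m k"
  using sts_Gi[of "1\<^sub>m k"] Gi by (simp add: mm_one_right)

text \<open>Woodbury's formula for the inverse of \<open>L\<close>. The middle factor is
  \<open>t\<close> times the inverse of \<open>1 - w t\<close>, rewritten through \<open>G\<close>
  so that it is visibly hermitian and involves no inverse of \<open>t\<close>.\<close>

definition Li :: "complex mat" where
  "Li = minv P + minv P * (Q * ((t + t * (s * (minv G * (s * t)))) * (adj Q * minv P)))"

lemma Li_dims: "dim_row Li = n" "dim_col Li = n"
  using dims by (auto simp: Li_def)

lemma L_Li: "L * Li = 1\<^sub>m n"
  by (rule eq_matI)
    (use dims s Gi in \<open>simp_all add: L_def Li_def mat_ring PP PP' ww sts_Gi del: index_mult_mat(1)\<close>)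

lemma minv_L: "minv L = Li" "det L \<noteq> 0"
  using minv_unique[OF L_carrier(1) _ L_Li] Li_dims by auto

text \<open>With \<open>N = s t s\<close>, compressing the Woodbury formula gives
  \<open>s (1 + N + N (minv G) N) s\<close>, and the bracket is an expansion of
  \<open>minv G\<close> because \<open>G = 1 - N\<close>.\<close>

lemma compressed_L: "adj Q * (minv L * Q) = s * (minv G * s)"
  unfolding minv_L
proof (rule eq_matI)
  fix i j assume "i < dim_row (s * (minv G * s))" "j < dim_col (s * (minv G * s))"
  then have ij: "i < k" "j < k" using s by auto
  have a: "s * (s * (t * (s * (minv G * (s * (t * (s * s))))))) = s * (minv G * (s * (t * (s * s)))) - s * (s * (t * (s * s)))"
    using dims s(1,3,4) Gi by (simp add: sts_Gi mat_ring)
  have b: "minv G * (s * (t * s)) = minv G - 1\<^sub>m k"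
    using arg_cong[OF sts_Gi', of adj] dims s(1,3,4) Gi t(2) by (simp add: mm_assoc)
  have b': "s * (minv G * (s * (t * (s * s)))) = s * (minv G * s) - s * s"
    using mm_assoc_eq3[of s t s "s * (t * s)" s] arg_cong[OF b, of "\<lambda>M. s * (M * s)"] dims s(1,3,4) Gi
    by (simp add: mat_ring)
  show "(adj Q * (Li * Q)) $$ (i, j) = (s * (minv G * s)) $$ (i, j)"
    using ij dims s(1,3,4) Gi by (simp add: Li_def mat_ring ww a b' sts_Gi del: index_mult_mat(1))
qed (use dims s Li_dims in auto)

text \<open>With \<open>t\<close> linear in \<open>X\<close> the first two summands are affine in
  \<open>X\<close> and become \<open>f\<close>; the last becomes the term with the square roots in
  the realization.\<close>

lemma minv_L_expansion:
  "minv L = minv P + minv P * (Q * (t * (adj Q * minv P)))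
     + minv P * (Q * (t * (s * (minv G * (s * (t * (adj Q * minv P)))))))"
  unfolding minv_L Li_def
  by (rule eq_matI) (use dims s Gi in \<open>simp_all add: mat_ring del: index_mult_mat(1)\<close>)

end

text \<open>\<open>G\<close> is the identity on the kernel of \<open>s\<close>, so only its compression to the range of \<open>s\<close> matters.\<close>

lemma psd_compressed_iff:
  assumes dL: "det L \<noteq> 0"
  shows "psd (adj Q * (minv L * Q)) \<longleftrightarrow> pd G"
proof
  note dG = det_G[OF dL]
  note Gi = Gi[OF dG]
  assume "pd G"
  then have "psd (minv G)" using psd_minv[OF pd_imp_psd dG] by simp
  then show "psd (adj Q * (minv L * Q))"
    unfolding compressed_L[OF dG] using psd_sandwich[of "minv G" s] s Gi by simp
next
  note dG = det_G[OF dL]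
  note Gi = Gi[OF dG]
  assume ps: "psd (adj Q * (minv L * Q))"
  have s_c: "s \<in> carrier_mat k k" using s by auto
  \<comment> \<open>Because \<open>s * (s * p) = s\<close>, every \<open>x\<close> is the sum of
    some \<open>s * u\<close> and a vector \<open>v\<close> killed by \<open>s\<close>.\<close>
  obtain p where p: "p \<in> carrier_mat k k" "s * (s * p) = s" using hermitian_pseudo_inverse[OF s_c s(1)] by auto
  note pd = carrier_matD[OF p(1)]
  have "psd (minv G)"
  proof (rule psdI[OF Gi(1,4)])
    fix x :: "complex mat" assume x: "x \<in> carrier_mat k 1"
    note xd = carrier_matD[OF x]
    define u where "u = p * x"
    define v where "v = x - s * (p * x)"
    have d: "dim_row u = k" "dim_col u = 1" "dim_row v = k" "dim_col v = 1"
      using s pd xd by (auto simp: u_def v_def)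
    have sv: "s * v = 0\<^sub>m k 1"
    proof (rule eq_matI)
      fix i j assume ij: "i < dim_row (0\<^sub>m k 1 :: complex mat)" "j < dim_col (0\<^sub>m k 1 :: complex mat)"
      have "s * (s * (p * x)) = s * x" using mm_assoc_eq3[OF p(2), of x] s pd xd by simp
      then show "(s * v) $$ (i, j) = 0\<^sub>m k 1 $$ (i, j)"
        using ij s pd xd by (simp add: v_def mat_ring del: index_mult_mat(1))
    qed (use s d in auto)
    have xuv: "x = s * u + v"
      by (rule eq_matI) (use s d xd pd in \<open>simp_all add: u_def v_def mat_ring del: index_mult_mat(1)\<close>)
    have "G * v = v" using dims s d by (simp add: G_def mat_ring sv) (auto intro!: eq_matI)
    then have "minv G * (G * v) = minv G * v" by simp
    then have Gv: "minv G * v = v"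
      using Gi(2,3) G_carrier d by (simp add: mm_assoc[symmetric] Gi mm_one_left)
    have vs: "adj v * s = 0\<^sub>m 1 k" using arg_cong[OF sv, of adj] s d by simp
    have vs': "adj v * (s * X) = 0\<^sub>m 1 (dim_col X)" if "dim_row X = k" for X
      using mm_assoc_eq[OF vs, of X] that s d by (simp add: mat_ring)
    have vG: "adj v * (minv G * X) = adj v * X" if "dim_row X = k" for X
    proof -
      have "adj v * minv G = adj (minv G * v)" using Gi d by simp
      then have "adj v * minv G = adj v" by (simp add: Gv)
      then show ?thesis using mm_assoc_eq[of "adj v" "minv G" "adj v" X] Gi d that by simp
    qed
    \<comment> \<open>The cross terms vanish: \<open>minv G\<close> fixes \<open>v\<close>, and
      \<open>adj v * s = 0\<close>.\<close>
    have "adj x * (minv G * x) = adj u * ((s * (minv G * s)) * u) + adj v * v"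
      unfolding xuv using s d Gi by (simp add: mat_ring Gv sv vs' vG) (auto intro!: eq_matI simp del: index_mult_mat(1))
    then have "qf (minv G) x = qf (s * (minv G * s)) u + qf (1\<^sub>m k) v"
      using s d Gi by (simp add: qf_def mm_one_left del: index_mult_mat(1))
    moreover have "qf (s * (minv G * s)) u \<ge> 0"
    proof (rule psdD(3))
      show "psd (s * (minv G * s))" using ps by (simp add: compressed_L[OF dG])
      show "u \<in> carrier_mat (dim_row (s * (minv G * s))) 1" using d s(3) by (intro carrier_matI) auto
    qed
    moreover have "0 \<le> qf (1\<^sub>m k) v" by (rule qf_one_nonneg) (use d in auto)
    ultimately show "0 \<le> qf (minv G) x" by linarith
  qed
  \<comment> \<open>\<open>G = adj G * (minv G * G)\<close>, so positivity passes from the inverse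
    back to \<open>G\<close>.\<close>
  then have "psd (adj G * (minv G * G))" using psd_sandwich[of "minv G" G] G_carrier Gi by simp
  then have "psd G" using G_carrier Gi carrier_matD[OF G_carrier(1)] by (simp add: mat_ring)
  then show "pd G" by (rule psd_det_pd) (rule dG)
qed

end

end

section \<open>Pencils and tuples\<close>

text \<open>Rectangular tuples without hermiticity, since the off-diagonal blocks of a direct sum
  are in general neither square nor hermitian.\<close>

definition mats :: "nat \<Rightarrow> nat \<Rightarrow> nat \<Rightarrow> complex mat list set" where
  "mats r c g = {X. length X = g \<and> set X \<subseteq> carrier_mat r c}"

lemma matsD: "X \<in> mats r c g \<Longrightarrow> length X = g" "X \<in> mats r c g \<Longrightarrow> i < g \<Longrightarrow> X ! i \<in> carrier_mat r c"
  by (auto simp: mats_def)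

lemma matsI: "length X = g \<Longrightarrow> (\<And>i. i < g \<Longrightarrow> X ! i \<in> carrier_mat r c) \<Longrightarrow> X \<in> mats r c g"
  by (auto simp: mats_def in_set_conv_nth)

lemma herm_tuples_iff:
  "X \<in> herm_tuples n g \<longleftrightarrow> X \<in> mats n n g \<and> (\<forall>i<g. adj (X ! i) = X ! i)"
proof -
  have "(\<forall>i<g. adj (X ! i) = X ! i) \<longleftrightarrow> (\<forall>M\<in>set X. adj M = M)" if "length X = g"
    using that by (auto simp: all_set_conv_all_nth)
  then show ?thesis by (auto simp: herm_tuples_def mats_def hermitian_iff)
qed

lemma herm_tuples_adj: "X \<in> herm_tuples n g \<longleftrightarrow> X \<in> mats n n g \<and> map adj X = X"
  unfolding herm_tuples_iff using matsD(1)[of X n n g] by (auto simp: list_eq_iff_nth_eq)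

text \<open>\<open>lin_pencil\<close> with both outer dimensions free, so that it also covers
  rectangular tuples.\<close>

definition plin :: "nat \<Rightarrow> nat \<Rightarrow> complex mat list \<Rightarrow> complex mat list \<Rightarrow> complex mat" where
  "plin a b T X = foldr (+) (map2 kron T X) (0\<^sub>m a b)"

lemma plin_simps:
  "plin a b [] X = 0\<^sub>m a b" "plin a b T [] = 0\<^sub>m a b"
  "plin a b (t # T) (x # X) = kron t x + plin a b T X"
  by (auto simp: plin_def)

lemma plin_dim [simp]: "dim_row (plin a b T X) = a" "dim_col (plin a b T X) = b"
proof -
  have "dim_row (foldr (+) Ms (0\<^sub>m a b :: complex mat)) = a \<and> dim_col (foldr (+) Ms (0\<^sub>m a b :: complex mat)) = b" for Ms
    by (induction Ms) auto
  then show "dim_row (plin a b T X) = a" "dim_col (plin a b T X) = b" by (auto simp: plin_def)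
qed

lemma plin_carrier [simp]: "plin a b T X \<in> carrier_mat a b"
  by (rule carrier_matI) auto

lemma lin_pencil_plin: "lin_pencil e n T X = plin (e * n) (e * n) T X"
  by (simp add: lin_pencil_def plin_def)

lemma mats_Nil [simp]: "X \<in> mats r c 0 \<longleftrightarrow> X = []"
  by (auto simp: mats_def)

lemma mats_SucE:
  assumes "X \<in> mats r c (Suc g)"
  obtains x X' where "X = x # X'" "x \<in> carrier_mat r c" "X' \<in> mats r c g"
  using assms by (cases X) (auto simp: mats_def)

lemma mats_Cons [simp]: "x # X \<in> mats r c (Suc g) \<longleftrightarrow> x \<in> carrier_mat r c \<and> X \<in> mats r c g"
  by (auto simp: mats_def)

text \<open>The mixed product rule, summed over the tuple. It carries unitary conjugation and block
  embeddings on the second tensor factor as well as compression of the coefficients on the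
  first.\<close>

lemma plin_sandwich:
  assumes "T \<in> mats e f g" "X \<in> mats n m g"
    and A: "dim_col A = e" and B: "dim_row B = f" and C: "dim_col C = n" and D: "dim_row D = m"
  shows "plin (dim_row A * dim_row C) (dim_col B * dim_col D) (map (\<lambda>t. A * (t * B)) T) (map (\<lambda>x. C * (x * D)) X)
    = kron A C * (plin (e * n) (f * m) T X * kron B D)"
  using assms(1,2)
proof (induction g arbitrary: T X)
  case 0
  then show ?case using A B C D by (simp add: plin_simps mat_ring)
next
  case (Suc g)
  obtain t T' x X' where eq: "T = t # T'" "X = x # X'" and c: "t \<in> carrier_mat e f" "T' \<in> mats e f g"
     "x \<in> carrier_mat n m" "X' \<in> mats n m g" by (metis Suc.prems mats_SucE)
  have "kron (A * (t * B)) (C * (x * D)) = kron A C * (kron t x * kron B D)"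
    using c(1,3) A B C D by (simp add: kron_mult)
  then show ?case using c A B C D Suc.IH[OF c(2,4)] unfolding eq
    by (simp add: plin_simps mat_ring)
qed

lemma plin_add:
  assumes "T \<in> mats e f g" "X \<in> mats n m g" "Y \<in> mats n m g"
  shows "plin (e * n) (f * m) T (map2 (+) X Y) = plin (e * n) (f * m) T X + plin (e * n) (f * m) T Y"
  using assms
proof (induction g arbitrary: T X Y)
  case 0
  then show ?case by (simp add: plin_simps)
next
  case (Suc g)
  obtain t T' x X' y Y' where eq: "T = t # T'" "X = x # X'" "Y = y # Y'"
    and c: "t \<in> carrier_mat e f" "T' \<in> mats e f g"
     "x \<in> carrier_mat n m" "X' \<in> mats n m g" "y \<in> carrier_mat n m" "Y' \<in> mats n m g"
    by (metis Suc.prems mats_SucE)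
  show ?case unfolding eq using c Suc.IH[OF c(2,4,6)]
    by (auto simp: plin_simps kron_add_right intro!: eq_matI)
qed

lemma plin_smult:
  assumes "T \<in> mats e f g" "X \<in> mats n m g"
  shows "plin (e * n) (f * m) T (map (\<lambda>x. z \<cdot>\<^sub>m x) X) = z \<cdot>\<^sub>m plin (e * n) (f * m) T X"
  using assms
proof (induction g arbitrary: T X)
  case 0
  then show ?case by (simp add: plin_simps)
next
  case (Suc g)
  obtain t T' x X' where eq: "T = t # T'" "X = x # X'" and c: "t \<in> carrier_mat e f" "T' \<in> mats e f g"
     "x \<in> carrier_mat n m" "X' \<in> mats n m g" by (metis Suc.prems mats_SucE)
  show ?case unfolding eq using c Suc.IH[OF c(2,4)]
    by (auto simp: plin_simps kron_smult_right smult_add_mm intro!: eq_matI)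
qed

lemma plin_adj:
  assumes "T \<in> mats e f g" "X \<in> mats n m g"
  shows "adj (plin (e * n) (f * m) T X) = plin (f * m) (e * n) (map adj T) (map adj X)"
  using assms
proof (induction g arbitrary: T X)
  case 0
  then show ?case by (simp add: plin_simps)
next
  case (Suc g)
  obtain t T' x X' where eq: "T = t # T'" "X = x # X'" and c: "t \<in> carrier_mat e f" "T' \<in> mats e f g"
     "x \<in> carrier_mat n m" "X' \<in> mats n m g" by (metis Suc.prems mats_SucE)
  show ?case unfolding eq using c Suc.IH[OF c(2,4)] by (simp add: plin_simps)
qed

lemma plin_index:
  assumes "T \<in> mats e f g" "X \<in> mats n m g" "p < e * n" "q < f * m"
  shows "plin (e * n) (f * m) T X $$ (p, q)
    = (\<Sum>i<g. (T ! i) $$ (p div n, q div m) * (X ! i) $$ (p mod n, q mod m))"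
  using assms(1,2)
proof (induction g arbitrary: T X)
  case 0
  then show ?case using assms by (simp add: plin_simps)
next
  case (Suc g)
  obtain t T' x X' where eq: "T = t # T'" "X = x # X'" and c: "t \<in> carrier_mat e f" "T' \<in> mats e f g"
     "x \<in> carrier_mat n m" "X' \<in> mats n m g" by (metis Suc.prems mats_SucE)
  show ?case unfolding eq sum.lessThan_Suc_shift using c Suc.IH[OF c(2,4)] assms(3,4)
    by (simp add: plin_simps)
qed

lemma plin_zero:
  assumes "T \<in> mats e f g"
  shows "plin (e * n) (f * n) T (zero_tuple n g) = 0\<^sub>m (e * n) (f * n)"
  using assms
proof (induction g arbitrary: T)
  case (Suc g)
  obtain t T' where "T = t # T'" "t \<in> carrier_mat e f" "T' \<in> mats e f g" by (metis Suc.prems mats_SucE)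
  then show ?case using Suc.IH[of T'] by (simp add: zero_tuple_def plin_simps)
qed (simp add: plin_simps)

lemma zero_tuple_herm: "zero_tuple n g \<in> herm_tuples n g"
  by (auto simp: herm_tuples_iff zero_tuple_def mats_def)

lemma map2_in_mats:
  assumes "X \<in> mats a b g" "Y \<in> mats c d g"
    and "\<And>x y. x \<in> carrier_mat a b \<Longrightarrow> y \<in> carrier_mat c d \<Longrightarrow> f x y \<in> carrier_mat p q"
  shows "map2 f X Y \<in> mats p q g"
  by (rule matsI) (use assms matsD(1)[OF assms(1)] matsD(1)[OF assms(2)] in \<open>auto simp: matsD(2)\<close>)

lemma map_in_mats:
  assumes "X \<in> mats a b g" and "\<And>x. x \<in> carrier_mat a b \<Longrightarrow> f x \<in> carrier_mat p q"
  shows "map f X \<in> mats p q g"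
  by (rule matsI) (use assms matsD(1)[OF assms(1)] in \<open>auto simp: matsD(2)\<close>)

lemma tuple_comb_alt:
  assumes "X \<in> mats n m g" "Y \<in> mats n m g"
  shows "tuple_comb s t X Y = map2 (+) (map (\<lambda>x. complex_of_real s \<cdot>\<^sub>m x) X) (map (\<lambda>x. complex_of_real t \<cdot>\<^sub>m x) Y)"
  by (rule nth_equalityI) (use matsD(1)[OF assms(1)] matsD(1)[OF assms(2)] in \<open>auto simp: tuple_comb_def\<close>)

lemma tuple_comb_nth:
  assumes "X \<in> mats n m g" "Y \<in> mats n m g" "i < g"
  shows "tuple_comb s t X Y ! i = complex_of_real s \<cdot>\<^sub>m (X ! i) + complex_of_real t \<cdot>\<^sub>m (Y ! i)"
  using assms(3) matsD(1)[OF assms(1)] matsD(1)[OF assms(2)] by (auto simp: tuple_comb_def)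

lemma tuple_comb_mats:
  assumes "X \<in> mats n m g" "Y \<in> mats n m g"
  shows "tuple_comb s t X Y \<in> mats n m g"
  unfolding tuple_comb_def by (rule map2_in_mats[OF assms]) auto

lemma tuple_comb_herm:
  assumes "X \<in> herm_tuples n g" "Y \<in> herm_tuples n g"
  shows "tuple_comb s t X Y \<in> herm_tuples n g"
proof -
  have X: "X \<in> mats n n g" "Y \<in> mats n n g" using assms by (auto simp: herm_tuples_iff)
  have "adj (tuple_comb s t X Y ! i) = tuple_comb s t X Y ! i" if "i < g" for i
    using assms that matsD(2)[OF X(1) that] matsD(2)[OF X(2) that]
    by (simp add: tuple_comb_nth[OF X that] herm_tuples_iff)
  then show ?thesis using tuple_comb_mats[OF X] by (auto simp: herm_tuples_iff)
qed

lemma plin_tuple_comb: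
  assumes "T \<in> mats e f g" "X \<in> mats n m g" "Y \<in> mats n m g"
  shows "plin (e * n) (f * m) T (tuple_comb s t X Y) =
    complex_of_real s \<cdot>\<^sub>m plin (e * n) (f * m) T X + complex_of_real t \<cdot>\<^sub>m plin (e * n) (f * m) T Y"
  unfolding tuple_comb_alt[OF assms(2,3)]
  by (subst plin_add[OF assms(1)]) (use assms in \<open>auto simp: plin_smult intro!: map_in_mats\<close>)

section \<open>Direct sums through coordinate isometries\<close>

definition iota1 :: "nat \<Rightarrow> nat \<Rightarrow> complex mat" where
  "iota1 m n = mat (m + n) m (\<lambda>(i, j). if i = j then 1 else 0)"
definition iota2 :: "nat \<Rightarrow> nat \<Rightarrow> complex mat" where
  "iota2 m n = mat (m + n) n (\<lambda>(i, j). if i = m + j then 1 else 0)"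

lemma iota_dim [simp]:
  "dim_row (iota1 m n) = m + n" "dim_col (iota1 m n) = m" "dim_row (iota2 m n) = m + n" "dim_col (iota2 m n) = n"
  by (auto simp: iota1_def iota2_def)

lemma iota1_mult_index:
  assumes "dim_row X = m" "i < m + n" "j < dim_col X"
  shows "(iota1 m n * X) $$ (i, j) = (if i < m then X $$ (i, j) else 0)"
proof -
  have "(iota1 m n * X) $$ (i, j) = (\<Sum>k<m. if k = i then X $$ (k, j) else 0)"
    using assms by (subst times_mat_index) (auto simp: iota1_def simp del: sum.delta sum.delta' intro!: sum.cong)
  then show ?thesis by simp
qed

lemma iota2_mult_index:
  assumes "dim_row X = n" "i < m + n" "j < dim_col X"
  shows "(iota2 m n * X) $$ (i, j) = (if i < m then 0 else X $$ (i - m, j))"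
proof -
  have "(iota2 m n * X) $$ (i, j) = (\<Sum>k<n. if k = i - m then (if i < m then 0 else X $$ (k, j)) else 0)"
    using assms by (subst times_mat_index) (auto simp: iota2_def simp del: sum.delta sum.delta' intro!: sum.cong)
  then show ?thesis using assms by auto
qed

lemma mult_adj_iota_index:
  assumes "dim_col X = m" "j < m + n" "i < dim_row X"
  shows "(X * adj (iota1 m n)) $$ (i, j) = (if j < m then X $$ (i, j) else 0)"
proof -
  have "(X * adj (iota1 m n)) $$ (i, j) = adj (iota1 m n * adj X) $$ (i, j)" using assms by simp
  also have "\<dots> = cnj ((iota1 m n * adj X) $$ (j, i))" by (rule adj_index) (use assms in auto)
  also have "\<dots> = (if j < m then X $$ (i, j) else 0)"
    using assms by (subst iota1_mult_index) auto
  finally show ?thesis .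
qed

lemma mult_adj_iota2_index:
  assumes "dim_col X = n" "j < m + n" "i < dim_row X"
  shows "(X * adj (iota2 m n)) $$ (i, j) = (if j < m then 0 else X $$ (i, j - m))"
proof -
  have "(X * adj (iota2 m n)) $$ (i, j) = adj (iota2 m n * adj X) $$ (i, j)" using assms by simp
  also have "\<dots> = cnj ((iota2 m n * adj X) $$ (j, i))" by (rule adj_index) (use assms in auto)
  also have "\<dots> = (if j < m then 0 else X $$ (i, j - m))"
    using assms by (subst iota2_mult_index) auto
  finally show ?thesis .
qed

lemma dsum_iota:
  assumes "X \<in> carrier_mat m m" "Y \<in> carrier_mat n n"
  shows "dsum X Y = iota1 m n * (X * adj (iota1 m n)) + iota2 m n * (Y * adj (iota2 m n))"
  by (rule eq_matI)
    (use assms in \<open>auto simp: dsum_def iota1_mult_index iota2_mult_index mult_adj_iota_index mult_adj_iota2_index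
      simp del: index_mult_mat(1)\<close>)

lemma iota_sum: "iota1 m n * adj (iota1 m n) + iota2 m n * adj (iota2 m n) = 1\<^sub>m (m + n)"
  by (rule eq_matI)
    (auto simp: mult_adj_iota_index mult_adj_iota2_index simp del: index_mult_mat(1), auto simp: iota1_def iota2_def)

lemma iota_orth:
  "adj (iota1 m n) * iota1 m n = 1\<^sub>m m" "adj (iota2 m n) * iota2 m n = 1\<^sub>m n"
  "adj (iota1 m n) * iota2 m n = 0\<^sub>m m n" "adj (iota2 m n) * iota1 m n = 0\<^sub>m n m"
proof -
  have a1: "adj (iota1 m n) = mat m (m + n) (\<lambda>(i, j). if i = j then 1 else 0)"
    by (rule eq_matI) (auto simp: iota1_def)
  have a2: "adj (iota2 m n) = mat n (m + n) (\<lambda>(i, j). if j = m + i then 1 else 0)"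
    by (rule eq_matI) (auto simp: iota2_def)
  have A1: "(adj (iota1 m n) * M) $$ (i, j) = M $$ (i, j)" if "dim_row M = m + n" "i < m" "j < dim_col M" for M i j
  proof -
    have "(adj (iota1 m n) * M) $$ (i, j) = (\<Sum>k<m + n. if k = i then M $$ (k, j) else 0)"
      unfolding a1 using that by (subst times_mat_index) (auto simp del: sum.delta sum.delta' intro!: sum.cong)
    then show ?thesis using that by simp
  qed
  have A2: "(adj (iota2 m n) * M) $$ (i, j) = M $$ (m + i, j)" if "dim_row M = m + n" "i < n" "j < dim_col M" for M i j
  proof -
    have "(adj (iota2 m n) * M) $$ (i, j) = (\<Sum>k<m + n. if k = m + i then M $$ (k, j) else 0)"
      unfolding a2 using that by (subst times_mat_index) (auto simp del: sum.delta sum.delta' intro!: sum.cong)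
    then show ?thesis using that by simp
  qed
  show "adj (iota1 m n) * iota1 m n = 1\<^sub>m m" "adj (iota2 m n) * iota2 m n = 1\<^sub>m n"
    "adj (iota1 m n) * iota2 m n = 0\<^sub>m m n" "adj (iota2 m n) * iota1 m n = 0\<^sub>m n m"
    by (rule eq_matI; simp add: A1 A2 del: index_mult_mat(1); auto simp: iota1_def iota2_def)+
qed

lemma inverse_sandwich:
  fixes L W :: "complex mat"
  assumes L: "L \<in> carrier_mat N N" "det L \<noteq> 0"
    and W: "W \<in> carrier_mat N N" "adj W * W = 1\<^sub>m N" "W * adj W = 1\<^sub>m N"
  shows "minv (adj W * (L * W)) = adj W * (minv L * W)" "det (adj W * (L * W)) \<noteq> 0"
proof -
  note m = minv_props[OF L]
  note d = carrier_matD[OF L(1)] carrier_matD[OF W(1)] carrier_matD[OF m(1)]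
  have "(adj W * (L * W)) * (adj W * (minv L * W)) = adj W * (L * ((W * adj W) * (minv L * W)))"
    using d by (simp add: mat_ring)
  also have "\<dots> = adj W * ((L * minv L) * W)" using d by (simp add: W(3) mat_ring)
  also have "\<dots> = 1\<^sub>m N" unfolding m using d by (simp add: mat_ring W)
  finally have *: "(adj W * (L * W)) * (adj W * (minv L * W)) = 1\<^sub>m N" .
  have c: "adj W * (L * W) \<in> carrier_mat N N" "adj W * (minv L * W) \<in> carrier_mat N N"
    using d by (auto intro!: carrier_matI)
  show "minv (adj W * (L * W)) = adj W * (minv L * W)" "det (adj W * (L * W)) \<noteq> 0"
    using minv_unique[OF c *] by auto
qed

text \<open>In the layout of \<open>kron\<close> the blocks of the pencil of a direct sum are
  interleaved, so it is not literally block diagonal. Isometries \<open>E1\<close>,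
  \<open>E2\<close> with complementary orthogonal ranges express it as a direct sum without a
  permutation of coordinates.\<close>

lemma inverse_two_blocks:
  fixes L1 L2 E1 E2 :: "complex mat"
  assumes L1: "L1 \<in> carrier_mat a a" "det L1 \<noteq> 0" and L2: "L2 \<in> carrier_mat b b" "det L2 \<noteq> 0"
    and E: "E1 \<in> carrier_mat N a" "E2 \<in> carrier_mat N b"
    and o: "adj E1 * E1 = 1\<^sub>m a" "adj E2 * E2 = 1\<^sub>m b" "adj E1 * E2 = 0\<^sub>m a b" "adj E2 * E1 = 0\<^sub>m b a"
    and s: "E1 * adj E1 + E2 * adj E2 = 1\<^sub>m N"
  shows "minv (E1 * (L1 * adj E1) + E2 * (L2 * adj E2)) = E1 * (minv L1 * adj E1) + E2 * (minv L2 * adj E2)"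
    "det (E1 * (L1 * adj E1) + E2 * (L2 * adj E2)) \<noteq> 0"
proof -
  note m = minv_props[OF L1] minv_props[OF L2]
  note d = carrier_matD[OF L1(1)] carrier_matD[OF L2(1)] carrier_matD[OF E(1)] carrier_matD[OF E(2)]
     carrier_matD[OF m(1)] carrier_matD[OF m(5)]
  let ?L = "E1 * (L1 * adj E1) + E2 * (L2 * adj E2)"
  let ?M = "E1 * (minv L1 * adj E1) + E2 * (minv L2 * adj E2)"
  have x: "adj E1 * (E1 * X) = X" "L1 * (minv L1 * X) = X" "adj E2 * (E1 * X) = 0\<^sub>m b (dim_col X)" if "dim_row X = a" for X
    using that d by (simp_all add: mm_assoc[symmetric] o m mat_ring(8-11))
  have y: "adj E2 * (E2 * X) = X" "L2 * (minv L2 * X) = X" "adj E1 * (E2 * X) = 0\<^sub>m a (dim_col X)" if "dim_row X = b" for X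
    using that d by (simp_all add: mm_assoc[symmetric] o m mat_ring(8-11))
  have "?L * ?M = E1 * adj E1 + E2 * adj E2"
    by (rule eq_matI) (use d in \<open>simp_all add: mat_ring x y del: index_mult_mat(1)\<close>)
  then have *: "?L * ?M = 1\<^sub>m N" using s by simp
  have c: "?L \<in> carrier_mat N N" "?M \<in> carrier_mat N N"
    using d by (auto intro!: carrier_matI)
  show "minv ?L = ?M" "det ?L \<noteq> 0"
    using minv_unique[OF c *] by auto
qed

lemma plin_embed:
  assumes "T \<in> mats e e g" "X \<in> mats n m g" "dim_col C = n" "dim_row D = m"
  shows "plin (e * dim_row C) (e * dim_col D) T (map (\<lambda>x. C * (x * D)) X)
    = kron (1\<^sub>m e) C * (plin (e * n) (e * m) T X * kron (1\<^sub>m e) D)"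
proof -
  have "map (\<lambda>t. 1\<^sub>m e * (t * 1\<^sub>m e)) T = T"
  proof (rule nth_equalityI)
    fix i assume "i < length (map (\<lambda>t. 1\<^sub>m e * (t * 1\<^sub>m e)) T)"
    then show "map (\<lambda>t. 1\<^sub>m e * (t * 1\<^sub>m e)) T ! i = T ! i"
      using carrier_matD[OF matsD(2)[OF assms(1), of i]] matsD(1)[OF assms(1)] by (simp add: mat_ring)
  qed simp
  then show ?thesis using plin_sandwich[OF assms(1,2), of "1\<^sub>m e" "1\<^sub>m e" C D] assms by simp
qed

lemma map2_dsum:
  assumes "X \<in> mats m m g" "Y \<in> mats n n g"
  shows "map2 dsum X Y = map2 (+) (map (\<lambda>x. iota1 m n * (x * adj (iota1 m n))) X)
      (map (\<lambda>y. iota2 m n * (y * adj (iota2 m n))) Y)"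
  by (rule nth_equalityI)
    (use matsD(1)[OF assms(1)] matsD(1)[OF assms(2)] matsD(2)[OF assms(1)] matsD(2)[OF assms(2)] in
      \<open>auto intro!: dsum_iota\<close>)

lemma tuple_conj_alt:
  assumes "X \<in> mats n n g" "dim_row U = n"
  shows "tuple_conj U X = map (\<lambda>x. adj U * (x * U)) X"
proof (rule nth_equalityI)
  fix i assume "i < length (tuple_conj U X)"
  then show "tuple_conj U X ! i = map (\<lambda>x. adj U * (x * U)) X ! i"
    using carrier_matD[OF matsD(2)[OF assms(1), of i]] matsD(1)[OF assms(1)] assms(2)
    by (simp add: tuple_conj_def mm_assoc)
qed (simp add: tuple_conj_def)

lemma plin_dsum:
  assumes T: "T \<in> mats e e g" and X: "X \<in> mats m m g" and Y: "Y \<in> mats n n g"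
  shows "plin (e * (m + n)) (e * (m + n)) T (map2 dsum X Y) =
    kron (1\<^sub>m e) (iota1 m n) * (plin (e * m) (e * m) T X * adj (kron (1\<^sub>m e) (iota1 m n))) +
    kron (1\<^sub>m e) (iota2 m n) * (plin (e * n) (e * n) T Y * adj (kron (1\<^sub>m e) (iota2 m n)))"
proof -
  have "map (\<lambda>x. iota1 m n * (x * adj (iota1 m n))) X \<in> mats (m + n) (m + n) g"
    by (rule map_in_mats[OF X]) (auto intro!: carrier_matI)
  moreover have "map (\<lambda>x. iota2 m n * (x * adj (iota2 m n))) Y \<in> mats (m + n) (m + n) g"
    by (rule map_in_mats[OF Y]) (auto intro!: carrier_matI)
  ultimately show ?thesis
    unfolding map2_dsum[OF X Y]
    using plin_embed[OF T X, of "iota1 m n" "adj (iota1 m n)"] plin_embed[OF T Y, of "iota2 m n" "adj (iota2 m n)"]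
    by (subst plin_add[OF T]) (auto simp: add.commute)
qed

lemma herm_tuples_dsum:
  assumes X: "X \<in> herm_tuples m g" and Y: "Y \<in> herm_tuples n g"
  shows "map2 dsum X Y \<in> herm_tuples (m + n) g"
proof -
  have X': "X \<in> mats m m g" and Y': "Y \<in> mats n n g" using X Y by (auto simp: herm_tuples_iff)
  have 1: "map2 dsum X Y \<in> mats (m + n) (m + n) g"
    by (rule map2_in_mats[OF X' Y']) (auto simp: dsum_def)
  have "adj (dsum (X ! i) (Y ! i)) = dsum (X ! i) (Y ! i)" if i: "i < g" for i
    using matsD(2)[OF X' i] matsD(2)[OF Y' i] X Y i
    by (simp add: dsum_iota[of _ m _ n] herm_tuples_iff mm_assoc)
  then show ?thesis using 1 matsD(1)[OF X'] matsD(1)[OF Y'] by (auto simp: herm_tuples_iff)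
qed

lemma herm_tuples_conj:
  assumes X: "X \<in> herm_tuples n g" and U: "U \<in> carrier_mat n n"
  shows "tuple_conj U X \<in> herm_tuples n g"
proof -
  have X': "X \<in> mats n n g" using X by (auto simp: herm_tuples_iff)
  note d = carrier_matD[OF U]
  have 1: "tuple_conj U X \<in> mats n n g"
    unfolding tuple_conj_alt[OF X' d(1)] by (rule map_in_mats[OF X']) (use d in \<open>auto intro!: carrier_matI\<close>)
  have "adj (tuple_conj U X ! i) = tuple_conj U X ! i" if i: "i < g" for i
    using matsD(2)[OF X' i] matsD(1)[OF X'] X i d
    by (simp add: tuple_conj_alt[OF X'] herm_tuples_iff mm_assoc)
  then show ?thesis using 1 by (auto simp: herm_tuples_iff)
qed

lemma tuple_conj_zero: "U \<in> carrier_mat n n \<Longrightarrow> tuple_conj U (zero_tuple n g) = zero_tuple n g"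
  by (auto simp: tuple_conj_def zero_tuple_def mat_ring)

lemma dsum_zero: "map2 dsum (zero_tuple m g) (zero_tuple n g) = zero_tuple (m + n) g"
  by (rule nth_equalityI) (auto simp: zero_tuple_def dsum_def)

section \<open>Realizations under direct sums and unitary conjugation\<close>

locale wf_real =
  fixes h g :: nat and R :: realization
  assumes wf: "wf_realization h g R"
begin

abbreviation "e \<equiv> rdim R"
abbreviation "J \<equiv> rJ R"
abbreviation "T \<equiv> rT R"
abbreviation "S \<equiv> rS R"

lemma basic:
  "J \<in> carrier_mat e e" "J * J = 1\<^sub>m e" "adj J = J" "T \<in> mats e e g" "map adj T = T"
  "S \<in> mats e e h" "map adj S = S" "rc R \<in> carrier_vec e"
  using wf by (auto simp: wf_realization_def hermitian_iff herm_tuples_adj)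

lemma J_dim: "dim_row J = e" "dim_col J = e"
  using basic(1) by auto

abbreviation "Tl n X \<equiv> plin (e * n) (e * n) T X"
abbreviation "Sl n A \<equiv> plin (e * n) (e * n) S A"
abbreviation "pen \<equiv> pencil R"

lemma pen_def: "pen n A X = kron J (1\<^sub>m n) - Tl n X - Sl n A"
  by (simp add: pencil_def lin_pencil_plin)

lemma pen_dim [simp]: "dim_row (pen n A X) = e * n" "dim_col (pen n A X) = e * n"
  by (simp_all add: pen_def J_dim)

lemma pen_carrier [simp]: "pen n A X \<in> carrier_mat (e * n) (e * n)"
  by (rule carrier_matI) auto

lemma plin_herm:
  assumes "T' \<in> mats p p q" "map adj T' = T'" "X \<in> herm_tuples n q"
  shows "adj (plin (p * n) (p * n) T' X) = plin (p * n) (p * n) T' X"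
  using assms(3) plin_adj[OF assms(1), of X n n] assms(2) by (auto simp: herm_tuples_adj)

lemma pen_herm:
  assumes "A \<in> herm_tuples n h" "X \<in> herm_tuples n g"
  shows "adj (pen n A X) = pen n A X"
  using plin_herm[OF basic(4,5) assms(2)] plin_herm[OF basic(6,7) assms(1)] basic(3)
  by (simp add: pen_def J_dim)

lemma pen_zero: "pen n A (zero_tuple n g) = kron J (1\<^sub>m n) - Sl n A"
  unfolding pen_def plin_zero[OF basic(4)] by (rule eq_matI) (auto simp: J_dim)

lemma pen_split: "pen n A X = pen n A (zero_tuple n g) - Tl n X"
  unfolding pen_zero unfolding pen_def by (rule eq_matI) (auto simp: J_dim)

lemma pen_conj:
  assumes A: "A \<in> mats n n h" and X: "X \<in> mats n n g" and U: "unitary n U"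
  shows "pen n (tuple_conj U A) (tuple_conj U X) = adj (kron (1\<^sub>m e) U) * (pen n A X * kron (1\<^sub>m e) U)"
proof -
  have Uc: "U \<in> carrier_mat n n" "adj U * U = 1\<^sub>m n" using U by (auto simp: unitary_def)
  note d = carrier_matD[OF Uc(1)]
  have "kron J (1\<^sub>m n) = kron (1\<^sub>m e) (adj U) * (kron J (1\<^sub>m n) * kron (1\<^sub>m e) U)"
    using d J_dim by (simp add: kron_mult mat_ring Uc)
  moreover have "Tl n (tuple_conj U X) = kron (1\<^sub>m e) (adj U) * (Tl n X * kron (1\<^sub>m e) U)"
    using plin_embed[OF basic(4) X, of "adj U" U] d by (simp add: tuple_conj_alt[OF X])
  moreover have "Sl n (tuple_conj U A) = kron (1\<^sub>m e) (adj U) * (Sl n A * kron (1\<^sub>m e) U)"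
    using plin_embed[OF basic(6) A, of "adj U" U] d by (simp add: tuple_conj_alt[OF A])
  ultimately show ?thesis
    unfolding pen_def using d J_dim by (simp add: mat_ring)
qed

lemma pen_dsum:
  assumes A: "A \<in> mats m m h" and X: "X \<in> mats m m g" and B: "B \<in> mats n n h" and Y: "Y \<in> mats n n g"
  shows "pen (m + n) (map2 dsum A B) (map2 dsum X Y) =
    kron (1\<^sub>m e) (iota1 m n) * (pen m A X * adj (kron (1\<^sub>m e) (iota1 m n))) +
    kron (1\<^sub>m e) (iota2 m n) * (pen n B Y * adj (kron (1\<^sub>m e) (iota2 m n)))"
proof -
  have J: "kron J (1\<^sub>m (m + n)) =
      kron (1\<^sub>m e) (iota1 m n) * (kron J (1\<^sub>m m) * adj (kron (1\<^sub>m e) (iota1 m n))) +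
      kron (1\<^sub>m e) (iota2 m n) * (kron J (1\<^sub>m n) * adj (kron (1\<^sub>m e) (iota2 m n)))"
    using J_dim by (simp add: iota_sum[symmetric] kron_add_right kron_mult mat_ring)
  show ?thesis
    unfolding pen_def J plin_dsum[OF basic(4) X Y] plin_dsum[OF basic(6) A B]
    by (rule eq_matI) (use J_dim in \<open>simp_all add: mat_ring del: index_mult_mat(1) adj_kron\<close>)
qed

lemma kron_iota:
  "kron (1\<^sub>m a) (iota1 m n) \<in> carrier_mat (a * (m + n)) (a * m)"
  "kron (1\<^sub>m a) (iota2 m n) \<in> carrier_mat (a * (m + n)) (a * n)"
  "adj (kron (1\<^sub>m a) (iota1 m n)) * kron (1\<^sub>m a) (iota1 m n) = 1\<^sub>m (a * m)"
  "adj (kron (1\<^sub>m a) (iota2 m n)) * kron (1\<^sub>m a) (iota2 m n) = 1\<^sub>m (a * n)"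
  "adj (kron (1\<^sub>m a) (iota1 m n)) * kron (1\<^sub>m a) (iota2 m n) = 0\<^sub>m (a * m) (a * n)"
  "adj (kron (1\<^sub>m a) (iota2 m n)) * kron (1\<^sub>m a) (iota1 m n) = 0\<^sub>m (a * n) (a * m)"
  "kron (1\<^sub>m a) (iota1 m n) * adj (kron (1\<^sub>m a) (iota1 m n)) +
   kron (1\<^sub>m a) (iota2 m n) * adj (kron (1\<^sub>m a) (iota2 m n)) = 1\<^sub>m (a * (m + n))"
  by (auto simp: kron_mult iota_orth kron_one mm_one_left kron_add_right[symmetric] iota_sum intro!: carrier_matI)

text \<open>With \<open>V_T R\<close> for \<open>V\<close> this is membership in
  \<open>dom_plus\<close> apart from hermiticity of the tuples. The closure properties below use
  only the number of rows of \<open>V\<close>.\<close>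

definition good :: "complex mat \<Rightarrow> nat \<Rightarrow> complex mat list \<Rightarrow> complex mat list \<Rightarrow> bool" where
  "good V n A X \<longleftrightarrow> det (pen n A X) \<noteq> 0 \<and> psd (compressed V R n A X)"

lemma compressed_alt:
  assumes "dim_row V = e" "det (pen n A X) \<noteq> 0"
  shows "compressed V R n A X = adj (kron V (1\<^sub>m n)) * (minv (pen n A X) * kron V (1\<^sub>m n))"
  unfolding compressed_def using assms carrier_matD[OF minv_props(1)[OF pen_carrier assms(2)]]
  by (subst mm_assoc) auto

lemma good_conj:
  assumes A: "A \<in> mats n n h" and X: "X \<in> mats n n g" and U: "unitary n U" and V: "dim_row V = e"
    and good: "good V n A X"
  shows "good V n (tuple_conj U A) (tuple_conj U X)"
proof -
  have Uc: "U \<in> carrier_mat n n" "adj U * U = 1\<^sub>m n" "U * adj U = 1\<^sub>m n" using U by (auto simp: unitary_def)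
  note d = carrier_matD[OF Uc(1)]
  have dt: "det (pen n A X) \<noteq> 0" using good by (simp add: good_def)
  note m = carrier_matD[OF minv_props(1)[OF pen_carrier dt]]
  have W: "kron (1\<^sub>m e) U \<in> carrier_mat (e * n) (e * n)"
    "adj (kron (1\<^sub>m e) U) * kron (1\<^sub>m e) U = 1\<^sub>m (e * n)"
    "kron (1\<^sub>m e) U * adj (kron (1\<^sub>m e) U) = 1\<^sub>m (e * n)"
    using d by (auto simp: kron_mult Uc kron_one mat_ring intro!: carrier_matI)
  note inv = inverse_sandwich[OF pen_carrier dt W]
  let ?F = "kron (1\<^sub>m (dim_col V)) U"
  \<comment> \<open>\<open>U\<close> acts on the second tensor factor and \<open>V\<close> on the
    first, so \<open>U\<close> passes through \<open>V\<close> and only the number of its copies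
    changes.\<close>
  have sw: "kron (1\<^sub>m e) U * kron V (1\<^sub>m n) = kron V (1\<^sub>m n) * ?F"
    using d V by (simp add: kron_mult mat_ring)
  have det': "det (pen n (tuple_conj U A) (tuple_conj U X)) \<noteq> 0"
    unfolding pen_conj[OF A X U] by (rule inv)
  have "compressed V R n (tuple_conj U A) (tuple_conj U X) =
      adj (kron (1\<^sub>m e) U * kron V (1\<^sub>m n)) * (minv (pen n A X) * (kron (1\<^sub>m e) U * kron V (1\<^sub>m n)))"
    unfolding compressed_alt[OF V det'] pen_conj[OF A X U] inv(1)
    using d V m by (simp add: mat_ring del: adj_kron)
  also have "\<dots> = adj ?F * (compressed V R n A X * ?F)"
    unfolding sw compressed_alt[OF V dt] using d V m by (simp add: mat_ring del: adj_kron)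
  finally have "compressed V R n (tuple_conj U A) (tuple_conj U X) = adj ?F * (compressed V R n A X * ?F)" .
  moreover have "psd (adj ?F * (compressed V R n A X * ?F))"
    by (rule psd_sandwich) (use good d V m in \<open>auto simp: good_def compressed_alt[OF V dt]\<close>)
  ultimately show ?thesis using det' by (simp add: good_def)
qed

lemma compressed_dsum:
  assumes A: "A \<in> mats m m h" and X: "X \<in> mats m m g" and B: "B \<in> mats n n h" and Y: "Y \<in> mats n n g"
    and V: "dim_row V = e" and d1: "det (pen m A X) \<noteq> 0" and d2: "det (pen n B Y) \<noteq> 0"
  shows "det (pen (m + n) (map2 dsum A B) (map2 dsum X Y)) \<noteq> 0"
    "compressed V R (m + n) (map2 dsum A B) (map2 dsum X Y) =
       kron (1\<^sub>m (dim_col V)) (iota1 m n) * (compressed V R m A X * adj (kron (1\<^sub>m (dim_col V)) (iota1 m n))) +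
       kron (1\<^sub>m (dim_col V)) (iota2 m n) * (compressed V R n B Y * adj (kron (1\<^sub>m (dim_col V)) (iota2 m n)))"
proof -
  note inv = inverse_two_blocks[OF pen_carrier d1 pen_carrier d2 kron_iota[of e m n]]
  show det': "det (pen (m + n) (map2 dsum A B) (map2 dsum X Y)) \<noteq> 0"
    unfolding pen_dsum[OF A X B Y] by (rule inv)
  let ?E1 = "kron (1\<^sub>m e) (iota1 m n)" let ?E2 = "kron (1\<^sub>m e) (iota2 m n)"
  let ?F1 = "kron (1\<^sub>m (dim_col V)) (iota1 m n)" let ?F2 = "kron (1\<^sub>m (dim_col V)) (iota2 m n)"
  have sw: "adj ?E1 * kron V (1\<^sub>m (m + n)) = kron V (1\<^sub>m m) * adj ?F1"
    "adj ?E2 * kron V (1\<^sub>m (m + n)) = kron V (1\<^sub>m n) * adj ?F2"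
    using V by (simp_all add: kron_mult mat_ring)
  have sw': "adj (kron V (1\<^sub>m (m + n))) * ?E1 = ?F1 * adj (kron V (1\<^sub>m m))"
    "adj (kron V (1\<^sub>m (m + n))) * ?E2 = ?F2 * adj (kron V (1\<^sub>m n))"
    using V by (simp_all add: kron_mult mat_ring)
  note m = carrier_matD[OF minv_props(1)[OF pen_carrier d1]] carrier_matD[OF minv_props(1)[OF pen_carrier d2]]
  have sw'': "adj (kron V (1\<^sub>m (m + n))) * (?E1 * M) = ?F1 * (adj (kron V (1\<^sub>m m)) * M)" if "dim_row M = e * m" for M
    using mm_assoc_eq[OF sw'(1), of M] that V by (simp add: mm_assoc del: adj_kron)
  have sw3: "adj (kron V (1\<^sub>m (m + n))) * (?E2 * M) = ?F2 * (adj (kron V (1\<^sub>m n)) * M)" if "dim_row M = e * n" for M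
    using mm_assoc_eq[OF sw'(2), of M] that V by (simp add: mm_assoc del: adj_kron)
  show "compressed V R (m + n) (map2 dsum A B) (map2 dsum X Y) =
       ?F1 * (compressed V R m A X * adj ?F1) + ?F2 * (compressed V R n B Y * adj ?F2)"
    unfolding compressed_alt[OF V det'] pen_dsum[OF A X B Y] inv(1) compressed_alt[OF V d1] compressed_alt[OF V d2]
    using V m by (simp add: mat_ring sw sw'' sw3 del: adj_kron)
qed

lemma good_dsum:
  assumes A: "A \<in> mats m m h" and X: "X \<in> mats m m g" and B: "B \<in> mats n n h" and Y: "Y \<in> mats n n g"
    and V: "dim_row V = e" and good: "good V m A X" "good V n B Y"
  shows "good V (m + n) (map2 dsum A B) (map2 dsum X Y)"
proof -
  have d1: "det (pen m A X) \<noteq> 0" and d2: "det (pen n B Y) \<noteq> 0" using good by (auto simp: good_def)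
  have ps: "psd (F * (compressed V R q C Z * adj F))" if "det (pen q C Z) \<noteq> 0" "dim_col F = dim_col V * q" "psd (compressed V R q C Z)" for q F C Z
    using psd_sandwich[OF that(3), of "adj F"] that V by (simp add: compressed_alt)
  have "psd (compressed V R (m + n) (map2 dsum A B) (map2 dsum X Y))"
    unfolding compressed_dsum[OF A X B Y V d1 d2]
    by (intro psd_add ps) (use good d1 d2 in \<open>auto simp: good_def\<close>)
  then show ?thesis using compressed_dsum(1)[OF A X B Y V d1 d2] by (simp add: good_def)
qed

lemma dom_ver_plus_iff:
  "(A, X) \<in> dom_ver_plus h g R n \<longleftrightarrow> A \<in> herm_tuples n h \<and> X \<in> herm_tuples n g \<and>
     good (V_T R) n A X \<and> good (V_T R) n A (zero_tuple n g)"
  by (auto simp: dom_ver_plus_def dom_plus_def dom_r_def nc_space_def good_def R_T_def zero_tuple_herm)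

lemma free_dom_ver_plus:
  assumes V: "dim_row (V_T R) = e"
  shows "free_set h g (dom_ver_plus h g R)"
proof -
  have 1: "nc_subset (dom_ver_plus h g R) (nc_space h g)"
    by (auto simp: nc_subset_def nc_space_def dom_ver_plus_iff)
  have 2: "(map2 dsum A B, map2 dsum X Y) \<in> dom_ver_plus h g R (m + n)"
    if "(A, X) \<in> dom_ver_plus h g R m" "(B, Y) \<in> dom_ver_plus h g R n" for m n A X B Y
    using that good_dsum[of A m X B n Y, OF _ _ _ _ V] good_dsum[of A m "zero_tuple m g" B n "zero_tuple n g", OF _ _ _ _ V]
      herm_tuples_dsum[of A m h B n] herm_tuples_dsum[of X m g Y n] zero_tuple_herm[of m g] zero_tuple_herm[of n g]
    unfolding dom_ver_plus_iff dsum_zero by (auto simp: herm_tuples_adj)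
  have 3: "(tuple_conj U A, tuple_conj U X) \<in> dom_ver_plus h g R n"
    if "(A, X) \<in> dom_ver_plus h g R n" "unitary n U" for n A X U
    using that good_conj[of A n X U, OF _ _ _ V] good_conj[of A n "zero_tuple n g" U, OF _ _ _ V]
      herm_tuples_conj[of A n h U] herm_tuples_conj[of X n g U] zero_tuple_herm[of n g] tuple_conj_zero[of U n g]
    unfolding dom_ver_plus_iff by (auto simp: herm_tuples_adj unitary_def)
  show ?thesis unfolding free_set_def using 1 2 3 by blast
qed

end

section \<open>Slices of the vertebral positivity domain\<close>

text \<open>The sum of the moduli of the entries stands in for the operator norm, by
  \<open>2 |x_i| |x_j| \<le> |x_i|^2 + |x_j|^2\<close>.\<close>

lemma qf_entry_bound:
  assumes M: "M \<in> carrier_mat n n" and x: "x \<in> carrier_mat n 1"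
  shows "\<bar>qf M x\<bar> \<le> (\<Sum>i<n. \<Sum>j<n. cmod (M $$ (i, j))) * qf (1\<^sub>m n) x"
proof -
  note d = carrier_matD[OF M] carrier_matD[OF x]
  have c: "(cmod (x $$ (i, 0)))\<^sup>2 \<le> qf (1\<^sub>m n) x" if "i < n" for i
    unfolding qf_one[OF x] using that by (intro member_le_sum) auto
  have "(adj x * (M * x)) $$ (0, 0) = (\<Sum>i<n. \<Sum>j<n. cnj (x $$ (i, 0)) * (M $$ (i, j) * x $$ (j, 0)))"
    using d by (subst times_mat_index) (auto simp: times_mat_index sum_distrib_left simp del: index_mult_mat(1) intro!: sum.cong)
  then have "\<bar>qf M x\<bar> \<le> cmod (\<Sum>i<n. \<Sum>j<n. cnj (x $$ (i, 0)) * (M $$ (i, j) * x $$ (j, 0)))"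
    unfolding qf_def by (metis abs_Re_le_cmod)
  also have "\<dots> \<le> (\<Sum>i<n. \<Sum>j<n. cmod (M $$ (i, j)) * qf (1\<^sub>m n) x)"
  proof (intro order.trans[OF norm_sum] sum_mono)
    fix i j assume ij: "i \<in> {..<n}" "j \<in> {..<n}"
    have "2 * (cmod (x $$ (i, 0)) * cmod (x $$ (j, 0))) \<le> (cmod (x $$ (i, 0)))\<^sup>2 + (cmod (x $$ (j, 0)))\<^sup>2"
      using sum_squares_bound[of "cmod (x $$ (i, 0))" "cmod (x $$ (j, 0))"] by (simp add: mult.assoc)
    then have "cmod (x $$ (i, 0)) * cmod (x $$ (j, 0)) \<le> qf (1\<^sub>m n) x"
      using c[of i] c[of j] ij by auto
    then have "cmod (M $$ (i, j)) * (cmod (x $$ (i, 0)) * cmod (x $$ (j, 0))) \<le> cmod (M $$ (i, j)) * qf (1\<^sub>m n) x"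
      by (intro mult_left_mono) auto
    then show "norm (cnj (x $$ (i, 0)) * (M $$ (i, j) * x $$ (j, 0))) \<le> cmod (M $$ (i, j)) * qf (1\<^sub>m n) x"
      by (simp add: norm_mult mult_ac)
  qed
  finally show ?thesis by (simp add: sum_distrib_right)
qed

text \<open>With \<open>y = psd_sqrt M * x\<close> the form at \<open>x\<close> is the squared
  length of \<open>y\<close>, and \<open>x\<close> is recovered as the inverse root applied to
  \<open>y\<close>; the entry bound for that inverse gives \<open>c\<close> without a compactness
  argument.\<close>

lemma pd_lower_bound:
  assumes "pd M"
  shows "\<exists>c>0. \<forall>x \<in> carrier_mat (dim_row M) 1. c * qf (1\<^sub>m (dim_row M)) x \<le> qf M x"
proof -
  let ?n = "dim_row M"
  note m = pdD[OF assms]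
  have M: "M \<in> carrier_mat ?n ?n" using m by auto
  have dt: "det M \<noteq> 0" by (rule pd_det[OF assms])
  note s = psd_sqrt[OF pd_imp_psd[OF assms]]
  let ?s = "psd_sqrt M"
  have sc: "?s \<in> carrier_mat ?n ?n" using s by auto
  have "det ?s * det ?s = det M" using det_mult[OF sc sc] s by simp
  then have ds: "det ?s \<noteq> 0" using dt by auto
  note i = minv_props[OF sc ds]
  note d = carrier_matD[OF i(1)] carrier_matD[OF sc]
  \<comment> \<open>The summand 1 makes \<open>B\<close> positive also in dimension 0, so that it
    can be inverted.\<close>
  define B where "B = 1 + (\<Sum>i<?n. \<Sum>j<?n. cmod ((adj (minv ?s) * minv ?s) $$ (i, j)))"
  have B: "B > 0" unfolding B_def by (intro add_pos_nonneg sum_nonneg) auto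
  have "qf (1\<^sub>m ?n) x \<le> B * qf M x" if x: "x \<in> carrier_mat ?n 1" for x
  proof -
    note xd = carrier_matD[OF x]
    define y where "y = ?s * x"
    have y: "y \<in> carrier_mat ?n 1" using d xd by (auto simp: y_def)
    have xy: "minv ?s * y = x" using d xd by (simp add: y_def mm_assoc[symmetric] i mm_one_left)
    have "adj y * (adj (minv ?s) * minv ?s * y) = adj (minv ?s * y) * (minv ?s * y)"
      using d xd carrier_matD[OF y] by (simp add: mat_ring)
    then have 1: "qf (adj (minv ?s) * minv ?s) y = qf (1\<^sub>m ?n) x"
      unfolding xy using xd by (simp add: qf_def mm_one_left)
    have "adj y * y = adj x * ((?s * ?s) * x)" using d xd s(5) by (simp add: y_def mm_assoc)
    then have "adj y * y = adj x * (M * x)" using s(2) by simp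
    then have 2: "qf (1\<^sub>m ?n) y = qf M x" using carrier_matD[OF y] by (simp add: qf_def mm_one_left)
    have "qf (1\<^sub>m ?n) x \<le> (B - 1) * qf M x"
    proof -
      have "adj (minv ?s) * minv ?s \<in> carrier_mat ?n ?n" using d by (auto intro!: carrier_matI)
      from qf_entry_bound[OF this y] show ?thesis unfolding 1 2 B_def by simp
    qed
    also have "\<dots> \<le> B * qf M x"
      using psdD(3)[OF pd_imp_psd[OF assms] x] by (simp add: algebra_simps)
    finally show ?thesis .
  qed
  then have "\<forall>x \<in> carrier_mat ?n 1. inverse B * qf (1\<^sub>m ?n) x \<le> qf M x"
    using B by (auto simp: field_simps)
  then show ?thesis using B by (intro exI[of _ "inverse B"]) auto
qed

text \<open>The gap between the two sides is the form of \<open>G\<close> at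
  \<open>minv G * y - u\<close>. So the form of \<open>minv G\<close> at \<open>y\<close> is a
  maximum over \<open>u\<close> of expressions affine in the pair of \<open>y\<close> and
  \<open>G\<close>, which makes it jointly convex in them.\<close>

lemma qf_minv_lower:
  assumes G: "pd G" and y: "y \<in> carrier_mat (dim_row G) 1" and u: "u \<in> carrier_mat (dim_row G) 1"
  shows "2 * Re ((adj u * y) $$ (0, 0)) - qf G u \<le> qf (minv G) y"
    and "u = minv G * y \<Longrightarrow> 2 * Re ((adj u * y) $$ (0, 0)) - qf G u = qf (minv G) y"
proof -
  let ?n = "dim_row G"
  have Gc: "G \<in> carrier_mat ?n ?n" using pdD[OF G] by auto
  note dt = pd_det[OF G]
  note i = minv_props[OF Gc dt] hermitian_minv[OF Gc dt pdD(2)[OF G]]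
  note d = carrier_matD[OF i(1)] carrier_matD[OF Gc] carrier_matD[OF y] carrier_matD[OF u]
  define z where "z = minv G * y - u"
  have z: "z \<in> carrier_mat ?n 1" using d by (auto simp: z_def)
  have Gz: "G * (minv G * y) = y" using d by (simp add: mm_assoc[symmetric] i mm_one_left)
  have "adj y * u = adj (adj u * y)" using d by simp
  then have yu: "Re ((adj y * u) $$ (0, 0)) = Re ((adj u * y) $$ (0, 0))" using d by (simp del: adj_mult)
  have uGi: "adj y * (minv G * (G * u)) = adj y * u" using mm_assoc_eq[OF i(3), of u] d by (simp add: mm_one_left)
  have "qf G z = qf (minv G) y - Re ((adj u * y) $$ (0, 0)) - Re ((adj y * u) $$ (0, 0)) + qf G u"
    using d by (simp add: qf_def z_def mat_ring i Gz uGi pdD(2)[OF G] del: index_mult_mat(1))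
  then have *: "qf G z = qf (minv G) y - 2 * Re ((adj u * y) $$ (0, 0)) + qf G u" using yu by simp
  show "2 * Re ((adj u * y) $$ (0, 0)) - qf G u \<le> qf (minv G) y"
    using psdD(3)[OF pd_imp_psd[OF G] z] * by simp
  show "2 * Re ((adj u * y) $$ (0, 0)) - qf G u = qf (minv G) y" if "u = minv G * y"
  proof -
    have "z = 0\<^sub>m ?n 1" unfolding z_def that by (rule eq_matI) (use d in \<open>auto simp del: index_mult_mat(1)\<close>)
    then have "qf G z = 0" using qf_zero[of G] pdD(1)[OF G] by simp
    then show ?thesis using * by simp
  qed
qed

text \<open>\<open>V\<close> is an isometry whose range contains the ranges of all
  \<open>T_i\<close>: the last assumption says that the projection \<open>V * adj V\<close> fixes
  them.\<close>

locale coisometry_real = wf_real +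
  fixes V :: "complex mat" and m :: nat
  assumes V: "V \<in> carrier_mat (rdim R) m" "adj V * V = 1\<^sub>m m"
    and VT: "i < g \<Longrightarrow> V * (adj V * (rT R ! i)) = rT R ! i"
begin

text \<open>\<open>Q\<close> is \<open>V\<close> with a zero column appended. This keeps
  \<open>k\<close> positive when all coefficients of \<open>x\<close> vanish and
  \<open>m = 0\<close>.\<close>

definition k :: nat where "k = m + 1"
definition Q :: "complex mat" where "Q = V * adj (iota1 m 1)"
definition T' :: "complex mat list" where "T' = map (\<lambda>t. adj Q * (t * Q)) T"

lemma Qd: "dim_row Q = e" "dim_col Q = k" "dim_row V = e" "dim_col V = m"
  using V by (auto simp: Q_def k_def)

lemma QQ: "Q * adj Q = V * adj V" "Q * iota1 m 1 = V"
  using Qd(3,4) mm_assoc_eq[OF iota_orth(1)[of m 1], of "adj V"] by (simp_all add: Q_def mat_ring iota_orth)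

lemma VT': "i < g \<Longrightarrow> (T ! i) * (V * adj V) = T ! i"
proof -
  assume i: "i < g"
  have Ti: "T ! i \<in> carrier_mat e e" by (rule matsD(2)[OF basic(4) i])
  have a: "adj (T ! i) = T ! i" using i arg_cong[OF basic(5), of "\<lambda>l. l ! i"] matsD(1)[OF basic(4)] by simp
  from arg_cong[OF VT[OF i], of adj] show ?thesis
    using a Qd(3,4) carrier_matD[OF Ti] by (simp add: mm_assoc)
qed

lemma T'_mats: "T' \<in> mats k k g"
  unfolding T'_def by (rule map_in_mats[OF basic(4)]) (auto simp: Qd)

lemma T'_herm: "map adj T' = T'"
proof (rule nth_equalityI)
  fix i assume "i < length (map adj T')"
  then have i: "i < g" using matsD(1)[OF T'_mats] by simp
  have a: "adj (T ! i) = T ! i" using i arg_cong[OF basic(5), of "\<lambda>l. l ! i"] matsD(1)[OF basic(4)] by simp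
  show "map adj T' ! i = T' ! i"
    using i matsD(1)[OF basic(4)] carrier_matD[OF matsD(2)[OF basic(4) i]] a
    by (simp add: T'_def Qd mm_assoc)
qed simp

lemma T'_expand: "map (\<lambda>t. Q * (t * adj Q)) T' = T"
proof (rule nth_equalityI)
  fix i assume "i < length (map (\<lambda>t. Q * (t * adj Q)) T')"
  then have i: "i < g" using matsD(1)[OF T'_mats] by simp
  note d = carrier_matD[OF matsD(2)[OF basic(4) i]] Qd
  have "Q * (adj Q * (T ! i * Q) * adj Q) = (Q * adj Q) * (T ! i * (Q * adj Q))"
    using d by (simp add: mm_assoc)
  also have "\<dots> = T ! i" unfolding QQ(1) VT'[OF i] using d VT[OF i] by (simp add: mm_assoc)
  finally show "map (\<lambda>t. Q * (t * adj Q)) T' ! i = T ! i"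
    using i matsD(1)[OF basic(4)] by (simp add: T'_def)
qed (simp add: T'_def)

abbreviation "Qn n \<equiv> kron Q (1\<^sub>m n)"
abbreviation "tl' n X \<equiv> plin (k * n) (k * n) T' X"
abbreviation "P n A \<equiv> pen n A (zero_tuple n g)"

lemma Tl_expand:
  assumes "X \<in> mats n n g"
  shows "Tl n X = Qn n * (tl' n X * adj (Qn n))"
proof -
  have "map (\<lambda>x. 1\<^sub>m n * (x * 1\<^sub>m n)) X = X"
  proof (rule nth_equalityI)
    fix i assume "i < length (map (\<lambda>x. 1\<^sub>m n * (x * 1\<^sub>m n)) X)"
    then show "map (\<lambda>x. 1\<^sub>m n * (x * 1\<^sub>m n)) X ! i = X ! i"
      using carrier_matD[OF matsD(2)[OF assms, of i]] matsD(1)[OF assms] by (simp add: mat_ring)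
  qed simp
  then show ?thesis
    using plin_sandwich[OF T'_mats assms, of Q "adj Q" "1\<^sub>m n" "1\<^sub>m n"] Qd by (simp add: T'_expand)
qed

definition W :: "nat \<Rightarrow> complex mat list \<Rightarrow> complex mat" where
  "W n A = adj (Qn n) * (minv (P n A) * Qn n)"

text \<open>\<open>perturbation.G\<close> for the square root of \<open>W n A\<close>. It is affine
  in \<open>X\<close>, and the slices of \<open>dom_ver_plus\<close> turn out to be the sets on
  which it is positive definite.\<close>

definition GG :: "nat \<Rightarrow> complex mat list \<Rightarrow> complex mat list \<Rightarrow> complex mat" where
  "GG n A X = 1\<^sub>m (k * n) - psd_sqrt (W n A) * (tl' n X * psd_sqrt (W n A))"

lemma pert:
  assumes "A \<in> herm_tuples n h" "X \<in> herm_tuples n g" "det (P n A) \<noteq> 0"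
  shows "perturbation (e * n) (k * n) (P n A) (Qn n) (tl' n X)"
    and "perturbation.L (P n A) (Qn n) (tl' n X) = pen n A X"
    and "perturbation.w (P n A) (Qn n) = W n A"
proof -
  have X: "X \<in> mats n n g" using assms by (auto simp: herm_tuples_iff)
  show p: "perturbation (e * n) (k * n) (P n A) (Qn n) (tl' n X)"
    by unfold_locales
      (use assms Qd pen_herm[OF assms(1) zero_tuple_herm] plin_herm[OF T'_mats T'_herm assms(2)] in \<open>auto intro!: carrier_matI\<close>)
  show "perturbation.L (P n A) (Qn n) (tl' n X) = pen n A X"
    unfolding perturbation.L_def[OF p] pen_split[of n A X] Tl_expand[OF X] by simp
  show w: "perturbation.w (P n A) (Qn n) = W n A"
    unfolding perturbation.w_def[OF p] W_def by simp
qed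

lemma pert_G:
  assumes "A \<in> herm_tuples n h" "X \<in> herm_tuples n g" "det (P n A) \<noteq> 0" "psd (W n A)"
  shows "perturbation.G (k * n) (tl' n X) (psd_sqrt (W n A)) = GG n A X"
proof -
  note p = pert[OF assms(1-3)]
  note s = psd_sqrt[OF assms(4)]
  show ?thesis using s Qd by (subst perturbation.G_def[OF p(1)]) (auto simp: p GG_def W_def)
qed

lemma W_dim: "dim_row (W n A) = k * n" "dim_col (W n A) = k * n"
  using Qd by (auto simp: W_def)

lemma sqrt_facts:
  assumes "A \<in> herm_tuples n h" "det (P n A) \<noteq> 0" "psd (W n A)"
  shows "adj (psd_sqrt (W n A)) = psd_sqrt (W n A)"
    "psd_sqrt (W n A) * psd_sqrt (W n A) = perturbation.w (P n A) (Qn n)"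
    "dim_row (psd_sqrt (W n A)) = k * n" "dim_col (psd_sqrt (W n A)) = k * n"
  using psd_sqrt[OF assms(3)] pert(3)[OF assms(1) zero_tuple_herm assms(2)] by (auto simp: W_dim)

text \<open>Padding \<open>V\<close> to \<open>Q\<close> preserves positivity in both directions,
  because each of the two is the other one times a fixed matrix.\<close>

lemma psd_compressed_V:
  assumes "det (pen n A X) \<noteq> 0"
  shows "psd (compressed V R n A X) \<longleftrightarrow> psd (adj (Qn n) * (minv (pen n A X) * Qn n))"
proof -
  note d = carrier_matD[OF minv_props(1)[OF pen_carrier assms]] Qd
  let ?C = "kron (adj (iota1 m 1)) (1\<^sub>m n)" let ?D = "kron (iota1 m 1) (1\<^sub>m n)"
  have Q1: "Qn n = kron V (1\<^sub>m n) * ?C" using Qd by (simp add: kron_mult Q_def mat_ring)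
  have V1: "kron V (1\<^sub>m n) = Qn n * ?D" using Qd by (simp add: kron_mult QQ k_def mat_ring)
  have a: "adj ?C * (compressed V R n A X * ?C) = adj (Qn n) * (minv (pen n A X) * Qn n)"
    unfolding Q1 compressed_alt[OF Qd(3) assms] using d by (simp add: mm_assoc del: adj_kron)
  have b: "adj ?D * ((adj (Qn n) * (minv (pen n A X) * Qn n)) * ?D) = compressed V R n A X"
    unfolding V1 compressed_alt[OF Qd(3) assms] using d by (simp add: mm_assoc k_def del: adj_kron)
  show ?thesis
    using psd_sandwich[of "compressed V R n A X" ?C, unfolded a]
      psd_sandwich[of "adj (Qn n) * (minv (pen n A X) * Qn n)" ?D, unfolded b] d
    by (auto simp: compressed_alt[OF Qd(3) assms] k_def)
qed

lemma good_zero_iff: "good V n A (zero_tuple n g) \<longleftrightarrow> det (P n A) \<noteq> 0 \<and> psd (W n A)"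
  using psd_compressed_V[of n A "zero_tuple n g"] by (auto simp: good_def W_def)

text \<open>Invertibility of the pencil at \<open>(A, X)\<close> is part of the left side and is not
  assumed: positive definiteness of \<open>GG\<close> supplies it through the Woodbury
  formula.\<close>

lemma good_iff:
  assumes "A \<in> herm_tuples n h" "X \<in> herm_tuples n g" "det (P n A) \<noteq> 0" "psd (W n A)"
  shows "good V n A X \<longleftrightarrow> pd (GG n A X)"
proof -
  note p = pert[OF assms(1-3)]
  note s = sqrt_facts[OF assms(1,3,4)]
  note G = pert_G[OF assms]
  have 1: "psd (compressed V R n A X) \<longleftrightarrow> pd (GG n A X)" if "det (pen n A X) \<noteq> 0"
    unfolding psd_compressed_V[OF that]
    using perturbation.psd_compressed_iff[OF p(1) s] that by (simp add: p(2) G)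
  have 2: "det (pen n A X) \<noteq> 0" if "pd (GG n A X)"
    using perturbation.minv_L(2)[OF p(1) s] pd_det[OF that] by (simp add: p(2) G)
  show ?thesis using 1 2 by (auto simp: good_def)
qed

lemma GG_comb:
  assumes "X \<in> mats n n g" "Y \<in> mats n n g" "psd (W n A)"
  shows "GG n A (tuple_comb (1 - t) t X Y) =
    complex_of_real (1 - t) \<cdot>\<^sub>m GG n A X + complex_of_real t \<cdot>\<^sub>m GG n A Y"
  unfolding GG_def plin_tuple_comb[OF T'_mats assms(1,2)]
  using psd_sqrt(3,4)[OF assms(3)]
  by (intro eq_matI) (simp_all add: W_dim mat_ring ring_distribs del: index_mult_mat(1))

lemma GG_carrier:
  assumes "psd (W n A)" "X \<in> herm_tuples n g"
  shows "GG n A X \<in> carrier_mat (k * n) (k * n)" "adj (GG n A X) = GG n A X"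
  using psd_sqrt[OF assms(1)] plin_herm[OF T'_mats T'_herm assms(2)]
  by (auto simp: GG_def W_dim mm_assoc intro!: carrier_matI)

lemma GG_convex:
  assumes "X \<in> herm_tuples n g" "Y \<in> herm_tuples n g" "psd (W n A)" "0 \<le> t" "t \<le> 1"
    and pd: "pd (GG n A X)" "pd (GG n A Y)"
  shows "pd (GG n A (tuple_comb (1 - t) t X Y))"
proof (rule pdI)
  note c = GG_carrier[OF assms(3)]
  show "GG n A (tuple_comb (1 - t) t X Y) \<in> carrier_mat (k * n) (k * n)"
    "adj (GG n A (tuple_comb (1 - t) t X Y)) = GG n A (tuple_comb (1 - t) t X Y)"
    using c[OF tuple_comb_herm[OF assms(1,2)]] by auto
  fix x :: "complex mat" assume x: "x \<in> carrier_mat (k * n) 1" "x \<noteq> 0\<^sub>m (k * n) 1"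
  have X: "X \<in> mats n n g" "Y \<in> mats n n g" using assms by (auto simp: herm_tuples_iff)
  have p: "0 < qf (GG n A X) x" "0 < qf (GG n A Y) x"
    using pdD(3)[OF pd(1), of x] pdD(3)[OF pd(2), of x] x carrier_matD[OF c(1)[OF assms(1)]] carrier_matD[OF c(1)[OF assms(2)]]
    by auto
  have "qf (GG n A (tuple_comb (1 - t) t X Y)) x = (1 - t) * qf (GG n A X) x + t * qf (GG n A Y) x"
    unfolding GG_comb[OF X assms(3)] using c(1)[OF assms(1)] c(1)[OF assms(2)] x(1)
    by (subst qf_add[of _ "k * n"]) (auto simp: qf_smult[of _ "k * n"] simp del: of_real_diff)
  also have "\<dots> > 0"
  proof (cases "t = 0")
    case False
    then show ?thesis using p assms(4,5) by (intro add_nonneg_pos mult_nonneg_nonneg mult_pos_pos) auto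
  qed (use p in simp)
  finally show "0 < qf (GG n A (tuple_comb (1 - t) t X Y)) x" .
qed

text \<open>\<open>GG n A Y\<close> differs from \<open>GG n A X\<close> by a sandwich of
  \<open>E = T'(Y) - T'(X)\<close> between square roots. The form of this sandwich at
  \<open>x\<close> is at most \<open>\<epsilon> C D\<close> times the squared length of
  \<open>x\<close>, against the lower bound \<open>c\<close> for \<open>GG n A X\<close>.\<close>

lemma GG_open:
  assumes X: "X \<in> herm_tuples n g" and W: "psd (W n A)" and pd: "pd (GG n A X)"
  shows "\<exists>\<epsilon>>0. \<forall>Y \<in> herm_tuples n g. tuple_close n \<epsilon> X Y \<longrightarrow> pd (GG n A Y)"
proof -
  let ?N = "k * n"
  note cX = GG_carrier[OF W X]
  note s = psd_sqrt[OF W]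
  let ?s = "psd_sqrt (W n A)"
  have sd: "dim_row ?s = ?N" "dim_col ?s = ?N" using s by (auto simp: W_dim)
  obtain c where c: "c > 0" "\<And>x. x \<in> carrier_mat ?N 1 \<Longrightarrow> c * qf (1\<^sub>m ?N) x \<le> qf (GG n A X) x"
    using pd_lower_bound[OF pd] carrier_matD[OF cX(1)] by auto
  define C where "C = (\<Sum>p<?N. \<Sum>q<?N. \<Sum>i<g. cmod ((T' ! i) $$ (p div n, q div n)))"
  define D where "D = (\<Sum>p<?N. \<Sum>q<?N. cmod (W n A $$ (p, q)))"
  have CD: "0 \<le> C" "0 \<le> D" unfolding C_def D_def by (auto intro!: sum_nonneg)
  \<comment> \<open>\<open>C\<close> collects the coefficients and \<open>D\<close> the entries of
    \<open>W n A\<close>, which enters because the squared length of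
    \<open>psd_sqrt (W n A) * x\<close> is its form at \<open>x\<close>. The summand 1 avoids
    division by zero.\<close>
  define \<epsilon> where "\<epsilon> = c / (C * D + 1)"
  have CD1: "0 < C * D + 1" using CD by (simp add: add_nonneg_pos)
  have \<epsilon>: "0 < \<epsilon>" "\<epsilon> * (C * D) < c"
  proof -
    show "0 < \<epsilon>" using c CD1 by (simp add: \<epsilon>_def)
    have "c * (C * D) < c * (C * D + 1)" using c by simp
    then show "\<epsilon> * (C * D) < c" using CD1 by (simp add: \<epsilon>_def divide_less_eq)
  qed
  have "pd (GG n A Y)" if Y: "Y \<in> herm_tuples n g" and cl: "tuple_close n \<epsilon> X Y" for Y
  proof (rule pdI)
    note cY = GG_carrier[OF W Y]
    show "GG n A Y \<in> carrier_mat ?N ?N" "adj (GG n A Y) = GG n A Y" using cY by auto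
    fix x :: "complex mat" assume x: "x \<in> carrier_mat ?N 1" "x \<noteq> 0\<^sub>m ?N 1"
    note xd = carrier_matD[OF x(1)]
    have XY: "X \<in> mats n n g" "Y \<in> mats n n g" using X Y by (auto simp: herm_tuples_iff)
    define E where "E = tl' n Y - tl' n X"
    have E: "E \<in> carrier_mat ?N ?N" unfolding E_def by (rule carrier_matI) auto
    define y where "y = ?s * x"
    have y: "y \<in> carrier_mat ?N 1" using sd xd by (auto simp: y_def)
    have entry: "cmod (E $$ (p, q)) \<le> \<epsilon> * (\<Sum>i<g. cmod ((T' ! i) $$ (p div n, q div n)))" if pq: "p < ?N" "q < ?N" for p q
    proof -
      have "n > 0" using pq by (cases n) auto
      then have md: "p mod n < n" "q mod n < n" by auto
      have eq: "E $$ (p, q) = (\<Sum>i<g. (T' ! i) $$ (p div n, q div n) * ((Y ! i) $$ (p mod n, q mod n) - (X ! i) $$ (p mod n, q mod n)))"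
        using pq by (simp add: E_def plin_index[OF T'_mats XY(1)] plin_index[OF T'_mats XY(2)] sum_subtractf right_diff_distrib)
      have "cmod (E $$ (p, q)) \<le> (\<Sum>i<g. cmod ((T' ! i) $$ (p div n, q div n)) * \<epsilon>)"
        unfolding eq
      proof (intro order.trans[OF norm_sum] sum_mono)
        fix i assume "i \<in> {..<g}"
        then have "cmod ((X ! i) $$ (p mod n, q mod n) - (Y ! i) $$ (p mod n, q mod n)) < \<epsilon>"
          using cl md matsD(1)[OF XY(1)] by (auto simp: tuple_close_def)
        then have "cmod ((Y ! i) $$ (p mod n, q mod n) - (X ! i) $$ (p mod n, q mod n)) \<le> \<epsilon>"
          by (simp add: norm_minus_commute)
        then show "cmod ((T' ! i) $$ (p div n, q div n) * ((Y ! i) $$ (p mod n, q mod n) - (X ! i) $$ (p mod n, q mod n)))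
            \<le> cmod ((T' ! i) $$ (p div n, q div n)) * \<epsilon>"
          unfolding norm_mult by (intro mult_left_mono) auto
      qed
      also have "\<dots> = (\<Sum>i<g. cmod ((T' ! i) $$ (p div n, q div n))) * \<epsilon>"
        by (rule sum_distrib_right[symmetric])
      also have "\<dots> = \<epsilon> * (\<Sum>i<g. cmod ((T' ! i) $$ (p div n, q div n)))"
        by (rule mult.commute)
      finally show ?thesis .
    qed
    have "(\<Sum>p<?N. \<Sum>q<?N. cmod (E $$ (p, q))) \<le> \<epsilon> * C"
      unfolding C_def sum_distrib_left by (intro sum_mono order.trans[OF entry]) (auto simp: sum_distrib_left)
    then have "\<bar>qf E y\<bar> \<le> (\<epsilon> * C) * qf (1\<^sub>m ?N) y"
      using qf_entry_bound[OF E y] mult_right_mono[OF _ qf_one_nonneg[OF y]] by fastforce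
    also have "qf (1\<^sub>m ?N) y = qf (W n A) x"
    proof -
      have "adj y * y = adj x * ((?s * ?s) * x)" using sd xd s(5) by (simp add: y_def mm_assoc)
      then have "adj y * y = adj x * (W n A * x)" using s(2) by simp
      then show ?thesis using carrier_matD[OF y] by (simp add: qf_def mm_one_left)
    qed
    also have "(\<epsilon> * C) * qf (W n A) x \<le> (\<epsilon> * C) * (D * qf (1\<^sub>m ?N) x)"
    proof (rule mult_left_mono)
      have "W n A \<in> carrier_mat ?N ?N" using W_dim by auto
      from qf_entry_bound[OF this x(1)] show "qf (W n A) x \<le> D * qf (1\<^sub>m ?N) x" by (simp add: D_def)
    qed (use \<epsilon> CD in auto)
    finally have bE: "\<bar>qf E y\<bar> \<le> (\<epsilon> * (C * D)) * qf (1\<^sub>m ?N) x" by (simp add: mult_ac)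
    have "qf (GG n A Y) x = qf (GG n A X) x - qf E y"
      using sd xd s(5) by (simp add: qf_def GG_def E_def y_def mat_ring del: index_mult_mat(1))
    moreover have "0 < qf (1\<^sub>m ?N) x" using pdD(3)[OF pd_one, of x] x by auto
    then have "(\<epsilon> * (C * D)) * qf (1\<^sub>m ?N) x < c * qf (1\<^sub>m ?N) x" using \<epsilon> by (intro mult_strict_right_mono)
    ultimately show "0 < qf (GG n A Y) x" using bE c(2)[OF x(1)] by linarith
  qed
  then show ?thesis using \<epsilon> by blast
qed

section \<open>Values and convexity of the realization on a slice\<close>

definition cn :: "nat \<Rightarrow> complex mat" where "cn n = kron (colmat (rc R)) (1\<^sub>m n)"
text \<open>The part of \<open>l\<close> that depends on \<open>a\<close> alone: the value of
  \<open>l\<close> at \<open>(A, X)\<close> will be \<open>tl' n X * bn n A\<close>.\<close>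

definition bn :: "nat \<Rightarrow> complex mat list \<Rightarrow> complex mat" where
  "bn n A = adj (Qn n) * (minv (P n A) * cn n)"

lemma cn_dim: "dim_row (cn n) = e * n" "dim_col (cn n) = n"
  using basic(8) by (auto simp: cn_def)

lemma bn_dim: "dim_row (bn n A) = k * n" "dim_col (bn n A) = n"
  using cn_dim Qd by (auto simp: bn_def)

lemma realization_eval_alt:
  assumes "det (pen n A X) \<noteq> 0"
  shows "realization_eval R n A X = adj (cn n) * (minv (pen n A X) * cn n)"
  unfolding realization_eval_def using basic(8) assms
  by (subst compressed_alt) (auto simp: mat_of_cols_colmat cn_def)

lemma det_pen_of_pd:
  assumes "A \<in> herm_tuples n h" "X \<in> herm_tuples n g" "det (P n A) \<noteq> 0" "psd (W n A)" "pd (GG n A X)"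
  shows "det (pen n A X) \<noteq> 0"
  using good_iff[OF assms(1-4)] assms(5) by (simp add: good_def)

text \<open>The first two summands are the value of \<open>f\<close>; in the last one
  \<open>tl' n X * bn n A\<close> plays the role of \<open>l\<close>.\<close>

lemma realization_eval_expansion:
  assumes "A \<in> herm_tuples n h" "X \<in> herm_tuples n g" "det (P n A) \<noteq> 0" "psd (W n A)" "pd (GG n A X)"
  shows "realization_eval R n A X = adj (cn n) * (minv (P n A) * cn n) + adj (bn n A) * (tl' n X * bn n A) +
    adj (tl' n X * bn n A) * (psd_sqrt (W n A) * (minv (GG n A X) * (psd_sqrt (W n A) * (tl' n X * bn n A))))"
proof -
  note p = pert[OF assms(1-3)]
  note s = sqrt_facts[OF assms(1,3,4)]
  note G = pert_G[OF assms(1-4)]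
  note dG = pd_det[OF assms(5)]
  have ex: "minv (pen n A X) = minv (P n A) + minv (P n A) * (Qn n * (tl' n X * (adj (Qn n) * minv (P n A))))
     + minv (P n A) * (Qn n * (tl' n X * (psd_sqrt (W n A) * (minv (GG n A X) * (psd_sqrt (W n A) * (tl' n X * (adj (Qn n) * minv (P n A))))))))"
    using perturbation.minv_L_expansion[OF p(1) s, unfolded G p(2), OF dG] .
  note d = carrier_matD[OF minv_props(1)[OF pen_carrier assms(3)]] Qd cn_dim s(3,4)
    carrier_matD[OF minv_props(1)[OF GG_carrier(1)[OF assms(4,2)] dG]]
  have ap: "adj (minv (P n A)) = minv (P n A)" using perturbation.PP(3)[OF p(1)] .
  have at: "adj (tl' n X) = tl' n X" by (rule plin_herm[OF T'_mats T'_herm assms(2)])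
  show ?thesis
    unfolding realization_eval_alt[OF det_pen_of_pd[OF assms]] ex bn_def
    using d by (simp add: mat_ring ap at del: adj_kron)
qed

text \<open>The affine part of the expansion contributes equality at midpoints. In the rest, both
  the vector \<open>y\<close> and \<open>GG\<close> are affine in \<open>X\<close>, so the joint
  convexity behind \<open>qf_minv_lower\<close> applies.\<close>

lemma realization_eval_convex:
  assumes A: "A \<in> herm_tuples n h" and X: "X \<in> herm_tuples n g" and Y: "Y \<in> herm_tuples n g"
    and P: "det (P n A) \<noteq> 0" and W: "psd (W n A)"
    and pd: "pd (GG n A X)" "pd (GG n A Y)" "pd (GG n A (tuple_comb (1/2) (1/2) X Y))"
  shows "loewner_le (realization_eval R n A (tuple_comb (1/2) (1/2) X Y))
          ((1/2) \<cdot>\<^sub>m (realization_eval R n A X + realization_eval R n A Y))"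
proof -
  let ?M = "tuple_comb (1/2) (1/2) X Y"
  let ?s = "psd_sqrt (W n A)" let ?N = "k * n"
  have M: "?M \<in> herm_tuples n g" by (rule tuple_comb_herm[OF X Y])
  have XY: "X \<in> mats n n g" "Y \<in> mats n n g" using X Y by (auto simp: herm_tuples_iff)
  note s = psd_sqrt[OF W]
  have sd: "dim_row ?s = ?N" "dim_col ?s = ?N" using s by (auto simp: W_dim)
  have re_dim: "dim_row (realization_eval R n A Z) = n" "dim_col (realization_eval R n A Z) = n"
    if "det (pen n A Z) \<noteq> 0" for Z
    using cn_dim by (auto simp: realization_eval_alt[OF that])
  have re_herm: "adj (realization_eval R n A Z) = realization_eval R n A Z"
    if "det (pen n A Z) \<noteq> 0" "Z \<in> herm_tuples n g" for Z
    using cn_dim carrier_matD[OF minv_props(1)[OF pen_carrier that(1)]]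
      hermitian_minv[OF pen_carrier that(1) pen_herm[OF A that(2)]]
    by (auto simp: realization_eval_alt[OF that(1)] mm_assoc)
  note dX = det_pen_of_pd[OF A X P W pd(1)] and dY = det_pen_of_pd[OF A Y P W pd(2)] and dM = det_pen_of_pd[OF A M P W pd(3)]
  define q where "q Z v = qf (adj (cn n) * (minv (P n A) * cn n)) v + qf (tl' n Z) (bn n A * v)" for Z v
  define y where "y Z v = ?s * (tl' n Z * (bn n A * v))" for Z v
  have Pd: "dim_row (minv (P n A)) = e * n" "dim_col (minv (P n A)) = e * n"
    using carrier_matD[OF minv_props(1)[OF pen_carrier P]] by auto
  have yc: "y Z v \<in> carrier_mat ?N 1" if "v \<in> carrier_mat n 1" for Z v
    using that sd by (intro carrier_matI) (auto simp: y_def)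
  have re: "qf (realization_eval R n A Z) v = q Z v + qf (minv (GG n A Z)) (y Z v)"
    if Z: "Z \<in> herm_tuples n g" "pd (GG n A Z)" and v: "v \<in> carrier_mat n 1" for Z v
  proof -
    note d = carrier_matD[OF minv_props(1)[OF GG_carrier(1)[OF W Z(1)] pd_det[OF Z(2)]]]
      sd bn_dim cn_dim Pd carrier_matD[OF v]
    have at: "adj (tl' n Z) = tl' n Z" by (rule plin_herm[OF T'_mats T'_herm Z(1)])
    show ?thesis
      unfolding realization_eval_expansion[OF A Z(1) P W Z(2)] q_def y_def qf_def
      using d by (simp add: mat_ring s(5) at del: index_mult_mat(1))
  qed
  have psd: "psd ((1/2) \<cdot>\<^sub>m (realization_eval R n A X + realization_eval R n A Y) - realization_eval R n A ?M)"
  proof (rule psdI[of _ n])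
    fix v :: "complex mat" assume v: "v \<in> carrier_mat n 1"
    note vd = carrier_matD[OF v]
    \<comment> \<open>The maximiser at the midpoint: for it equality holds there, while at
      \<open>X\<close> and \<open>Y\<close> it gives lower bounds, which is the direction that
      convexity asks for.\<close>
    define u where "u = minv (GG n A ?M) * y ?M v"
    have u: "u \<in> carrier_mat ?N 1"
      using carrier_matD[OF minv_props(1)[OF GG_carrier(1)[OF W M] pd_det[OF pd(3)]]] carrier_matD[OF yc[OF v, of ?M]]
      by (auto simp: u_def intro!: carrier_matI)
    have tM: "tl' n ?M = complex_of_real (1/2) \<cdot>\<^sub>m tl' n X + complex_of_real (1/2) \<cdot>\<^sub>m tl' n Y"
      by (rule plin_tuple_comb[OF T'_mats XY])
    have yM: "y ?M v = complex_of_real (1/2) \<cdot>\<^sub>m y X v + complex_of_real (1/2) \<cdot>\<^sub>m y Y v"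
      unfolding y_def tM using sd vd bn_dim by (simp add: mat_ring)
    have GM: "GG n A ?M = complex_of_real (1/2) \<cdot>\<^sub>m GG n A X + complex_of_real (1/2) \<cdot>\<^sub>m GG n A Y"
      using GG_comb[OF XY W, of "1/2"] by simp
    have gd: "dim_row (GG n A Z) = ?N" if "Z \<in> herm_tuples n g" for Z
      using GG_carrier(1)[OF W that] by auto
    have qM: "q ?M v = (q X v + q Y v) / 2"
      unfolding q_def tM using vd bn_dim by (simp add: qf_def mat_ring del: index_mult_mat(1))
    have "qf (minv (GG n A ?M)) (y ?M v) = 2 * Re ((adj u * y ?M v) $$ (0, 0)) - qf (GG n A ?M) u"
      by (rule qf_minv_lower(2)[symmetric]) (use yc[OF v] u pd M gd u_def in auto)
    also have "\<dots> = ((2 * Re ((adj u * y X v) $$ (0, 0)) - qf (GG n A X) u) +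
        (2 * Re ((adj u * y Y v) $$ (0, 0)) - qf (GG n A Y) u)) / 2"
      unfolding yM GM qf_def
      using carrier_matD[OF u] carrier_matD[OF yc[OF v, of X]] carrier_matD[OF yc[OF v, of Y]]
        carrier_matD[OF GG_carrier(1)[OF W X]] carrier_matD[OF GG_carrier(1)[OF W Y]]
      by (simp add: mat_ring del: index_mult_mat(1))
    also have "\<dots> \<le> (qf (minv (GG n A X)) (y X v) + qf (minv (GG n A Y)) (y Y v)) / 2"
      by (intro divide_right_mono add_mono qf_minv_lower(1)) (use yc[OF v] u pd X Y gd in auto)
    finally have "qf (realization_eval R n A ?M) v \<le>
        (qf (realization_eval R n A X) v + qf (realization_eval R n A Y) v) / 2"
      unfolding re[OF X pd(1) v] re[OF Y pd(2) v] re[OF M pd(3) v] qM by argo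
    then show "0 \<le> qf ((1/2) \<cdot>\<^sub>m (realization_eval R n A X + realization_eval R n A Y) - realization_eval R n A ?M) v"
      using re_dim[OF dX] re_dim[OF dY] re_dim[OF dM] vd
      by (simp add: qf_def mat_ring del: index_mult_mat(1))
  qed (use re_dim[OF dX] re_dim[OF dY] re_dim[OF dM] re_herm[OF dX X] re_herm[OF dY Y] re_herm[OF dM M] in \<open>auto intro!: carrier_matI\<close>)
  then show ?thesis by (simp add: loewner_le_def)
qed

lemma dom_ver_plus_V_iff:
  assumes "V = V_T R"
  shows "(A, X) \<in> dom_ver_plus h g R n \<longleftrightarrow> A \<in> herm_tuples n h \<and> X \<in> herm_tuples n g \<and>
     det (P n A) \<noteq> 0 \<and> psd (W n A) \<and> pd (GG n A X)"
  unfolding dom_ver_plus_iff assms[symmetric] good_zero_iff using good_iff by blast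

lemma vertebral_domain_dom_ver_plus:
  assumes V: "V = V_T R"
  shows "vertebral_domain_of_convexity h g R (dom_ver_plus h g R)"
proof -
  note iff = dom_ver_plus_V_iff[OF V]
  have 1: "free_set h g (dom_ver_plus h g R)" using free_dom_ver_plus Qd V by simp
  have 2: "vertebral g (dom_ver_plus h g R)"
    using zero_tuple_herm by (auto simp: vertebral_def dom_ver_plus_iff)
  have 3: "open_in_x h g (dom_ver_plus h g R)"
    unfolding open_in_x_def slice_def mem_Collect_eq iff using GG_open by blast
  have 4: "convex_in_x h (dom_ver_plus h g R)"
    unfolding convex_in_x_def slice_def mem_Collect_eq iff using GG_convex tuple_comb_herm by blast
  have 5: "convex_in_x_on h g R (dom_ver_plus h g R)"
    unfolding convex_in_x_on_def
  proof (intro conjI allI impI, goal_cases)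
    case 1
    then show ?case
      by (auto simp: nc_subset_def dom_ver_plus_iff dom_r_def nc_space_def good_def)
  next
    case (2 n A X Y)
    then show ?case unfolding iff using realization_eval_convex by blast
  qed
  show ?thesis using 1 2 3 4 5 by (simp add: vertebral_domain_of_convexity_def)
qed

end

section \<open>Matrices of noncommutative rational expressions\<close>

lemma nc_eval_carrier:
  assumes "\<And>v. v \<in> V \<Longrightarrow> \<rho> v \<in> carrier_mat n n"
  shows "set_nc_expr p \<subseteq> V \<Longrightarrow> nc_eval n \<rho> p = Some M \<Longrightarrow> M \<in> carrier_mat n n"
proof (induction p arbitrary: M)
  case (Inv p)
  then obtain N where N: "nc_eval n \<rho> p = Some N" "mat_inverse N = Some M" by (auto simp: bind_eq_Some_conv)
  then show ?case using mat_inverse(2)[OF Inv.IH[OF _ N(1)]] Inv.prems by auto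
qed (use assms in \<open>auto simp: bind_eq_Some_conv\<close>)

definition esum :: "'v nc_expr list \<Rightarrow> 'v nc_expr" where
  "esum ps = foldr Add ps (Scal 0)"

lemma esum_set: "set_nc_expr (esum ps) = (\<Union>p\<in>set ps. set_nc_expr p)"
  by (induction ps) (auto simp: esum_def)

lemma esum_eval_defined: "nc_eval n \<rho> (esum ps) \<noteq> None \<longleftrightarrow> (\<forall>p\<in>set ps. nc_eval n \<rho> p \<noteq> None)"
  by (induction ps) (auto simp: esum_def bind_eq_None_conv simp del: not_None_eq)

lemma esum_eval:
  assumes "\<And>v. v \<in> V \<Longrightarrow> \<rho> v \<in> carrier_mat n n"
    and "\<And>p. p \<in> set ps \<Longrightarrow> set_nc_expr p \<subseteq> V \<and> nc_eval n \<rho> p \<noteq> None"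
    and "i < n" "j < n"
  shows "the (nc_eval n \<rho> (esum ps)) $$ (i, j) = (\<Sum>p\<leftarrow>ps. the (nc_eval n \<rho> p) $$ (i, j))"
  using assms(2)
proof (induction ps)
  case (Cons p ps)
  obtain M where M: "nc_eval n \<rho> p = Some M" using Cons.prems[of p] by auto
  obtain N where N: "nc_eval n \<rho> (esum ps) = Some N" using Cons.prems esum_eval_defined[of n \<rho> ps] by force
  have "M \<in> carrier_mat n n" by (rule nc_eval_carrier[OF assms(1) _ M]) (use Cons.prems in auto)
  moreover have "N \<in> carrier_mat n n" by (rule nc_eval_carrier[OF assms(1) _ N]) (use Cons.prems in \<open>auto simp: esum_set\<close>)
  ultimately show ?case using M N Cons assms(3,4) by (auto simp: esum_def)
qed (use assms in \<open>auto simp: esum_def\<close>)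

abbreviation "ev \<equiv> nc_mat_eval"
abbreviation "df \<equiv> nc_mat_defined"

lemma ev_dim [simp]: "dim_row (ev n \<rho> W) = dim_row W * n" "dim_col (ev n \<rho> W) = dim_col W * n"
  by (auto simp: nc_mat_eval_def)

lemma ev_index:
  "p < dim_row W * n \<Longrightarrow> q < dim_col W * n \<Longrightarrow>
    ev n \<rho> W $$ (p, q) = the (nc_eval n \<rho> (W $$ (p div n, q div n))) $$ (p mod n, q mod n)"
  by (auto simp: nc_mat_eval_def)

lemma over_iff: "nc_mat_over V k l W \<longleftrightarrow> dim_row W = k \<and> dim_col W = l \<and>
    (\<forall>i<k. \<forall>j<l. set_nc_expr (W $$ (i, j)) \<subseteq> V)"
  unfolding nc_mat_over_def elements_mat_def by fastforce

definition emul :: "'v nc_expr mat \<Rightarrow> 'v nc_expr mat \<Rightarrow> 'v nc_expr mat" where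
  "emul A B = mat (dim_row A) (dim_col B)
     (\<lambda>(i, j). esum (map (\<lambda>k. Mul (A $$ (i, k)) (B $$ (k, j))) [0..<dim_row B]))"
definition eadd :: "'v nc_expr mat \<Rightarrow> 'v nc_expr mat \<Rightarrow> 'v nc_expr mat" where
  "eadd A B = mat (dim_row A) (dim_col A) (\<lambda>ij. Add (A $$ ij) (B $$ ij))"
definition eneg :: "'v nc_expr mat \<Rightarrow> 'v nc_expr mat" where
  "eneg A = mat (dim_row A) (dim_col A) (\<lambda>ij. Mul (Scal (-1)) (A $$ ij))"
definition econst :: "complex mat \<Rightarrow> 'v nc_expr mat" where
  "econst M = mat (dim_row M) (dim_col M) (\<lambda>ij. Scal (M $$ ij))"
definition elin :: "nat \<Rightarrow> (nat \<Rightarrow> 'v) \<Rightarrow> complex mat list \<Rightarrow> 'v nc_expr mat" where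
  "elin e va T = mat e e (\<lambda>(i, j). esum (map (\<lambda>l. Mul (Scal (T ! l $$ (i, j))) (Var (va l))) [0..<length T]))"

lemma e_dim [simp]:
  "dim_row (emul A B) = dim_row A" "dim_col (emul A B) = dim_col B"
  "dim_row (eadd A B) = dim_row A" "dim_col (eadd A B) = dim_col A"
  "dim_row (eneg A) = dim_row A" "dim_col (eneg A) = dim_col A"
  "dim_row (econst M) = dim_row M" "dim_col (econst M) = dim_col M"
  "dim_row (elin e va T) = e" "dim_col (elin e va T) = e"
  by (auto simp: emul_def eadd_def eneg_def econst_def elin_def)

lemma over_emul:
  assumes "nc_mat_over V a b A" "nc_mat_over V b c B"
  shows "nc_mat_over V a c (emul A B)"
  using assms by (auto simp: over_iff emul_def esum_set) blast+

lemma over_eadd: "nc_mat_over V a b A \<Longrightarrow> nc_mat_over V a b B \<Longrightarrow> nc_mat_over V a b (eadd A B)"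
  by (auto simp: over_iff eadd_def)

lemma over_eneg: "nc_mat_over V a b A \<Longrightarrow> nc_mat_over V a b (eneg A)"
  by (auto simp: over_iff eneg_def)

lemma over_econst: "M \<in> carrier_mat a b \<Longrightarrow> nc_mat_over V a b (econst M)"
  by (auto simp: over_iff econst_def)

lemma over_elin: "(\<And>l. l < length T \<Longrightarrow> va l \<in> V) \<Longrightarrow> nc_mat_over V e e (elin e va T)"
  by (auto simp: over_iff elin_def esum_set)

text \<open>The converse has to look at an entry of the product: with no rows or no columns the
  product is defined vacuously, whatever its factors are.\<close>

lemma df_emul:
  assumes "dim_col A = dim_row B"
  shows "df n \<rho> A \<Longrightarrow> df n \<rho> B \<Longrightarrow> df n \<rho> (emul A B)"
    and "df n \<rho> (emul A B) \<Longrightarrow> 0 < dim_row A \<Longrightarrow> 0 < dim_col B \<Longrightarrow> df n \<rho> A \<and> df n \<rho> B"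
proof -
  have e: "nc_eval n \<rho> (emul A B $$ (i, j)) \<noteq> None \<longleftrightarrow>
      (\<forall>k<dim_row B. nc_eval n \<rho> (A $$ (i, k)) \<noteq> None \<and> nc_eval n \<rho> (B $$ (k, j)) \<noteq> None)"
    if "i < dim_row A" "j < dim_col B" for i j
  proof -
    have "nc_eval n \<rho> (emul A B $$ (i, j)) \<noteq> None \<longleftrightarrow>
        (\<forall>p\<in>set (map (\<lambda>k. Mul (A $$ (i, k)) (B $$ (k, j))) [0..<dim_row B]). nc_eval n \<rho> p \<noteq> None)"
      using that by (simp add: emul_def esum_eval_defined del: not_None_eq)
    also have "\<dots> \<longleftrightarrow> (\<forall>k<dim_row B. nc_eval n \<rho> (Mul (A $$ (i, k)) (B $$ (k, j))) \<noteq> None)"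
      by (auto simp: atLeast0LessThan simp del: not_None_eq nc_eval.simps)
    finally show ?thesis by (simp add: bind_eq_None_conv del: not_None_eq)
  qed
  show "df n \<rho> (emul A B)" if "df n \<rho> A" "df n \<rho> B"
    using that assms by (simp add: nc_mat_defined_def e del: not_None_eq)
  show "df n \<rho> A \<and> df n \<rho> B" if L: "df n \<rho> (emul A B)" and pos: "0 < dim_row A" "0 < dim_col B"
  proof -
    have E: "nc_eval n \<rho> (A $$ (i, k)) \<noteq> None \<and> nc_eval n \<rho> (B $$ (k, j)) \<noteq> None"
      if ijk: "i < dim_row A" "j < dim_col B" "k < dim_row B" for i j k
    proof -
      have "nc_eval n \<rho> (emul A B $$ (i, j)) \<noteq> None"
        using L ijk(1,2) by (simp add: nc_mat_defined_def del: not_None_eq)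
      then show ?thesis using e[OF ijk(1,2)] ijk(3) by blast
    qed
    have "nc_eval n \<rho> (A $$ (i, k)) \<noteq> None" if "i < dim_row A" "k < dim_col A" for i k
      using E[of i 0 k] that pos assms by simp
    moreover have "nc_eval n \<rho> (B $$ (k, j)) \<noteq> None" if "k < dim_row B" "j < dim_col B" for j k
      using E[of 0 j k] that pos by simp
    ultimately show ?thesis by (simp add: nc_mat_defined_def del: not_None_eq)
  qed
qed

lemma df_eadd:
  assumes "dim_row A = dim_row B" "dim_col A = dim_col B"
  shows "df n \<rho> (eadd A B) \<longleftrightarrow> df n \<rho> A \<and> df n \<rho> B"
  using assms by (auto simp: nc_mat_defined_def eadd_def bind_eq_None_conv)

lemma df_eneg: "df n \<rho> (eneg A) \<longleftrightarrow> df n \<rho> A"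
  by (auto simp: nc_mat_defined_def eneg_def bind_eq_None_conv)

lemma df_econst: "df n \<rho> (econst M)"
  by (auto simp: nc_mat_defined_def econst_def)

lemma df_elin: "df n \<rho> (elin e va T)"
  by (auto simp: nc_mat_defined_def elin_def esum_eval_defined bind_eq_None_conv simp del: not_None_eq)

lemma ev_econst: "ev n \<rho> (econst M) = kron M (1\<^sub>m n)"
  by (rule eq_matI) (auto simp: ev_index econst_def div_lt_of_lt_mult mod_lt_of_lt_mult)

lemma ev_four_block:
  assumes "dim_row A = a" "dim_col A = b" "dim_row B = a" "dim_col B = d" "dim_row C = c" "dim_col C = b"
    "dim_row D = c" "dim_col D = d"
  shows "ev n \<rho> (four_block_mat A B C D) = four_block_mat (ev n \<rho> A) (ev n \<rho> B) (ev n \<rho> C) (ev n \<rho> D)"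
proof (rule eq_matI)
  fix p q assume "p < dim_row (four_block_mat (ev n \<rho> A) (ev n \<rho> B) (ev n \<rho> C) (ev n \<rho> D))"
    "q < dim_col (four_block_mat (ev n \<rho> A) (ev n \<rho> B) (ev n \<rho> C) (ev n \<rho> D))"
  then have pq: "p < (a + c) * n" "q < (b + d) * n" using assms by (auto simp: algebra_simps)
  have n: "n > 0" using pq by (cases n) auto
  note dm = pq[THEN div_lt_of_lt_mult] pq[THEN mod_lt_of_lt_mult]
  have lt: "p div n < a \<longleftrightarrow> p < a * n" "q div n < b \<longleftrightarrow> q < b * n"
    using n by (simp_all add: div_less_iff_less_mult)
  have sh: "(x - y * n) div n = x div n - y" "(x - y * n) mod n = x mod n" if "\<not> x < y * n" for x y
  proof -
    define z where "z = x - y * n"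
    have x: "x = y * n + z" using that by (simp add: z_def)
    show "(x - y * n) div n = x div n - y" "(x - y * n) mod n = x mod n"
      using n by (simp_all add: x)
  qed
  have bd: "x - y * n < z * n" if "\<not> x < y * n" "x < (y + z) * n" for x y z
    using that by (simp add: algebra_simps)
  have pq': "p < a * n + c * n" "q < b * n + d * n" using pq by (simp_all add: algebra_simps)
  show "ev n \<rho> (four_block_mat A B C D) $$ (p, q) =
      four_block_mat (ev n \<rho> A) (ev n \<rho> B) (ev n \<rho> C) (ev n \<rho> D) $$ (p, q)"
    using pq pq' dm lt sh bd assms by (cases "p < a * n"; cases "q < b * n") (simp_all add: ev_index)
qed (use assms in \<open>auto simp: algebra_simps\<close>)

context
  fixes V :: "'v set" and \<rho> :: "'v \<Rightarrow> complex mat" and n :: nat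
  assumes env: "\<And>v. v \<in> V \<Longrightarrow> \<rho> v \<in> carrier_mat n n"
begin

lemma entry_carrier:
  assumes "nc_mat_over V a b A" "df n \<rho> A" "i < a" "j < b"
  obtains M where "nc_eval n \<rho> (A $$ (i, j)) = Some M" "M \<in> carrier_mat n n"
  using assms nc_eval_carrier[OF env, where p = "A $$ (i, j)"] by (force simp: over_iff nc_mat_defined_def)

lemma ev_emul:
  assumes A: "nc_mat_over V a b A" and B: "nc_mat_over V b c B" and d: "df n \<rho> A" "df n \<rho> B"
  shows "ev n \<rho> (emul A B) = ev n \<rho> A * ev n \<rho> B"
proof (rule eq_matI)
  have dd: "dim_row A = a" "dim_col A = b" "dim_row B = b" "dim_col B = c" using A B by (auto simp: over_iff)
  fix p q assume "p < dim_row (ev n \<rho> A * ev n \<rho> B)" "q < dim_col (ev n \<rho> A * ev n \<rho> B)"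
  then have pq: "p < a * n" "q < c * n" using dd by auto
  note dm = pq[THEN div_lt_of_lt_mult] pq[THEN mod_lt_of_lt_mult]
  let ?A = "\<lambda>k. the (nc_eval n \<rho> (A $$ (p div n, k)))" let ?B = "\<lambda>k. the (nc_eval n \<rho> (B $$ (k, q div n)))"
  have ms: "the (nc_eval n \<rho> (Mul (A $$ (p div n, k)) (B $$ (k, q div n)))) $$ (p mod n, q mod n)
      = (\<Sum>l<n. ?A k $$ (p mod n, l) * ?B k $$ (l, q mod n))" if k: "k < b" for k
  proof -
    obtain M where M: "nc_eval n \<rho> (A $$ (p div n, k)) = Some M" "M \<in> carrier_mat n n"
      using entry_carrier[OF A d(1) dm(1) k] .
    obtain N where N: "nc_eval n \<rho> (B $$ (k, q div n)) = Some N" "N \<in> carrier_mat n n"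
      using entry_carrier[OF B d(2) k dm(2)] .
    show ?thesis using M N dm by (simp add: times_mat_index del: index_mult_mat(1))
  qed
  have "ev n \<rho> (emul A B) $$ (p, q) =
      the (nc_eval n \<rho> (esum (map (\<lambda>k. Mul (A $$ (p div n, k)) (B $$ (k, q div n))) [0..<b]))) $$ (p mod n, q mod n)"
    using pq dd dm by (simp add: ev_index emul_def)
  also have "\<dots> = (\<Sum>k<b. the (nc_eval n \<rho> (Mul (A $$ (p div n, k)) (B $$ (k, q div n)))) $$ (p mod n, q mod n))"
  proof (subst esum_eval[OF env])
    fix x assume "x \<in> set (map (\<lambda>k. Mul (A $$ (p div n, k)) (B $$ (k, q div n))) [0..<b])"
    then obtain k where k: "k < b" "x = Mul (A $$ (p div n, k)) (B $$ (k, q div n))" by auto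
    show "set_nc_expr x \<subseteq> V \<and> nc_eval n \<rho> x \<noteq> None"
      using k dm A B d dd by (auto simp: over_iff nc_mat_defined_def bind_eq_None_conv)
  qed (use dm in \<open>auto simp: interv_sum_list_conv_sum_set_nat lessThan_atLeast0 comp_def\<close>)
  also have "\<dots> = (\<Sum>k<b. \<Sum>l<n. ?A k $$ (p mod n, l) * ?B k $$ (l, q mod n))"
    by (rule sum.cong) (use ms in auto)
  also have "\<dots> = (\<Sum>k<b * n. ?A (k div n) $$ (p mod n, k mod n) * ?B (k div n) $$ (k mod n, q mod n))"
    by (rule sum_div_mod[symmetric])
  also have "\<dots> = (ev n \<rho> A * ev n \<rho> B) $$ (p, q)"
    using pq dd by (subst times_mat_index) (auto simp: ev_index intro!: sum.cong)
  finally show "ev n \<rho> (emul A B) $$ (p, q) = (ev n \<rho> A * ev n \<rho> B) $$ (p, q)" .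
qed (use A B in \<open>auto simp: over_iff\<close>)

lemma ev_eadd:
  assumes A: "nc_mat_over V a b A" and B: "nc_mat_over V a b B" and d: "df n \<rho> A" "df n \<rho> B"
  shows "ev n \<rho> (eadd A B) = ev n \<rho> A + ev n \<rho> B"
proof (rule eq_matI)
  have dd: "dim_row A = a" "dim_col A = b" "dim_row B = a" "dim_col B = b" using A B by (auto simp: over_iff)
  fix p q assume "p < dim_row (ev n \<rho> A + ev n \<rho> B)" "q < dim_col (ev n \<rho> A + ev n \<rho> B)"
  then have pq: "p < a * n" "q < b * n" using dd by auto
  note dm = pq[THEN div_lt_of_lt_mult] pq[THEN mod_lt_of_lt_mult]
  obtain M where M: "nc_eval n \<rho> (A $$ (p div n, q div n)) = Some M" "M \<in> carrier_mat n n"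
    using entry_carrier[OF A d(1) dm(1,2)] .
  obtain N where N: "nc_eval n \<rho> (B $$ (p div n, q div n)) = Some N" "N \<in> carrier_mat n n"
    using entry_carrier[OF B d(2) dm(1,2)] .
  show "ev n \<rho> (eadd A B) $$ (p, q) = (ev n \<rho> A + ev n \<rho> B) $$ (p, q)"
    using pq dd dm M N by (simp add: ev_index eadd_def)
qed (use A B in \<open>auto simp: over_iff\<close>)

lemma ev_eneg:
  assumes A: "nc_mat_over V a b A" and d: "df n \<rho> A"
  shows "ev n \<rho> (eneg A) = (-1) \<cdot>\<^sub>m ev n \<rho> A"
proof (rule eq_matI)
  have dd: "dim_row A = a" "dim_col A = b" using A by (auto simp: over_iff)
  fix p q assume "p < dim_row ((-1) \<cdot>\<^sub>m ev n \<rho> A)" "q < dim_col ((-1) \<cdot>\<^sub>m ev n \<rho> A)"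
  then have pq: "p < a * n" "q < b * n" using dd by auto
  note dm = pq[THEN div_lt_of_lt_mult] pq[THEN mod_lt_of_lt_mult]
  obtain M where M: "nc_eval n \<rho> (A $$ (p div n, q div n)) = Some M" "M \<in> carrier_mat n n"
    using entry_carrier[OF A d(1) dm(1,2)] .
  have "((-1) \<cdot>\<^sub>m 1\<^sub>m n) * M = (-1) \<cdot>\<^sub>m M" using M by (simp add: mat_ring)
  then show "ev n \<rho> (eneg A) $$ (p, q) = ((-1) \<cdot>\<^sub>m ev n \<rho> A) $$ (p, q)"
    using pq dd dm M by (simp add: ev_index eneg_def del: index_mult_mat(1))
qed auto

lemma ev_elin:
  assumes "T \<in> mats e e g" "\<And>l. l < g \<Longrightarrow> va l \<in> V \<and> \<rho> (va l) = X ! l" "X \<in> mats n n g"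
  shows "ev n \<rho> (elin e va T) = plin (e * n) (e * n) T X"
proof (rule eq_matI)
  fix p q assume "p < dim_row (plin (e * n) (e * n) T X)" "q < dim_col (plin (e * n) (e * n) T X)"
  then have pq: "p < e * n" "q < e * n" by auto
  note dm = pq[THEN div_lt_of_lt_mult] pq[THEN mod_lt_of_lt_mult]
  have lT: "length T = g" using matsD(1)[OF assms(1)] .
  have "ev n \<rho> (elin e va T) $$ (p, q) =
     the (nc_eval n \<rho> (esum (map (\<lambda>l. Mul (Scal (T ! l $$ (p div n, q div n))) (Var (va l))) [0..<g]))) $$ (p mod n, q mod n)"
    using pq dm by (simp add: ev_index elin_def lT)
  also have "\<dots> = (\<Sum>l<g. the (nc_eval n \<rho> (Mul (Scal (T ! l $$ (p div n, q div n))) (Var (va l)))) $$ (p mod n, q mod n))"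
    by (subst esum_eval[OF env])
      (use dm assms(2) in \<open>auto simp: interv_sum_list_conv_sum_set_nat lessThan_atLeast0 comp_def\<close>)
  also have "\<dots> = plin (e * n) (e * n) T X $$ (p, q)"
    unfolding plin_index[OF assms(1,3) pq]
  proof (rule sum.cong[OF refl])
    fix l assume "l \<in> {..<g}"
    then have l: "l < g" by simp
    note c = carrier_matD[OF matsD(2)[OF assms(3) l]]
    have "(z \<cdot>\<^sub>m 1\<^sub>m n) * (X ! l) = z \<cdot>\<^sub>m (X ! l)" for z using c by (simp add: mat_ring)
    then show "the (nc_eval n \<rho> (Mul (Scal (T ! l $$ (p div n, q div n))) (Var (va l)))) $$ (p mod n, q mod n)
      = T ! l $$ (p div n, q div n) * X ! l $$ (p mod n, q mod n)"
      using assms(2)[OF l] c dm by (simp del: index_mult_mat(1))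
  qed
  finally show "ev n \<rho> (elin e va T) $$ (p, q) = plin (e * n) (e * n) T X $$ (p, q)" .
qed auto

end

lemma ev_cong_four_block_over:
  assumes "nc_mat_over V a b A" "nc_mat_over V a d B" "nc_mat_over V c b C" "nc_mat_over V c d D"
  shows "nc_mat_over V (a + c) (b + d) (four_block_mat A B C D)"
  using assms by (auto simp: over_iff)

lemma df_four_block:
  assumes "dim_row A = a" "dim_col A = b" "dim_row B = a" "dim_col B = d" "dim_row C = c" "dim_col C = b"
    "dim_row D = c" "dim_col D = d"
  shows "df n \<rho> (four_block_mat A B C D) \<longleftrightarrow> df n \<rho> A \<and> df n \<rho> B \<and> df n \<rho> C \<and> df n \<rho> D"
    (is "?L \<longleftrightarrow> ?R")
proof
  let ?F = "four_block_mat A B C D"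
  assume L: ?L
  have F: "nc_eval n \<rho> (?F $$ (i, j)) \<noteq> None" if "i < a + c" "j < b + d" for i j
    using L that assms by (simp add: nc_mat_defined_def del: index_mat_four_block(1))
  show ?R
    unfolding nc_mat_defined_def
  proof (intro conjI allI impI)
    fix i j assume "i < dim_row A" "j < dim_col A"
    then show "nc_eval n \<rho> (A $$ (i, j)) \<noteq> None" using F[of i j] assms by simp
  next
    fix i j assume "i < dim_row B" "j < dim_col B"
    then show "nc_eval n \<rho> (B $$ (i, j)) \<noteq> None" using F[of i "b + j"] assms by simp
  next
    fix i j assume "i < dim_row C" "j < dim_col C"
    then show "nc_eval n \<rho> (C $$ (i, j)) \<noteq> None" using F[of "a + i" j] assms by simp
  next
    fix i j assume "i < dim_row D" "j < dim_col D"
    then show "nc_eval n \<rho> (D $$ (i, j)) \<noteq> None" using F[of "a + i" "b + j"] assms by simp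
  qed
next
  assume ?R
  then show ?L using assms by (auto simp: nc_mat_defined_def simp del: not_None_eq)
qed

lemma four_block_iota:
  assumes "A \<in> carrier_mat a a" "B \<in> carrier_mat a b" "C \<in> carrier_mat b a" "D \<in> carrier_mat b b"
  shows "four_block_mat A B C D = iota1 a b * (A * adj (iota1 a b)) + iota1 a b * (B * adj (iota2 a b)) +
     iota2 a b * (C * adj (iota1 a b)) + iota2 a b * (D * adj (iota2 a b))"
  by (rule eq_matI)
    (use assms in \<open>auto simp: iota1_mult_index iota2_mult_index mult_adj_iota_index mult_adj_iota2_index
      simp del: index_mult_mat(1)\<close>)

lemma four_block_compress:
  assumes "A \<in> carrier_mat a a" "B \<in> carrier_mat a b" "C \<in> carrier_mat b a" "D \<in> carrier_mat b b"
  shows "adj (iota1 a b) * (four_block_mat A B C D * iota1 a b) = A"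
    "adj (iota1 a b) * (four_block_mat A B C D * iota2 a b) = B"
    "adj (iota2 a b) * (four_block_mat A B C D * iota1 a b) = C"
    "adj (iota2 a b) * (four_block_mat A B C D * iota2 a b) = D"
proof -
  note d = carrier_matD[OF assms(1)] carrier_matD[OF assms(2)] carrier_matD[OF assms(3)] carrier_matD[OF assms(4)]
  note o = iota_orth[of a b]
  have o': "adj (iota1 a b) * (iota1 a b * X) = X" "adj (iota2 a b) * (iota1 a b * X) = 0\<^sub>m b (dim_col X)" if "dim_row X = a" for X
    using that by (simp_all add: mm_assoc[symmetric] o mm_one_left mm_zero_left)
  have o2: "adj (iota2 a b) * (iota2 a b * X) = X" "adj (iota1 a b) * (iota2 a b * X) = 0\<^sub>m a (dim_col X)" if "dim_row X = b" for X
    using that by (simp_all add: mm_assoc[symmetric] o mm_one_left mm_zero_left)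
  show "adj (iota1 a b) * (four_block_mat A B C D * iota1 a b) = A"
    "adj (iota1 a b) * (four_block_mat A B C D * iota2 a b) = B"
    "adj (iota2 a b) * (four_block_mat A B C D * iota1 a b) = C"
    "adj (iota2 a b) * (four_block_mat A B C D * iota2 a b) = D"
    unfolding four_block_iota[OF assms]
    by (rule eq_matI; use d in \<open>simp add: mat_ring o o' o2 del: index_mult_mat(1)\<close>)+
qed

lemma pd_sandwich:
  assumes "pd M" "dim_row K = dim_row M" "H * K = 1\<^sub>m (dim_col K)" "dim_col H = dim_row K"
  shows "pd (adj K * (M * K))"
proof (rule pdI[of _ "dim_col K"])
  note m = pdD[OF assms(1)]
  show "adj K * (M * K) \<in> carrier_mat (dim_col K) (dim_col K)" by (rule carrier_matI) auto
  show "adj (adj K * (M * K)) = adj K * (M * K)" using m assms(2) by (simp add: mm_assoc)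
  fix x :: "complex mat" assume x: "x \<in> carrier_mat (dim_col K) 1" "x \<noteq> 0\<^sub>m (dim_col K) 1"
  note xd = carrier_matD[OF x(1)]
  have "K * x \<noteq> 0\<^sub>m (dim_row M) 1"
  proof
    assume "K * x = 0\<^sub>m (dim_row M) 1"
    moreover have "dim_row H = dim_col K" using arg_cong[OF assms(3), of dim_row] by simp
    ultimately have "H * (K * x) = 0\<^sub>m (dim_col K) 1" using assms(2,4) by (simp add: mm_zero_right)
    then show False using x xd mm_assoc_eq[OF assms(3), of x] assms by (simp add: mm_one_left)
  qed
  moreover have "K * x \<in> carrier_mat (dim_row M) 1" using assms(2) xd by (intro carrier_matI) auto
  ultimately have "0 < qf M (K * x)" using m(3)[of "K * x"] by blast
  then show "0 < qf (adj K * (M * K)) x" using assms m xd by (subst qf_cong_mult) auto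
qed

text \<open>The compression of the block matrix by \<open>K\<close>, with upper block
  \<open>- minv A * B\<close> and lower block the identity, is the Schur complement; the lower block
  also shows that \<open>K\<close> is injective.\<close>

lemma schur_complement_pd:
  assumes A: "A \<in> carrier_mat a a" and B: "B \<in> carrier_mat a b" and C: "C \<in> carrier_mat b a" and D: "D \<in> carrier_mat b b"
    and pd: "pd (four_block_mat A B C D)"
  shows "det A \<noteq> 0" "pd (D + (-1) \<cdot>\<^sub>m (C * (minv A * B)))"
proof -
  note d = carrier_matD[OF A] carrier_matD[OF B] carrier_matD[OF C] carrier_matD[OF D]
  note cp = four_block_compress[OF A B C D]
  let ?M = "four_block_mat A B C D"
  have Md: "dim_row ?M = a + b" "dim_col ?M = a + b" using d by auto
  have pA: "pd A"
    using pd_sandwich[OF pd, of "iota1 a b" "adj (iota1 a b)"] d unfolding cp by (simp add: iota_orth)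
  show dA: "det A \<noteq> 0" by (rule pd_det[OF pA])
  note i = minv_props[OF A dA]
  note di = carrier_matD[OF i(1)]
  have ai: "adj (minv A) = minv A" by (rule hermitian_minv[OF A dA pdD(2)[OF pA]])
  have "adj B = adj (adj (iota1 a b) * (?M * iota2 a b))" by (simp only: cp(2))
  also have "\<dots> = adj (iota2 a b) * (?M * iota1 a b)"
    using Md pdD(2)[OF pd] by (simp add: mm_assoc del: index_mat_four_block)
  finally have BC: "adj B = C" by (simp only: cp(3))
  define K where "K = iota2 a b + (-1) \<cdot>\<^sub>m (iota1 a b * (minv A * B))"
  have Kd: "dim_row K = a + b" "dim_col K = b" using d by (auto simp: K_def)
  note o = iota_orth[of a b]
  have o': "adj (iota2 a b) * (iota1 a b * X) = 0\<^sub>m b (dim_col X)" if "dim_row X = a" for X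
    using that by (simp add: mm_assoc[symmetric] o mm_zero_left)
  have HK: "adj (iota2 a b) * K = 1\<^sub>m b"
    unfolding K_def by (rule eq_matI) (use d di in \<open>simp_all add: mat_ring o o' del: index_mult_mat(1)\<close>)
  have cpX: "adj (iota1 a b) * (?M * (iota1 a b * X)) = A * X" "adj (iota2 a b) * (?M * (iota1 a b * X)) = C * X"
    if "dim_row X = a" for X
    using mm_assoc_eq3[OF cp(1), of X] mm_assoc_eq3[OF cp(3), of X] that Md by simp_all
  have AX: "A * (minv A * X) = X" if "dim_row X = a" for X
    using mm_assoc_eq[OF i(2), of X] that d di by (simp add: mm_one_left)
  have "adj K * (?M * K) = D + (-1) \<cdot>\<^sub>m (C * (minv A * B))"
    unfolding K_def
    by (rule eq_matI) (use d di Md in \<open>simp_all add: mat_ring cp cpX AX ai BC smult_add_mm del: index_mult_mat(1) index_mat_four_block\<close>)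
  then show "pd (D + (-1) \<cdot>\<^sub>m (C * (minv A * B)))"
    using pd_sandwich[OF pd, of K "adj (iota2 a b)"] HK Kd Md by simp
qed

text \<open>Block elimination: on a positive definite value every pivot is invertible, so the
  expression that inverts the \<open>p \<times> p\<close> matrix is defined there.\<close>

lemma einverse_exists:
  assumes "nc_mat_over V p p W"
  shows "\<exists>W'. nc_mat_over V p p W' \<and> (\<forall>n \<rho>. (\<forall>v\<in>V. \<rho> v \<in> carrier_mat n n) \<longrightarrow>
     (df n \<rho> W' \<longrightarrow> df n \<rho> W \<and> ev n \<rho> W * ev n \<rho> W' = 1\<^sub>m (p * n)) \<and>
     (df n \<rho> W \<and> pd (ev n \<rho> W) \<longrightarrow> df n \<rho> W'))"
  using assms
proof (induction p arbitrary: W)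
  case 0
  then show ?case
    by (intro exI[of _ W]) (auto simp: over_iff nc_mat_defined_def intro!: eq_matI)
next
  case (Suc p)
  define A where "A = mat 1 1 (\<lambda>(i, j). W $$ (i, j))"
  define B where "B = mat 1 p (\<lambda>(i, j). W $$ (i, Suc j))"
  define C where "C = mat p 1 (\<lambda>(i, j). W $$ (Suc i, j))"
  define D where "D = mat p p (\<lambda>(i, j). W $$ (Suc i, Suc j))"
  have Wd: "dim_row W = Suc p" "dim_col W = Suc p" using Suc.prems by (auto simp: over_iff)
  have Weq: "W = four_block_mat A B C D"
    by (rule eq_matI) (use Wd in \<open>auto simp: A_def B_def C_def D_def\<close>)
  have ov: "nc_mat_over V 1 1 A" "nc_mat_over V 1 p B" "nc_mat_over V p 1 C" "nc_mat_over V p p D"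
    using Suc.prems by (auto simp: over_iff A_def B_def C_def D_def)
  have dims: "dim_row A = 1" "dim_col A = 1" "dim_row B = 1" "dim_col B = p" "dim_row C = p" "dim_col C = 1"
    "dim_row D = p" "dim_col D = p" by (auto simp: A_def B_def C_def D_def)
  \<comment> \<open>The pivot is a single expression, since \<open>Inv\<close> inverts nothing
    larger; its value is still an \<open>n\<close> by \<open>n\<close> matrix.\<close>
  define Ai where "Ai = mat 1 1 (\<lambda>ij. Inv (A $$ ij))"
  have ovi: "nc_mat_over V 1 1 Ai" using ov(1) by (auto simp: over_iff Ai_def)
  \<comment> \<open>The Schur complement of the pivot, one row and column smaller, to which the
    induction hypothesis applies.\<close>
  define S where "S = eadd D (eneg (emul C (emul Ai B)))"
  have ovS: "nc_mat_over V p p S" unfolding S_def by (rule over_eadd over_eneg over_emul ov ovi)+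
  obtain S' where ovS': "nc_mat_over V p p S'" and S':
    "\<And>n \<rho>. (\<forall>v\<in>V. \<rho> v \<in> carrier_mat n n) \<Longrightarrow> df n \<rho> S' \<Longrightarrow> df n \<rho> S \<and> ev n \<rho> S * ev n \<rho> S' = 1\<^sub>m (p * n)"
    "\<And>n \<rho>. (\<forall>v\<in>V. \<rho> v \<in> carrier_mat n n) \<Longrightarrow> df n \<rho> S \<Longrightarrow> pd (ev n \<rho> S) \<Longrightarrow> df n \<rho> S'"
    using Suc.IH[OF ovS] by blast
  \<comment> \<open>The blocks of the inverse by the Schur formula: \<open>X\<close> corrects the
    inverse pivot, \<open>Y\<close> and \<open>Z\<close> are the off-diagonal blocks up to
    sign.\<close>
  define X where "X = emul Ai (emul B (emul S' (emul C Ai)))"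
  define Y where "Y = emul Ai (emul B S')"
  define Z where "Z = emul S' (emul C Ai)"
  define W' where "W' = four_block_mat (eadd Ai X) (eneg Y) (eneg Z) S'"
  have ovX: "nc_mat_over V 1 1 X" "nc_mat_over V 1 p Y" "nc_mat_over V p 1 Z"
    unfolding X_def Y_def Z_def by (rule over_emul ov ovi ovS')+
  have ovW': "nc_mat_over V (Suc p) (Suc p) W'"
    using ev_cong_four_block_over[of V 1 1 "eadd Ai X" p "eneg Y" p "eneg Z" S'] ovX ovi ovS'
    by (simp add: W'_def over_eadd over_eneg One_nat_def)
  have dims': "dim_row Ai = 1" "dim_col Ai = 1" "dim_row S' = p" "dim_col S' = p"
    "dim_row X = 1" "dim_col X = 1" "dim_row Y = 1" "dim_col Y = p" "dim_row Z = p" "dim_col Z = 1"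
    using ovi ovS' ovX by (auto simp: over_iff)
  show ?case
  proof (intro exI[of _ W'] conjI ovW' allI impI)
    fix n and \<rho> :: "'a \<Rightarrow> complex mat"
    assume env: "\<forall>v\<in>V. \<rho> v \<in> carrier_mat n n"
    then have env': "\<And>v. v \<in> V \<Longrightarrow> \<rho> v \<in> carrier_mat n n" by auto
    note evs = ev_emul[OF env'] ev_eadd[OF env'] ev_eneg[OF env']
    let ?a = "ev n \<rho> A" let ?b = "ev n \<rho> B" let ?c = "ev n \<rho> C" let ?d = "ev n \<rho> D"
    have evc: "?a \<in> carrier_mat (1 * n) (1 * n)" "?b \<in> carrier_mat (1 * n) (p * n)"
      "?c \<in> carrier_mat (p * n) (1 * n)" "?d \<in> carrier_mat (p * n) (p * n)"
      using dims by (auto intro!: carrier_matI)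
    have evW: "ev n \<rho> W = four_block_mat ?a ?b ?c ?d"
      unfolding Weq by (rule ev_four_block[OF dims])
    have dfW: "df n \<rho> W \<longleftrightarrow> df n \<rho> A \<and> df n \<rho> B \<and> df n \<rho> C \<and> df n \<rho> D"
      unfolding Weq by (rule df_four_block[OF dims])
    have ev1: "ev n \<rho> F = M" if "F = mat 1 1 (\<lambda>_. q)" "nc_eval n \<rho> q = Some M" "M \<in> carrier_mat n n" for F q M
      by (rule eq_matI) (use that in \<open>auto simp: ev_index\<close>)
    have Ai_ev: "det ?a \<noteq> 0 \<and> ev n \<rho> Ai = minv ?a" if dA: "df n \<rho> Ai"
    proof -
      obtain N where N: "nc_eval n \<rho> (Inv (W $$ (0, 0))) = Some N"
        using dA by (auto simp: nc_mat_defined_def Ai_def A_def)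
      then obtain M where M: "nc_eval n \<rho> (W $$ (0, 0)) = Some M" "mat_inverse M = Some N" by (auto simp: bind_eq_Some_conv)
      have Mc: "M \<in> carrier_mat n n" by (rule nc_eval_carrier[OF env' _ M(1)]) (use Suc.prems in \<open>auto simp: over_iff\<close>)
      note mi = mat_inverse_SomeD[OF Mc M(2)]
      have "?a = M" by (rule ev1[OF _ M(1) Mc]) (auto simp: A_def)
      moreover have "ev n \<rho> Ai = N"
        by (rule ev1[OF _ N]) (use mat_inverse(2)[OF Mc M(2)] in \<open>auto simp: A_def Ai_def\<close>)
      ultimately show ?thesis using mi by simp
    qed
    have Ai_df: "df n \<rho> Ai" if dA: "df n \<rho> A" "det ?a \<noteq> 0"
    proof -
      obtain M where M: "nc_eval n \<rho> (W $$ (0, 0)) = Some M"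
        using dA by (auto simp: nc_mat_defined_def A_def)
      have Mc: "M \<in> carrier_mat n n" by (rule nc_eval_carrier[OF env' _ M(1)]) (use Suc.prems in \<open>auto simp: over_iff\<close>)
      have "?a = M" by (rule ev1[OF _ M(1) Mc]) (auto simp: A_def)
      then have "mat_inverse M = Some (minv M)" using minv_props(4)[OF Mc] dA by simp
      then show ?thesis using M by (auto simp: nc_mat_defined_def Ai_def A_def)
    qed
    have Ai_dfA: "df n \<rho> A" if "df n \<rho> Ai"
      using that by (auto simp: nc_mat_defined_def Ai_def bind_eq_None_conv dims simp del: not_None_eq)
    have dfS: "df n \<rho> S" if "df n \<rho> D" "df n \<rho> C" "df n \<rho> Ai" "df n \<rho> B"
      unfolding S_def using that dims dims' by (simp add: df_eadd df_eneg df_emul(1))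
    have evS: "ev n \<rho> S = ?d + (-1) \<cdot>\<^sub>m (?c * (minv ?a * ?b))" if "df n \<rho> D" "df n \<rho> C" "df n \<rho> Ai" "df n \<rho> B"
    proof -
      have 1: "ev n \<rho> (emul Ai B) = ev n \<rho> Ai * ?b" by (rule ev_emul[OF env' ovi ov(2)]) (use that in auto)
      have d1: "df n \<rho> (emul Ai B)" using that dims dims' by (simp add: df_emul(1))
      have 2: "ev n \<rho> (emul C (emul Ai B)) = ?c * (ev n \<rho> Ai * ?b)"
        using ev_emul[OF env' ov(3) over_emul[OF ovi ov(2)] that(2) d1] 1 by simp
      have d2: "df n \<rho> (emul C (emul Ai B))" using that d1 dims dims' by (simp add: df_emul(1))
      have 3: "ev n \<rho> (eneg (emul C (emul Ai B))) = (-1) \<cdot>\<^sub>m (?c * (ev n \<rho> Ai * ?b))"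
        using ev_eneg[OF env' over_emul[OF ov(3) over_emul[OF ovi ov(2)]] d2] 2 by simp
      show ?thesis unfolding S_def
        using ev_eadd[OF env' ov(4) over_eneg[OF over_emul[OF ov(3) over_emul[OF ovi ov(2)]]] that(1)] d2 3 Ai_ev[OF that(3)]
        by (simp add: df_eneg)
    qed
    { assume dW': "df n \<rho> W'"
      have "df n \<rho> (eadd Ai X)" and dS': "df n \<rho> S'"
        using dW' df_four_block[of "eadd Ai X" 1 1 "eneg Y" p "eneg Z" p S' n \<rho>] dims' by (auto simp: W'_def)
      then have dAi: "df n \<rho> Ai" using dims' by (auto simp: df_eadd)
      have dS: "df n \<rho> S" and SS': "ev n \<rho> S * ev n \<rho> S' = 1\<^sub>m (p * n)" using S'(1)[OF env dS'] by auto
      have dD: "df n \<rho> D" and dCAB: "df n \<rho> (emul C (emul Ai B))"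
        using dS dims dims' by (auto simp: S_def df_eadd df_eneg)
      have dC: "df n \<rho> C" and dB: "df n \<rho> B"
      proof -
        \<comment> \<open>For \<open>p = 0\<close> the products with \<open>B\<close> and
          \<open>C\<close> have no entries and carry no information, but then \<open>B\<close> and
          \<open>C\<close> are empty as well.\<close>
        have "df n \<rho> C \<and> df n \<rho> B" if p: "p > 0"
          using df_emul(2)[of C "emul Ai B" n \<rho>] df_emul(2)[of Ai B n \<rho>] dCAB p dims dims' by auto
        moreover have "df n \<rho> C \<and> df n \<rho> B" if p: "p = 0"
          using p dims by (auto simp: nc_mat_defined_def)
        ultimately show "df n \<rho> C" "df n \<rho> B" by auto
      qed
      have dA: "df n \<rho> A" by (rule Ai_dfA[OF dAi])
      show "df n \<rho> W" using dA dB dC dD dfW by simp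
      have det: "det ?a \<noteq> 0" and evAi: "ev n \<rho> Ai = minv ?a" using Ai_ev[OF dAi] by auto
      note mi = minv_props[OF evc(1) det]
      let ?i = "minv ?a" let ?s = "ev n \<rho> S'"
      note dd = dims dims' carrier_matD[OF mi(1)]
      have sd: "dim_row ?s = p * n" "dim_col ?s = p * n" using dims' by auto
      have dCA: "df n \<rho> (emul C Ai)" using dC dAi dims dims' by (simp add: df_emul(1))
      have dZ: "df n \<rho> Z" unfolding Z_def using dCA dS' dims dims' by (simp add: df_emul(1))
      have dBS: "df n \<rho> (emul B S')" using dB dS' dims dims' by (simp add: df_emul(1))
      have dY: "df n \<rho> Y" unfolding Y_def using dBS dAi dims dims' by (simp add: df_emul(1))
      have dBZ: "df n \<rho> (emul B Z)" using dB dZ dims dims' by (simp add: df_emul(1))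
      have dX: "df n \<rho> X" unfolding X_def Z_def[symmetric] using dBZ dAi dims dims' by (simp add: df_emul(1))
      have eZ: "ev n \<rho> Z = ?s * (?c * ?i)"
        unfolding Z_def using ev_emul[OF env' ovS' over_emul[OF ov(3) ovi] dS' dCA] ev_emul[OF env' ov(3) ovi dC dAi] evAi by simp
      have eY: "ev n \<rho> Y = ?i * (?b * ?s)"
        unfolding Y_def using ev_emul[OF env' ovi over_emul[OF ov(2) ovS'] dAi dBS] ev_emul[OF env' ov(2) ovS' dB dS'] evAi by simp
      have eX: "ev n \<rho> X = ?i * (?b * (?s * (?c * ?i)))"
        unfolding X_def Z_def[symmetric] using ev_emul[OF env' ovi over_emul[OF ov(2) ovX(3)] dAi dBZ] ev_emul[OF env' ov(2) ovX(3) dB dZ] eZ evAi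
        by simp
      have "ev n \<rho> W' = four_block_mat (ev n \<rho> (eadd Ai X)) (ev n \<rho> (eneg Y)) (ev n \<rho> (eneg Z)) ?s"
        unfolding W'_def by (rule ev_four_block) (use dims' in auto)
      also have "\<dots> = four_block_mat (?i + ?i * (?b * (?s * (?c * ?i)))) ((-1) \<cdot>\<^sub>m (?i * (?b * ?s))) ((-1) \<cdot>\<^sub>m (?s * (?c * ?i))) ?s"
        using ev_eadd[OF env' ovi ovX(1) dAi dX] ev_eneg[OF env' ovX(2) dY] ev_eneg[OF env' ovX(3) dZ] eX eY eZ evAi by simp
      finally have evW': "ev n \<rho> W' = four_block_mat (?i + ?i * (?b * (?s * (?c * ?i)))) ((-1) \<cdot>\<^sub>m (?i * (?b * ?s))) ((-1) \<cdot>\<^sub>m (?s * (?c * ?i))) ?s" .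
      have Ss: "(?d + (-1) \<cdot>\<^sub>m (?c * (?i * ?b))) * ?s = 1\<^sub>m (p * n)"
        using SS' evS[OF dD dC dAi dB] by simp
      have AX: "?a * (?i * M) = M" if "dim_row M = 1 * n" for M
        using mm_assoc_eq[OF mi(2), of M] that dd by (simp add: mm_one_left)
      have DS: "(?d * (?s * M)) $$ (i, j) = M $$ (i, j) + (?c * (?i * (?b * (?s * M)))) $$ (i, j)"
        if "dim_row M = p * n" "i < p * n" "j < dim_col M" for M i j
        using arg_cong[OF Ss, of "\<lambda>N. (N * M) $$ (i, j)"] that dd sd by (simp add: mat_ring diff_eq_eq del: index_mult_mat(1))
      have DS1: "(?d * ?s) $$ (i, j) = 1\<^sub>m (p * n) $$ (i, j) + (?c * (?i * (?b * ?s))) $$ (i, j)"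
        if "i < p * n" "j < p * n" for i j
        using arg_cong[OF Ss, of "\<lambda>N. N $$ (i, j)"] that dd sd by (simp add: mat_ring algebra_simps del: index_mult_mat(1) index_one_mat)
      have "ev n \<rho> W * ev n \<rho> W' = four_block_mat (1\<^sub>m (1 * n)) (0\<^sub>m (1 * n) (p * n)) (0\<^sub>m (p * n) (1 * n)) (1\<^sub>m (p * n))"
        unfolding evW evW'
      proof (subst mult_four_block_mat[OF evc, of _ "1 * n" _ "p * n"], goal_cases)
        case 5
        show ?case
        proof (rule cong_four_block_mat)
          show "?a * (?i + ?i * (?b * (?s * (?c * ?i)))) + ?b * ((-1) \<cdot>\<^sub>m (?s * (?c * ?i))) = 1\<^sub>m (1 * n)"
            by (rule eq_matI) (use dd sd in \<open>simp_all add: mat_ring AX mi(2) del: index_mult_mat(1)\<close>)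
          show "?a * ((-1) \<cdot>\<^sub>m (?i * (?b * ?s))) + ?b * ?s = 0\<^sub>m (1 * n) (p * n)"
            by (rule eq_matI) (use dd sd in \<open>simp_all add: mat_ring AX del: index_mult_mat(1)\<close>)
          show "?c * (?i + ?i * (?b * (?s * (?c * ?i)))) + ?d * ((-1) \<cdot>\<^sub>m (?s * (?c * ?i))) = 0\<^sub>m (p * n) (1 * n)"
            by (rule eq_matI) (use dd sd in \<open>simp_all add: mat_ring DS del: index_mult_mat(1)\<close>)
          show "?c * ((-1) \<cdot>\<^sub>m (?i * (?b * ?s))) + ?d * ?s = 1\<^sub>m (p * n)"
            by (rule eq_matI) (use dd sd in \<open>simp_all add: mat_ring DS1 del: index_mult_mat(1)\<close>)
        qed
      qed (use dd sd in \<open>auto intro!: carrier_matI\<close>)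
      then show "ev n \<rho> W * ev n \<rho> W' = 1\<^sub>m (Suc p * n)" by simp
    }
    { assume "df n \<rho> W \<and> pd (ev n \<rho> W)"
      then have dd: "df n \<rho> A" "df n \<rho> B" "df n \<rho> C" "df n \<rho> D" and pd: "pd (four_block_mat ?a ?b ?c ?d)"
        using dfW evW by auto
      note sc = schur_complement_pd[OF evc pd]
      have dAi: "df n \<rho> Ai" by (rule Ai_df[OF dd(1) sc(1)])
      have dS': "df n \<rho> S'"
        using S'(2)[OF env dfS] evS sc(2) dd dAi by simp
      have "df n \<rho> X" "df n \<rho> Y" "df n \<rho> Z"
        unfolding X_def Y_def Z_def using dd dAi dS' dims dims' by (simp_all add: df_emul(1))
      then show "df n \<rho> W'"
        using df_four_block[of "eadd Ai X" 1 1 "eneg Y" p "eneg Z" p S' n \<rho>] dims' dAi dS'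
        by (simp add: W'_def df_eadd df_eneg)
    }
  qed
qed

lemma ev_single:
  assumes "\<And>v. v \<in> V \<Longrightarrow> \<rho> v \<in> carrier_mat n n" "nc_mat_over V 1 1 F" "df n \<rho> F"
  shows "nc_eval n \<rho> (F $$ (0, 0)) = Some (ev n \<rho> F)"
proof -
  obtain M where M: "nc_eval n \<rho> (F $$ (0, 0)) = Some M" "M \<in> carrier_mat n n"
    using entry_carrier[where V = V and \<rho> = \<rho> and n = n, OF assms, of 0 0] by auto
  have "ev n \<rho> F = M"
    by (rule eq_matI) (use M assms(2) in \<open>auto simp: ev_index over_iff\<close>)
  then show ?thesis using M by simp
qed

lemma df_single: "nc_mat_over V 1 1 F \<Longrightarrow> df n \<rho> F \<longleftrightarrow> nc_eval n \<rho> (F $$ (0, 0)) \<noteq> None"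
  by (auto simp: nc_mat_defined_def over_iff)

section \<open>The inverse pencil and the functions w, l and f as expressions\<close>

context wf_real
begin

abbreviation "P0 n A \<equiv> pen n A (zero_tuple n g)"

text \<open>\<open>va\<close> names the variables for \<open>a\<close>, so that one construction
  serves functions of \<open>a\<close> alone, with \<open>id\<close>, and functions of
  \<open>a\<close> and \<open>x\<close>, with \<open>AVar\<close>.\<close>

definition env_ok :: "'v set \<Rightarrow> (nat \<Rightarrow> 'v) \<Rightarrow> nat \<Rightarrow> ('v \<Rightarrow> complex mat) \<Rightarrow> complex mat list \<Rightarrow> bool" where
  "env_ok V va n \<rho> A \<longleftrightarrow> (\<forall>v\<in>V. \<rho> v \<in> carrier_mat n n) \<and> A \<in> herm_tuples n h \<and>
     (\<forall>l<h. va l \<in> V \<and> \<rho> (va l) = A ! l)"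

text \<open>The inverse of the hermitian pencil \<open>P(a)\<close> is written as \<open>P (P\<^sup>2)\<^sup>-\<^sup>1\<close>: where \<open>P\<close> is
  invertible, \<open>P\<^sup>2\<close> is positive definite, so block elimination never fails.\<close>

lemma einverse_pencil:
  assumes va: "\<And>l. l < h \<Longrightarrow> va l \<in> V"
  shows "\<exists>E. nc_mat_over V e e E \<and> (\<forall>n \<rho> A. env_ok V va n \<rho> A \<longrightarrow>
     (df n \<rho> E \<longleftrightarrow> det (P0 n A) \<noteq> 0) \<and> (det (P0 n A) \<noteq> 0 \<longrightarrow> ev n \<rho> E = minv (P0 n A)))"
proof -
  define eP where "eP = eadd (econst J) (eneg (elin e va S))"
  have lS: "length S = h" by (rule matsD(1)[OF basic(6)])
  have oS: "nc_mat_over V e e (elin e va S)" by (rule over_elin) (use va lS in auto)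
  have oP: "nc_mat_over V e e eP"
    unfolding eP_def by (intro over_eadd over_econst over_eneg oS basic(1))
  obtain I where oI: "nc_mat_over V e e I" and
    I: "\<And>n \<rho>. (\<forall>v\<in>V. \<rho> v \<in> carrier_mat n n) \<Longrightarrow> df n \<rho> I \<Longrightarrow>
      df n \<rho> (emul eP eP) \<and> ev n \<rho> (emul eP eP) * ev n \<rho> I = 1\<^sub>m (e * n)"
      "\<And>n \<rho>. (\<forall>v\<in>V. \<rho> v \<in> carrier_mat n n) \<Longrightarrow> df n \<rho> (emul eP eP) \<Longrightarrow> pd (ev n \<rho> (emul eP eP)) \<Longrightarrow> df n \<rho> I"
    using einverse_exists[OF over_emul[OF oP oP]] by blast
  have dims: "dim_row eP = e" "dim_col eP = e" "dim_row I = e" "dim_col I = e"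
    using oP oI by (auto simp: over_iff)
  have dfP: "df n \<rho> eP" for n \<rho>
    using J_dim by (simp add: eP_def df_eadd df_econst df_eneg df_elin)
  show ?thesis
  proof (intro exI[of _ "emul eP I"] conjI over_emul[OF oP oI] allI impI)
    fix n and \<rho> :: "'a \<Rightarrow> complex mat" and A
    assume ok: "env_ok V va n \<rho> A"
    then have env: "\<forall>v\<in>V. \<rho> v \<in> carrier_mat n n" and env': "\<And>v. v \<in> V \<Longrightarrow> \<rho> v \<in> carrier_mat n n"
      and A: "A \<in> herm_tuples n h" and vaA: "\<And>l. l < h \<Longrightarrow> va l \<in> V \<and> \<rho> (va l) = A ! l"
      by (auto simp: env_ok_def)
    have Am: "A \<in> mats n n h" using A by (simp add: herm_tuples_iff)
    have evS: "ev n \<rho> (elin e va S) = Sl n A" by (rule ev_elin[OF env' basic(6) vaA Am])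
    have "ev n \<rho> eP = kron J (1\<^sub>m n) + (-1) \<cdot>\<^sub>m Sl n A"
      unfolding eP_def
      using ev_eadd[OF env' over_econst[OF basic(1)] over_eneg[OF oS] df_econst] ev_eneg[OF env' oS df_elin] evS
      by (simp add: df_eneg df_elin ev_econst)
    also have "\<dots> = P0 n A" unfolding pen_zero by (rule eq_matI) (auto simp: J_dim)
    finally have evP: "ev n \<rho> eP = P0 n A" .
    have evPP: "ev n \<rho> (emul eP eP) = P0 n A * P0 n A" using ev_emul[OF env' oP oP dfP dfP] evP by simp
    have dfPP: "df n \<rho> (emul eP eP)" using dims dfP by (simp add: df_emul(1))
    have hP: "adj (P0 n A) = P0 n A" by (rule pen_herm[OF A zero_tuple_herm])
    note pd = pen_dim[of n A "zero_tuple n g"]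
    have ev_I: "det (P0 n A) \<noteq> 0" "ev n \<rho> (emul eP I) = minv (P0 n A)" if dI: "df n \<rho> I"
    proof -
      have 1: "ev n \<rho> (emul eP I) = P0 n A * ev n \<rho> I" using ev_emul[OF env' oP oI dfP dI] evP by simp
      have "P0 n A * (P0 n A * ev n \<rho> I) = 1\<^sub>m (e * n)"
        using I(1)[OF env dI] evPP dims by (simp add: mm_assoc)
      then have 2: "P0 n A * ev n \<rho> (emul eP I) = 1\<^sub>m (e * n)" using 1 by simp
      have "ev n \<rho> (emul eP I) \<in> carrier_mat (e * n) (e * n)" using dims by (auto intro!: carrier_matI)
      from minv_unique[OF pen_carrier this 2]
      show "det (P0 n A) \<noteq> 0" "ev n \<rho> (emul eP I) = minv (P0 n A)" by auto
    qed
    have df_I: "df n \<rho> I" if d: "det (P0 n A) \<noteq> 0"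
    proof -
      note m = minv_props[OF pen_carrier d]
      have "pd (adj (P0 n A) * (1\<^sub>m (e * n) * P0 n A))"
        by (rule pd_sandwich[OF pd_one, of _ _ "minv (P0 n A)"]) (use m carrier_matD[OF m(1)] in auto)
      then have "pd (ev n \<rho> (emul eP eP))" using hP evPP by (simp add: mm_one_left)
      then show ?thesis using I(2)[OF env dfPP] by simp
    qed
    have df_iff: "df n \<rho> (emul eP I) \<longleftrightarrow> df n \<rho> I"
    proof (cases "e = 0")
      case True
      then show ?thesis using dims by (auto simp: nc_mat_defined_def)
    next
      case False
      then show ?thesis using df_emul[of eP I n \<rho>] dims dfP by auto
    qed
    show "df n \<rho> (emul eP I) \<longleftrightarrow> det (P0 n A) \<noteq> 0" using df_iff df_I ev_I by blast
    show "ev n \<rho> (emul eP I) = minv (P0 n A)" if "det (P0 n A) \<noteq> 0" using that df_I ev_I by blast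
  qed
qed

end

context coisometry_real
begin

text \<open>As \<open>C\<close> has a column, every entry of \<open>E\<close> occurs in the product,
  unless \<open>e = 0\<close> and \<open>E\<close> is empty.\<close>

lemma df_const_emul:
  assumes "dim_row E = e" "dim_col E = e" "dim_row C = e" "dim_col C > 0" "df n \<rho> C"
  shows "df n \<rho> (emul E C) \<longleftrightarrow> df n \<rho> E"
proof (cases "e = 0")
  case True
  then show ?thesis using assms by (auto simp: nc_mat_defined_def)
next
  case False
  then show ?thesis using assms df_emul[of E C n \<rho>] by auto
qed

text \<open>\<open>w\<close> is \<open>adj Q\<close> times the inverse pencil times
  \<open>Q\<close>. As \<open>k\<close> is positive, no entry of the inverse gets lost in the
  product, so its domain is determined exactly.\<close>

lemma w_exists:
  "\<exists>w. nc_mat_over (vars_a h) k k w \<and>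
    (\<forall>n. \<forall>A\<in>herm_tuples n h. (df n (env_a A) w \<longleftrightarrow> det (P n A) \<noteq> 0) \<and>
      (det (P n A) \<noteq> 0 \<longrightarrow> ev n (env_a A) w = W n A))"
proof -
  obtain E where oE: "nc_mat_over (vars_a h) e e E" and E:
    "\<And>n \<rho> A. env_ok (vars_a h) id n \<rho> A \<Longrightarrow> (df n \<rho> E \<longleftrightarrow> det (P n A) \<noteq> 0) \<and> (det (P n A) \<noteq> 0 \<longrightarrow> ev n \<rho> E = minv (P n A))"
    using einverse_pencil[of id "vars_a h"] by (auto simp: vars_a_def)
  have cQ: "Q \<in> carrier_mat e k" "adj Q \<in> carrier_mat k e" using Qd by auto
  let ?w1 = "emul E (econst Q)"
  let ?w = "emul (econst (adj Q)) ?w1"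
  have o1: "nc_mat_over (vars_a h) e k ?w1" by (rule over_emul[OF oE over_econst[OF cQ(1)]])
  have o2: "nc_mat_over (vars_a h) k k ?w" by (rule over_emul[OF over_econst[OF cQ(2)] o1])
  have k: "k > 0" by (simp add: k_def)
  have Ed: "dim_row E = e" "dim_col E = e" using oE by (auto simp: over_iff)
  have df1: "df n \<rho> ?w1 \<longleftrightarrow> df n \<rho> E" for n and \<rho> :: "nat \<Rightarrow> complex mat"
    by (rule df_const_emul) (use Ed Qd k in \<open>auto simp: df_econst\<close>)
  have df2: "df n \<rho> ?w \<longleftrightarrow> df n \<rho> E" for n and \<rho> :: "nat \<Rightarrow> complex mat"
    unfolding df1[symmetric] using df_emul[of "econst (adj Q)" ?w1 n \<rho>] Qd Ed k by (auto simp: df_econst)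
  show ?thesis
  proof (intro exI[of _ ?w] conjI o2 allI ballI)
    fix n A assume A: "A \<in> herm_tuples n h"
    then have Am: "A \<in> mats n n h" by (simp add: herm_tuples_iff)
    have ok: "env_ok (vars_a h) id n (env_a A) A"
      using A matsD(2)[OF Am] by (auto simp: env_ok_def vars_a_def env_a_def)
    have env': "\<And>v. v \<in> vars_a h \<Longrightarrow> env_a A v \<in> carrier_mat n n" using ok by (auto simp: env_ok_def)
    show "df n (env_a A) ?w \<longleftrightarrow> det (P n A) \<noteq> 0" unfolding df2 using E[OF ok] by simp
    show "det (P n A) \<noteq> 0 \<longrightarrow> ev n (env_a A) ?w = W n A"
    proof
      assume d: "det (P n A) \<noteq> 0"
      then have dE: "df n (env_a A) E" and eE: "ev n (env_a A) E = minv (P n A)" using E[OF ok] by auto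
      have "ev n (env_a A) ?w1 = minv (P n A) * Qn n"
        using ev_emul[OF env' oE over_econst[OF cQ(1)] dE df_econst] eE by (simp add: ev_econst df_econst df_elin)
      then show "ev n (env_a A) ?w = W n A"
        using ev_emul[OF env' over_econst[OF cQ(2)] o1 df_econst] df1[of n "env_a A"] dE
        by (simp add: W_def ev_econst df_econst)
    qed
  qed
qed

text \<open>Expressions have no adjoint, so the factor \<open>adj (bn n A)\<close> in
  \<open>f\<close> is built from \<open>adj c\<close>, the inverse pencil and \<open>Q\<close>; the
  two agree in value because the inverse pencil is hermitian.\<close>

lemma l_f_exist:
  "\<exists>l f. nc_mat_over (vars_ax h g) k 1 l \<and> nc_mat_over (vars_ax h g) 1 1 f \<and>
    (\<forall>n. \<forall>A\<in>herm_tuples n h. \<forall>X\<in>herm_tuples n g.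
      (df n (env_ax A X) l \<longleftrightarrow> det (P n A) \<noteq> 0) \<and> (df n (env_ax A X) f \<longleftrightarrow> det (P n A) \<noteq> 0) \<and>
      (det (P n A) \<noteq> 0 \<longrightarrow> ev n (env_ax A X) l = tl' n X * bn n A \<and>
        ev n (env_ax A X) f = adj (cn n) * (minv (P n A) * cn n) + adj (bn n A) * (tl' n X * bn n A)))"
proof -
  let ?V = "vars_ax h g"
  obtain E where oE: "nc_mat_over ?V e e E" and E:
    "\<And>n \<rho> A. env_ok ?V AVar n \<rho> A \<Longrightarrow> (df n \<rho> E \<longleftrightarrow> det (P n A) \<noteq> 0) \<and> (det (P n A) \<noteq> 0 \<longrightarrow> ev n \<rho> E = minv (P n A))"
    using einverse_pencil[of AVar ?V] by (auto simp: vars_ax_def)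
  define c where "c = colmat (rc R)"
  have cd: "dim_row c = e" "dim_col c = 1" using basic(8) by (auto simp: c_def)
  have cc: "c \<in> carrier_mat e 1" "adj c \<in> carrier_mat 1 e" "Q \<in> carrier_mat e k" "adj Q \<in> carrier_mat k e"
    using cd Qd by auto
  have lT: "length T' = g" by (rule matsD(1)[OF T'_mats])
  have oT: "nc_mat_over ?V k k (elin k XVar T')" by (rule over_elin) (auto simp: lT vars_ax_def)
  let ?l1 = "emul E (econst c)"
  let ?l2 = "emul (econst (adj Q)) ?l1"
  let ?l = "emul (elin k XVar T') ?l2"
  let ?f1 = "emul (econst (adj c)) ?l1"
  let ?f2 = "emul (econst Q) ?l"
  let ?f3 = "emul E ?f2"
  let ?f4 = "emul (econst (adj c)) ?f3"
  let ?f = "eadd ?f1 ?f4"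
  have o1: "nc_mat_over ?V e 1 ?l1" by (rule over_emul[OF oE over_econst[OF cc(1)]])
  have o2: "nc_mat_over ?V k 1 ?l2" by (rule over_emul[OF over_econst[OF cc(4)] o1])
  have o3: "nc_mat_over ?V k 1 ?l" by (rule over_emul[OF oT o2])
  have p1: "nc_mat_over ?V 1 1 ?f1" by (rule over_emul[OF over_econst[OF cc(2)] o1])
  have p2: "nc_mat_over ?V e 1 ?f2" by (rule over_emul[OF over_econst[OF cc(3)] o3])
  have p3: "nc_mat_over ?V e 1 ?f3" by (rule over_emul[OF oE p2])
  have p4: "nc_mat_over ?V 1 1 ?f4" by (rule over_emul[OF over_econst[OF cc(2)] p3])
  have p5: "nc_mat_over ?V 1 1 ?f" by (rule over_eadd[OF p1 p4])
  have k: "k > 0" by (simp add: k_def)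
  have Ed: "dim_row E = e" "dim_col E = e" using oE by (auto simp: over_iff)
  have d1: "df n \<rho> ?l1 \<longleftrightarrow> df n \<rho> E" for n and \<rho> :: "ax_var \<Rightarrow> complex mat"
    by (rule df_const_emul) (use Ed cd in \<open>auto simp: df_econst\<close>)
  have d2: "df n \<rho> ?l2 \<longleftrightarrow> df n \<rho> E" for n and \<rho> :: "ax_var \<Rightarrow> complex mat"
    unfolding d1[symmetric] using df_emul[of "econst (adj Q)" ?l1 n \<rho>] Qd Ed k cd by (auto simp: df_econst)
  have d3: "df n \<rho> ?l \<longleftrightarrow> df n \<rho> E" for n and \<rho> :: "ax_var \<Rightarrow> complex mat"
    unfolding d2[symmetric] using df_emul[of "elin k XVar T'" ?l2 n \<rho>] Qd Ed k cd by (auto simp: df_elin)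
  have e1: "df n \<rho> ?f1 \<longleftrightarrow> df n \<rho> E" for n and \<rho> :: "ax_var \<Rightarrow> complex mat"
    unfolding d1[symmetric] using df_emul[of "econst (adj c)" ?l1 n \<rho>] Qd Ed k cd by (auto simp: df_econst)
  have e4: "df n \<rho> E \<Longrightarrow> df n \<rho> ?f2 \<and> df n \<rho> ?f3 \<and> df n \<rho> ?f4" for n and \<rho> :: "ax_var \<Rightarrow> complex mat"
    using d3[of n \<rho>] Qd Ed k cd by (simp add: df_emul(1) df_econst)
  have e5: "df n \<rho> ?f \<longleftrightarrow> df n \<rho> E" for n and \<rho> :: "ax_var \<Rightarrow> complex mat"
    using e1[of n \<rho>] e4[of n \<rho>] cd by (auto simp: df_eadd)
  show ?thesis
  proof (rule exI[of _ ?l], rule exI[of _ ?f], intro conjI o3 p5 allI ballI)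
    fix n A X assume A: "A \<in> herm_tuples n h" and X: "X \<in> herm_tuples n g"
    then have Am: "A \<in> mats n n h" and Xm: "X \<in> mats n n g" by (simp_all add: herm_tuples_iff)
    let ?\<rho> = "env_ax A X"
    have ok: "env_ok ?V AVar n ?\<rho> A"
      using A matsD(2)[OF Am] matsD(2)[OF Xm] by (auto simp: env_ok_def vars_ax_def)
    have env': "\<And>v. v \<in> ?V \<Longrightarrow> ?\<rho> v \<in> carrier_mat n n" using ok by (auto simp: env_ok_def)
    show "df n ?\<rho> ?l \<longleftrightarrow> det (P n A) \<noteq> 0" unfolding d3 using E[OF ok] by simp
    show "df n ?\<rho> ?f \<longleftrightarrow> det (P n A) \<noteq> 0" unfolding e5 using E[OF ok] by simp
    show "det (P n A) \<noteq> 0 \<longrightarrow> ev n ?\<rho> ?l = tl' n X * bn n A \<and>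
        ev n ?\<rho> ?f = adj (cn n) * (minv (P n A) * cn n) + adj (bn n A) * (tl' n X * bn n A)"
    proof
      assume d: "det (P n A) \<noteq> 0"
      then have dE: "df n ?\<rho> E" and eE: "ev n ?\<rho> E = minv (P n A)" using E[OF ok] by auto
      note df = dE d1[of n ?\<rho>] d2[of n ?\<rho>] d3[of n ?\<rho>] e1[of n ?\<rho>] e4[OF dE]
      have ap: "adj (minv (P n A)) = minv (P n A)"
        by (rule hermitian_minv[OF pen_carrier d pen_herm[OF A zero_tuple_herm]])
      note md = carrier_matD[OF minv_props(1)[OF pen_carrier d]]
      have cn: "cn n = kron c (1\<^sub>m n)" by (simp add: cn_def c_def)
      have q1: "ev n ?\<rho> ?l1 = minv (P n A) * cn n"
        using ev_emul[OF env' oE over_econst[OF cc(1)]] df eE cn by (simp add: ev_econst df_econst df_elin)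
      have q2: "ev n ?\<rho> ?l2 = bn n A"
        using ev_emul[OF env' over_econst[OF cc(4)] o1] df q1 by (simp add: bn_def ev_econst df_econst)
      have "ev n ?\<rho> (elin k XVar T') = tl' n X"
        by (rule ev_elin[where V = ?V, OF env' T'_mats _ Xm]) (auto simp: vars_ax_def)
      then have q3: "ev n ?\<rho> ?l = tl' n X * bn n A"
        using ev_emul[OF env' oT o2] df q2 by (simp add: df_elin)
      have r1: "ev n ?\<rho> ?f1 = adj (cn n) * (minv (P n A) * cn n)"
        using ev_emul[OF env' over_econst[OF cc(2)] o1] df q1 cn by (simp add: ev_econst df_econst df_elin)
      have r2: "ev n ?\<rho> ?f2 = Qn n * (tl' n X * bn n A)"
        using ev_emul[OF env' over_econst[OF cc(3)] o3] df q3 by (simp add: ev_econst df_econst df_elin)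
      have r3: "ev n ?\<rho> ?f3 = minv (P n A) * (Qn n * (tl' n X * bn n A))"
        using ev_emul[OF env' oE p2] df r2 eE by simp
      have r4: "ev n ?\<rho> ?f4 = adj (cn n) * (minv (P n A) * (Qn n * (tl' n X * bn n A)))"
        using ev_emul[OF env' over_econst[OF cc(2)] p3] df r3 cn by (simp add: ev_econst df_econst df_elin)
      have ab: "adj (bn n A) = adj (cn n) * (minv (P n A) * Qn n)"
        using md cn_dim Qd by (simp add: bn_def ap mm_assoc)
      have "adj (bn n A) * (tl' n X * bn n A) = adj (cn n) * (minv (P n A) * (Qn n * (tl' n X * bn n A)))"
        unfolding ab using md cn_dim Qd bn_dim by (simp add: mm_assoc del: adj_kron)
      then have "ev n ?\<rho> ?f = adj (cn n) * (minv (P n A) * cn n) + adj (bn n A) * (tl' n X * bn n A)"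
        using ev_eadd[OF env' p1 p4] df r1 r4 by simp
      with q3 show "ev n ?\<rho> ?l = tl' n X * bn n A \<and>
        ev n ?\<rho> ?f = adj (cn n) * (minv (P n A) * cn n) + adj (bn n A) * (tl' n X * bn n A)" by simp
    qed
  qed
qed

lemma dom_ver_iff: "(A, X) \<in> dom_ver h g R n \<longleftrightarrow>
    A \<in> herm_tuples n h \<and> X \<in> herm_tuples n g \<and> det (pen n A X) \<noteq> 0 \<and> det (P n A) \<noteq> 0"
  by (auto simp: dom_ver_def dom_r_def nc_space_def zero_tuple_herm)

lemma parts_3_4:
  assumes V: "V = V_T R"
  shows "\<exists>k T' w.
        1 \<le> k \<and> length T' = g \<and> set T' \<subseteq> carrier_mat k k \<and>
        nc_mat_over (vars_a h) k k w \<and>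
        nc_mat_symmetric_a h w \<and>
        (\<forall>n \<ge> 1. \<forall>A \<in> proj_a (dom_ver h g R) n. nc_mat_defined n (env_a A) w) \<and>
        (\<forall>n \<ge> 1. dom_ver_plus h g R n =
           {(A, X) \<in> dom_ver h g R n.
              let W = nc_mat_eval n (env_a A) w in
              psd W \<and> pd (1\<^sub>m (k * n) - psd_sqrt W * lin_pencil k n T' X * psd_sqrt W)}) \<and>
        (\<exists>l f.
           nc_mat_over (vars_ax h g) k 1 l \<and>
           (\<forall>n \<ge> 1. \<forall>(A, X) \<in> dom_ver h g R n. nc_mat_defined n (env_ax A X) l) \<and>
           linear_in_x h g l \<and>
           set_nc_expr f \<subseteq> vars_ax h g \<and>
           nc_symmetric_ax h g f \<and>
           (\<forall>n \<ge> 1. \<forall>(A, X) \<in> dom_ver h g R n. nc_eval n (env_ax A X) f \<noteq> None) \<and>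
           affine_in_x h g f \<and>
           (\<forall>n \<ge> 1. \<forall>(A, X) \<in> dom_ver_plus h g R n.
              let W = nc_mat_eval n (env_a A) w; L = nc_mat_eval n (env_ax A X) l in
              realization_eval R n A X =
                mat_adjoint L * psd_sqrt W *
                  minv (1\<^sub>m (k * n) - psd_sqrt W * lin_pencil k n T' X * psd_sqrt W) *
                  psd_sqrt W * L
                + the (nc_eval n (env_ax A X) f)))"
proof -
  obtain w where ow: "nc_mat_over (vars_a h) k k w" and
    w: "\<And>n A. A \<in> herm_tuples n h \<Longrightarrow> df n (env_a A) w \<longleftrightarrow> det (P n A) \<noteq> 0"
       "\<And>n A. A \<in> herm_tuples n h \<Longrightarrow> det (P n A) \<noteq> 0 \<Longrightarrow> ev n (env_a A) w = W n A"
    using w_exists by blast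
  obtain l F where ol: "nc_mat_over (vars_ax h g) k 1 l" and oF: "nc_mat_over (vars_ax h g) 1 1 F" and
    lF: "\<And>n A X. A \<in> herm_tuples n h \<Longrightarrow> X \<in> herm_tuples n g \<Longrightarrow> df n (env_ax A X) l \<longleftrightarrow> det (P n A) \<noteq> 0"
       "\<And>n A X. A \<in> herm_tuples n h \<Longrightarrow> X \<in> herm_tuples n g \<Longrightarrow> df n (env_ax A X) F \<longleftrightarrow> det (P n A) \<noteq> 0"
       "\<And>n A X. A \<in> herm_tuples n h \<Longrightarrow> X \<in> herm_tuples n g \<Longrightarrow> det (P n A) \<noteq> 0 \<Longrightarrow> ev n (env_ax A X) l = tl' n X * bn n A"
       "\<And>n A X. A \<in> herm_tuples n h \<Longrightarrow> X \<in> herm_tuples n g \<Longrightarrow> det (P n A) \<noteq> 0 \<Longrightarrow>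
          ev n (env_ax A X) F = adj (cn n) * (minv (P n A) * cn n) + adj (bn n A) * (tl' n X * bn n A)"
    using l_f_exist by blast
  let ?f = "F $$ (0, 0)"
  have env_ax: "\<And>v. v \<in> vars_ax h g \<Longrightarrow> env_ax A X v \<in> carrier_mat n n"
    if "A \<in> herm_tuples n h" "X \<in> herm_tuples n g" for A X n
    using that by (auto simp: vars_ax_def herm_tuples_iff dest: matsD)
  have f_def: "nc_eval n (env_ax A X) ?f \<noteq> None \<longleftrightarrow> det (P n A) \<noteq> 0"
    if "A \<in> herm_tuples n h" "X \<in> herm_tuples n g" for A X n
    using lF(2)[OF that] df_single[OF oF, of n "env_ax A X"] by simp
  have f_eval: "nc_eval n (env_ax A X) ?f = Some (ev n (env_ax A X) F)"
    if "A \<in> herm_tuples n h" "X \<in> herm_tuples n g" "det (P n A) \<noteq> 0" for A X n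
    using ev_single[OF env_ax[OF that(1,2)] oF] lF(2)[OF that(1,2)] that(3) by auto
  have at: "adj (tl' n X) = tl' n X" if "X \<in> herm_tuples n g" for n X
    by (rule plin_herm[OF T'_mats T'_herm that])
  have ap: "adj (minv (P n A)) = minv (P n A)" "dim_row (minv (P n A)) = e * n" "dim_col (minv (P n A)) = e * n"
    if "A \<in> herm_tuples n h" "det (P n A) \<noteq> 0" for n A
    using hermitian_minv[OF pen_carrier that(2) pen_herm[OF that(1) zero_tuple_herm]]
      carrier_matD[OF minv_props(1)[OF pen_carrier that(2)]] by auto
  have GG_eq: "1\<^sub>m (k * n) - psd_sqrt (W n A) * lin_pencil k n T' X * psd_sqrt (W n A) = GG n A X"
    if "psd (W n A)" for n A X
    using psd_sqrt[OF that] by (simp add: GG_def lin_pencil_plin mm_assoc W_dim)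
  have 1: "nc_mat_symmetric_a h w"
    unfolding nc_mat_symmetric_a_def
  proof (intro allI ballI impI)
    fix n A assume A: "A \<in> herm_tuples n h" and "df n (env_a A) w"
    then have d: "det (P n A) \<noteq> 0" using w by simp
    show "adj (ev n (env_a A) w) = ev n (env_a A) w"
      unfolding w(2)[OF A d] using ap[OF A d] Qd by (simp add: W_def mm_assoc del: adj_kron)
  qed
  have 2: "dom_ver_plus h g R n = {(A, X) \<in> dom_ver h g R n.
              let W = nc_mat_eval n (env_a A) w in
              psd W \<and> pd (1\<^sub>m (k * n) - psd_sqrt W * lin_pencil k n T' X * psd_sqrt W)}" (is "_ = ?S") for n
  proof (rule Set.set_eqI)
    fix z :: "complex mat list \<times> complex mat list"
    obtain A X where z: "z = (A, X)" by (cases z)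
    show "z \<in> dom_ver_plus h g R n \<longleftrightarrow> z \<in> ?S"
    proof (cases "A \<in> herm_tuples n h \<and> X \<in> herm_tuples n g \<and> det (P n A) \<noteq> 0 \<and> psd (W n A)")
      case True
      \<comment> \<open>Membership in \<open>dom_ver\<close> includes invertibility of the pencil at
        \<open>(A, X)\<close>, which positive definiteness of \<open>GG\<close> provides.\<close>
      then show ?thesis
        using det_pen_of_pd[of A n X] z
        by (auto simp: dom_ver_plus_V_iff[OF V] dom_ver_iff w(2) GG_eq Let_def)
    next
      case False
      then show ?thesis using z
        by (auto simp: dom_ver_plus_V_iff[OF V] dom_ver_iff w(2) Let_def)
    qed
  qed
  have 3: "linear_in_x h g l"
    unfolding linear_in_x_def
  proof (intro allI ballI impI, elim conjE)
    fix n A X Y and s t :: real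
    assume A: "A \<in> herm_tuples n h" and X: "X \<in> herm_tuples n g" and Y: "Y \<in> herm_tuples n g"
      and "df n (env_ax A X) l"
    then have d: "det (P n A) \<noteq> 0" using lF(1) by simp
    have XY: "X \<in> mats n n g" "Y \<in> mats n n g" using X Y by (auto simp: herm_tuples_iff)
    show "ev n (env_ax A (tuple_comb s t X Y)) l =
      complex_of_real s \<cdot>\<^sub>m ev n (env_ax A X) l + complex_of_real t \<cdot>\<^sub>m ev n (env_ax A Y) l"
      unfolding lF(3)[OF A X d] lF(3)[OF A Y d] lF(3)[OF A tuple_comb_herm[OF X Y] d] plin_tuple_comb[OF T'_mats XY]
      using bn_dim by (simp add: mat_ring)
  qed
  have 4: "nc_symmetric_ax h g ?f"
    unfolding nc_symmetric_ax_def
  proof (intro allI ballI impI, clarify)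
    fix n A X M assume AX: "(A, X) \<in> nc_space h g n" and M: "nc_eval n (env_ax A X) ?f = Some M"
    then have A: "A \<in> herm_tuples n h" and X: "X \<in> herm_tuples n g" by (auto simp: nc_space_def)
    have d: "det (P n A) \<noteq> 0" using f_def[OF A X] M by simp
    have "M = ev n (env_ax A X) F" using M f_eval[OF A X d] by simp
    then show "adj M = M"
      using ap[OF A d] cn_dim bn_dim at[OF X] by (simp add: lF(4)[OF A X d] mm_assoc)
  qed
  have 5: "affine_in_x h g ?f"
    unfolding affine_in_x_def
  proof (intro allI ballI impI, elim conjE)
    fix n A X Y and t :: real and M N K
    assume A: "A \<in> herm_tuples n h" and X: "X \<in> herm_tuples n g" and Y: "Y \<in> herm_tuples n g"
      and M: "nc_eval n (env_ax A X) ?f = Some M" and N: "nc_eval n (env_ax A Y) ?f = Some N"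
      and K: "nc_eval n (env_ax A (tuple_comb (1 - t) t X Y)) ?f = Some K"
    have d: "det (P n A) \<noteq> 0" using f_def[OF A X] M by simp
    have XY: "X \<in> mats n n g" "Y \<in> mats n n g" using X Y by (auto simp: herm_tuples_iff)
    note Z = tuple_comb_herm[OF X Y]
    have eqs: "M = ev n (env_ax A X) F" "N = ev n (env_ax A Y) F" "K = ev n (env_ax A (tuple_comb (1 - t) t X Y)) F"
      using M N K f_eval[OF A X d] f_eval[OF A Y d] f_eval[OF A Z d] by auto
    show "K = complex_of_real (1 - t) \<cdot>\<^sub>m M + complex_of_real t \<cdot>\<^sub>m N"
      unfolding eqs lF(4)[OF A X d] lF(4)[OF A Y d] lF(4)[OF A Z d] plin_tuple_comb[OF T'_mats XY]
      using ap(2,3)[OF A d] cn_dim bn_dim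
      by (intro eq_matI) (simp_all add: mat_ring smult_add_mm ring_distribs del: index_mult_mat(1))
  qed
  have 6: "let W = nc_mat_eval n (env_a A) w; L = nc_mat_eval n (env_ax A X) l in
              realization_eval R n A X =
                mat_adjoint L * psd_sqrt W *
                  minv (1\<^sub>m (k * n) - psd_sqrt W * lin_pencil k n T' X * psd_sqrt W) *
                  psd_sqrt W * L
                + the (nc_eval n (env_ax A X) ?f)" if "(A, X) \<in> dom_ver_plus h g R n" for n A X
  proof -
    have A: "A \<in> herm_tuples n h" and X: "X \<in> herm_tuples n g" and d: "det (P n A) \<noteq> 0" and ps: "psd (W n A)" and pd: "pd (GG n A X)"
      using that by (auto simp: dom_ver_plus_V_iff[OF V])
    note s = psd_sqrt[OF ps]
    note Gd = carrier_matD[OF minv_props(1)[OF GG_carrier(1)[OF ps X] pd_det[OF pd]]]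
    show ?thesis
      unfolding Let_def w(2)[OF A d] lF(3)[OF A X d] f_eval[OF A X d] option.sel lF(4)[OF A X d] GG_eq[OF ps]
        realization_eval_expansion[OF A X d ps pd]
      using s(3-) Gd bn_dim cn_dim ap(2,3)[OF A d] at[OF X]
      by (intro eq_matI) (simp_all add: W_dim mm_assoc algebra_simps del: index_mult_mat(1))
  qed
  have "k \<ge> 1" "length T' = g" "set T' \<subseteq> carrier_mat k k" using T'_mats by (auto simp: k_def mats_def)
  moreover have "\<forall>n \<ge> 1. \<forall>A \<in> proj_a (dom_ver h g R) n. nc_mat_defined n (env_a A) w"
    using w(1) by (auto simp: proj_a_def dom_ver_iff)
  moreover have "\<forall>n \<ge> 1. \<forall>(A, X) \<in> dom_ver h g R n. nc_mat_defined n (env_ax A X) l"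
    "\<forall>n \<ge> 1. \<forall>(A, X) \<in> dom_ver h g R n. nc_eval n (env_ax A X) ?f \<noteq> None"
    using lF(1) f_eval by (auto simp: dom_ver_iff)
  moreover have "set_nc_expr ?f \<subseteq> vars_ax h g" using oF by (auto simp: over_iff)
  moreover have "\<forall>n \<ge> 1. \<forall>(A, X) \<in> dom_ver_plus h g R n.
              let W = nc_mat_eval n (env_a A) w; L = nc_mat_eval n (env_ax A X) l in
              realization_eval R n A X =
                mat_adjoint L * psd_sqrt W *
                  minv (1\<^sub>m (k * n) - psd_sqrt W * lin_pencil k n T' X * psd_sqrt W) *
                  psd_sqrt W * L
                + the (nc_eval n (env_ax A X) ?f)"
    using 6 by blast
  ultimately show ?thesis using 1 2 3 4 5 ow ol by blast
qed

end

section \<open>Subspaces of column space\<close>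

text \<open>Subspaces are kept as sets of one-column matrices, so that bases, coordinates and
  inverses all stay within matrix products.\<close>

definition colspace :: "nat \<Rightarrow> complex mat set \<Rightarrow> bool" where
  "colspace e K \<longleftrightarrow> K \<subseteq> carrier_mat e 1 \<and> 0\<^sub>m e 1 \<in> K \<and> (\<forall>x\<in>K. \<forall>y\<in>K. x + y \<in> K) \<and>
     (\<forall>z. \<forall>x\<in>K. z \<cdot>\<^sub>m x \<in> K)"

lemma mult_one_one:
  fixes z w :: "complex mat"
  assumes "dim_col z = 1" "dim_row w = 1" "dim_col w = 1"
  shows "z * w = (w $$ (0, 0)) \<cdot>\<^sub>m z"
  by (rule eq_matI) (use assms in \<open>auto simp: times_mat_index One_nat_def simp del: index_mult_mat(1)\<close>)

text \<open>If \<open>m\<close> exceeded \<open>e\<close>, padding by zeros would make both matrices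
  square; then the product in the other order is the identity as well, but its last rows are
  zero.\<close>

lemma left_inverse_dim_le:
  fixes H E :: "complex mat"
  assumes E: "E \<in> carrier_mat e m" and H: "H \<in> carrier_mat m e" and HE: "H * E = 1\<^sub>m m"
  shows "m \<le> e"
proof (rule ccontr)
  assume "\<not> m \<le> e"
  then obtain d where m: "m = e + d" and d: "d > 0" using less_imp_add_positive[of e m] by auto
  note dd = carrier_matD[OF E] carrier_matD[OF H]
  let ?H = "H * adj (iota1 e d)" and ?E = "iota1 e d * E"
  have c: "?H \<in> carrier_mat m m" "?E \<in> carrier_mat m m" using dd m by (auto intro!: carrier_matI)
  have "?H * ?E = H * ((adj (iota1 e d) * iota1 e d) * E)" using dd by (simp add: mm_assoc)
  also have "\<dots> = 1\<^sub>m m" using dd HE by (simp add: iota_orth mm_one_left)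
  finally have "?E * ?H = 1\<^sub>m m" using inverse_comm[OF c] by simp
  then have "(iota1 e d * (E * ?H)) $$ (e, e) = 1" using dd m d by (simp add: mm_assoc)
  moreover have "(iota1 e d * (E * ?H)) $$ (e, e) = 0" using dd m d by (subst iota1_mult_index) auto
  ultimately show False by simp
qed

text \<open>Take \<open>m\<close> maximal such that an \<open>E\<close> with a left inverse maps
  into \<open>K\<close>. An \<open>x\<close> in \<open>K\<close> with \<open>E * (H * x)\<close>
  different from \<open>x\<close> leaves a nonzero residue in \<open>K\<close> that \<open>H\<close>
  kills, and appending it to \<open>E\<close> contradicts maximality.\<close>

lemma colspace_basis:
  assumes K: "colspace e K"
  shows "\<exists>m E H. m \<le> e \<and> E \<in> carrier_mat e m \<and> H \<in> carrier_mat m e \<and> H * E = 1\<^sub>m m \<and>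
    (\<forall>x\<in>K. E * (H * x) = x) \<and> (\<forall>y\<in>carrier_mat m 1. E * y \<in> K)"
proof -
  define Pr where "Pr m \<longleftrightarrow> (\<exists>E H. E \<in> carrier_mat e m \<and> H \<in> carrier_mat m e \<and> H * E = 1\<^sub>m m \<and>
    (\<forall>y\<in>carrier_mat m 1. E * y \<in> K))" for m
  have K0: "K \<subseteq> carrier_mat e 1" "0\<^sub>m e 1 \<in> K" and Ka: "\<And>x y. x \<in> K \<Longrightarrow> y \<in> K \<Longrightarrow> x + y \<in> K"
    and Ks: "\<And>z x. x \<in> K \<Longrightarrow> z \<cdot>\<^sub>m x \<in> K" using K by (auto simp: colspace_def)
  have le: "m \<le> e" if "Pr m" for m using that left_inverse_dim_le unfolding Pr_def by blast
  have P0: "Pr 0"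
    unfolding Pr_def using K0
    by (intro exI[of _ "0\<^sub>m e 0"] exI[of _ "0\<^sub>m 0 e"]) (auto simp: mm_zero_left intro!: eq_matI)
  have fin: "finite {m. Pr m}" using le by (auto intro!: finite_subset[of _ "{..e}"])
  define m where "m = Max {m. Pr m}"
  have "Pr m" unfolding m_def using Max_in[OF fin] P0 by blast
  then obtain E H where E: "E \<in> carrier_mat e m" and H: "H \<in> carrier_mat m e" and HE: "H * E = 1\<^sub>m m"
    and EK: "\<And>y. y \<in> carrier_mat m 1 \<Longrightarrow> E * y \<in> K" by (auto simp: Pr_def)
  note dd = carrier_matD[OF E] carrier_matD[OF H]
  have HEX: "H * (E * X) = X" if "dim_row X = m" for X using mm_assoc_eq[OF HE, of X] dd that by (simp add: mm_one_left)
  have "E * (H * x) = x" if x: "x \<in> K" for x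
  proof (rule ccontr)
    assume neq: "E * (H * x) \<noteq> x"
    note xd = carrier_matD[OF subsetD[OF K0(1) x]]
    define z where "z = x + (-1) \<cdot>\<^sub>m (E * (H * x))"
    have zd: "dim_row z = e" "dim_col z = 1" using dd xd by (auto simp: z_def)
    have zK: "z \<in> K" unfolding z_def by (intro Ka x Ks EK) (use dd xd in auto)
    have Hz: "H * z = 0\<^sub>m m 1"
      by (rule eq_matI) (use dd xd in \<open>simp_all add: z_def mat_ring HEX del: index_mult_mat(1)\<close>)
    have "z \<noteq> 0\<^sub>m e 1"
    proof
      assume z0: "z = 0\<^sub>m e 1"
      have "E * (H * x) = x"
      proof (rule eq_matI)
        fix i j assume "i < dim_row x" "j < dim_col x"
        then show "(E * (H * x)) $$ (i, j) = x $$ (i, j)"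
          using arg_cong[OF z0, of "\<lambda>M. M $$ (i, j)"] dd xd by (simp add: z_def del: index_mult_mat(1))
      qed (use dd xd in auto)
      then show False using neq by simp
    qed
    moreover have zc: "z \<in> carrier_mat e 1" using zd by auto
    ultimately have "0 < qf (1\<^sub>m e) z" using pdD(3)[OF pd_one, of z e] by simp
    then have N: "(adj z * z) $$ (0, 0) \<noteq> 0" using zd by (auto simp: qf_def mm_one_left simp del: index_mult_mat(1))
    define b where "b = (1 / (adj z * z) $$ (0, 0)) \<cdot>\<^sub>m adj z"
    have bd: "dim_row b = 1" "dim_col b = e" using zd by (auto simp: b_def)
    have bz: "b * z = 1\<^sub>m 1"
      by (rule eq_matI) (use N zd in \<open>auto simp: b_def mm_smult_left simp del: index_mult_mat(1)\<close>)
    \<comment> \<open>\<open>b\<close> sends \<open>z\<close> to 1; subtracting its restriction to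
      the range of \<open>E\<close> makes it vanish there without changing its value at
      \<open>z\<close>, as \<open>H * z = 0\<close>. The result is the new row of the left
      inverse.\<close>
    define b' where "b' = b + (-1) \<cdot>\<^sub>m (b * (E * H))"
    have b'd: "dim_row b' = 1" "dim_col b' = e" using bd dd by (auto simp: b'_def)
    have b'E: "b' * E = 0\<^sub>m 1 m"
      by (rule eq_matI) (use bd dd in \<open>simp_all add: b'_def mat_ring HE del: index_mult_mat(1)\<close>)
    have b'z: "b' * z = 1\<^sub>m 1"
      by (rule eq_matI) (use bd dd zd Hz bz in \<open>simp_all add: b'_def mat_ring del: index_mult_mat(1)\<close>)
    let ?i = "iota1 m 1" and ?j = "iota2 m 1"
    define E1 where "E1 = E * adj ?i + z * adj ?j"
    define H1 where "H1 = ?i * H + ?j * b'"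
    have p: "H * (E * X) = X" "b' * (E * X) = 0\<^sub>m 1 (dim_col X)" if "dim_row X = m" for X
      using mm_assoc_eq[OF b'E, of X] HEX that bd dd b'd by (simp_all add: mm_zero_left)
    have q: "H * (z * X) = 0\<^sub>m m (dim_col X)" "b' * (z * X) = X" if "dim_row X = 1" for X
      using mm_assoc_eq[OF Hz, of X] mm_assoc_eq[OF b'z, of X] that dd b'd zd by (simp_all add: mm_zero_left mm_one_left)
    have "H1 * E1 = ?i * adj ?i + ?j * adj ?j"
      unfolding H1_def E1_def
      by (rule eq_matI) (use dd zd b'd in \<open>simp_all add: mat_ring p q del: index_mult_mat(1)\<close>)
    then have "H1 * E1 = 1\<^sub>m (m + 1)" by (simp add: iota_sum)
    moreover have "E1 \<in> carrier_mat e (m + 1)" "H1 \<in> carrier_mat (m + 1) e"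
      using dd zd b'd by (auto simp: E1_def H1_def intro!: carrier_matI)
    moreover have "E1 * y \<in> K" if y: "y \<in> carrier_mat (m + 1) 1" for y
    proof -
      note yd = carrier_matD[OF y]
      have "E1 * y = E * (adj ?i * y) + z * (adj ?j * y)"
        using dd zd yd by (simp add: E1_def mat_ring)
      also have "z * (adj ?j * y) = ((adj ?j * y) $$ (0, 0)) \<cdot>\<^sub>m z"
        by (rule mult_one_one) (use zd yd in auto)
      finally have eq: "E1 * y = E * (adj ?i * y) + ((adj ?j * y) $$ (0, 0)) \<cdot>\<^sub>m z" .
      show ?thesis unfolding eq by (intro Ka Ks zK EK) (use yd in \<open>auto intro!: carrier_matI\<close>)
    qed
    ultimately have "Pr (m + 1)" unfolding Pr_def by blast
    then have "m + 1 \<le> m" unfolding m_def using Max_ge[OF fin] by blast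
    then show False by simp
  qed
  then show ?thesis using le[OF \<open>Pr m\<close>] E H HE EK by blast
qed

text \<open>\<open>E\<close> times the inverse square root of its Gram matrix, the isometric factor
  of the polar decomposition, has orthonormal columns and the same range.\<close>

lemma orthonormal_colspace_basis:
  assumes "colspace e K"
  shows "\<exists>m V. V \<in> carrier_mat e m \<and> adj V * V = 1\<^sub>m m \<and> (\<forall>x\<in>K. \<exists>y\<in>carrier_mat m 1. x = V * y) \<and>
    (\<forall>y\<in>carrier_mat m 1. V * y \<in> K)"
proof -
  obtain m E H where E: "E \<in> carrier_mat e m" and H: "H \<in> carrier_mat m e" and HE: "H * E = 1\<^sub>m m"
    and KE: "\<And>x. x \<in> K \<Longrightarrow> E * (H * x) = x" and EK: "\<And>y. y \<in> carrier_mat m 1 \<Longrightarrow> E * y \<in> K"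
    using colspace_basis[OF assms] by blast
  note dd = carrier_matD[OF E] carrier_matD[OF H]
  have "pd (adj E * (1\<^sub>m e * E))" by (rule pd_sandwich[OF pd_one, of _ _ H]) (use dd HE in auto)
  then have pd: "pd (adj E * E)" using dd by (simp add: mm_one_left)
  let ?S = "psd_sqrt (adj E * E)"
  note s = psd_sqrt[OF pd_imp_psd[OF pd]]
  have sc: "?S \<in> carrier_mat m m" using s dd by auto
  have "det ?S * det ?S \<noteq> 0" using det_mult[OF sc sc] s(2) pd_det[OF pd] by simp
  then have ds: "det ?S \<noteq> 0" by auto
  note i = minv_props[OF sc ds] hermitian_minv[OF sc ds s(5)]
  note d = carrier_matD[OF i(1)] carrier_matD[OF sc] dd
  define V where "V = E * minv ?S"
  have "adj V * V = minv ?S * ((adj E * E) * minv ?S)" using d i by (simp add: V_def mm_assoc)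
  also have "\<dots> = minv ?S * ((?S * ?S) * minv ?S)" by (simp add: s(2))
  also have "\<dots> = 1\<^sub>m m" using d mm_assoc_eq[OF i(3), of "1\<^sub>m m"] by (simp add: mm_assoc i mat_ring)
  finally have 1: "adj V * V = 1\<^sub>m m" .
  have V: "V \<in> carrier_mat e m" using d by (auto simp: V_def intro!: carrier_matI)
  show ?thesis
  proof (intro exI[of _ m] exI[of _ V] conjI V 1 ballI)
    fix x assume x: "x \<in> K"
    have xd: "dim_row x = e" "dim_col x = 1" using x assms by (auto simp: colspace_def)
    have "V * (?S * (H * x)) = E * ((minv ?S * ?S) * (H * x))" using d xd by (simp add: V_def mm_assoc)
    also have "\<dots> = x" using d xd KE[OF x] by (simp add: i mm_one_left)
    finally show "\<exists>y\<in>carrier_mat m 1. x = V * y" using d xd by (intro bexI[of _ "?S * (H * x)"]) auto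
  next
    fix y :: "complex mat" assume y: "y \<in> carrier_mat m 1"
    have "V * y = E * (minv ?S * y)" using carrier_matD[OF y] d by (simp add: V_def mm_assoc)
    moreover have "minv ?S * y \<in> carrier_mat m 1" using carrier_matD[OF y] d by (intro carrier_matI) simp_all
    ultimately show "V * y \<in> K" using EK by simp
  qed
qed

lemma colmat_image_iff: "dim_col x = 1 \<Longrightarrow> x \<in> colmat ` A \<longleftrightarrow> col x 0 \<in> A"
proof
  assume x: "dim_col x = 1" and "x \<in> colmat ` A"
  then obtain v where v: "v \<in> A" "x = colmat v" by auto
  have "col (colmat v) 0 = v" by (rule eq_vecI) auto
  then show "col x 0 \<in> A" using v by simp
next
  assume x: "dim_col x = 1" and "col x 0 \<in> A"
  then have "colmat (col x 0) \<in> colmat ` A" by blast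
  then show "x \<in> colmat ` A" by (simp add: colmat_col[OF x])
qed

lemma col_ops:
  assumes "dim_col x = 1" "dim_col y = 1" "dim_row x = dim_row y"
  shows "col (x + y) 0 = col x 0 + col y 0" "col (z \<cdot>\<^sub>m x) 0 = z \<cdot>\<^sub>v col x 0"
  using assms by (auto intro!: eq_vecI)

lemma col_mult: "dim_col M = dim_row y \<Longrightarrow> dim_col y = 1 \<Longrightarrow> col (M * y) 0 = M *\<^sub>v col y 0"
  by (auto intro!: eq_vecI)

section \<open>The span of the ranges of the coefficients of x and its inclusion\<close>

context wf_real
begin

definition rangeT :: "complex vec set" where
  "rangeT = LinearCombinations.module.span class_ring (module_vec TYPE(complex) e) (\<Union>M \<in> set T. mat_range M)"

lemma rangeT_props:
  shows "(\<Union>M \<in> set T. mat_range M) \<subseteq> rangeT"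
    "rangeT \<subseteq> carrier_vec e" "0\<^sub>v e \<in> rangeT" "x \<in> rangeT \<Longrightarrow> y \<in> rangeT \<Longrightarrow> x + y \<in> rangeT"
    "x \<in> rangeT \<Longrightarrow> z \<cdot>\<^sub>v x \<in> rangeT"
proof -
  interpret vec_space "TYPE(complex)" e .
  have S: "(\<Union>M \<in> set T. mat_range M) \<subseteq> carrier_vec e"
    using basic(4) by (auto simp: mat_range_def mats_def)
  show "(\<Union>M \<in> set T. mat_range M) \<subseteq> rangeT" unfolding rangeT_def by (rule in_own_span[OF S])
  have sm: "submodule class_ring rangeT V" unfolding rangeT_def by (rule span_is_submodule[OF S])
  show "rangeT \<subseteq> carrier_vec e" using sm by (auto simp: submodule_def module_vec_def)
  show "0\<^sub>v e \<in> rangeT" using submodule.zero_closed[OF sm] by (simp add: module_vec_def)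
  show "x \<in> rangeT \<Longrightarrow> y \<in> rangeT \<Longrightarrow> x + y \<in> rangeT"
    using submodule.m_closed[OF sm, of x y] by (simp add: module_vec_def)
  show "x \<in> rangeT \<Longrightarrow> z \<cdot>\<^sub>v x \<in> rangeT"
    using submodule.smult_closed[OF sm, of z x] by (simp add: module_vec_def)
qed

lemma rangeT_minimal:
  assumes "(\<Union>M \<in> set T. mat_range M) \<subseteq> N" "N \<subseteq> carrier_vec e" "0\<^sub>v e \<in> N"
    "\<And>x y. x \<in> N \<Longrightarrow> y \<in> N \<Longrightarrow> x + y \<in> N" "\<And>z x. x \<in> N \<Longrightarrow> z \<cdot>\<^sub>v x \<in> N"
  shows "rangeT \<subseteq> N"
proof -
  interpret vec_space "TYPE(complex)" e .
  have "submodule class_ring N V"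
    unfolding submodule_def using assms module_axioms by (auto simp: module_vec_def)
  then show ?thesis unfolding rangeT_def by (rule span_is_subset[OF assms(1)])
qed

text \<open>\<open>V_T\<close> is a choice, so every property of it rests on this existence
  statement.\<close>

lemma inclusion_exists: "\<exists>V. is_inclusion_T R V"
proof -
  have K: "colspace e (colmat ` rangeT)"
    unfolding colspace_def
  proof (intro conjI ballI allI)
    show sub: "colmat ` rangeT \<subseteq> carrier_mat e 1" using carrier_vecD[OF subsetD[OF rangeT_props(2)]] by (auto intro!: carrier_matI)
    have "colmat (0\<^sub>v e) \<in> colmat ` rangeT" using rangeT_props(3) by blast
    then show "0\<^sub>m e 1 \<in> colmat ` rangeT" using colmat_zero[of "0\<^sub>v e" e] by simp
    fix x y z assume x: "x \<in> colmat ` rangeT"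
    then have xd: "dim_row x = e" "dim_col x = 1" using sub by auto
    show "z \<cdot>\<^sub>m x \<in> colmat ` rangeT"
      using x xd rangeT_props(5) by (simp add: colmat_image_iff col_ops)
    assume y: "y \<in> colmat ` rangeT"
    then have yd: "dim_row y = e" "dim_col y = 1" using sub by auto
    show "x + y \<in> colmat ` rangeT"
      using x y xd yd rangeT_props(4) by (simp add: colmat_image_iff col_ops)
  qed
  obtain m V where V: "V \<in> carrier_mat e m" "adj V * V = 1\<^sub>m m"
    and KV: "\<And>x. x \<in> colmat ` rangeT \<Longrightarrow> \<exists>y\<in>carrier_mat m 1. x = V * y"
    and VK: "\<And>y. y \<in> carrier_mat m 1 \<Longrightarrow> V * y \<in> colmat ` rangeT"
    using orthonormal_colspace_basis[OF K] by blast
  have "mat_range V = rangeT"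
  proof
    show "mat_range V \<subseteq> rangeT"
    proof
      fix u assume "u \<in> mat_range V"
      then obtain v where v: "v \<in> carrier_vec m" "u = V *\<^sub>v v" using V by (auto simp: mat_range_def)
      have "V * colmat v \<in> colmat ` rangeT" by (rule VK) (use v in auto)
      then have "colmat u \<in> colmat ` rangeT" using v V by (simp add: colmat_mult)
      moreover have "col (colmat u) 0 = u" by (rule eq_vecI) auto
      ultimately show "u \<in> rangeT" by (simp add: colmat_image_iff)
    qed
    show "rangeT \<subseteq> mat_range V"
    proof
      fix u assume "u \<in> rangeT"
      then obtain y where y: "y \<in> carrier_mat m 1" "colmat u = V * y" using KV by blast
      have "u = col (colmat u) 0" by (rule eq_vecI) auto
      also have "\<dots> = V *\<^sub>v col y 0" unfolding y(2) by (rule col_mult) (use y V in auto)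
      finally show "u \<in> mat_range V" using y(1) V by (auto simp: mat_range_def intro!: image_eqI[of _ _ "col y 0"] carrier_vecI)
    qed
  qed
  then have "is_inclusion_T R V" using V by (auto simp: is_inclusion_T_def rangeT_def)
  then show ?thesis by blast
qed

lemma V_T_props:
  shows "dim_row (V_T R) = e" "adj (V_T R) * V_T R = 1\<^sub>m (dim_col (V_T R))" "mat_range (V_T R) = rangeT"
proof -
  have "is_inclusion_T R (V_T R)" unfolding V_T_def by (rule someI_ex[OF inclusion_exists])
  then show "dim_row (V_T R) = e" "adj (V_T R) * V_T R = 1\<^sub>m (dim_col (V_T R))" "mat_range (V_T R) = rangeT"
    unfolding is_inclusion_T_def rangeT_def by blast+
qed

text \<open>\<open>V * adj V\<close> fixes each vector in the range of \<open>V\<close>, in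
  particular every \<open>T_i x\<close>; comparing the two matrices on all columns gives the
  identity.\<close>

lemma coisometry_V_T: "coisometry_real h g R (V_T R) (dim_col (V_T R))"
proof
  let ?V = "V_T R" and ?m = "dim_col (V_T R)"
  show V: "?V \<in> carrier_mat e ?m" "adj ?V * ?V = 1\<^sub>m ?m" using V_T_props by auto
  fix i assume i: "i < g"
  note Ti = matsD(2)[OF basic(4) i]
  show "?V * (adj ?V * (T ! i)) = T ! i"
  proof (rule mult_right_cancel_inj[of _ e e])
    fix x :: "complex mat" assume x: "x \<in> carrier_mat e 1"
    note d = carrier_matD[OF V(1)] carrier_matD[OF Ti] carrier_matD[OF x]
    have "T ! i *\<^sub>v col x 0 \<in> mat_range (T ! i)" using d by (auto simp: mat_range_def intro!: imageI carrier_vecI)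
    moreover have "T ! i \<in> set T" using i matsD(1)[OF basic(4)] by auto
    ultimately have "T ! i *\<^sub>v col x 0 \<in> mat_range ?V" using V_T_props(3) rangeT_props(1) by blast
    then obtain y where y: "y \<in> carrier_vec ?m" "T ! i *\<^sub>v col x 0 = ?V *\<^sub>v y" by (auto simp: mat_range_def)
    have "(T ! i) * colmat (col x 0) = ?V * colmat y"
      using y d by (simp add: colmat_mult[symmetric])
    then have eq: "(T ! i) * x = ?V * colmat y" using d by (simp add: colmat_col)
    have "?V * (adj ?V * (T ! i)) * x = ?V * (adj ?V * ((T ! i) * x))" using d by (simp add: mm_assoc)
    also have "\<dots> = ?V * ((adj ?V * ?V) * colmat y)" unfolding eq using y d by (simp add: mm_assoc)
    also have "\<dots> = (T ! i) * x" unfolding V(2) eq using y d by (simp add: mm_one_left)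
    finally show "?V * (adj ?V * (T ! i)) * x = (T ! i) * x" .
  next
    show "?V * (adj ?V * (T ! i)) \<in> carrier_mat e e"
      by (rule carrier_matI) (simp_all add: V_T_props(1) carrier_matD[OF Ti])
    show "T ! i \<in> carrier_mat e e" by (rule Ti)
  qed
qed

end

section \<open>Entrywise limits\<close>

text \<open>The size of \<open>f t\<close> is required only eventually, because an inverse has a
  known size only once its matrix has become invertible.\<close>

definition mtends :: "nat \<Rightarrow> nat \<Rightarrow> ('t \<Rightarrow> complex mat) \<Rightarrow> complex mat \<Rightarrow> 't filter \<Rightarrow> bool" where
  "mtends n m f M F \<longleftrightarrow> M \<in> carrier_mat n m \<and> (\<forall>\<^sub>F t in F. f t \<in> carrier_mat n m) \<and>
     (\<forall>i<n. \<forall>j<m. ((\<lambda>t. f t $$ (i, j)) \<longlongrightarrow> M $$ (i, j)) F)"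

lemma mtendsD:
  assumes "mtends n m f M F"
  shows "M \<in> carrier_mat n m" "\<forall>\<^sub>F t in F. f t \<in> carrier_mat n m"
    "i < n \<Longrightarrow> j < m \<Longrightarrow> ((\<lambda>t. f t $$ (i, j)) \<longlongrightarrow> M $$ (i, j)) F"
  using assms by (auto simp: mtends_def)

lemma mtends_cong:
  assumes "mtends n m f M F" "\<forall>\<^sub>F t in F. f t = g t"
  shows "mtends n m g M F"
  unfolding mtends_def
proof (intro conjI allI impI)
  note d = mtendsD[OF assms(1)]
  show "M \<in> carrier_mat n m" by (rule d)
  show "\<forall>\<^sub>F t in F. g t \<in> carrier_mat n m" using d(2) assms(2) by eventually_elim simp
  fix i j assume "i < n" "j < m"
  from d(3)[OF this] show "((\<lambda>t. g t $$ (i, j)) \<longlongrightarrow> M $$ (i, j)) F"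
    by (rule Lim_transform_eventually) (use assms(2) in \<open>auto elim: eventually_mono\<close>)
qed

lemma mtends_const: "M \<in> carrier_mat n m \<Longrightarrow> mtends n m (\<lambda>_. M) M F"
  by (auto simp: mtends_def)

lemma mtends_add:
  assumes "mtends n m f M F" "mtends n m g N F"
  shows "mtends n m (\<lambda>t. f t + g t) (M + N) F"
  unfolding mtends_def
proof (intro conjI allI impI)
  note a = mtendsD[OF assms(1)] and b = mtendsD[OF assms(2)]
  show "M + N \<in> carrier_mat n m" using a b by simp
  show "\<forall>\<^sub>F t in F. f t + g t \<in> carrier_mat n m" using a(2) b(2) by eventually_elim simp
  fix i j assume ij: "i < n" "j < m"
  have "((\<lambda>t. f t $$ (i, j) + g t $$ (i, j)) \<longlongrightarrow> M $$ (i, j) + N $$ (i, j)) F"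
    by (intro tendsto_add a b ij)
  moreover have "\<forall>\<^sub>F t in F. f t $$ (i, j) + g t $$ (i, j) = (f t + g t) $$ (i, j)"
    using b(2) by eventually_elim (use ij in auto)
  ultimately show "((\<lambda>t. (f t + g t) $$ (i, j)) \<longlongrightarrow> (M + N) $$ (i, j)) F"
    using ij carrier_matD[OF b(1)] by (simp add: Lim_transform_eventually)
qed

lemma mtends_smult:
  assumes "mtends n m f M F" "(c \<longlongrightarrow> z) F"
  shows "mtends n m (\<lambda>t. c t \<cdot>\<^sub>m f t) (z \<cdot>\<^sub>m M) F"
  unfolding mtends_def
proof (intro conjI allI impI)
  note a = mtendsD[OF assms(1)]
  show "z \<cdot>\<^sub>m M \<in> carrier_mat n m" using a by simp
  show "\<forall>\<^sub>F t in F. c t \<cdot>\<^sub>m f t \<in> carrier_mat n m" using a(2) by eventually_elim simp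
  fix i j assume ij: "i < n" "j < m"
  have "((\<lambda>t. c t * f t $$ (i, j)) \<longlongrightarrow> z * M $$ (i, j)) F"
    by (intro tendsto_mult a assms(2) ij)
  moreover have "\<forall>\<^sub>F t in F. c t * f t $$ (i, j) = (c t \<cdot>\<^sub>m f t) $$ (i, j)"
    using a(2) by eventually_elim (use ij in auto)
  ultimately show "((\<lambda>t. (c t \<cdot>\<^sub>m f t) $$ (i, j)) \<longlongrightarrow> (z \<cdot>\<^sub>m M) $$ (i, j)) F"
    using ij carrier_matD[OF a(1)] by (simp add: Lim_transform_eventually)
qed

lemma mtends_mult:
  assumes "mtends n m f M F" "mtends m p g N F"
  shows "mtends n p (\<lambda>t. f t * g t) (M * N) F"
  unfolding mtends_def
proof (intro conjI allI impI)
  note a = mtendsD[OF assms(1)] and b = mtendsD[OF assms(2)]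
  show "M * N \<in> carrier_mat n p" using a b by simp
  show "\<forall>\<^sub>F t in F. f t * g t \<in> carrier_mat n p" using a(2) b(2) by eventually_elim simp
  fix i j assume ij: "i < n" "j < p"
  have "((\<lambda>t. \<Sum>k<m. f t $$ (i, k) * g t $$ (k, j)) \<longlongrightarrow> (\<Sum>k<m. M $$ (i, k) * N $$ (k, j))) F"
    by (intro tendsto_sum tendsto_mult a b ij) auto
  moreover have "\<forall>\<^sub>F t in F. (\<Sum>k<m. f t $$ (i, k) * g t $$ (k, j)) = (f t * g t) $$ (i, j)"
    using a(2) b(2) by eventually_elim (use ij in \<open>subst times_mat_index; auto\<close>)
  moreover have "(M * N) $$ (i, j) = (\<Sum>k<m. M $$ (i, k) * N $$ (k, j))"
    using ij carrier_matD[OF b(1)] carrier_matD[OF a(1)] by (subst times_mat_index) auto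
  ultimately show "((\<lambda>t. (f t * g t) $$ (i, j)) \<longlongrightarrow> (M * N) $$ (i, j)) F"
    by (simp add: Lim_transform_eventually del: index_mult_mat(1))
qed

lemma mtends_det:
  assumes "mtends n n f M F"
  shows "((\<lambda>t. det (f t)) \<longlongrightarrow> det M) F"
proof -
  note a = mtendsD[OF assms]
  have "((\<lambda>t. \<Sum>p\<in>{p. p permutes {0..<n}}. signof p * (\<Prod>i = 0..<n. f t $$ (i, p i))) \<longlongrightarrow>
      (\<Sum>p\<in>{p. p permutes {0..<n}}. signof p * (\<Prod>i = 0..<n. M $$ (i, p i)))) F"
  proof (intro tendsto_sum tendsto_mult tendsto_const tendsto_prod)
    fix p i assume "p \<in> {p. p permutes {0..<n}}" "i \<in> {0..<n}"
    then have "i < n" "p i < n" using permutes_in_image[of p "{0..<n}" i] by auto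
    then show "((\<lambda>t. f t $$ (i, p i)) \<longlongrightarrow> M $$ (i, p i)) F" by (rule a(3))
  qed
  moreover have "\<forall>\<^sub>F t in F. (\<Sum>p\<in>{p. p permutes {0..<n}}. signof p * (\<Prod>i = 0..<n. f t $$ (i, p i))) = det (f t)"
    using a(2) by eventually_elim (simp add: det_def')
  ultimately show ?thesis unfolding det_def'[OF a(1)] by (rule Lim_transform_eventually)
qed

lemma mtends_mat_delete:
  assumes "mtends n n f M F" "i < n" "j < n"
  shows "mtends (n - 1) (n - 1) (\<lambda>t. mat_delete (f t) i j) (mat_delete M i j) F"
  unfolding mtends_def
proof (intro conjI allI impI)
  note a = mtendsD[OF assms(1)]
  show "mat_delete M i j \<in> carrier_mat (n - 1) (n - 1)" using a(1) by (rule mat_delete_carrier)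
  show "\<forall>\<^sub>F t in F. mat_delete (f t) i j \<in> carrier_mat (n - 1) (n - 1)"
    using a(2) by eventually_elim (rule mat_delete_carrier)
  fix k l assume kl: "k < n - 1" "l < n - 1"
  let ?k = "if k < i then k else Suc k" and ?l = "if l < j then l else Suc l"
  have kl': "?k < n" "?l < n" using kl assms by auto
  have "mat_delete M i j $$ (k, l) = M $$ (?k, ?l)" if "M \<in> carrier_mat n n" for M :: "complex mat"
    using that kl by (simp add: mat_delete_def)
  then have "\<forall>\<^sub>F t in F. f t $$ (?k, ?l) = mat_delete (f t) i j $$ (k, l)" "mat_delete M i j $$ (k, l) = M $$ (?k, ?l)"
    using a(1) a(2) by (auto elim: eventually_mono)
  then show "((\<lambda>t. mat_delete (f t) i j $$ (k, l)) \<longlongrightarrow> mat_delete M i j $$ (k, l)) F"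
    using Lim_transform_eventually[OF a(3)[OF kl']] by simp
qed

lemma minv_adj_mat:
  assumes "A \<in> carrier_mat n n" "det A \<noteq> (0::complex)"
  shows "minv A = (1 / det A) \<cdot>\<^sub>m adj_mat A"
proof (rule minv_unique(1)[OF assms(1)])
  note j = adj_mat[OF assms(1)]
  show "(1 / det A) \<cdot>\<^sub>m adj_mat A \<in> carrier_mat n n" using j by simp
  show "A * ((1 / det A) \<cdot>\<^sub>m adj_mat A) = 1\<^sub>m n"
    using carrier_matD[OF assms(1)] carrier_matD[OF j(1)] assms(2)
    by (simp add: mm_smult_right j) (auto intro!: eq_matI)
qed

text \<open>By Cramer's rule the entries of the inverse are polynomials in the entries divided by
  the determinant, whose limit is not zero.\<close>

lemma mtends_minv:
  assumes "mtends n n f M F" "det M \<noteq> 0"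
  shows "\<forall>\<^sub>F t in F. det (f t) \<noteq> 0" "mtends n n (\<lambda>t. minv (f t)) (minv M) F"
proof -
  note a = mtendsD[OF assms(1)] and dt = mtends_det[OF assms(1)]
  show e: "\<forall>\<^sub>F t in F. det (f t) \<noteq> 0" by (rule tendsto_imp_eventually_ne[OF dt assms(2)])
  have "mtends n n (\<lambda>t. adj_mat (f t)) (adj_mat M) F"
    unfolding mtends_def
  proof (intro conjI allI impI)
    show "adj_mat M \<in> carrier_mat n n" by (rule adj_mat[OF a(1)])
    show "\<forall>\<^sub>F t in F. adj_mat (f t) \<in> carrier_mat n n" using a(2) by eventually_elim (rule adj_mat)
    fix i j assume ij: "i < n" "j < n"
    have l1: "((\<lambda>t. (-1) ^ (j + i) * det (mat_delete (f t) j i)) \<longlongrightarrow> (-1) ^ (j + i) * det (mat_delete M j i)) F"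
      by (intro tendsto_mult tendsto_const mtends_det[OF mtends_mat_delete[OF assms(1) ij(2,1)]])
    have e1: "\<forall>\<^sub>F t in F. (-1) ^ (j + i) * det (mat_delete (f t) j i) = adj_mat (f t) $$ (i, j)"
      using a(2) by eventually_elim (use ij in \<open>auto simp: adj_mat_def cofactor_def\<close>)
    have eq: "adj_mat M $$ (i, j) = (-1) ^ (j + i) * det (mat_delete M j i)"
      using ij a(1) by (auto simp: adj_mat_def cofactor_def)
    show "((\<lambda>t. adj_mat (f t) $$ (i, j)) \<longlongrightarrow> adj_mat M $$ (i, j)) F"
      unfolding eq by (rule Lim_transform_eventually[OF l1 e1])
  qed
  moreover have "((\<lambda>t. 1 / det (f t)) \<longlongrightarrow> 1 / det M) F" by (intro tendsto_divide tendsto_const dt assms(2))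
  ultimately have "mtends n n (\<lambda>t. (1 / det (f t)) \<cdot>\<^sub>m adj_mat (f t)) ((1 / det M) \<cdot>\<^sub>m adj_mat M) F"
    by (rule mtends_smult)
  moreover have "\<forall>\<^sub>F t in F. (1 / det (f t)) \<cdot>\<^sub>m adj_mat (f t) = minv (f t)"
    using a(2) e by eventually_elim (simp add: minv_adj_mat)
  ultimately show "mtends n n (\<lambda>t. minv (f t)) (minv M) F"
    unfolding minv_adj_mat[OF a(1) assms(2)] by (rule mtends_cong)
qed

lemma mtends_unique:
  assumes "mtends n m f M F" "mtends n m f N F" "F \<noteq> bot"
  shows "M = N"
proof (rule eq_matI)
  fix i j assume "i < dim_row N" "j < dim_col N"
  then have ij: "i < n" "j < m" using mtendsD(1)[OF assms(2)] by auto
  show "M $$ (i, j) = N $$ (i, j)"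
    by (rule tendsto_unique[OF assms(3) mtendsD(3)[OF assms(1) ij] mtendsD(3)[OF assms(2) ij]])
qed (use mtendsD(1)[OF assms(1)] mtendsD(1)[OF assms(2)] in auto)

lemma mtends_qf_nonneg:
  assumes "mtends n n f M F" "x \<in> carrier_mat n 1" "F \<noteq> bot" "\<forall>\<^sub>F t in F. 0 \<le> qf (f t) x"
  shows "0 \<le> qf M x"
proof -
  have "mtends 1 1 (\<lambda>t. adj x * (f t * x)) (adj x * (M * x)) F"
    by (rule mtends_mult[OF mtends_const mtends_mult[OF assms(1) mtends_const]]) (use assms(2) in auto)
  then have "((\<lambda>t. qf (f t) x) \<longlongrightarrow> qf M x) F"
    unfolding qf_def by (intro tendsto_Re) (auto intro: mtendsD(3))
  then show ?thesis using assms(3,4) tendsto_lowerbound by blast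
qed

text \<open>Being defined at the limit forces being defined nearby: only \<open>Inv\<close> is at
  stake, and there the determinant has a nonzero limit.\<close>

lemma mtends_nc_eval:
  assumes "\<And>v. v \<in> V \<Longrightarrow> mtends n n (\<lambda>t. \<rho> t v) (\<rho>0 v) F"
  shows "set_nc_expr p \<subseteq> V \<Longrightarrow> nc_eval n \<rho>0 p = Some M \<Longrightarrow>
    (\<forall>\<^sub>F t in F. nc_eval n (\<rho> t) p \<noteq> None) \<and> mtends n n (\<lambda>t. the (nc_eval n (\<rho> t) p)) M F"
proof (induction p arbitrary: M)
  case (Scal z)
  then show ?case by (auto intro: mtends_const)
next
  case (Var v)
  then show ?case using assms by auto
next
  case (Add p q)
  then obtain M1 M2 where M: "nc_eval n \<rho>0 p = Some M1" "nc_eval n \<rho>0 q = Some M2" "M = M1 + M2"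
    by (auto simp: bind_eq_Some_conv)
  have a: "\<forall>\<^sub>F t in F. nc_eval n (\<rho> t) p \<noteq> None" "mtends n n (\<lambda>t. the (nc_eval n (\<rho> t) p)) M1 F"
    "\<forall>\<^sub>F t in F. nc_eval n (\<rho> t) q \<noteq> None" "mtends n n (\<lambda>t. the (nc_eval n (\<rho> t) q)) M2 F"
    using Add M by auto
  have "\<forall>\<^sub>F t in F. nc_eval n (\<rho> t) (Add p q) \<noteq> None"
    using a(1,3) by eventually_elim auto
  moreover have "\<forall>\<^sub>F t in F. the (nc_eval n (\<rho> t) p) + the (nc_eval n (\<rho> t) q) = the (nc_eval n (\<rho> t) (Add p q))"
    using a(1,3) by eventually_elim auto
  ultimately show ?case unfolding M(3) by (intro conjI mtends_cong[OF mtends_add[OF a(2,4)]])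
next
  case (Mul p q)
  then obtain M1 M2 where M: "nc_eval n \<rho>0 p = Some M1" "nc_eval n \<rho>0 q = Some M2" "M = M1 * M2"
    by (auto simp: bind_eq_Some_conv)
  have a: "\<forall>\<^sub>F t in F. nc_eval n (\<rho> t) p \<noteq> None" "mtends n n (\<lambda>t. the (nc_eval n (\<rho> t) p)) M1 F"
    "\<forall>\<^sub>F t in F. nc_eval n (\<rho> t) q \<noteq> None" "mtends n n (\<lambda>t. the (nc_eval n (\<rho> t) q)) M2 F"
    using Mul M by auto
  have "\<forall>\<^sub>F t in F. nc_eval n (\<rho> t) (Mul p q) \<noteq> None"
    using a(1,3) by eventually_elim auto
  moreover have "\<forall>\<^sub>F t in F. the (nc_eval n (\<rho> t) p) * the (nc_eval n (\<rho> t) q) = the (nc_eval n (\<rho> t) (Mul p q))"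
    using a(1,3) by eventually_elim auto
  ultimately show ?case unfolding M(3) by (intro conjI mtends_cong[OF mtends_mult[OF a(2,4)]])
next
  case (Inv p)
  then obtain N where N: "nc_eval n \<rho>0 p = Some N" "mat_inverse N = Some M"
    by (auto simp: bind_eq_Some_conv)
  have a: "\<forall>\<^sub>F t in F. nc_eval n (\<rho> t) p \<noteq> None" "mtends n n (\<lambda>t. the (nc_eval n (\<rho> t) p)) N F"
    using Inv N by auto
  note m = mat_inverse_SomeD[OF mtendsD(1)[OF a(2)] N(2)]
  note i = mtends_minv[OF a(2) m(1)]
  have ev: "\<forall>\<^sub>F t in F. nc_eval n (\<rho> t) (Inv p) = Some (minv (the (nc_eval n (\<rho> t) p)))"
    using a(1) i(1) mtendsD(2)[OF a(2)] by eventually_elim (auto simp: minv_props(4))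
  have "\<forall>\<^sub>F t in F. nc_eval n (\<rho> t) (Inv p) \<noteq> None"
    using ev by eventually_elim simp
  moreover have "\<forall>\<^sub>F t in F. minv (the (nc_eval n (\<rho> t) p)) = the (nc_eval n (\<rho> t) (Inv p))"
    using ev by eventually_elim simp
  ultimately show ?case unfolding m(2) by (intro conjI mtends_cong[OF i(2)])
qed

section \<open>Minimal realizations are controllable\<close>

text \<open>The range of \<open>E\<close> is stable under \<open>Jn \<Lambda>\<close> and contains
  the columns of \<open>Jn c\<close>, so the solution \<open>z\<close> of \<open>L z = c\<close>
  lies in it. Writing \<open>z = u + B z2\<close>, the part \<open>u\<close> lies in the radical of
  the form of \<open>Jn\<close> on that range; it contributes neither to \<open>adj c * z\<close>
  nor to the compressed equation \<open>L' z2 = adj B * c\<close>.\<close>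

lemma reduction_algebra:
  fixes L Jn \<Lambda> E H c B W J' L' :: "complex mat"
  assumes dims: "Jn \<in> carrier_mat N N" "\<Lambda> \<in> carrier_mat N N" "E \<in> carrier_mat N M" "H \<in> carrier_mat M N"
      "c \<in> carrier_mat N p" "W \<in> carrier_mat M M" "J' \<in> carrier_mat M M"
    and L: "L = Jn - \<Lambda>" and JJ: "Jn * Jn = 1\<^sub>m N" "adj Jn = Jn" and h\<Lambda>: "adj \<Lambda> = \<Lambda>"
    and HE: "H * E = 1\<^sub>m M" and inv\<Lambda>: "E * (H * (Jn * (\<Lambda> * E))) = Jn * (\<Lambda> * E)"
    and invc: "E * (H * (Jn * c)) = Jn * c"
    and B: "B = E * W" and J': "J' * J' = 1\<^sub>m M"
    and key: "adj E * (Jn * (B * (J' * (adj B * (Jn * E))))) = adj E * (Jn * E)"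
    and L': "L' = J' - adj B * (\<Lambda> * B)" and dL: "det L \<noteq> 0" and dL': "det L' \<noteq> 0"
  shows "adj (adj B * c) * (minv L' * (adj B * c)) = adj c * (minv L * c)"
proof -
  note d0 = carrier_matD[OF dims(1)] carrier_matD[OF dims(2)] carrier_matD[OF dims(3)] carrier_matD[OF dims(4)]
    carrier_matD[OF dims(5)] carrier_matD[OF dims(6)] carrier_matD[OF dims(7)]
  have d1: "dim_row L = N" "dim_col L = N" "dim_row B = N" "dim_col B = M" "dim_row L' = M" "dim_col L' = M"
    using d0 by (auto simp: L B L')
  have Lc: "L \<in> carrier_mat N N" "L' \<in> carrier_mat M M" using d1 by auto
  note iL = minv_props[OF Lc(1) dL] and iL' = minv_props[OF Lc(2) dL']
  note d = d0 d1 carrier_matD[OF iL(1)] carrier_matD[OF iL'(1)]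
  have JX: "Jn * (Jn * X) = X" if "dim_row X = N" for X
    using mm_assoc_eq[OF JJ(1), of X] that d by (simp add: mm_one_left)
  have HEX: "H * (E * X) = X" if "dim_row X = M" for X
    using mm_assoc_eq[OF HE, of X] that d by (simp add: mm_one_left)
  have JL: "Jn * (L * E) = E - Jn * (\<Lambda> * E)" using d by (simp add: L mat_ring JX)
  \<comment> \<open>The matrix of \<open>Jn L\<close> on the range of \<open>E\<close>, invertible
    because \<open>L\<close> is; with it \<open>L z = c\<close> is solved inside that range.\<close>
  define \<Theta> where "\<Theta> = H * (Jn * (L * E))"
  have \<Theta>d: "dim_row \<Theta> = M" "dim_col \<Theta> = M" using d by (auto simp: \<Theta>_def)
  have f1: "E * \<Theta> = Jn * (L * E)" using d by (simp add: \<Theta>_def JL mat_ring HE inv\<Lambda>)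
  have f1X: "E * (\<Theta> * X) = Jn * (L * (E * X))" if "dim_row X = M" for X
    using mm_assoc_eq[OF f1, of X] that d \<Theta>d by (simp add: mm_assoc)
  have \<Theta>c: "\<Theta> \<in> carrier_mat M M" using \<Theta>d by auto
  have d\<Theta>: "det \<Theta> \<noteq> 0"
  proof (rule det_nonzeroI[OF \<Theta>c])
    fix x assume x: "x \<in> carrier_mat M 1" and z: "\<Theta> * x = 0\<^sub>m M 1"
    note xd = carrier_matD[OF x]
    have "Jn * (Jn * (L * (E * x))) = Jn * (E * (\<Theta> * x))" using f1X xd by simp
    then have "L * (E * x) = 0\<^sub>m N 1" using xd d by (simp add: JX z mm_zero_right)
    then have "minv L * (L * (E * x)) = 0\<^sub>m N 1" using d by (simp add: mm_zero_right)
    then have "E * x = 0\<^sub>m N 1" using mm_assoc_eq[OF iL(3), of "E * x"] xd d by (simp add: mm_one_left)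
    then have "H * (E * x) = 0\<^sub>m M 1" using d by (simp add: mm_zero_right)
    then show "x = 0\<^sub>m M 1" using HEX xd by simp
  qed
  note i\<Theta> = minv_props[OF \<Theta>c d\<Theta>]
  define y where "y = minv \<Theta> * (H * (Jn * c))"
  have yd: "dim_row y = M" "dim_col y = p" using d carrier_matD[OF i\<Theta>(1)] by (auto simp: y_def)
  define z where "z = E * y"
  have zd: "dim_row z = N" "dim_col z = p" using d yd by (auto simp: z_def)
  have "\<Theta> * y = H * (Jn * c)"
    unfolding y_def using mm_assoc_eq[OF i\<Theta>(2), of "H * (Jn * c)"] d \<Theta>d carrier_matD[OF i\<Theta>(1)] by (simp add: mm_one_left)
  then have "Jn * (L * z) = Jn * c" using f1X[of y] yd by (simp add: z_def invc)
  then have "Jn * (Jn * (L * z)) = Jn * (Jn * c)" by simp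
  then have Lz: "L * z = c" using d zd by (simp add: JX)
  have z_eq: "minv L * c = z"
    unfolding Lz[symmetric] using mm_assoc_eq[OF iL(3), of z] d zd by (simp add: mm_one_left)
  \<comment> \<open>By \<open>key\<close>, the operator \<open>B J' adj B Jn\<close> moves a vector
    of the range of \<open>E\<close> only by a vector of the radical, here \<open>u\<close>.\<close>
  define z2 where "z2 = J' * (adj B * (Jn * z))"
  have z2d: "dim_row z2 = M" "dim_col z2 = p" using d zd by (auto simp: z2_def)
  define u where "u = z - B * z2"
  have ud: "dim_row u = N" "dim_col u = p" using d zd z2d by (auto simp: u_def)
  have keyX: "adj E * (Jn * (B * (J' * (adj B * (Jn * (E * X)))))) = adj E * (Jn * (E * X))" if "dim_row X = M" for X
    using arg_cong[OF key, of "\<lambda>M. M * X"] that d by (simp add: mm_assoc)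
  have EJu: "adj E * (Jn * u) = 0\<^sub>m M p"
    unfolding u_def z2_def z_def
    by (rule eq_matI) (use d yd in \<open>simp_all add: mat_ring keyX del: index_mult_mat(1)\<close>)
  \<comment> \<open>The matrix of \<open>Jn \<Lambda>\<close> on the range of \<open>E\<close>. Its
    adjoint moves \<open>\<Lambda>\<close> past \<open>adj E\<close>, so \<open>u\<close>,
    orthogonal to the range with respect to \<open>Jn\<close>, is also orthogonal to it with respect
    to \<open>\<Lambda>\<close>.\<close>
  define \<Psi> where "\<Psi> = H * (Jn * (\<Lambda> * E))"
  have \<Psi>d: "dim_row \<Psi> = M" "dim_col \<Psi> = M" using d by (auto simp: \<Psi>_def)
  have "\<Lambda> * E = Jn * (E * \<Psi>)" using d by (simp add: \<Psi>_def inv\<Lambda> JX)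
  then have "adj (\<Lambda> * E) = adj (Jn * (E * \<Psi>))" by simp
  then have E\<Lambda>: "adj E * \<Lambda> = adj \<Psi> * (adj E * Jn)"
    using d \<Psi>d by (simp add: h\<Lambda> JJ(2) mm_assoc)
  have E\<Lambda>u: "adj E * (\<Lambda> * u) = 0\<^sub>m M p"
  proof -
    have "adj E * (\<Lambda> * u) = adj \<Psi> * (adj E * (Jn * u))"
      using mm_assoc_eq[OF E\<Lambda>, of u] d ud \<Psi>d by (simp add: mm_assoc)
    then show ?thesis using d \<Psi>d by (simp add: EJu mm_zero_right)
  qed
  have cu: "adj c * u = 0\<^sub>m p p"
  proof -
    have "c = Jn * (E * (H * (Jn * c)))" using d by (simp add: invc JX)
    then have "adj c = adj (Jn * (E * (H * (Jn * c))))" by simp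
    then have "adj c = adj (H * (Jn * c)) * (adj E * Jn)" using d by (simp add: JJ(2) mm_assoc)
    then have "adj c * u = adj (H * (Jn * c)) * (adj E * Jn) * u" by simp
    then have "adj c * u = adj (H * (Jn * c)) * (adj E * (Jn * u))" using d ud by (simp add: mm_assoc)
    then show ?thesis using d by (simp add: EJu mm_zero_right)
  qed
  have zu: "z = u + B * z2" unfolding u_def by (rule eq_matI) (use d zd z2d in \<open>auto simp del: index_mult_mat(1)\<close>)
  have B\<Lambda>: "adj B * (\<Lambda> * z) = adj B * (\<Lambda> * (B * z2))"
  proof -
    have "adj B * (\<Lambda> * z) = adj W * (adj E * (\<Lambda> * u)) + adj B * (\<Lambda> * (B * z2))"
      unfolding zu using d ud z2d by (simp add: mat_ring B)
    also have "\<dots> = adj B * (\<Lambda> * (B * z2))"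
      unfolding E\<Lambda>u by (rule eq_matI) (use d z2d in \<open>simp_all add: mat_ring del: index_mult_mat(1)\<close>)
    finally show ?thesis .
  qed
  have J'X: "J' * (J' * X) = X" if "dim_row X = M" for X
    using mm_assoc_eq[OF J', of X] that d by (simp add: mm_one_left)
  have "L' * z2 = J' * z2 - adj B * (\<Lambda> * (B * z2))" using d z2d by (simp add: L' mat_ring)
  also have "\<dots> = adj B * (Jn * z) - adj B * (\<Lambda> * z)"
    using d zd by (simp add: B\<Lambda>[symmetric]) (simp add: z2_def J'X)
  also have "\<dots> = adj B * (L * z)" using d zd by (simp add: L mat_ring)
  finally have L'z: "L' * z2 = adj B * c" by (simp add: Lz)
  have "minv L' * (adj B * c) = z2"
    unfolding L'z[symmetric] using mm_assoc_eq[OF iL'(3), of z2] d z2d by (simp add: mm_one_left)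
  then have "adj (adj B * c) * (minv L' * (adj B * c)) = adj c * (B * z2)" using d z2d by (simp add: mm_assoc)
  also have "\<dots> = adj c * z" unfolding zu
    by (rule eq_matI) (use d ud z2d in \<open>simp_all add: mat_ring cu del: index_mult_mat(1)\<close>)
  finally show ?thesis by (simp add: z_eq)
qed

lemma kron_one_mult: "dim_col A = dim_row B \<Longrightarrow> kron A (1\<^sub>m n) * kron B (1\<^sub>m n) = kron (A * B) (1\<^sub>m n)"
  by (simp add: kron_mult mm_one_left)

lemma kron_one_mult': "dim_col A = dim_row B \<Longrightarrow> dim_row X = dim_col B * n \<Longrightarrow>
    kron A (1\<^sub>m n) * (kron B (1\<^sub>m n) * X) = kron (A * B) (1\<^sub>m n) * X"
  using mm_assoc_eq[OF kron_one_mult[of A B n], of X] by simp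

definition tscale :: "real \<Rightarrow> complex mat list \<Rightarrow> complex mat list" where
  "tscale t X = map (\<lambda>x. complex_of_real t \<cdot>\<^sub>m x) X"

lemma tscale_herm: "X \<in> herm_tuples n g \<Longrightarrow> tscale t X \<in> herm_tuples n g"
  by (auto simp: herm_tuples_iff tscale_def mats_def)

text \<open>As \<open>Jn\<close> is an involution, a singular \<open>Jn + t \<Lambda>\<close> with
  \<open>t\<close> nonzero means that \<open>- 1 / t\<close> is an eigenvalue of
  \<open>Jn \<Lambda>\<close>, so only finitely many \<open>t\<close> are excluded.\<close>

lemma eventually_det_nonzero:
  fixes Jn \<Lambda> :: "complex mat"
  assumes J: "Jn \<in> carrier_mat N N" "Jn * Jn = 1\<^sub>m N" and \<Lambda>: "\<Lambda> \<in> carrier_mat N N"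
  shows "\<forall>\<^sub>F t in at (1::real). det (Jn + complex_of_real t \<cdot>\<^sub>m \<Lambda>) \<noteq> 0"
proof -
  \<comment> \<open>\<open>Re\<close> only turns the candidates into reals; 0 is added so that one
    may divide by \<open>t\<close>.\<close>
  define S where "S = insert 0 ((\<lambda>k. Re (- (1 / k))) ` spectrum (Jn * \<Lambda>))"
  have c: "Jn * \<Lambda> \<in> carrier_mat N N" using J \<Lambda> by simp
  have fin: "finite S" unfolding S_def using card_finite_spectrum(1)[OF c] by simp
  note d = carrier_matD[OF J(1)] carrier_matD[OF \<Lambda>]
  have ne: "det (Jn + complex_of_real t \<cdot>\<^sub>m \<Lambda>) \<noteq> 0" if t: "t \<notin> S" for t
  proof
    assume z: "det (Jn + complex_of_real t \<cdot>\<^sub>m \<Lambda>) = 0"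
    have Mc: "Jn + complex_of_real t \<cdot>\<^sub>m \<Lambda> \<in> carrier_mat N N" using J \<Lambda> by simp
    obtain v where v: "v \<in> carrier_vec N" "v \<noteq> 0\<^sub>v N" "(Jn + complex_of_real t \<cdot>\<^sub>m \<Lambda>) *\<^sub>v v = 0\<^sub>v N"
      using z det_0_iff_vec_prod_zero[OF Mc] by auto
    have t0: "t \<noteq> 0" using t by (auto simp: S_def)
    let ?x = "colmat v"
    have "(Jn + complex_of_real t \<cdot>\<^sub>m \<Lambda>) * ?x = colmat (0\<^sub>v N)" using v d by (simp add: colmat_mult[symmetric])
    also have "\<dots> = 0\<^sub>m N 1" using colmat_zero by blast
    finally have 0: "Jn * ((Jn + complex_of_real t \<cdot>\<^sub>m \<Lambda>) * ?x) = 0\<^sub>m N 1" using d by (simp add: mm_zero_right)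
    have "Jn * ((Jn + complex_of_real t \<cdot>\<^sub>m \<Lambda>) * ?x) = ?x + complex_of_real t \<cdot>\<^sub>m (Jn * \<Lambda> * ?x)"
      using mm_assoc_eq[OF J(2), of ?x] v d by (simp add: mat_ring)
    then have eq: "?x + complex_of_real t \<cdot>\<^sub>m (Jn * \<Lambda> * ?x) = 0\<^sub>m N 1" using 0 by simp
    have "(Jn * \<Lambda>) *\<^sub>v v = (- (1 / complex_of_real t)) \<cdot>\<^sub>v v"
    proof (rule eq_vecI)
      fix i assume "i < dim_vec ((- (1 / complex_of_real t)) \<cdot>\<^sub>v v)"
      then have i: "i < N" using v by simp
      have "colmat (Jn * \<Lambda> *\<^sub>v v) = Jn * \<Lambda> * ?x" using v d by (simp add: colmat_mult)
      then have "((Jn * \<Lambda>) *\<^sub>v v) $ i = (Jn * \<Lambda> * ?x) $$ (i, 0)"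
        using colmat_index[of i "Jn * \<Lambda> *\<^sub>v v"] i d by simp
      moreover have "v $ i + complex_of_real t * (Jn * \<Lambda> * ?x) $$ (i, 0) = 0"
        using arg_cong[OF eq, of "\<lambda>M. M $$ (i, 0)"] i v d by (simp del: index_mult_mat(1))
      ultimately show "((Jn * \<Lambda>) *\<^sub>v v) $ i = ((- (1 / complex_of_real t)) \<cdot>\<^sub>v v) $ i"
        using i v t0 by (simp add: field_simps add_eq_0_iff)
    qed (use v d in auto)
    then have "eigenvector (Jn * \<Lambda>) v (- (1 / complex_of_real t))"
      using v d by (auto simp: eigenvector_def)
    then have "- (1 / complex_of_real t) \<in> spectrum (Jn * \<Lambda>)" by (auto simp: spectrum_def eigenvalue_def)
    moreover have "Re (- (1 / (- (1 / complex_of_real t)))) = t" using t0 by simp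
    ultimately have "t \<in> S" unfolding S_def by (metis (no_types, lifting) image_eqI insertCI)
    then show False using t by simp
  qed
  have "\<forall>\<^sub>F t in at (1::real). t \<noteq> s" for s
  proof (cases "s = 1")
    case True
    then show ?thesis by (simp add: eventually_at_filter)
  next
    case False
    then show ?thesis using tendsto_imp_eventually_ne[OF tendsto_ident_at, of 1 s UNIV] by simp
  qed
  then have "\<forall>\<^sub>F t in at (1::real). \<forall>s\<in>S. t \<noteq> s" by (intro eventually_ball_finite fin) auto
  then show ?thesis by (rule eventually_mono) (use ne in blast)
qed

context wf_real
begin

abbreviation "cm \<equiv> colmat (rc R)"

lemma cm_dim: "dim_row cm = e" "dim_col cm = 1" using basic(8) by auto

lemma re_alt:
  assumes "det (pen n A X) \<noteq> 0"
  shows "realization_eval R n A X = adj (kron cm (1\<^sub>m n)) * (minv (pen n A X) * kron cm (1\<^sub>m n))"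
  unfolding realization_eval_def using basic(8) assms
  by (subst compressed_alt) (auto simp: mat_of_cols_colmat)

lemma pen_tscale:
  assumes "A \<in> mats n n h" "X \<in> mats n n g"
  shows "pen n (tscale t A) (tscale t X) = kron J (1\<^sub>m n) + complex_of_real t \<cdot>\<^sub>m ((-1) \<cdot>\<^sub>m (Tl n X + Sl n A))"
  unfolding pen_def tscale_def plin_smult[OF basic(4) assms(2)] plin_smult[OF basic(6) assms(1)]
  by (rule eq_matI) (auto simp: J_dim algebra_simps)

text \<open>\<open>E * H\<close> fixes \<open>Jm T_i E\<close> for each coefficient, hence also
  every combination of them with matrix weights. \<open>Jm\<close> is left free because both
  \<open>J\<close> and an inverse pencil take its place.\<close>

lemma plin_invariant:
  fixes Jm :: "complex mat"
  assumes Jm: "Jm \<in> carrier_mat e e" and Ts: "Ts \<in> mats e e q" and X: "X \<in> mats n n q" and E: "E \<in> carrier_mat e m" and H: "H \<in> carrier_mat m e"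
    and inv: "\<And>i. i < q \<Longrightarrow> E * (H * (Jm * (Ts ! i * E))) = Jm * (Ts ! i * E)"
  shows "kron E (1\<^sub>m n) * (kron H (1\<^sub>m n) * (kron Jm (1\<^sub>m n) * (plin (e * n) (e * n) Ts X * kron E (1\<^sub>m n)))) =
    kron Jm (1\<^sub>m n) * (plin (e * n) (e * n) Ts X * kron E (1\<^sub>m n))"
proof -
  have id: "map (\<lambda>x. 1\<^sub>m n * (x * 1\<^sub>m n)) X = X"
  proof (rule nth_equalityI)
    fix i assume "i < length (map (\<lambda>x. 1\<^sub>m n * (x * 1\<^sub>m n)) X)"
    then show "map (\<lambda>x. 1\<^sub>m n * (x * 1\<^sub>m n)) X ! i = X ! i"
      using carrier_matD[OF matsD(2)[OF X, of i]] matsD(1)[OF X] by (simp add: mat_ring)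
  qed simp
  note d = carrier_matD[OF E] carrier_matD[OF H] carrier_matD[OF Jm]
  have a: "kron Jm (1\<^sub>m n) * (plin (e * n) (e * n) Ts X * kron E (1\<^sub>m n)) = plin (e * n) (m * n) (map (\<lambda>t. Jm * (t * E)) Ts) X"
    using plin_sandwich[OF Ts X, of Jm E "1\<^sub>m n" "1\<^sub>m n"] d by (simp add: id)
  have T2: "map (\<lambda>t. Jm * (t * E)) Ts \<in> mats e m q" by (rule map_in_mats[OF Ts]) (use d in \<open>auto intro!: carrier_matI\<close>)
  have eqT: "map (\<lambda>t. (E * H) * (t * 1\<^sub>m m)) (map (\<lambda>t. Jm * (t * E)) Ts) = map (\<lambda>t. Jm * (t * E)) Ts"
  proof (rule nth_equalityI)
    fix i assume "i < length (map (\<lambda>t. (E * H) * (t * 1\<^sub>m m)) (map (\<lambda>t. Jm * (t * E)) Ts))"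
    then have i: "i < q" using matsD(1)[OF Ts] by simp
    show "map (\<lambda>t. (E * H) * (t * 1\<^sub>m m)) (map (\<lambda>t. Jm * (t * E)) Ts) ! i = map (\<lambda>t. Jm * (t * E)) Ts ! i"
      using inv[OF i] i matsD(1)[OF Ts] carrier_matD[OF matsD(2)[OF Ts i]] d by (simp add: mat_ring)
  qed simp
  have "kron (E * H) (1\<^sub>m n) * (plin (e * n) (m * n) (map (\<lambda>t. Jm * (t * E)) Ts) X * kron (1\<^sub>m m) (1\<^sub>m n)) =
      plin (e * n) (m * n) (map (\<lambda>t. Jm * (t * E)) Ts) X"
    using plin_sandwich[OF T2 X, of "E * H" "1\<^sub>m m" "1\<^sub>m n" "1\<^sub>m n"] d by (simp add: id eqT del: map_map)
  then show ?thesis unfolding a using d by (simp add: kron_one_mult' kron_one mm_one_right)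
qed

text \<open>Compresses the realization to the range of \<open>E\<close>. The role of
  \<open>J\<close> falls to the Gram matrix \<open>adj E J E\<close>, which need not be an
  involution and may be singular, so its eigenvectors are rescaled. Agreement is claimed where both
  pencils are invertible.\<close>

lemma reduction:
  assumes E: "E \<in> carrier_mat e m" and H: "H \<in> carrier_mat m e" and HE: "H * E = 1\<^sub>m m"
    and invT: "\<And>i. i < g \<Longrightarrow> E * (H * (J * (T ! i * E))) = J * (T ! i * E)"
    and invS: "\<And>i. i < h \<Longrightarrow> E * (H * (J * (S ! i * E))) = J * (S ! i * E)"
    and invc: "E * (H * (J * cm)) = J * cm"
  shows "\<exists>R'. rdim R' = m \<and> wf_realization h g R' \<and>
    (\<forall>n A X. A \<in> herm_tuples n h \<longrightarrow> X \<in> herm_tuples n g \<longrightarrow> det (pencil R n A X) \<noteq> 0 \<longrightarrow> det (pencil R' n A X) \<noteq> 0 \<longrightarrow>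
      realization_eval R' n A X = realization_eval R n A X)"
proof -
  note d = carrier_matD[OF E] carrier_matD[OF H] J_dim cm_dim
  define G where "G = adj E * (J * E)"
  have G: "G \<in> carrier_mat m m" "adj G = G" using d basic(3) by (auto simp: G_def mm_assoc intro!: carrier_matI)
  obtain U d' where Un: "unitary m U" and Geq: "G = U * (dg m d' * adj U)" using hermitian_spectral[OF G] by auto
  have U: "U \<in> carrier_mat m m" "adj U * U = 1\<^sub>m m" using Un by (auto simp: unitary_def)
  note dU = carrier_matD[OF U(1)]
  \<comment> \<open>Null eigenvalues get the sign 1, which keeps \<open>J'\<close> an involution,
    and the weight 0 in \<open>r\<close>, which makes the columns of \<open>B\<close> there vanish;
    these coordinates then decouple from the coefficients and from the new \<open>c\<close>.\<close>
  define sg where "sg i = (if d' i < 0 then -1 else 1 :: real)" for i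
  define r where "r i = (if d' i = 0 then 0 else 1 / sqrt \<bar>d' i\<bar>)" for i
  define W where "W = U * dg m r"
  define B where "B = E * W"
  define J' where "J' = dg m sg"
  have Wd: "dim_row W = m" "dim_col W = m" using dU by (auto simp: W_def)
  have Bd: "dim_row B = e" "dim_col B = m" using d Wd by (auto simp: B_def)
  have J'J': "J' * J' = 1\<^sub>m m"
    unfolding J'_def dg_mult dg_one[symmetric] by (rule dg_cong) (auto simp: sg_def)
  have key: "adj E * (J * (B * (J' * (adj B * (J * E))))) = adj E * (J * E)"
  proof -
    have "adj E * (J * (B * (J' * (adj B * (J * E))))) = G * (U * (dg m r * (dg m sg * (dg m r * (adj U * G)))))"
      unfolding B_def W_def J'_def G_def using d dU by (simp add: mm_assoc)
    also have "\<dots> = U * (dg m d' * ((adj U * U) * (dg m r * (dg m sg * (dg m r * ((adj U * U) * (dg m d' * adj U)))))))"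
      unfolding Geq using dU by (simp add: mm_assoc)
    also have "\<dots> = U * ((dg m d' * (dg m r * (dg m sg * (dg m r * dg m d')))) * adj U)"
      using dU by (simp add: U(2) mat_ring)
    also have "dg m d' * (dg m r * (dg m sg * (dg m r * dg m d'))) = dg m d'"
      unfolding dg_mult
    proof (rule dg_cong)
      fix i
      show "d' i * (r i * (sg i * (r i * d' i))) = d' i"
      proof (cases "d' i = 0")
        case False
        have "r i * r i = 1 / \<bar>d' i\<bar>" using False by (simp add: r_def)
        then have "d' i * (r i * (sg i * (r i * d' i))) = d' i * d' i * sg i * (1 / \<bar>d' i\<bar>)"
          by (metis (no_types, opaque_lifting) mult.assoc mult.commute)
        also have "\<dots> = d' i" using False by (auto simp: sg_def field_simps)
        finally show ?thesis .
      qed simp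
    qed
    finally show ?thesis using Geq by (simp add: G_def)
  qed
  let ?f = "\<lambda>t. adj B * (t * B)"
  define R' where "R' = \<lparr>rdim = m, rJ = J', rT = map ?f T, rS = map ?f S, rc = col (adj B * cm) 0\<rparr>"
  have mT: "map ?f T \<in> mats m m g" "map ?f S \<in> mats m m h"
    by (rule map_in_mats[OF basic(4)], use Bd in \<open>auto intro!: carrier_matI\<close>)
       (rule map_in_mats[OF basic(6)], use Bd in \<open>auto intro!: carrier_matI\<close>)
  have hf: "adj (?f t) = ?f t" if "t \<in> carrier_mat e e" "adj t = t" for t
    using that(2) carrier_matD[OF that(1)] Bd by (simp add: mm_assoc)
  have herm: "map ?f Ts \<in> herm_tuples m q" if Ts: "Ts \<in> mats e e q" "map adj Ts = Ts" "map ?f Ts \<in> mats m m q" for Ts q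
    unfolding herm_tuples_iff
  proof (intro conjI allI impI that(3))
    fix i assume i: "i < q"
    have "adj (Ts ! i) = Ts ! i" using arg_cong[OF Ts(2), of "\<lambda>l. l ! i"] i matsD(1)[OF Ts(1)] by simp
    then show "adj (map ?f Ts ! i) = map ?f Ts ! i"
      using hf[OF matsD(2)[OF Ts(1) i]] i matsD(1)[OF Ts(1)] by simp
  qed
  have wf': "wf_realization h g R'"
    using herm[OF basic(4,5) mT(1)] herm[OF basic(6,7) mT(2)] J'J' Bd
    by (auto simp: wf_realization_def R'_def J'_def hermitian_iff intro!: carrier_vecI)
  interpret R': wf_real h g R' by unfold_locales (rule wf')
  have cm': "colmat (rc R') = adj B * cm" using colmat_col[of "adj B * cm"] d by (simp add: R'_def)
  show ?thesis
  proof (intro exI[of _ R'] conjI allI impI wf')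
    show "rdim R' = m" by (simp add: R'_def)
    fix n A X assume A: "A \<in> herm_tuples n h" and X: "X \<in> herm_tuples n g"
      and det: "det (pencil R n A X) \<noteq> 0" and det': "det (pencil R' n A X) \<noteq> 0"
    have Am: "A \<in> mats n n h" and Xm: "X \<in> mats n n g" using A X by (auto simp: herm_tuples_iff)
    let ?k = "\<lambda>M. kron M (1\<^sub>m n)"
    let ?L = "Tl n X + Sl n A"
    have id: "map (\<lambda>x. 1\<^sub>m n * (x * 1\<^sub>m n)) Y = Y" if Y: "Y \<in> mats n n q" for Y q
    proof (rule nth_equalityI)
      fix i assume "i < length (map (\<lambda>x. 1\<^sub>m n * (x * 1\<^sub>m n)) Y)"
      then show "map (\<lambda>x. 1\<^sub>m n * (x * 1\<^sub>m n)) Y ! i = Y ! i"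
        using carrier_matD[OF matsD(2)[OF Y, of i]] matsD(1)[OF Y] by (simp add: mat_ring)
    qed simp
    have sw: "plin (m * n) (m * n) (map ?f Ts) Y = adj (?k B) * (plin (e * n) (e * n) Ts Y * ?k B)"
      if "Ts \<in> mats e e q" "Y \<in> mats n n q" for Ts Y q
      using plin_sandwich[OF that, of "adj B" B "1\<^sub>m n" "1\<^sub>m n"] Bd by (simp add: id[OF that(2)])
    have hL: "adj ?L = ?L" using plin_herm[OF basic(4,5) X] plin_herm[OF basic(6,7) A] by simp
    have "adj (adj (?k B) * ?k cm) * (minv (pencil R' n A X) * (adj (?k B) * ?k cm)) = adj (?k cm) * (minv (pencil R n A X) * ?k cm)"
    proof (rule reduction_algebra[where Jn = "?k J" and \<Lambda> = ?L and E = "?k E" and H = "?k H" and W = "?k W" and J' = "?k J'"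
          and N = "e * n" and M = "m * n" and p = n])
      show "?k J \<in> carrier_mat (e * n) (e * n)" "?L \<in> carrier_mat (e * n) (e * n)" "?k E \<in> carrier_mat (e * n) (m * n)"
        "?k H \<in> carrier_mat (m * n) (e * n)" "?k cm \<in> carrier_mat (e * n) n" "?k W \<in> carrier_mat (m * n) (m * n)"
        "?k J' \<in> carrier_mat (m * n) (m * n)"
        using d Wd by (auto simp: J'_def intro!: carrier_matI)
      show "pencil R n A X = ?k J - ?L" unfolding pen_def by (rule eq_matI) (auto simp: J_dim)
      show "?k J * ?k J = 1\<^sub>m (e * n)" using d basic(2) by (simp add: kron_one_mult kron_one)
      show "adj (?k J) = ?k J" using basic(3) by simp
      show "adj ?L = ?L" by (rule hL)
      show "?k H * ?k E = 1\<^sub>m (m * n)" using d HE by (simp add: kron_one_mult kron_one)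
      show "?k E * (?k H * (?k J * (?L * ?k E))) = ?k J * (?L * ?k E)"
        using plin_invariant[OF basic(1,4) Xm E H invT] plin_invariant[OF basic(1,6) Am E H invS] d by (simp add: mat_ring)
      show "?k E * (?k H * (?k J * ?k cm)) = ?k J * ?k cm" using d invc by (simp add: kron_one_mult)
      show "?k B = ?k E * ?k W" using d Wd by (simp add: kron_one_mult B_def)
      show "?k J' * ?k J' = 1\<^sub>m (m * n)" using J'J' by (simp add: kron_one_mult kron_one J'_def)
      show "adj (?k E) * (?k J * (?k B * (?k J' * (adj (?k B) * (?k J * ?k E))))) = adj (?k E) * (?k J * ?k E)"
        using d Bd key by (simp add: kron_one_mult J'_def)
      show "pencil R' n A X = ?k J' - adj (?k B) * (?L * ?k B)"
      proof -
        have "pencil R' n A X = ?k J' - plin (m * n) (m * n) (map ?f T) X - plin (m * n) (m * n) (map ?f S) A"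
          unfolding R'.pen_def by (simp add: R'_def)
        then show ?thesis unfolding sw[OF basic(4) Xm] sw[OF basic(6) Am]
          using Bd by (intro eq_matI) (simp_all add: J'_def mat_ring del: index_mult_mat(1) adj_kron)
      qed
      show "det (pencil R n A X) \<noteq> 0" "det (pencil R' n A X) \<noteq> 0" by (rule det, rule det')
    qed
    moreover have "adj (?k B) * ?k cm = ?k (colmat (rc R'))" unfolding cm' using d Bd by (simp add: kron_one_mult)
    ultimately show "realization_eval R' n A X = realization_eval R n A X"
      unfolding re_alt[OF det] R'.re_alt[OF det'] by simp
  qed
qed

end

text \<open>The reduced realization has size \<open>m\<close>, so minimality gives the bound once it
  is a realization of \<open>r\<close>. That demands agreement wherever its own pencil is
  invertible, even where that of \<open>R\<close> is singular; there the value is obtained as the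
  limit along \<open>t\<close> times the point as \<open>t\<close> tends to 1.\<close>

lemma SMR_controllable:
  assumes smr: "SMR h g r R" and vars: "set_nc_expr r \<subseteq> vars_ax h g"
    and E: "E \<in> carrier_mat (rdim R) m" and H: "H \<in> carrier_mat m (rdim R)" and HE: "H * E = 1\<^sub>m m"
    and invT: "\<And>i. i < g \<Longrightarrow> E * (H * (rJ R * (rT R ! i * E))) = rJ R * (rT R ! i * E)"
    and invS: "\<And>i. i < h \<Longrightarrow> E * (H * (rJ R * (rS R ! i * E))) = rJ R * (rS R ! i * E)"
    and invc: "E * (H * (rJ R * colmat (rc R))) = rJ R * colmat (rc R)"
  shows "rdim R \<le> m"
proof -
  have wf: "wf_realization h g R" and sr: "\<And>n A X M. n \<ge> 1 \<Longrightarrow> (A, X) \<in> dom_r h g R n \<Longrightarrow>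
      nc_eval n (env_ax A X) r = Some M \<Longrightarrow> M = realization_eval R n A X"
    using smr unfolding SMR_def symmetric_realization_def by blast+
  interpret wf_real h g R by unfold_locales (rule wf)
  obtain R' where R': "rdim R' = m" "wf_realization h g R'" and
    red: "\<And>n A X. A \<in> herm_tuples n h \<Longrightarrow> X \<in> herm_tuples n g \<Longrightarrow> det (pencil R n A X) \<noteq> 0 \<Longrightarrow> det (pencil R' n A X) \<noteq> 0 \<Longrightarrow>
      realization_eval R' n A X = realization_eval R n A X"
    using reduction[OF E H HE invT invS invc] by blast
  interpret R': wf_real h g R' by unfold_locales (rule R')
  have "M = realization_eval R' n A X"
    if n: "n \<ge> 1" and AX: "(A, X) \<in> dom_r h g R' n" and M: "nc_eval n (env_ax A X) r = Some M" for n A X M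
  proof -
    have A: "A \<in> herm_tuples n h" and X: "X \<in> herm_tuples n g" and det': "det (pencil R' n A X) \<noteq> 0"
      using AX by (auto simp: dom_r_def nc_space_def)
    have Am: "A \<in> mats n n h" and Xm: "X \<in> mats n n g" using A X by (auto simp: herm_tuples_iff)
    \<comment> \<open>The filter at 1 leaves out \<open>t = 1\<close> itself, where the pencil of
      \<open>R\<close> may be singular.\<close>
    let ?A = "\<lambda>t. tscale t A" and ?X = "\<lambda>t. tscale t X" and ?F = "at (1::real)"
    have of1: "((\<lambda>t. complex_of_real t) \<longlongrightarrow> 1) ?F" using tendsto_of_real[OF tendsto_ident_at, of 1 UNIV] by simp
    have sc: "mtends n n (\<lambda>t. tscale t Y ! i) (Y ! i) ?F" if "Y \<in> mats n n q" "i < q" for Y q i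
    proof -
      have "mtends n n (\<lambda>t. complex_of_real t \<cdot>\<^sub>m (Y ! i)) (1 \<cdot>\<^sub>m (Y ! i)) ?F"
        by (rule mtends_smult[OF mtends_const of1]) (rule matsD(2)[OF that])
      moreover have "1 \<cdot>\<^sub>m (Y ! i) = Y ! i" by (rule eq_matI) auto
      ultimately show ?thesis using that matsD(1)[OF that(1)] by (simp add: tscale_def)
    qed
    have env: "mtends n n (\<lambda>t. env_ax (?A t) (?X t) v) (env_ax A X v) ?F" if "v \<in> vars_ax h g" for v
      using that sc[OF Am] sc[OF Xm] by (auto simp: vars_ax_def)
    have r: "(\<forall>\<^sub>F t in ?F. nc_eval n (env_ax (?A t) (?X t)) r \<noteq> None) \<and>
        mtends n n (\<lambda>t. the (nc_eval n (env_ax (?A t) (?X t)) r)) M ?F"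
      by (rule mtends_nc_eval[where V = "vars_ax h g", OF _ vars M]) (rule env)
    have pm: "mtends (rdim R' * n) (rdim R' * n) (\<lambda>t. pencil R' n (?A t) (?X t)) (pencil R' n A X) ?F"
    proof -
      have "mtends (rdim R' * n) (rdim R' * n)
         (\<lambda>t. kron (rJ R') (1\<^sub>m n) + complex_of_real t \<cdot>\<^sub>m ((-1) \<cdot>\<^sub>m (R'.Tl n X + R'.Sl n A)))
         (kron (rJ R') (1\<^sub>m n) + 1 \<cdot>\<^sub>m ((-1) \<cdot>\<^sub>m (R'.Tl n X + R'.Sl n A))) ?F"
        by (intro mtends_add mtends_const mtends_smult of1) (use R'.J_dim in \<open>auto intro!: carrier_matI\<close>)
      moreover have "kron (rJ R') (1\<^sub>m n) + 1 \<cdot>\<^sub>m ((-1) \<cdot>\<^sub>m (R'.Tl n X + R'.Sl n A)) = pencil R' n A X"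
        unfolding R'.pen_def by (rule eq_matI) (auto simp: R'.J_dim)
      ultimately show ?thesis by (simp add: R'.pen_tscale[OF Am Xm])
    qed
    note pi = mtends_minv[OF pm det']
    have cc: "kron (colmat (rc R')) (1\<^sub>m n) \<in> carrier_mat (rdim R' * n) n"
      using R'.cm_dim by (auto intro!: carrier_matI)
    have "mtends n n (\<lambda>t. adj (kron (colmat (rc R')) (1\<^sub>m n)) * (minv (pencil R' n (?A t) (?X t)) * kron (colmat (rc R')) (1\<^sub>m n)))
       (adj (kron (colmat (rc R')) (1\<^sub>m n)) * (minv (pencil R' n A X) * kron (colmat (rc R')) (1\<^sub>m n))) ?F"
      by (rule mtends_mult[OF mtends_const mtends_mult[OF pi(2) mtends_const]])
        (use adj_carrier[OF cc] cc in \<open>simp_all del: adj_kron\<close>)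
    then have re': "mtends n n (\<lambda>t. adj (kron (colmat (rc R')) (1\<^sub>m n)) * (minv (pencil R' n (?A t) (?X t)) * kron (colmat (rc R')) (1\<^sub>m n)))
       (realization_eval R' n A X) ?F" unfolding R'.re_alt[OF det'] .
    have "\<forall>\<^sub>F t in ?F. det (kron J (1\<^sub>m n) + complex_of_real t \<cdot>\<^sub>m ((-1) \<cdot>\<^sub>m (Tl n X + Sl n A))) \<noteq> 0"
      by (rule eventually_det_nonzero[of _ "e * n"])
        (use J_dim basic(2) in \<open>auto simp: kron_one_mult kron_one intro!: carrier_matI\<close>)
    then have "\<forall>\<^sub>F t in ?F. det (pencil R n (?A t) (?X t)) \<noteq> 0" by (simp add: pen_tscale[OF Am Xm])
    then have ev: "\<forall>\<^sub>F t in ?F. the (nc_eval n (env_ax (?A t) (?X t)) r) =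
        adj (kron (colmat (rc R')) (1\<^sub>m n)) * (minv (pencil R' n (?A t) (?X t)) * kron (colmat (rc R')) (1\<^sub>m n))"
      using pi(1) conjunct1[OF r]
    proof eventually_elim
      case (elim t)
      obtain N where N: "nc_eval n (env_ax (?A t) (?X t)) r = Some N" using elim(3) by auto
      have "(?A t, ?X t) \<in> dom_r h g R n"
        using elim(1) tscale_herm[OF A] tscale_herm[OF X] by (auto simp: dom_r_def nc_space_def)
      from sr[OF n this N] red[OF tscale_herm[OF A] tscale_herm[OF X] elim(1) elim(2)]
      show ?case using N R'.re_alt[OF elim(2)] by simp
    qed
    have "mtends n n (\<lambda>t. the (nc_eval n (env_ax (?A t) (?X t)) r)) (realization_eval R' n A X) ?F"
      by (rule mtends_cong[OF re']) (use ev in \<open>auto elim: eventually_mono\<close>)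
    then show ?thesis using mtends_unique[OF conjunct2[OF r]] by simp
  qed
  then have "symmetric_realization h g r R'" using R'(2) by (auto simp: symmetric_realization_def)
  then show ?thesis using smr R'(1) by (auto simp: SMR_def)
qed

section \<open>Domains of convexity are contained in the positivity domain\<close>

text \<open>The two forms of the resolvent identity, one inserted into the other. The expansion is
  exact, and the perturbed inverse occurs only in the quadratic term, so continuity of the inverse
  suffices to pass to the limit there.\<close>

lemma resolvent_expansion:
  fixes L K :: "complex mat"
  assumes L: "L \<in> carrier_mat N N" "det L \<noteq> 0" and K: "K \<in> carrier_mat N N"
    and L': "det (L + z \<cdot>\<^sub>m K) \<noteq> 0"
  shows "minv (L + z \<cdot>\<^sub>m K) = minv L + (- z) \<cdot>\<^sub>m (minv L * (K * minv L)) +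
    (z * z) \<cdot>\<^sub>m (minv L * (K * (minv (L + z \<cdot>\<^sub>m K) * (K * minv L))))"
proof -
  let ?M = "L + z \<cdot>\<^sub>m K"
  have M: "?M \<in> carrier_mat N N" using L K by simp
  note i = minv_props[OF L] and j = minv_props[OF M L']
  note d = carrier_matD[OF L(1)] carrier_matD[OF K] carrier_matD[OF i(1)] carrier_matD[OF j(1)]
  have a: "minv ?M = minv L + (- z) \<cdot>\<^sub>m (minv ?M * (K * minv L))"
  proof -
    have "minv ?M * (?M * minv L) = minv L" using mm_assoc_eq[OF j(3), of "minv L"] d by (simp add: mm_one_left)
    moreover have "minv ?M * (?M * minv L) = minv ?M + z \<cdot>\<^sub>m (minv ?M * (K * minv L))"
      using d by (simp add: mat_ring i)
    ultimately have eq: "minv L = minv ?M + z \<cdot>\<^sub>m (minv ?M * (K * minv L))" by simp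
    show ?thesis
    proof (rule eq_matI)
      fix p q assume "p < dim_row (minv L + (- z) \<cdot>\<^sub>m (minv ?M * (K * minv L)))"
        "q < dim_col (minv L + (- z) \<cdot>\<^sub>m (minv ?M * (K * minv L)))"
      then show "minv ?M $$ (p, q) = (minv L + (- z) \<cdot>\<^sub>m (minv ?M * (K * minv L))) $$ (p, q)"
        using arg_cong[OF eq, of "\<lambda>M. M $$ (p, q)"] d by (simp del: index_mult_mat(1))
    qed (use d in auto)
  qed
  have b: "minv ?M = minv L + (- z) \<cdot>\<^sub>m (minv L * (K * minv ?M))"
  proof -
    have "minv L * (?M * minv ?M) = minv L" using d by (simp add: j mm_one_right)
    moreover have "minv L * (?M * minv ?M) = minv ?M + z \<cdot>\<^sub>m (minv L * (K * minv ?M))"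
      using mm_assoc_eq[OF i(3), of "minv ?M"] d by (simp add: mat_ring)
    ultimately have eq: "minv L = minv ?M + z \<cdot>\<^sub>m (minv L * (K * minv ?M))" by simp
    show ?thesis
    proof (rule eq_matI)
      fix p q assume "p < dim_row (minv L + (- z) \<cdot>\<^sub>m (minv L * (K * minv ?M)))"
        "q < dim_col (minv L + (- z) \<cdot>\<^sub>m (minv L * (K * minv ?M)))"
      then show "minv ?M $$ (p, q) = (minv L + (- z) \<cdot>\<^sub>m (minv L * (K * minv ?M))) $$ (p, q)"
        using arg_cong[OF eq, of "\<lambda>M. M $$ (p, q)"] d by (simp del: index_mult_mat(1))
    qed (use d in auto)
  qed
  define X where "X = minv ?M"
  have a': "X = minv L + (- z) \<cdot>\<^sub>m (X * (K * minv L))" using a by (simp only: X_def)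
  have b': "X = minv L + (- z) \<cdot>\<^sub>m (minv L * (K * X))" using b by (simp only: X_def)
  have Xd: "dim_row X = N" "dim_col X = N" using d by (auto simp: X_def)
  have "X = minv L + (- z) \<cdot>\<^sub>m (minv L * (K * (minv L + (- z) \<cdot>\<^sub>m (X * (K * minv L)))))"
    using b' a' by metis
  also have "\<dots> = minv L + (- z) \<cdot>\<^sub>m (minv L * (K * minv L)) + (z * z) \<cdot>\<^sub>m (minv L * (K * (X * (K * minv L))))"
    by (rule eq_matI) (use d Xd in \<open>simp_all add: mat_ring smult_add_mm algebra_simps del: index_mult_mat(1)\<close>)
  finally show ?thesis by (simp only: X_def)
qed

lemma at_0_of_real: "((\<lambda>t. complex_of_real t) \<longlongrightarrow> 0) (at (0::real))"
  using tendsto_of_real[OF tendsto_ident_at, of 0 UNIV] by simp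

lemma tuple_comb_close:
  assumes X: "X \<in> mats n n q" and H: "H \<in> mats n n q" and \<delta>: "\<delta> > 0"
  shows "\<forall>\<^sub>F t in at (0::real). tuple_close n \<delta> X (tuple_comb 1 t X H)"
proof -
  have "\<forall>\<^sub>F t in at (0::real). \<forall>i\<in>{..<q}. \<forall>p\<in>{..<n}. \<forall>r\<in>{..<n}. cmod (complex_of_real t * (H ! i) $$ (p, r)) < \<delta>"
  proof (intro eventually_ball_finite ballI finite_lessThan)
    fix i p r
    have "((\<lambda>t. cmod (complex_of_real t * (H ! i) $$ (p, r))) \<longlongrightarrow> cmod (0 * (H ! i) $$ (p, r))) (at (0::real))"
      by (intro tendsto_norm tendsto_mult at_0_of_real tendsto_const)
    then show "\<forall>\<^sub>F t in at (0::real). cmod (complex_of_real t * (H ! i) $$ (p, r)) < \<delta>"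
      using \<delta> by (simp add: order_tendstoD(2))
  qed
  then show ?thesis
  proof (rule eventually_mono)
    fix t :: real assume *: "\<forall>i\<in>{..<q}. \<forall>p\<in>{..<n}. \<forall>r\<in>{..<n}. cmod (complex_of_real t * (H ! i) $$ (p, r)) < \<delta>"
    show "tuple_close n \<delta> X (tuple_comb 1 t X H)"
      unfolding tuple_close_def
    proof (intro allI impI)
      fix i p r assume i: "i < length X" and pr: "p < n" "r < n"
      then have i: "i < q" using matsD(1)[OF X] by simp
      have "(X ! i) $$ (p, r) - (tuple_comb 1 t X H ! i) $$ (p, r) = - (complex_of_real t * (H ! i) $$ (p, r))"
        using pr carrier_matD[OF matsD(2)[OF X i]] carrier_matD[OF matsD(2)[OF H i]]
        by (simp add: tuple_comb_nth[OF X H i])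
      then show "cmod ((X ! i) $$ (p, r) - (tuple_comb 1 t X H ! i) $$ (p, r)) < \<delta>"
        using * i pr by (simp only: norm_minus_cancel) simp
    qed
  qed
qed

text \<open>Blocks \<open>H\<close> and \<open>adj H\<close> off the diagonal and zero blocks on it,
  so that an arbitrary rectangular \<open>H\<close> becomes a hermitian direction.\<close>

definition offd :: "nat \<Rightarrow> nat \<Rightarrow> complex mat list \<Rightarrow> complex mat list" where
  "offd m n H = map2 (+) (map (\<lambda>x. iota1 m n * (x * adj (iota2 m n))) H)
     (map (\<lambda>x. iota2 m n * (x * adj (iota1 m n))) (map adj H))"

lemma offd_herm:
  assumes H: "H \<in> mats m n q"
  shows "offd m n H \<in> herm_tuples (m + n) q"
proof -
  have l: "length (offd m n H) = q" using matsD(1)[OF H] by (simp add: offd_def)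
  have nth: "offd m n H ! i = iota1 m n * (H ! i * adj (iota2 m n)) + iota2 m n * (adj (H ! i) * adj (iota1 m n))"
    if "i < q" for i using that matsD(1)[OF H] by (simp add: offd_def)
  have "offd m n H \<in> mats (m + n) (m + n) q"
    by (rule matsI[OF l]) (auto simp: nth intro!: carrier_matI)
  moreover have "adj (offd m n H ! i) = offd m n H ! i" if i: "i < q" for i
    using carrier_matD[OF matsD(2)[OF H i]] by (simp add: nth[OF i] mm_assoc) (rule eq_matI, simp_all del: index_mult_mat(1))
  ultimately show ?thesis by (auto simp: herm_tuples_iff)
qed

lemma plin_offd:
  assumes Ts: "Ts \<in> mats e e q" "map adj Ts = Ts" and H: "H \<in> mats m n q"
  shows "plin (e * (m + n)) (e * (m + n)) Ts (offd m n H) =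
    kron (1\<^sub>m e) (iota1 m n) * (plin (e * m) (e * n) Ts H * adj (kron (1\<^sub>m e) (iota2 m n))) +
    kron (1\<^sub>m e) (iota2 m n) * (adj (plin (e * m) (e * n) Ts H) * adj (kron (1\<^sub>m e) (iota1 m n)))"
proof -
  have H': "map adj H \<in> mats n m q" by (rule map_in_mats[OF H]) auto
  have 1: "map (\<lambda>x. iota1 m n * (x * adj (iota2 m n))) H \<in> mats (m + n) (m + n) q"
    by (rule map_in_mats[OF H]) (auto intro!: carrier_matI)
  have 2: "map (\<lambda>x. iota2 m n * (x * adj (iota1 m n))) (map adj H) \<in> mats (m + n) (m + n) q"
    by (rule map_in_mats[OF H']) (auto intro!: carrier_matI)
  show ?thesis
    unfolding offd_def plin_add[OF Ts(1) 1 2] plin_adj[OF Ts(1) H] Ts(2)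
    using plin_embed[OF Ts(1) H, of "iota1 m n" "adj (iota2 m n)"] plin_embed[OF Ts(1) H', of "iota2 m n" "adj (iota1 m n)"]
    by (simp del: map_map)
qed

text \<open>With \<open>i\<close> outside the range of indices this is the zero tuple, which is how
  a direction without an \<open>a\<close> part or without an \<open>x\<close> part is written
  below.\<close>

definition single :: "nat \<Rightarrow> nat \<Rightarrow> nat \<Rightarrow> nat \<Rightarrow> complex mat \<Rightarrow> complex mat list" where
  "single q n m i M = map (\<lambda>l. if l = i then M else 0\<^sub>m n m) [0..<q]"

lemma single_mats: "M \<in> carrier_mat n m \<Longrightarrow> single q n m i M \<in> mats n m q"
  by (rule matsI) (auto simp: single_def)

lemma plin_single:
  assumes Ts: "Ts \<in> mats e f q" and M: "M \<in> carrier_mat n m"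
  shows "plin (e * n) (f * m) Ts (single q n m i M) = (if i < q then kron (Ts ! i) M else 0\<^sub>m (e * n) (f * m))"
proof (rule eq_matI)
  let ?R = "if i < q then kron (Ts ! i) M else 0\<^sub>m (e * n) (f * m)"
  have Rd: "dim_row ?R = e * n" "dim_col ?R = f * m"
    using matsD(2)[OF Ts, of i] M by auto
  then show "dim_row (plin (e * n) (f * m) Ts (single q n m i M)) = dim_row ?R"
    "dim_col (plin (e * n) (f * m) Ts (single q n m i M)) = dim_col ?R" by auto
  fix p r assume "p < dim_row ?R" "r < dim_col ?R"
  then have pr: "p < e * n" "r < f * m" using Rd by auto
  have "plin (e * n) (f * m) Ts (single q n m i M) $$ (p, r) =
     (\<Sum>l<q. (Ts ! l) $$ (p div n, r div m) * (single q n m i M ! l) $$ (p mod n, r mod m))"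
    by (rule plin_index[OF Ts single_mats[OF M] pr])
  also have "\<dots> = (\<Sum>l<q. if l = i then (Ts ! i) $$ (p div n, r div m) * M $$ (p mod n, r mod m) else 0)"
    using pr[THEN mod_lt_of_lt_mult] by (intro sum.cong) (auto simp: single_def)
  also have "\<dots> = ?R $$ (p, r)"
    using pr carrier_matD[OF matsD(2)[OF Ts, of i]] carrier_matD[OF M] by auto
  finally show "plin (e * n) (f * m) Ts (single q n m i M) $$ (p, r) = ?R $$ (p, r)" .
qed

context wf_real
begin

abbreviation "ccol N \<equiv> kron cm (1\<^sub>m N)"

lemma ccol_dim: "dim_row (ccol N) = e * N" "dim_col (ccol N) = N"
  using cm_dim by auto

lemma pen_comb:
  assumes A: "A \<in> mats n n h" and HA: "HA \<in> mats n n h" and X: "X \<in> mats n n g" and HX: "HX \<in> mats n n g"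
  shows "pen n (tuple_comb 1 t A HA) (tuple_comb 1 t X HX) =
    pen n A X + complex_of_real t \<cdot>\<^sub>m ((-1) \<cdot>\<^sub>m (Tl n HX + Sl n HA))"
  unfolding pen_def plin_tuple_comb[OF basic(4) X HX] plin_tuple_comb[OF basic(6) A HA]
  by (rule eq_matI) (auto simp: J_dim algebra_simps)

lemma mtends_pen:
  fixes K :: "complex mat"
  assumes "K \<in> carrier_mat (e * n) (e * n)" "det (pen n A X) \<noteq> 0" "(c \<longlongrightarrow> 0) F"
  shows "mtends (e * n) (e * n) (\<lambda>t. minv (pen n A X + c t \<cdot>\<^sub>m K)) (minv (pen n A X)) F"
proof -
  have "mtends (e * n) (e * n) (\<lambda>t. pen n A X + c t \<cdot>\<^sub>m K) (pen n A X + 0 \<cdot>\<^sub>m K) F"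
    by (intro mtends_add mtends_const mtends_smult assms pen_carrier)
  moreover have "pen n A X + 0 \<cdot>\<^sub>m K = pen n A X" by (rule eq_matI) (use assms in auto)
  ultimately show ?thesis using mtends_minv(2)[of "e * n" _ "pen n A X" F] assms(2) by simp
qed

text \<open>Second-order differences of \<open>r\<close> in the direction \<open>H\<close> are nonnegative and, divided by
  \<open>t\<^sup>2\<close>, converge to the quadratic form below.\<close>

lemma second_difference:
  assumes D: "vertebral_domain_of_convexity h g R D" and n: "n \<ge> 1" and AX: "(A, X) \<in> D n"
    and H: "H \<in> herm_tuples n g" and v: "v \<in> carrier_mat n 1"
  shows "0 \<le> qf (minv (pen n A X)) (Tl n H * (minv (pen n A X) * (ccol n * v)))"
proof -
  have sub: "(A', X') \<in> D n \<Longrightarrow> A' \<in> herm_tuples n h \<and> X' \<in> herm_tuples n g \<and> det (pen n A' X') \<noteq> 0" for A' X'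
    using D n unfolding vertebral_domain_of_convexity_def convex_in_x_on_def nc_subset_def dom_r_def nc_space_def by blast
  have A: "A \<in> herm_tuples n h" and X: "X \<in> herm_tuples n g" and det: "det (pen n A X) \<noteq> 0" using sub[OF AX] by auto
  have Am: "A \<in> mats n n h" and Xm: "X \<in> mats n n g" and Hm: "H \<in> mats n n g"
    using A X H by (auto simp: herm_tuples_iff)
  let ?Xt = "\<lambda>t. tuple_comb 1 t X H"
  obtain \<delta> where \<delta>: "\<delta> > 0" "\<And>Y. Y \<in> herm_tuples n g \<Longrightarrow> tuple_close n \<delta> X Y \<Longrightarrow> (A, Y) \<in> D n"
  proof -
    have "open_in_x h g D" using D by (simp add: vertebral_domain_of_convexity_def)
    then show ?thesis using that n A AX unfolding open_in_x_def slice_def by blast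
  qed
  have e1: "\<forall>\<^sub>F t in at (0::real). (A, ?Xt t) \<in> D n"
    using tuple_comb_close[OF Xm Hm \<delta>(1)] by (rule eventually_mono) (use \<delta>(2) tuple_comb_herm[OF X H] in blast)
  have e2: "\<forall>\<^sub>F t in at (0::real). (A, ?Xt (- t)) \<in> D n"
  proof -
    have "filterlim (\<lambda>t::real. - t) (at 0) (at 0)"
      unfolding filterlim_at using tendsto_minus[OF tendsto_ident_at[of "0::real" UNIV]] by (auto simp: eventually_at_filter)
    then show ?thesis using e1 by (auto simp: filterlim_iff)
  qed
  define K where "K = (-1) \<cdot>\<^sub>m Tl n H"
  have Kd: "dim_row K = e * n" "dim_col K = e * n" by (auto simp: K_def)
  have Kc: "K \<in> carrier_mat (e * n) (e * n)" using Kd by auto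
  have hT: "adj (Tl n H) = Tl n H" by (rule plin_herm[OF basic(4,5) H])
  have pt: "pen n A (?Xt t) = pen n A X + complex_of_real t \<cdot>\<^sub>m K" for t
    unfolding pen_def K_def plin_tuple_comb[OF basic(4) Xm Hm]
    by (rule eq_matI) (auto simp: J_dim algebra_simps)
  let ?L = "pen n A X"
  define u where "u = ccol n * v"
  define y where "y = Tl n H * (minv ?L * u)"
  note iL = minv_props[OF pen_carrier det] hermitian_minv[OF pen_carrier det pen_herm[OF A X]]
  note d = carrier_matD[OF iL(1)] Kd carrier_matD[OF v] cm_dim
  have ud: "dim_row u = e * n" "dim_col u = 1" using d by (auto simp: u_def)
  have yd: "dim_row y = e * n" "dim_col y = 1" using d ud by (auto simp: y_def)
  define a where "a = qf (minv ?L) u"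
  define b where "b = Re ((adj u * (minv ?L * (K * (minv ?L * u)))) $$ (0, 0))"
  \<comment> \<open>Exact in \<open>t\<close>: the constant and linear terms cancel in the symmetric
    second difference, and what is left is \<open>t * t\<close> times forms of perturbed inverses at
    the fixed vector \<open>y\<close>.\<close>
  have expand: "qf (realization_eval R n A (?Xt t)) v =
      a - t * b + t * t * qf (minv (?L + complex_of_real t \<cdot>\<^sub>m K)) y"
    if "det (pen n A (?Xt t)) \<noteq> 0" for t
  proof -
    have dt: "det (?L + complex_of_real t \<cdot>\<^sub>m K) \<noteq> 0" using that by (simp add: pt)
    have Mc: "?L + complex_of_real t \<cdot>\<^sub>m K \<in> carrier_mat (e * n) (e * n)" using Kc by simp
    define Q where "Q = minv (?L + complex_of_real t \<cdot>\<^sub>m K)"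
    have Qd: "dim_row Q = e * n" "dim_col Q = e * n" using minv_props(1)[OF Mc dt] by (auto simp: Q_def)
    have Qe: "Q = minv ?L + (- complex_of_real t) \<cdot>\<^sub>m (minv ?L * (K * minv ?L)) +
      (complex_of_real t * complex_of_real t) \<cdot>\<^sub>m (minv ?L * (K * (Q * (K * minv ?L))))"
      unfolding Q_def by (rule resolvent_expansion[OF pen_carrier det Kc dt])
    have "realization_eval R n A (?Xt t) = adj (ccol n) * (Q * ccol n)"
      unfolding re_alt[OF that] Q_def pt ..
    then have "qf (realization_eval R n A (?Xt t)) v = qf Q u"
      using d Qd by (simp add: qf_cong_mult u_def del: adj_kron)
    also have "qf Q u = qf (minv ?L + (- complex_of_real t) \<cdot>\<^sub>m (minv ?L * (K * minv ?L)) +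
      (complex_of_real t * complex_of_real t) \<cdot>\<^sub>m (minv ?L * (K * (Q * (K * minv ?L))))) u" using Qe by simp
    also have "\<dots> = a - t * b + t * t * qf Q y"
      using d ud Qd iL(5) hT
      by (simp add: qf_def a_def b_def y_def K_def mat_ring del: index_mult_mat(1))
    finally show ?thesis by (simp add: Q_def)
  qed
  have mid: "tuple_comb (1/2) (1/2) (?Xt t) (?Xt (- t)) = X" for t
  proof (rule nth_equalityI)
    have m: "?Xt t \<in> mats n n g" "?Xt (- t) \<in> mats n n g" using tuple_comb_mats[OF Xm Hm] by auto
    show "length (tuple_comb (1/2) (1/2) (?Xt t) (?Xt (- t))) = length X"
      using matsD(1)[OF tuple_comb_mats[OF m]] matsD(1)[OF Xm] by simp
    fix i assume "i < length (tuple_comb (1/2) (1/2) (?Xt t) (?Xt (- t)))"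
    then have i: "i < g" using matsD(1)[OF tuple_comb_mats[OF m]] by simp
    show "tuple_comb (1/2) (1/2) (?Xt t) (?Xt (- t)) ! i = X ! i"
      unfolding tuple_comb_nth[OF m i] tuple_comb_nth[OF Xm Hm i]
      by (rule eq_matI) (use carrier_matD[OF matsD(2)[OF Xm i]] carrier_matD[OF matsD(2)[OF Hm i]] in \<open>auto simp: algebra_simps\<close>)
  qed
  have X0: "?Xt 0 = X"
    by (rule nth_equalityI)
      (use matsD(1)[OF Xm] matsD(1)[OF Hm] carrier_matD[OF matsD(2)[OF Xm]] carrier_matD[OF matsD(2)[OF Hm]] in \<open>auto simp: tuple_comb_def intro!: eq_matI\<close>)
  have conv: "0 \<le> qf (minv (?L + complex_of_real t \<cdot>\<^sub>m K) + minv (?L + complex_of_real (- t) \<cdot>\<^sub>m K)) y"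
    if t: "(A, ?Xt t) \<in> D n" "(A, ?Xt (- t)) \<in> D n" "t \<noteq> 0" for t
  proof -
    have d1: "det (pen n A (?Xt t)) \<noteq> 0" "det (pen n A (?Xt (- t))) \<noteq> 0" using sub t by auto
    have "loewner_le (realization_eval R n A (tuple_comb (1/2) (1/2) (?Xt t) (?Xt (- t))))
          ((1/2) \<cdot>\<^sub>m (realization_eval R n A (?Xt t) + realization_eval R n A (?Xt (- t))))"
      using D n t AX mid unfolding vertebral_domain_of_convexity_def convex_in_x_on_def by metis
    then have ps: "psd ((1/2) \<cdot>\<^sub>m (realization_eval R n A (?Xt t) + realization_eval R n A (?Xt (- t))) - realization_eval R n A X)"
      unfolding mid by (simp add: loewner_le_def)
    have rd: "dim_row (realization_eval R n A Z) = n" "dim_col (realization_eval R n A Z) = n" if "det (pen n A Z) \<noteq> 0" for Z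
      using ccol_dim by (auto simp: re_alt[OF that])
    have "0 \<le> qf ((1/2) \<cdot>\<^sub>m (realization_eval R n A (?Xt t) + realization_eval R n A (?Xt (- t))) - realization_eval R n A X) v"
      by (rule psdD(3)[OF ps]) (use rd d1 det v in auto)
    also have "\<dots> = (qf (realization_eval R n A (?Xt t)) v + qf (realization_eval R n A (?Xt (- t))) v) / 2 - qf (realization_eval R n A X) v"
      using rd d1 det d by (simp add: qf_def mat_ring del: index_mult_mat(1))
    also have "qf (realization_eval R n A X) v = a" using expand[of 0] det by (simp add: X0)
    finally have "0 \<le> t * t * (qf (minv (?L + complex_of_real t \<cdot>\<^sub>m K)) y + qf (minv (?L + complex_of_real (- t) \<cdot>\<^sub>m K)) y)"
      unfolding expand[OF d1(1)] expand[OF d1(2)] by (simp add: algebra_simps)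
    then have nn: "0 \<le> qf (minv (?L + complex_of_real t \<cdot>\<^sub>m K)) y + qf (minv (?L + complex_of_real (- t) \<cdot>\<^sub>m K)) y"
      using t(3) not_real_square_gt_zero[of t] mult_pos_neg[of "t * t"] by (metis not_le)
    have mc: "minv (?L + complex_of_real s \<cdot>\<^sub>m K) \<in> carrier_mat (e * n) (e * n)" if "det (pen n A (?Xt s)) \<noteq> 0" for s
      using minv_props(1)[of "?L + complex_of_real s \<cdot>\<^sub>m K" "e * n"] that Kc by (simp add: pt)
    have "y \<in> carrier_mat (e * n) 1" using yd by auto
    from qf_add[OF mc[OF d1(1)] mc[OF d1(2)] this] nn show ?thesis by simp
  qed
  have "mtends (e * n) (e * n) (\<lambda>t. minv (?L + complex_of_real t \<cdot>\<^sub>m K) + minv (?L + complex_of_real (- t) \<cdot>\<^sub>m K))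
     (minv ?L + minv ?L) (at (0::real))"
  proof (intro mtends_add mtends_pen[OF Kc det])
    show "((\<lambda>t. complex_of_real t) \<longlongrightarrow> 0) (at (0::real))" by (rule at_0_of_real)
    show "((\<lambda>t. complex_of_real (- t)) \<longlongrightarrow> 0) (at (0::real))" using tendsto_minus[OF at_0_of_real] by simp
  qed
  then have "0 \<le> qf (minv ?L + minv ?L) y"
  proof (rule mtends_qf_nonneg)
    show "y \<in> carrier_mat (e * n) 1" using yd by auto
    show "\<forall>\<^sub>F t in at (0::real). 0 \<le> qf (minv (?L + complex_of_real t \<cdot>\<^sub>m K) + minv (?L + complex_of_real (- t) \<cdot>\<^sub>m K)) y"
      using e1 e2 eventually_neq_at_within[of 0 "0::real" UNIV] by eventually_elim (rule conv)
  qed simp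
  moreover have "qf (minv ?L + minv ?L) y = qf (minv ?L) y + qf (minv ?L) y"
    by (rule qf_add[OF iL(1) iL(1)]) (use yd in auto)
  ultimately show ?thesis unfolding y_def u_def by simp
qed

end

lemma kron_one_right1: "kron M (1\<^sub>m 1) = M"
  by (rule eq_matI) (auto simp: One_nat_def)

lemma kron_one_left1: "kron (1\<^sub>m 1) M = M"
  by (rule eq_matI) (auto simp: One_nat_def)

lemma kron_col_mult:
  assumes "dim_col c = 1" "dim_row M = N"
  shows "kron c (1\<^sub>m N) * M = kron c M"
  using kron_mult[of c "1\<^sub>m 1" "1\<^sub>m N" M] assms by (simp add: kron_one_left1 mm_one_left mm_one_right)

lemma free_set_dsum:
  assumes "free_set h g D" "1 \<le> m" "1 \<le> n" "(A, X) \<in> D m" "(B, Y) \<in> D n"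
  shows "(map2 dsum A B, map2 dsum X Y) \<in> D (m + n)"
  using assms unfolding free_set_def by blast

context wf_real
begin

text \<open>The second difference at the direct sum, in the direction \<open>offd n N H\<close> and
  at a vector supported in the second summand: the inverse pencil keeps it there, the direction
  moves it into the first summand, and so only the inverse pencil at \<open>(A, X)\<close> is
  tested.\<close>

lemma off_diagonal_positivity:
  assumes D: "vertebral_domain_of_convexity h g R D" and n: "n \<ge> 1" "N \<ge> 1"
    and AX: "(A, X) \<in> D n" and BY: "(B, Y) \<in> D N" and H: "H \<in> mats n N g" and v: "v \<in> carrier_mat N 1"
  shows "0 \<le> qf (minv (pen n A X)) (plin (e * n) (e * N) T H * (minv (pen N B Y) * (ccol N * v)))"
proof -
  have sub: "(A', X') \<in> D q \<Longrightarrow> A' \<in> herm_tuples q h \<and> X' \<in> herm_tuples q g \<and> det (pen q A' X') \<noteq> 0" if "q \<ge> 1" for q A' X'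
    using D that unfolding vertebral_domain_of_convexity_def convex_in_x_on_def nc_subset_def dom_r_def nc_space_def by blast
  have m: "A \<in> mats n n h" "X \<in> mats n n g" "B \<in> mats N N h" "Y \<in> mats N N g"
    and d1: "det (pen n A X) \<noteq> 0" and d2: "det (pen N B Y) \<noteq> 0"
    using sub[OF n(1) AX] sub[OF n(2) BY] by (auto simp: herm_tuples_iff)
  have DS: "(map2 dsum A B, map2 dsum X Y) \<in> D (n + N)"
    using D n AX BY unfolding vertebral_domain_of_convexity_def free_set_def by blast
  let ?E1 = "kron (1\<^sub>m e) (iota1 n N)" and ?E2 = "kron (1\<^sub>m e) (iota2 n N)"
  note o = kron_iota[of e n N]
  let ?v = "iota2 n N * v"
  have vc: "?v \<in> carrier_mat (n + N) 1" using carrier_matD[OF v] by (auto intro!: carrier_matI)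
  note pos = second_difference[OF D _ DS offd_herm[OF H] vc]
  let ?L = "pen (n + N) (map2 dsum A B) (map2 dsum X Y)"
  have iL: "minv ?L = ?E1 * (minv (pen n A X) * adj ?E1) + ?E2 * (minv (pen N B Y) * adj ?E2)"
    unfolding pen_dsum[OF m(1,2,3,4)] by (rule inverse_two_blocks(1)[OF pen_carrier d1 pen_carrier d2 o])
  note d = carrier_matD[OF minv_props(1)[OF pen_carrier d1]] carrier_matD[OF minv_props(1)[OF pen_carrier d2]]
    carrier_matD[OF v] cm_dim
  have x: "adj ?E1 * (?E1 * Z) = Z" "adj ?E2 * (?E1 * Z) = 0\<^sub>m (e * N) (dim_col Z)" if "dim_row Z = e * n" for Z
    using mm_assoc_eq[OF o(3), of Z] mm_assoc_eq[OF o(6), of Z] that by (simp_all add: mm_one_left mm_zero_left del: adj_kron)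
  have y: "adj ?E2 * (?E2 * Z) = Z" "adj ?E1 * (?E2 * Z) = 0\<^sub>m (e * n) (dim_col Z)" if "dim_row Z = e * N" for Z
    using mm_assoc_eq[OF o(4), of Z] mm_assoc_eq[OF o(5), of Z] that by (simp_all add: mm_one_left mm_zero_left del: adj_kron)
  define u where "u = ccol N * v"
  have ud: "dim_row u = e * N" "dim_col u = 1" using d by (auto simp: u_def)
  have cv: "ccol (n + N) * ?v = ?E2 * u"
  proof -
    have "ccol (n + N) * iota2 n N = ?E2 * ccol N" using d by (simp add: kron_col_mult kron_mult mat_ring)
    then have "(ccol (n + N) * iota2 n N) * v = (?E2 * ccol N) * v" by simp
    then show ?thesis using d by (simp add: mm_assoc u_def)
  qed
  define z where "z = minv (pen N B Y) * u"
  have zd: "dim_row z = e * N" "dim_col z = 1" using d ud by (auto simp: z_def)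
  have Lz: "minv ?L * (ccol (n + N) * ?v) = ?E2 * z"
    unfolding iL cv z_def
    by (rule eq_matI) (use d ud in \<open>simp_all add: mat_ring y del: index_mult_mat(1) adj_kron\<close>)
  let ?N = "plin (e * n) (e * N) T H"
  have Tz: "Tl (n + N) (offd n N H) * (?E2 * z) = ?E1 * (?N * z)"
    unfolding plin_offd[OF basic(4,5) H]
    by (rule eq_matI) (use d zd in \<open>simp_all add: mat_ring y del: index_mult_mat(1) adj_kron\<close>)
  have "qf (minv ?L) (?E1 * (?N * z)) = qf (minv (pen n A X)) (?N * z)"
    unfolding iL qf_def using d zd by (simp add: mat_ring x del: index_mult_mat(1) adj_kron)
  then show ?thesis using pos n unfolding Lz Tz by (simp add: z_def u_def)
qed

text \<open>Contracting the second tensor factor of the solution with a row \<open>r\<close> gives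
  its components in \<open>C^e\<close>. All levels \<open>N\<close> are allowed together, which
  makes the set closed under sums.\<close>

definition reach :: "nc_set \<Rightarrow> complex mat set" where
  "reach U = {x. \<exists>N\<ge>1. \<exists>B Y v r. (B, Y) \<in> U N \<and> v \<in> carrier_mat N 1 \<and> r \<in> carrier_mat 1 N \<and>
     x = kron (1\<^sub>m e) r * (minv (pen N B Y) * (ccol N * v))}"

lemma reachI:
  assumes "N \<ge> 1" "(B, Y) \<in> U N" "v \<in> carrier_mat N 1" "r \<in> carrier_mat 1 N"
  shows "kron (1\<^sub>m e) r * (minv (pen N B Y) * (ccol N * v)) \<in> reach U"
  using assms unfolding reach_def by blast

lemma solve_dsum:
  assumes m: "A \<in> mats n n h" "X \<in> mats n n g" "B \<in> mats N N h" "Y \<in> mats N N g"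
    and d1: "det (pen n A X) \<noteq> 0" and d2: "det (pen N B Y) \<noteq> 0" and v: "v \<in> carrier_mat n 1" "v' \<in> carrier_mat N 1"
  shows "minv (pen (n + N) (map2 dsum A B) (map2 dsum X Y)) * (ccol (n + N) * (iota1 n N * v + iota2 n N * v')) =
    kron (1\<^sub>m e) (iota1 n N) * (minv (pen n A X) * (ccol n * v)) + kron (1\<^sub>m e) (iota2 n N) * (minv (pen N B Y) * (ccol N * v'))"
proof -
  let ?E1 = "kron (1\<^sub>m e) (iota1 n N)" and ?E2 = "kron (1\<^sub>m e) (iota2 n N)"
  note o = kron_iota[of e n N]
  let ?L = "pen (n + N) (map2 dsum A B) (map2 dsum X Y)"
  have iL: "minv ?L = ?E1 * (minv (pen n A X) * adj ?E1) + ?E2 * (minv (pen N B Y) * adj ?E2)"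
    unfolding pen_dsum[OF m(1,2,3,4)] by (rule inverse_two_blocks(1)[OF pen_carrier d1 pen_carrier d2 o])
  note d = carrier_matD[OF minv_props(1)[OF pen_carrier d1]] carrier_matD[OF minv_props(1)[OF pen_carrier d2]]
    carrier_matD[OF v(1)] carrier_matD[OF v(2)] cm_dim
  have x: "adj ?E1 * (?E1 * Z) = Z" "adj ?E2 * (?E1 * Z) = 0\<^sub>m (e * N) (dim_col Z)" if "dim_row Z = e * n" for Z
    using mm_assoc_eq[OF o(3), of Z] mm_assoc_eq[OF o(6), of Z] that by (simp_all add: mm_one_left mm_zero_left del: adj_kron)
  have y: "adj ?E2 * (?E2 * Z) = Z" "adj ?E1 * (?E2 * Z) = 0\<^sub>m (e * n) (dim_col Z)" if "dim_row Z = e * N" for Z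
    using mm_assoc_eq[OF o(4), of Z] mm_assoc_eq[OF o(5), of Z] that by (simp_all add: mm_one_left mm_zero_left del: adj_kron)
  have c1: "ccol (n + N) * iota1 n N = ?E1 * ccol n" "ccol (n + N) * iota2 n N = ?E2 * ccol N"
    using d by (simp_all add: kron_col_mult kron_mult mat_ring)
  have cv: "ccol (n + N) * (iota1 n N * v + iota2 n N * v') = ?E1 * (ccol n * v) + ?E2 * (ccol N * v')"
    using mm_assoc_eq[OF c1(1), of v] mm_assoc_eq[OF c1(2), of v'] d by (simp add: mat_ring)
  define u where "u = ccol n * v"
  define u' where "u' = ccol N * v'"
  have ud: "dim_row u = e * n" "dim_col u = 1" "dim_row u' = e * N" "dim_col u' = 1" using d by (auto simp: u_def u'_def)
  show ?thesis
    unfolding iL cv u_def[symmetric] u'_def[symmetric]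
    by (rule eq_matI) (use d ud in \<open>simp_all add: mat_ring x y del: index_mult_mat(1) adj_kron\<close>)
qed

lemma row_iota:
  assumes "dim_row z = e * n" "dim_row z' = e * N" "dim_col z = dim_col z'" "r \<in> carrier_mat 1 n" "r' \<in> carrier_mat 1 N"
  shows "kron (1\<^sub>m e) (r * adj (iota1 n N) + r' * adj (iota2 n N)) * (kron (1\<^sub>m e) (iota1 n N) * z + kron (1\<^sub>m e) (iota2 n N) * z') =
    kron (1\<^sub>m e) r * z + kron (1\<^sub>m e) r' * z'"
proof -
  note rd = carrier_matD[OF assms(4)] carrier_matD[OF assms(5)]
  have k: "kron (1\<^sub>m e) (r * adj (iota1 n N) + r' * adj (iota2 n N)) =
      kron (1\<^sub>m e) r * adj (kron (1\<^sub>m e) (iota1 n N)) + kron (1\<^sub>m e) r' * adj (kron (1\<^sub>m e) (iota2 n N))"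
    using rd by (simp add: kron_add_right kron_mult mm_one_left)
  let ?E1 = "kron (1\<^sub>m e) (iota1 n N)" and ?E2 = "kron (1\<^sub>m e) (iota2 n N)"
  note o = kron_iota[of e n N]
  have x: "adj ?E1 * (?E1 * Z) = Z" "adj ?E2 * (?E1 * Z) = 0\<^sub>m (e * N) (dim_col Z)" if "dim_row Z = e * n" for Z
    using mm_assoc_eq[OF o(3), of Z] mm_assoc_eq[OF o(6), of Z] that by (simp_all add: mm_one_left mm_zero_left del: adj_kron)
  have y: "adj ?E2 * (?E2 * Z) = Z" "adj ?E1 * (?E2 * Z) = 0\<^sub>m (e * n) (dim_col Z)" if "dim_row Z = e * N" for Z
    using mm_assoc_eq[OF o(4), of Z] mm_assoc_eq[OF o(5), of Z] that by (simp_all add: mm_one_left mm_zero_left del: adj_kron)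
  show ?thesis unfolding k
    by (rule eq_matI) (use rd assms in \<open>simp_all add: mat_ring x y del: index_mult_mat(1) adj_kron\<close>)
qed

text \<open>For a sum, two elements are put over the direct sum of their points, with the vectors
  stacked and the rows concatenated; scalars are absorbed into \<open>v\<close>.\<close>

lemma reach_colspace:
  assumes U: "free_set h g U" "nc_subset U (dom_r h g R)" "U 1 \<noteq> {}"
  shows "colspace e (reach U)"
proof -
  have sub: "A' \<in> mats q q h \<and> X' \<in> mats q q g \<and> det (pen q A' X') \<noteq> 0" if "q \<ge> 1" "(A', X') \<in> U q" for q A' X'
  proof -
    have "(A', X') \<in> dom_r h g R q" using U(2) that by (auto simp: nc_subset_def)
    then show ?thesis by (auto simp: dom_r_def nc_space_def herm_tuples_iff)
  qed
  show ?thesis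
    unfolding colspace_def
  proof (intro conjI ballI allI)
    show "reach U \<subseteq> carrier_mat e 1"
    proof
      fix x assume "x \<in> reach U"
      then obtain N B Y v r where "v \<in> carrier_mat N 1" "r \<in> carrier_mat 1 N"
        and x: "x = kron (1\<^sub>m e) r * (minv (pen N B Y) * (ccol N * v))" unfolding reach_def by blast
      then show "x \<in> carrier_mat e 1" by (intro carrier_matI) simp_all
    qed
    obtain b y where U1: "(b, y) \<in> U 1" using U(3) by auto
    have "kron (1\<^sub>m e) (1\<^sub>m 1) * (minv (pen 1 b y) * (ccol 1 * 0\<^sub>m 1 1)) \<in> reach U"
      by (rule reachI) (use U1 in auto)
    moreover have "kron (1\<^sub>m e) (1\<^sub>m 1) * (minv (pen 1 b y) * (ccol 1 * 0\<^sub>m 1 1)) = 0\<^sub>m e 1"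
      using carrier_matD[OF minv_props(1)[OF pen_carrier conjunct2[OF conjunct2[OF sub[OF _ U1]]]]] cm_dim
      by (simp add: kron_one mat_ring)
    ultimately show "0\<^sub>m e 1 \<in> reach U" by simp
  next
    fix z x assume "x \<in> reach U"
    then obtain N B Y v r where N: "N \<ge> 1" "(B, Y) \<in> U N" "v \<in> carrier_mat N 1" "r \<in> carrier_mat 1 N"
      and x: "x = kron (1\<^sub>m e) r * (minv (pen N B Y) * (ccol N * v))" unfolding reach_def by blast
    note d = carrier_matD[OF minv_props(1)[OF pen_carrier conjunct2[OF conjunct2[OF sub[OF N(1,2)]]]]] cm_dim
      carrier_matD[OF N(3)] carrier_matD[OF N(4)]
    have "z \<cdot>\<^sub>m x = kron (1\<^sub>m e) r * (minv (pen N B Y) * (ccol N * (z \<cdot>\<^sub>m v)))"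
      unfolding x using d by (simp add: mat_ring)
    moreover have "\<dots> \<in> reach U" by (rule reachI) (use N in auto)
    ultimately show "z \<cdot>\<^sub>m x \<in> reach U" by simp
  next
    fix x x' assume "x \<in> reach U" "x' \<in> reach U"
    then obtain N B Y v r N' B' Y' v' r' where
      N: "N \<ge> 1" "(B, Y) \<in> U N" "v \<in> carrier_mat N 1" "r \<in> carrier_mat 1 N" and
      N': "N' \<ge> 1" "(B', Y') \<in> U N'" "v' \<in> carrier_mat N' 1" "r' \<in> carrier_mat 1 N'"
      and x: "x = kron (1\<^sub>m e) r * (minv (pen N B Y) * (ccol N * v))"
        "x' = kron (1\<^sub>m e) r' * (minv (pen N' B' Y') * (ccol N' * v'))" unfolding reach_def by blast
    note s = sub[OF N(1,2)] and s' = sub[OF N'(1,2)]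
    have ds: "(map2 dsum B B', map2 dsum Y Y') \<in> U (N + N')"
      by (rule free_set_dsum[OF U(1) N(1) N'(1) N(2) N'(2)])
    let ?r = "r * adj (iota1 N N') + r' * adj (iota2 N N')" and ?v = "iota1 N N' * v + iota2 N N' * v'"
    note rd = carrier_matD[OF N(3)] carrier_matD[OF N(4)] carrier_matD[OF N'(3)] carrier_matD[OF N'(4)]
      carrier_matD[OF minv_props(1)[OF pen_carrier conjunct2[OF conjunct2[OF s]]]]
      carrier_matD[OF minv_props(1)[OF pen_carrier conjunct2[OF conjunct2[OF s']]]]
    have "kron (1\<^sub>m e) ?r * (minv (pen (N + N') (map2 dsum B B') (map2 dsum Y Y')) * (ccol (N + N') * ?v)) \<in> reach U"
      by (rule reachI[where N = "N + N'" and U = U and B = "map2 dsum B B'" and Y = "map2 dsum Y Y'", OF _ ds]) (use N(1) rd in \<open>auto intro!: carrier_matI\<close>)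
    moreover have "kron (1\<^sub>m e) ?r * (minv (pen (N + N') (map2 dsum B B') (map2 dsum Y Y')) * (ccol (N + N') * ?v)) = x + x'"
      unfolding solve_dsum[OF conjunct1[OF s] conjunct1[OF conjunct2[OF s]] conjunct1[OF s'] conjunct1[OF conjunct2[OF s']]
          conjunct2[OF conjunct2[OF s]] conjunct2[OF conjunct2[OF s']] N(3) N'(3)] x
      by (rule row_iota) (use N(4) N'(4) rd in auto)
    ultimately show "x + x' \<in> reach U" by simp
  qed
qed

end

text \<open>A finite-dimensional subspace is closed: \<open>E * H\<close> is continuous and fixes
  each element of \<open>K\<close>, so it fixes the limit and thereby puts it into
  \<open>K\<close>.\<close>

lemma colspace_closed:
  assumes K: "colspace e K" and f: "mtends e 1 f M F" "F \<noteq> bot" "\<forall>\<^sub>F t in F. f t \<in> K"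
  shows "M \<in> K"
proof -
  obtain m E H where E: "E \<in> carrier_mat e m" and H: "H \<in> carrier_mat m e"
    and KE: "\<And>x. x \<in> K \<Longrightarrow> E * (H * x) = x" and EK: "\<And>y. y \<in> carrier_mat m 1 \<Longrightarrow> E * y \<in> K"
    using colspace_basis[OF K] by blast
  have 1: "mtends e 1 (\<lambda>t. E * (H * f t)) (E * (H * M)) F"
    by (rule mtends_mult[OF mtends_const[OF E] mtends_mult[OF mtends_const[OF H] f(1)]])
  have "mtends e 1 f (E * (H * M)) F"
    by (rule mtends_cong[OF 1]) (use f(3) KE in \<open>auto elim: eventually_mono\<close>)
  then have "M = E * (H * M)" using mtends_unique[OF f(1)] f(2) by blast
  moreover have "E * (H * M) \<in> K" by (rule EK) (use H mtendsD(1)[OF f(1)] in auto)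
  ultimately show ?thesis by simp
qed

lemma nc_openD:
  assumes "nc_open h g U" "1 \<le> n" "(A, X) \<in> U n"
  shows "\<exists>\<epsilon>>0. \<forall>B Y. B \<in> herm_tuples n h \<longrightarrow> Y \<in> herm_tuples n g \<longrightarrow> tuple_close n \<epsilon> A B \<longrightarrow> tuple_close n \<epsilon> X Y \<longrightarrow> (B, Y) \<in> U n"
proof -
  have "\<exists>\<epsilon>>0. \<forall>(B, Y) \<in> nc_space h g n. tuple_close n \<epsilon> A B \<and> tuple_close n \<epsilon> X Y \<longrightarrow> (B, Y) \<in> U n"
    using assms unfolding nc_open_def by fast
  then show ?thesis by (force simp: nc_space_def)
qed

context wf_real
begin

text \<open>For the direct sum of \<open>(B, Y)\<close> with \<open>(b, y)\<close>, perturbed off the diagonal in direction \<open>F\<close>,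
  the lower component of the solution is, up to a scalar factor, \<open>pen 1 b y\<^sup>-\<^sup>1 F\<close> applied to an
  element close to the given one.\<close>

lemma reach_invariant:
  assumes U: "free_set h g U" "nc_open h g U" "nc_subset U (dom_r h g R)" and U1: "(b, y) \<in> U 1"
    and F: "F \<in> carrier_mat e e" "adj F = F"
    and HF: "\<And>N r. r \<in> carrier_mat 1 N \<Longrightarrow> \<exists>HA HX. HA \<in> mats N 1 h \<and> HX \<in> mats N 1 g \<and>
        plin (e * N) (e * 1) T HX + plin (e * N) (e * 1) S HA = kron F (adj r)"
    and x: "x \<in> reach U"
  shows "minv (pen 1 b y) * (F * x) \<in> reach U"
proof -
  have K: "colspace e (reach U)" by (rule reach_colspace[OF U(1,3)]) (use U1 in auto)
  have sub: "A' \<in> herm_tuples q h \<and> X' \<in> herm_tuples q g \<and> det (pen q A' X') \<noteq> 0" if "q \<ge> 1" "(A', X') \<in> U q" for q A' X'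
  proof -
    have "(A', X') \<in> dom_r h g R q" using U(3) that by (auto simp: nc_subset_def)
    then show ?thesis by (auto simp: dom_r_def nc_space_def)
  qed
  obtain N B Y v r where N: "N \<ge> 1" "(B, Y) \<in> U N" "v \<in> carrier_mat N 1" "r \<in> carrier_mat 1 N"
    and x_eq: "x = kron (1\<^sub>m e) r * (minv (pen N B Y) * (ccol N * v))" using x unfolding reach_def by blast
  obtain HA HX where HA: "HA \<in> mats N 1 h" and HX: "HX \<in> mats N 1 g" and
    Nf: "plin (e * N) (e * 1) T HX + plin (e * N) (e * 1) S HA = kron F (adj r)" using HF[OF N(4)] by blast
  note sB = sub[OF N(1,2)] and sb = sub[OF order.refl U1]
  let ?A = "map2 dsum B b" and ?X = "map2 dsum Y y"
  have ds: "(?A, ?X) \<in> U (N + 1)" by (rule free_set_dsum[OF U(1) N(1) order.refl N(2) U1])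
  have N1: "1 \<le> N + 1" by simp
  note sD = sub[OF N1 ds]
  have Bm: "B \<in> mats N N h" "Y \<in> mats N N g" "b \<in> mats 1 1 h" "y \<in> mats 1 1 g" and
    Am: "?A \<in> mats (N + 1) (N + 1) h" "?X \<in> mats (N + 1) (N + 1) g"
    using sB sb sD by (auto simp: herm_tuples_iff)
  let ?OA = "offd N 1 HA" and ?OX = "offd N 1 HX"
  have O: "?OA \<in> herm_tuples (N + 1) h" "?OX \<in> herm_tuples (N + 1) g" by (rule offd_herm[OF HA], rule offd_herm[OF HX])
  have Om: "?OA \<in> mats (N + 1) (N + 1) h" "?OX \<in> mats (N + 1) (N + 1) g" using O by (auto simp: herm_tuples_iff)
  let ?At = "\<lambda>t. tuple_comb 1 t ?A ?OA" and ?Xt = "\<lambda>t. tuple_comb 1 t ?X ?OX"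
  obtain \<epsilon> where \<epsilon>: "\<epsilon> > 0" "\<And>C Z. C \<in> herm_tuples (N + 1) h \<Longrightarrow> Z \<in> herm_tuples (N + 1) g \<Longrightarrow>
      tuple_close (N + 1) \<epsilon> ?A C \<Longrightarrow> tuple_close (N + 1) \<epsilon> ?X Z \<Longrightarrow> (C, Z) \<in> U (N + 1)"
    using nc_openD[OF U(2) N1 ds] by blast
  have ev: "\<forall>\<^sub>F t in at (0::real). (?At t, ?Xt t) \<in> U (N + 1)"
    using tuple_comb_close[OF Am(1) Om(1) \<epsilon>(1)] tuple_comb_close[OF Am(2) Om(2) \<epsilon>(1)]
  proof eventually_elim
    case (elim t)
    show ?case by (rule \<epsilon>(2)[OF _ _ elim]) (use sD O in \<open>auto intro: tuple_comb_herm\<close>)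
  qed
  let ?E1 = "kron (1\<^sub>m e) (iota1 N 1)" and ?E2 = "kron (1\<^sub>m e) (iota2 N 1)"
  note o = kron_iota[of e N 1]
  let ?M = "pen 1 b y" and ?L1 = "pen N B Y" and ?L0 = "pen (N + 1) ?A ?X"
  have d1: "det ?L1 \<noteq> 0" and dM: "det ?M \<noteq> 0" and d0: "det ?L0 \<noteq> 0" using sB sb sD by auto
  note iM = minv_props[OF pen_carrier dM] and i1 = minv_props[OF pen_carrier d1]
  note Fd = carrier_matD[OF F(1)] and rd = carrier_matD[OF N(4)] and vd = carrier_matD[OF N(3)]
  note d = Fd rd vd carrier_matD[OF iM(1)] carrier_matD[OF i1(1)] cm_dim pen_dim
  let ?Nf = "kron F (adj r)"
  have Nfa: "adj ?Nf = kron F r" using F(2) by simp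
  define K0 where "K0 = (-1) \<cdot>\<^sub>m (?E1 * (?Nf * adj ?E2) + ?E2 * (adj ?Nf * adj ?E1))"
  have K0d: "dim_row K0 = e * (N + 1)" "dim_col K0 = e * (N + 1)" by (auto simp: K0_def)
  have K0c: "K0 \<in> carrier_mat (e * (N + 1)) (e * (N + 1))" using K0d by auto
  have K0_eq: "(-1) \<cdot>\<^sub>m (Tl (N + 1) ?OX + Sl (N + 1) ?OA) = K0"
    unfolding K0_def plin_offd[OF basic(4,5) HX] plin_offd[OF basic(6,7) HA] Nf[symmetric]
    by (rule eq_matI) (simp_all add: mat_ring del: index_mult_mat(1) adj_kron)
  have pt: "pen (N + 1) (?At t) (?Xt t) = ?L0 + complex_of_real t \<cdot>\<^sub>m K0" for t
    unfolding pen_comb[OF Am(1) Om(1) Am(2) Om(2)] K0_eq ..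
  define u where "u = ccol N * v"
  have ud: "dim_row u = e * N" "dim_col u = 1" using d by (auto simp: u_def)
  have cv: "ccol (N + 1) * (iota1 N 1 * v) = ?E1 * u"
  proof -
    have "ccol (N + 1) * iota1 N 1 = ?E1 * ccol N" using d by (simp add: kron_col_mult kron_mult mat_ring)
    from mm_assoc_eq[OF this, of v] show ?thesis using d by (simp add: mm_assoc u_def)
  qed
  have x1: "adj ?E1 * (?E1 * Z) = Z" "adj ?E2 * (?E1 * Z) = 0\<^sub>m (e * 1) (dim_col Z)" if "dim_row Z = e * N" for Z
    using mm_assoc_eq[OF o(3), of Z] mm_assoc_eq[OF o(6), of Z] that by (simp_all add: mm_one_left mm_zero_left del: adj_kron)
  have x2: "adj ?E2 * (?E2 * Z) = Z" "adj ?E1 * (?E2 * Z) = 0\<^sub>m (e * N) (dim_col Z)" if "dim_row Z = e * 1" for Z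
    using mm_assoc_eq[OF o(4), of Z] mm_assoc_eq[OF o(5), of Z] that by (simp_all add: mm_one_left mm_zero_left del: adj_kron)
  define z where "z t = minv (?L0 + complex_of_real t \<cdot>\<^sub>m K0) * (?E1 * u)" for t
  \<comment> \<open>For nonzero \<open>t\<close> this is the lower component of the solution divided
    by \<open>t\<close>, in a form that also makes sense at \<open>t = 0\<close>.\<close>
  define f where "f t = minv ?M * (adj ?Nf * (adj ?E1 * z t))" for t
  have fK: "f t \<in> reach U" if t: "(?At t, ?Xt t) \<in> U (N + 1)" "t \<noteq> 0" for t
  proof -
    have dt: "det (?L0 + complex_of_real t \<cdot>\<^sub>m K0) \<noteq> 0" using sub[OF N1 t(1)] by (simp add: pt)
    have Lc: "?L0 + complex_of_real t \<cdot>\<^sub>m K0 \<in> carrier_mat (e * (N + 1)) (e * (N + 1))" using K0c by simp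
    note it = minv_props[OF Lc dt]
    have zd: "dim_row (z t) = e * (N + 1)" "dim_col (z t) = 1"
      using carrier_matD[OF it(1)] ud by (auto simp: z_def)
    have w: "adj ?E2 * z t \<in> reach U"
    proof -
      have "kron (1\<^sub>m e) (adj (iota2 N 1)) * (minv (pen (N + 1) (?At t) (?Xt t)) * (ccol (N + 1) * (iota1 N 1 * v))) \<in> reach U"
        by (rule reachI[where N = "N + 1" and U = U and B = "?At t" and Y = "?Xt t", OF N1 t(1)]) (use vd in \<open>auto intro!: carrier_matI\<close>)
      then show ?thesis unfolding cv pt z_def by simp
    qed
    \<comment> \<open>The right-hand side is supported in the upper block, so the lower block row of
      the system expresses the lower component of \<open>z t\<close> through the upper one.\<close>
    have "(?L0 + complex_of_real t \<cdot>\<^sub>m K0) * z t = ?E1 * u"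
      unfolding z_def using mm_assoc_eq[OF it(2), of "?E1 * u"] ud carrier_matD[OF it(1)] K0d by (simp add: mm_one_left)
    then have "adj ?E2 * ((?L0 + complex_of_real t \<cdot>\<^sub>m K0) * z t) = 0\<^sub>m (e * 1) 1" using x1 ud by simp
    moreover have "adj ?E2 * ((?L0 + complex_of_real t \<cdot>\<^sub>m K0) * z t) =
        ?M * (adj ?E2 * z t) + (- complex_of_real t) \<cdot>\<^sub>m (adj ?Nf * (adj ?E1 * z t))"
      unfolding pen_dsum[OF Bm(1,2,3,4)] K0_def
      by (rule eq_matI) (use d zd in \<open>simp_all add: mat_ring smult_add_mm x1 x2 del: index_mult_mat(1) adj_kron\<close>)
    ultimately have eq: "?M * (adj ?E2 * z t) + (- complex_of_real t) \<cdot>\<^sub>m (adj ?Nf * (adj ?E1 * z t)) = 0\<^sub>m (e * 1) 1" by simp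
    have "minv ?M * (?M * (adj ?E2 * z t) + (- complex_of_real t) \<cdot>\<^sub>m (adj ?Nf * (adj ?E1 * z t))) = 0\<^sub>m (e * 1) 1"
      unfolding eq using d by (simp add: mm_zero_right)
    moreover have "minv ?M * (?M * (adj ?E2 * z t) + (- complex_of_real t) \<cdot>\<^sub>m (adj ?Nf * (adj ?E1 * z t))) =
        adj ?E2 * z t + (- complex_of_real t) \<cdot>\<^sub>m f t"
      using mm_assoc_eq[OF iM(3), of "adj ?E2 * z t"] d zd by (simp add: f_def mat_ring del: adj_kron)
    ultimately have eq2: "adj ?E2 * z t + (- complex_of_real t) \<cdot>\<^sub>m f t = 0\<^sub>m (e * 1) 1" by simp
    have fd: "dim_row (f t) = e * 1" "dim_col (f t) = 1" using d zd by (auto simp: f_def)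
    have "f t = (1 / complex_of_real t) \<cdot>\<^sub>m (adj ?E2 * z t)"
    proof (rule eq_matI)
      fix i j assume "i < dim_row ((1 / complex_of_real t) \<cdot>\<^sub>m (adj ?E2 * z t))" "j < dim_col ((1 / complex_of_real t) \<cdot>\<^sub>m (adj ?E2 * z t))"
      then have ij: "i < e * 1" "j < 1" using zd by auto
      have "(adj ?E2 * z t) $$ (i, j) - complex_of_real t * f t $$ (i, j) = 0"
        using arg_cong[OF eq2, of "\<lambda>M. M $$ (i, j)"] ij fd zd by (simp del: index_mult_mat(1) adj_kron)
      then show "f t $$ (i, j) = ((1 / complex_of_real t) \<cdot>\<^sub>m (adj ?E2 * z t)) $$ (i, j)"
        using ij zd t(2) by (simp add: field_simps del: index_mult_mat(1) adj_kron)
    qed (use fd zd in auto)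
    then show ?thesis using w K by (simp add: colspace_def)
  qed
  have evf: "\<forall>\<^sub>F t in at (0::real). f t \<in> reach U"
    using ev eventually_neq_at_within[of 0 "0::real" UNIV] by eventually_elim (rule fK)
  have mz: "mtends (e * (N + 1)) 1 z (minv ?L0 * (?E1 * u)) (at (0::real))"
    unfolding z_def
    by (rule mtends_mult[OF mtends_pen[OF K0c d0 at_0_of_real] mtends_const]) (use ud in \<open>auto intro!: carrier_matI\<close>)
  \<comment> \<open>The lower component itself tends to 0; divided by \<open>t\<close> it has the
    limit stated here, which closedness of the subspace keeps in \<open>reach U\<close>.\<close>
  have mf: "mtends (e * 1) 1 f (minv ?M * (adj ?Nf * (adj ?E1 * (minv ?L0 * (?E1 * u))))) (at (0::real))"
    unfolding f_def
    by (rule mtends_mult[OF mtends_const[OF iM(1)] mtends_mult[OF mtends_const mtends_mult[OF mtends_const mz]]])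
      (use d in \<open>auto intro!: carrier_matI\<close>)
  have "minv ?L0 * (?E1 * u) = ?E1 * (minv ?L1 * u)"
  proof -
    have iL: "minv ?L0 = ?E1 * (minv ?L1 * adj ?E1) + ?E2 * (minv ?M * adj ?E2)"
      unfolding pen_dsum[OF Bm(1,2,3,4)] by (rule inverse_two_blocks(1)[OF pen_carrier d1 pen_carrier dM o])
    show ?thesis unfolding iL
      by (rule eq_matI) (use d ud in \<open>simp_all add: mat_ring x1 del: index_mult_mat(1) adj_kron\<close>)
  qed
  moreover have "adj ?Nf * (minv ?L1 * u) = F * x"
  proof -
    have "F * kron (1\<^sub>m e) r = kron F (1\<^sub>m 1) * kron (1\<^sub>m e) r" by (simp only: kron_one_right1)
    also have "\<dots> = kron F r" using d by (simp add: kron_mult mat_ring)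
    finally show ?thesis unfolding Nfa x_eq u_def[symmetric] using d ud by (simp add: mm_assoc[symmetric])
  qed
  ultimately have lim: "minv ?M * (adj ?Nf * (adj ?E1 * (minv ?L0 * (?E1 * u)))) = minv ?M * (F * x)"
    using x1 d ud by (simp del: adj_kron)
  show ?thesis
    by (rule colspace_closed[OF K _ _ evf]) (use mf lim in auto)
qed

lemma T_nth_herm: "i < g \<Longrightarrow> adj (T ! i) = T ! i"
  using arg_cong[OF basic(5), of "\<lambda>l. l ! i"] matsD(1)[OF basic(4)] by simp

lemma S_nth_herm: "i < h \<Longrightarrow> adj (S ! i) = S ! i"
  using arg_cong[OF basic(7), of "\<lambda>l. l ! i"] matsD(1)[OF basic(6)] by simp

lemma plin_single_zero:
  assumes "Ts \<in> mats e e q"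
  shows "plin (e * N) (e * 1) Ts (single q N 1 q (0\<^sub>m N 1)) = 0\<^sub>m (e * N) (e * 1)"
  by (subst plin_single[OF assms]) auto

text \<open>With \<open>M\<close> the pencil at a scalar point of \<open>U\<close>, the reachable
  space is stable under \<open>minv M\<close> times each coefficient, whereas minimality speaks of
  \<open>J\<close>. As \<open>minv M * J = 1 + minv M * \<Lambda>\<close>, the space is stable under
  \<open>minv M * J\<close>, which is injective and hence bijective on it; the inverse
  \<open>J * M\<close> carries \<open>minv M T_i\<close> to \<open>J T_i\<close>.\<close>

lemma reach_full:
  assumes U: "free_set h g U" "nc_open h g U" "nc_subset U (dom_r h g R)" "U 1 \<noteq> {}"
    and smr: "SMR h g rr R" "set_nc_expr rr \<subseteq> vars_ax h g"
  shows "reach U = carrier_mat e 1"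
proof -
  obtain b y where U1: "(b, y) \<in> U 1" using U(4) by auto
  have K: "colspace e (reach U)" by (rule reach_colspace[OF U(1,3,4)])
  have "(b, y) \<in> dom_r h g R 1" using U(3) U1 by (auto simp: nc_subset_def)
  then have b: "b \<in> herm_tuples 1 h" and y: "y \<in> herm_tuples 1 g" and dM: "det (pen 1 b y) \<noteq> 0"
    by (auto simp: dom_r_def nc_space_def)
  have bm: "b \<in> mats 1 1 h" and ym: "y \<in> mats 1 1 g" using b y by (auto simp: herm_tuples_iff)
  let ?M = "pen 1 b y"
  have Mc: "?M \<in> carrier_mat e e" using pen_carrier[of 1 b y] by simp
  note iM = minv_props[OF Mc dM]
  have invT: "minv ?M * ((T ! i) * x) \<in> reach U" if i: "i < g" and x: "x \<in> reach U" for i x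
  proof (rule reach_invariant[OF U(1-3) U1 matsD(2)[OF basic(4) i] T_nth_herm[OF i] _ x])
    fix N and r :: "complex mat" assume r: "r \<in> carrier_mat 1 N"
    then have ra: "adj r \<in> carrier_mat N 1" by simp
    have "plin (e * N) (e * 1) T (single g N 1 i (adj r)) + plin (e * N) (e * 1) S (single h N 1 h (0\<^sub>m N 1)) = kron (T ! i) (adj r)"
      unfolding plin_single_zero[OF basic(6)] plin_single[OF basic(4) ra]
      using i carrier_matD[OF matsD(2)[OF basic(4) i]] carrier_matD[OF r] by (auto intro!: eq_matI)
    then show "\<exists>HA HX. HA \<in> mats N 1 h \<and> HX \<in> mats N 1 g \<and> plin (e * N) (e * 1) T HX + plin (e * N) (e * 1) S HA = kron (T ! i) (adj r)"
      by (intro exI[of _ "single h N 1 h (0\<^sub>m N 1)"] exI[of _ "single g N 1 i (adj r)"] conjI single_mats ra zero_carrier_mat)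
  qed
  have invS: "minv ?M * ((S ! i) * x) \<in> reach U" if i: "i < h" and x: "x \<in> reach U" for i x
  proof (rule reach_invariant[OF U(1-3) U1 matsD(2)[OF basic(6) i] S_nth_herm[OF i] _ x])
    fix N and r :: "complex mat" assume r: "r \<in> carrier_mat 1 N"
    then have ra: "adj r \<in> carrier_mat N 1" by simp
    have "plin (e * N) (e * 1) T (single g N 1 g (0\<^sub>m N 1)) + plin (e * N) (e * 1) S (single h N 1 i (adj r)) = kron (S ! i) (adj r)"
      unfolding plin_single_zero[OF basic(4)] plin_single[OF basic(6) ra]
      using i carrier_matD[OF matsD(2)[OF basic(6) i]] carrier_matD[OF r] by (auto intro!: eq_matI)
    then show "\<exists>HA HX. HA \<in> mats N 1 h \<and> HX \<in> mats N 1 g \<and> plin (e * N) (e * 1) T HX + plin (e * N) (e * 1) S HA = kron (S ! i) (adj r)"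
      by (intro exI[of _ "single h N 1 i (adj r)"] exI[of _ "single g N 1 g (0\<^sub>m N 1)"] conjI single_mats ra zero_carrier_mat)
  qed
  have c1: "minv ?M * cm \<in> reach U"
  proof -
    have "kron (1\<^sub>m e) (1\<^sub>m 1) * (minv ?M * (ccol 1 * 1\<^sub>m 1)) \<in> reach U" by (rule reachI) (use U1 in auto)
    then show ?thesis using carrier_matD[OF iM(1)] cm_dim by (simp add: kron_one kron_one_right1 mat_ring)
  qed
  obtain m E H where m: "m \<le> e" and E: "E \<in> carrier_mat e m" and H: "H \<in> carrier_mat m e" and HE: "H * E = 1\<^sub>m m"
    and KE: "\<And>x. x \<in> reach U \<Longrightarrow> E * (H * x) = x" and EK: "\<And>y. y \<in> carrier_mat m 1 \<Longrightarrow> E * y \<in> reach U"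
    using colspace_basis[OF K] by blast
  note d = carrier_matD[OF E] carrier_matD[OF H] carrier_matD[OF iM(1)] carrier_matD[OF Mc] J_dim cm_dim
  have HEX: "H * (E * X) = X" if "dim_row X = m" for X
    using mm_assoc_eq[OF HE, of X] that d by (simp add: mm_one_left)
  have lift: "E * (H * (minv ?M * (F * E))) = minv ?M * (F * E)"
    if F: "F \<in> carrier_mat e e" and inv: "\<And>x. x \<in> reach U \<Longrightarrow> minv ?M * (F * x) \<in> reach U" for F
  proof (rule mult_right_cancel_inj[of _ e m])
    note Fd = carrier_matD[OF F]
    show "E * (H * (minv ?M * (F * E))) \<in> carrier_mat e m" "minv ?M * (F * E) \<in> carrier_mat e m"
      using d by (auto intro!: carrier_matI)
    fix x :: "complex mat" assume x: "x \<in> carrier_mat m 1"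
    show "E * (H * (minv ?M * (F * E))) * x = minv ?M * (F * E) * x"
      using KE[OF inv[OF EK[OF x]]] d Fd carrier_matD[OF x] by (simp add: mm_assoc)
  qed
  have liftT: "E * (H * (minv ?M * (T ! i * E))) = minv ?M * (T ! i * E)" if "i < g" for i
    by (rule lift[OF matsD(2)[OF basic(4) that]]) (rule invT[OF that])
  have liftS: "E * (H * (minv ?M * (S ! i * E))) = minv ?M * (S ! i * E)" if "i < h" for i
    by (rule lift[OF matsD(2)[OF basic(6) that]]) (rule invS[OF that])
  define \<Lambda> where "\<Lambda> = Tl 1 y + Sl 1 b"
  have \<Lambda>d: "dim_row \<Lambda> = e" "dim_col \<Lambda> = e" by (auto simp: \<Lambda>_def)
  have lift\<Lambda>: "E * (H * (minv ?M * (\<Lambda> * E))) = minv ?M * (\<Lambda> * E)"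
    using plin_invariant[OF iM(1) basic(4) ym E H liftT] plin_invariant[OF iM(1) basic(6) bm E H liftS] d
    by (simp add: kron_one_right1 \<Lambda>_def mat_ring)
  have JM: "J = ?M + \<Lambda>" unfolding pen_def \<Lambda>_def kron_one_right1 by (rule eq_matI) (auto simp: J_dim)
  have MJE: "minv ?M * (J * E) = E + minv ?M * (\<Lambda> * E)"
    unfolding JM using mm_assoc_eq[OF iM(3), of E] d \<Lambda>d by (simp add: mat_ring)
  \<comment> \<open>The matrix of \<open>minv M * J\<close> on the reachable space; its
    invertibility yields stability under \<open>J * M\<close>.\<close>
  define \<Psi> where "\<Psi> = H * (minv ?M * (J * E))"
  have \<Psi>d: "dim_row \<Psi> = m" "dim_col \<Psi> = m" using d by (auto simp: \<Psi>_def)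
  have \<Psi>c: "\<Psi> \<in> carrier_mat m m" using \<Psi>d by auto
  have E\<Psi>: "E * \<Psi> = minv ?M * (J * E)"
    unfolding \<Psi>_def MJE using d \<Lambda>d by (simp add: mat_ring lift\<Lambda> HE)
  have JX: "J * (J * X) = X" if "dim_row X = e" for X
    using mm_assoc_eq[OF basic(2), of X] that d by (simp add: mm_one_left)
  have MX: "?M * (minv ?M * X) = X" if "dim_row X = e" for X
    using mm_assoc_eq[OF iM(2), of X] that d by (simp add: mm_one_left)
  have ME\<Psi>: "?M * (E * \<Psi>) = J * E" unfolding E\<Psi> using d by (simp add: MX)
  have d\<Psi>: "det \<Psi> \<noteq> 0"
  proof (rule det_nonzeroI[OF \<Psi>c])
    fix x assume x: "x \<in> carrier_mat m 1" "\<Psi> * x = 0\<^sub>m m 1"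
    note xd = carrier_matD[OF x(1)]
    have "J * (E * x) = ?M * (E * (\<Psi> * x))" using arg_cong[OF ME\<Psi>, of "\<lambda>M. M * x"] d \<Psi>d xd by (simp add: mm_assoc)
    also have "\<dots> = 0\<^sub>m e 1" unfolding x(2) using d by (simp add: mm_zero_right)
    finally have "J * (J * (E * x)) = 0\<^sub>m e 1" using d by (simp add: mm_zero_right)
    then have "H * (E * x) = 0\<^sub>m m 1" using d xd by (simp add: JX mm_zero_right)
    then show "x = 0\<^sub>m m 1" using HEX xd by simp
  qed
  note i\<Psi> = minv_props[OF \<Psi>c d\<Psi>]
  have JME: "J * (?M * E) = E * minv \<Psi>"
  proof -
    have "J * (?M * (E * (\<Psi> * minv \<Psi>))) = J * ((?M * (E * \<Psi>)) * minv \<Psi>)"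
      using d \<Psi>d carrier_matD[OF i\<Psi>(1)] by (simp add: mm_assoc)
    then show ?thesis unfolding ME\<Psi> i\<Psi>(2) using d carrier_matD[OF i\<Psi>(1)] by (simp add: mat_ring JX)
  qed
  have JME': "J * (?M * (E * X)) = E * (minv \<Psi> * X)" if "dim_row X = m" for X
    using arg_cong[OF JME, of "\<lambda>M. M * X"] d that carrier_matD[OF i\<Psi>(1)] by (simp add: mm_assoc)
  have J_inv: "E * (H * (J * Z)) = J * Z" if Z: "dim_row Z = e" and eq: "E * (H * (minv ?M * Z)) = minv ?M * Z" for Z
  proof -
    have "J * Z = J * (?M * (E * (H * (minv ?M * Z))))" unfolding eq using Z by (simp add: MX)
    also have "\<dots> = E * (minv \<Psi> * (H * (minv ?M * Z)))" using d by (simp add: JME')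
    finally have "J * Z = E * (minv \<Psi> * (H * (minv ?M * Z)))" .
    then show ?thesis using d carrier_matD[OF i\<Psi>(1)] by (simp add: HEX)
  qed
  have "e \<le> m"
  proof (rule SMR_controllable[OF smr E H HE])
    show "E * (H * (J * (T ! i * E))) = J * (T ! i * E)" if "i < g" for i
      by (rule J_inv[OF _ liftT[OF that]]) (use carrier_matD[OF matsD(2)[OF basic(4) that]] in simp)
    show "E * (H * (J * (S ! i * E))) = J * (S ! i * E)" if "i < h" for i
      by (rule J_inv[OF _ liftS[OF that]]) (use carrier_matD[OF matsD(2)[OF basic(6) that]] in simp)
    show "E * (H * (J * cm)) = J * cm" by (rule J_inv[OF _ KE[OF c1]]) (use d in simp)
  qed
  then have me: "m = e" using m by simp
  have EH: "E * H = 1\<^sub>m e" by (rule inverse_comm[OF H[unfolded me] E[unfolded me] HE[unfolded me]])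
  show ?thesis
  proof
    show "reach U \<subseteq> carrier_mat e 1" using K by (simp add: colspace_def)
    show "carrier_mat e 1 \<subseteq> reach U"
    proof
      fix x :: "complex mat" assume x: "x \<in> carrier_mat e 1"
      have "x = E * (H * x)" using mm_assoc_eq[OF EH, of x] d carrier_matD[OF x] by (simp add: mm_one_left)
      moreover have "E * (H * x) \<in> reach U" by (rule EK) (use d carrier_matD[OF x] in \<open>auto intro!: carrier_matI\<close>)
      ultimately show "x \<in> reach U" by simp
    qed
  qed
qed

end

section \<open>Off-diagonal directions fill the range of the inclusion\<close>

lemma kron_one_mult_index:
  assumes i: "i < a" and q: "q < n" and M: "M \<in> carrier_mat n N" and z: "z \<in> carrier_mat (a * N) 1"
  shows "(kron (1\<^sub>m a) M * z) $$ (i * n + q, 0) = (\<Sum>l<N. M $$ (q, l) * z $$ (i * N + l, 0))"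
proof -
  note d = carrier_matD[OF M] carrier_matD[OF z]
  have "i * n + q < (i + 1) * n" using q by (simp add: algebra_simps)
  also have "\<dots> \<le> a * n" using i by (intro mult_le_mono1) simp
  finally have iq: "i * n + q < a * n" .
  have dm: "(i * n + q) div n = i" "(i * n + q) mod n = q" using q by auto
  have "(kron (1\<^sub>m a) M * z) $$ (i * n + q, 0) = (\<Sum>k<a * N. kron (1\<^sub>m a) M $$ (i * n + q, k) * z $$ (k, 0))"
    using iq d by (subst times_mat_index) auto
  also have "\<dots> = (\<Sum>k<a * N. (if i = k div N then M $$ (q, k mod N) * z $$ ((k div N) * N + k mod N, 0) else 0))"
    by (rule sum.cong) (use iq d i dm div_lt_of_lt_mult[of _ a N] in auto)
  also have "\<dots> = (\<Sum>i'<a. \<Sum>l<N. if i = i' then M $$ (q, l) * z $$ (i' * N + l, 0) else 0)"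
    by (rule sum_div_mod)
  also have "\<dots> = (\<Sum>i'<a. if i = i' then \<Sum>l<N. M $$ (q, l) * z $$ (i' * N + l, 0) else 0)"
    by (rule sum.cong) auto
  also have "\<dots> = (\<Sum>l<N. M $$ (q, l) * z $$ (i * N + l, 0))" using i by simp
  finally show ?thesis .
qed

text \<open>The rows \<open>r i\<close> form a dual system for the \<open>a\<close> blocks of
  \<open>z\<close>. Hence the sum of the blocks of \<open>u\<close>, each times its row, is a matrix
  that sends block \<open>i\<close> of \<open>z\<close> to block \<open>i\<close> of
  \<open>u\<close>.\<close>

lemma kron_rows_surj:
  assumes z: "z \<in> carrier_mat (a * N) 1" and r: "\<And>i. i < a \<Longrightarrow> r i \<in> carrier_mat 1 N"
    and rz: "\<And>i. i < a \<Longrightarrow> kron (1\<^sub>m a) (r i) * z = colmat (unit_vec a i)"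
    and u: "u \<in> carrier_mat (a * n) 1"
  shows "\<exists>M\<in>carrier_mat n N. kron (1\<^sub>m a) M * z = u"
proof
  let ?M = "mat n N (\<lambda>(q, l). \<Sum>i<a. u $$ (i * n + q, 0) * r i $$ (0, l))"
  show M: "?M \<in> carrier_mat n N" by simp
  show "kron (1\<^sub>m a) ?M * z = u"
  proof (rule eq_matI)
    fix p j assume "p < dim_row u" "j < dim_col u"
    then have p: "p < a * n" and j: "j = 0" using u by auto
    define i where "i = p div n"
    define q where "q = p mod n"
    have i: "i < a" and q: "q < n" and pq: "p = i * n + q"
      using p div_lt_of_lt_mult mod_lt_of_lt_mult by (auto simp: i_def q_def)
    have r1: "(\<Sum>l<N. r i' $$ (0, l) * z $$ (i * N + l, 0)) = (if i = i' then 1 else 0)" if "i' < a" for i'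
    proof -
      have "(\<Sum>l<N. r i' $$ (0, l) * z $$ (i * N + l, 0)) = (kron (1\<^sub>m a) (r i') * z) $$ (i * 1 + 0, 0)"
        by (rule kron_one_mult_index[symmetric]) (use i r that z in auto)
      then show ?thesis unfolding rz[OF that] using i that by (simp add: colmat_def)
    qed
    have "(kron (1\<^sub>m a) ?M * z) $$ (p, 0) = (\<Sum>l<N. ?M $$ (q, l) * z $$ (i * N + l, 0))"
      unfolding pq by (rule kron_one_mult_index[OF i q M z])
    also have "\<dots> = (\<Sum>l<N. \<Sum>i'<a. u $$ (i' * n + q, 0) * (r i' $$ (0, l) * z $$ (i * N + l, 0)))"
      by (rule sum.cong) (use q in \<open>auto simp: sum_distrib_right mult.assoc\<close>)
    also have "\<dots> = (\<Sum>i'<a. \<Sum>l<N. u $$ (i' * n + q, 0) * (r i' $$ (0, l) * z $$ (i * N + l, 0)))"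
      by (rule sum.swap)
    also have "\<dots> = (\<Sum>i'<a. u $$ (i' * n + q, 0) * (\<Sum>l<N. r i' $$ (0, l) * z $$ (i * N + l, 0)))"
      by (simp add: sum_distrib_left)
    also have "\<dots> = (\<Sum>i'<a. if i = i' then u $$ (i' * n + q, 0) else 0)"
      by (rule sum.cong) (auto simp: r1)
    also have "\<dots> = u $$ (p, 0)" using i by (simp add: pq)
    finally show "(kron (1\<^sub>m a) ?M * z) $$ (p, j) = u $$ (p, j)" by (simp add: j)
  qed (use u z in auto)
qed

lemma colspace_columns:
  assumes K: "colspace b K" and M: "M \<in> carrier_mat b m"
    and c: "\<And>j. j < m \<Longrightarrow> M * colmat (unit_vec m j) \<in> K" and x: "x \<in> carrier_mat m 1"
  shows "M * x \<in> K"
proof -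
  note d = carrier_matD[OF M] carrier_matD[OF x]
  have K0: "0\<^sub>m b 1 \<in> K" "\<And>x y. x \<in> K \<Longrightarrow> y \<in> K \<Longrightarrow> x + y \<in> K" "\<And>z x. x \<in> K \<Longrightarrow> z \<cdot>\<^sub>m x \<in> K"
    using K by (auto simp: colspace_def)
  define s where "s p = mat m 1 (\<lambda>(i, j). if i < p then x $$ (i, 0) else 0)" for p
  have sd: "dim_row (s p) = m" "dim_col (s p) = 1" for p by (auto simp: s_def)
  have "M * s p \<in> K" if "p \<le> m" for p
    using that
  proof (induction p)
    case 0
    have "s 0 = 0\<^sub>m m 1" by (rule eq_matI) (auto simp: s_def)
    then show ?case using K0(1) d by (simp add: mm_zero_right)
  next
    case (Suc p)
    have "s (Suc p) = s p + x $$ (p, 0) \<cdot>\<^sub>m colmat (unit_vec m p)"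
      by (rule eq_matI) (use Suc.prems in \<open>auto simp: s_def colmat_def less_Suc_eq\<close>)
    then have "M * s (Suc p) = M * s p + x $$ (p, 0) \<cdot>\<^sub>m (M * colmat (unit_vec m p))"
      using d sd by (simp add: mat_ring)
    moreover have "M * s p \<in> K" "M * colmat (unit_vec m p) \<in> K" using Suc c[of p] by auto
    ultimately show ?case using K0(2,3) by simp
  qed
  from this[of m] have "M * s m \<in> K" by simp
  moreover have "s m = x" by (rule eq_matI) (use d in \<open>auto simp: s_def\<close>)
  ultimately show ?thesis by simp
qed

context wf_real
begin

text \<open>Direct sums put finitely many reachable vectors over one common point and one vector
  \<open>v\<close>, the rows being extended by zeros. For the unit vectors this yields a single
  solution with independent blocks.\<close>

lemma reach_directed:
  assumes U: "free_set h g U" "nc_subset U (dom_r h g R)" "U 1 \<noteq> {}"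
    and x: "\<And>i. i < (p::nat) \<Longrightarrow> x i \<in> reach U"
  shows "\<exists>N\<ge>1. \<exists>B Y v. (B, Y) \<in> U N \<and> v \<in> carrier_mat N 1 \<and>
    (\<forall>i<p. \<exists>r\<in>carrier_mat 1 N. x i = kron (1\<^sub>m e) r * (minv (pen N B Y) * (ccol N * v)))"
  using x
proof (induction p)
  case 0
  then show ?case using U(3) by (auto intro!: exI[of _ "1::nat"] exI[of _ "0\<^sub>m 1 1"])
next
  case (Suc p)
  have sub: "A' \<in> mats q q h \<and> X' \<in> mats q q g \<and> det (pen q A' X') \<noteq> 0" if "q \<ge> 1" "(A', X') \<in> U q" for q A' X'
  proof -
    have "(A', X') \<in> dom_r h g R q" using U(2) that by (auto simp: nc_subset_def)
    then show ?thesis by (auto simp: dom_r_def nc_space_def herm_tuples_iff)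
  qed
  have "\<exists>N\<ge>1. \<exists>B Y v. (B, Y) \<in> U N \<and> v \<in> carrier_mat N 1 \<and>
    (\<forall>i<p. \<exists>r\<in>carrier_mat 1 N. x i = kron (1\<^sub>m e) r * (minv (pen N B Y) * (ccol N * v)))"
    by (rule Suc.IH) (use Suc.prems in simp)
  then obtain N B Y v where N: "N \<ge> 1" "(B, Y) \<in> U N" "v \<in> carrier_mat N 1"
    and IH: "\<And>i. i < p \<Longrightarrow> \<exists>r\<in>carrier_mat 1 N. x i = kron (1\<^sub>m e) r * (minv (pen N B Y) * (ccol N * v))"
    by blast
  from Suc.prems[of p] obtain N' B' Y' v' r' where
    N': "N' \<ge> 1" "(B', Y') \<in> U N'" "v' \<in> carrier_mat N' 1" "r' \<in> carrier_mat 1 N'"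
    and x': "x p = kron (1\<^sub>m e) r' * (minv (pen N' B' Y') * (ccol N' * v'))" unfolding reach_def by blast
  note s = sub[OF N(1,2)] and s' = sub[OF N'(1,2)]
  note sol = solve_dsum[OF conjunct1[OF s] conjunct1[OF conjunct2[OF s]] conjunct1[OF s'] conjunct1[OF conjunct2[OF s']]
    conjunct2[OF conjunct2[OF s]] conjunct2[OF conjunct2[OF s']] N(3) N'(3)]
  note rd = carrier_matD[OF N(3)] carrier_matD[OF N'(3)]
    carrier_matD[OF minv_props(1)[OF pen_carrier conjunct2[OF conjunct2[OF s]]]]
    carrier_matD[OF minv_props(1)[OF pen_carrier conjunct2[OF conjunct2[OF s']]]]
  let ?z = "minv (pen N B Y) * (ccol N * v)" and ?z' = "minv (pen N' B' Y') * (ccol N' * v')"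
  have zd: "dim_row ?z = e * N" "dim_row ?z' = e * N'" "dim_col ?z = 1" "dim_col ?z' = 1" using rd by simp_all
  have comb: "kron (1\<^sub>m e) (a * adj (iota1 N N') + a' * adj (iota2 N N')) *
      (kron (1\<^sub>m e) (iota1 N N') * ?z + kron (1\<^sub>m e) (iota2 N N') * ?z') = kron (1\<^sub>m e) a * ?z + kron (1\<^sub>m e) a' * ?z'"
    if "a \<in> carrier_mat 1 N" "a' \<in> carrier_mat 1 N'" for a a'
    by (rule row_iota) (use zd that in auto)
  let ?v = "iota1 N N' * v + iota2 N N' * v'"
  show ?case
  proof (intro exI conjI allI impI)
    show "1 \<le> N + N'" using N(1) by simp
    show "(map2 dsum B B', map2 dsum Y Y') \<in> U (N + N')"
      by (rule free_set_dsum[OF U(1) N(1) N'(1) N(2) N'(2)])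
    show "?v \<in> carrier_mat (N + N') 1" using rd by (auto intro!: carrier_matI)
    fix i assume i: "i < Suc p"
    show "\<exists>r\<in>carrier_mat 1 (N + N'). x i = kron (1\<^sub>m e) r *
        (minv (pen (N + N') (map2 dsum B B') (map2 dsum Y Y')) * (ccol (N + N') * ?v))"
    proof (cases "i = p")
      case True
      show ?thesis unfolding sol
      proof
        show "x i = kron (1\<^sub>m e) (0\<^sub>m 1 N * adj (iota1 N N') + r' * adj (iota2 N N')) *
            (kron (1\<^sub>m e) (iota1 N N') * ?z + kron (1\<^sub>m e) (iota2 N N') * ?z')"
          unfolding comb[OF zero_carrier_mat N'(4)] True x' using zd carrier_matD[OF N'(4)]
          by (intro eq_matI) (simp_all add: mm_zero_left del: index_mult_mat(1))
      qed (use carrier_matD[OF N'(4)] in \<open>auto intro!: carrier_matI\<close>)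
    next
      case False
      with i have "i < p" by simp
      from IH[OF this] obtain r where r: "r \<in> carrier_mat 1 N" and xi: "x i = kron (1\<^sub>m e) r * ?z" by blast
      show ?thesis unfolding sol
      proof
        show "x i = kron (1\<^sub>m e) (r * adj (iota1 N N') + 0\<^sub>m 1 N' * adj (iota2 N N')) *
            (kron (1\<^sub>m e) (iota1 N N') * ?z + kron (1\<^sub>m e) (iota2 N N') * ?z')"
          unfolding comb[OF r zero_carrier_mat] xi using zd carrier_matD[OF r]
          by (intro eq_matI) (simp_all add: mm_zero_left del: index_mult_mat(1))
      qed (use carrier_matD[OF r] in \<open>auto intro!: carrier_matI\<close>)
    qed
  qed
qed

end

lemma kron_unit_vec:
  assumes "j < m * n"
  shows "kron (colmat (unit_vec m (j div n))) (colmat (unit_vec n (j mod n))) = colmat (unit_vec (m * n) j)"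
proof (rule eq_matI)
  fix i l assume "i < dim_row (colmat (unit_vec (m * n) j) :: complex mat)" "l < dim_col (colmat (unit_vec (m * n) j) :: complex mat)"
  then have i: "i < m * n" and l: "l = 0" by auto
  have "i = j \<longleftrightarrow> i div n = j div n \<and> i mod n = j mod n" by (metis div_mult_mod_eq)
  then show "kron (colmat (unit_vec m (j div n))) (colmat (unit_vec n (j mod n))) $$ (i, l) = (colmat (unit_vec (m * n) j) :: complex mat) $$ (i, l)"
    using i l assms div_lt_of_lt_mult[of _ m n] mod_lt_of_lt_mult[of _ m n] by (auto simp: colmat_def)
qed auto

context wf_real
begin

text \<open>Positivity is tested on one fixed solution \<open>z\<close> at a point of
  \<open>U\<close>. The vectors \<open>T(H) z\<close> form a subspace \<open>K\<close>, and it
  remains to see that \<open>K\<close> contains the range of the inclusion tensored with the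
  identity.\<close>

lemma domain_good:
  assumes D: "vertebral_domain_of_convexity h g R D"
    and U: "free_set h g U" "nc_open h g U" "nc_subset U D" "U 1 \<noteq> {}"
    and smr: "SMR h g rr R" "set_nc_expr rr \<subseteq> vars_ax h g"
    and n: "n \<ge> 1" and AX: "(A, X) \<in> D n"
  shows "good (V_T R) n A X"
proof -
  have Dr: "nc_subset D (dom_r h g R)"
    using D by (simp add: vertebral_domain_of_convexity_def convex_in_x_on_def)
  have Ur: "nc_subset U (dom_r h g R)" using U(3) Dr unfolding nc_subset_def by blast
  note full = reach_full[OF U(1,2) Ur U(4) smr]
  have uR: "colmat (unit_vec e i) \<in> reach U" for i unfolding full by (rule carrier_matI) auto
  obtain N B Y v where N: "N \<ge> 1" "(B, Y) \<in> U N" "v \<in> carrier_mat N 1"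
    and r0: "\<forall>i<e. \<exists>r\<in>carrier_mat 1 N. colmat (unit_vec e i) = kron (1\<^sub>m e) r * (minv (pen N B Y) * (ccol N * v))"
    using reach_directed[where U = U and p = e and x = "\<lambda>i. colmat (unit_vec e i)", OF U(1) Ur U(4) uR] by blast
  define z where "z = minv (pen N B Y) * (ccol N * v)"
  have BY: "(B, Y) \<in> D N" using U(3) N unfolding nc_subset_def by blast
  have "(B, Y) \<in> dom_r h g R N" using Dr BY N(1) by (auto simp: nc_subset_def)
  then have d2: "det (pen N B Y) \<noteq> 0" by (simp add: dom_r_def)
  have z: "z \<in> carrier_mat (e * N) 1"
    using carrier_matD[OF minv_props(1)[OF pen_carrier d2]] carrier_matD[OF N(3)] by (auto simp: z_def intro!: carrier_matI)
  note zd = carrier_matD[OF z]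
  from r0 obtain r where r: "\<And>i. i < e \<Longrightarrow> r i \<in> carrier_mat 1 N"
    "\<And>i. i < e \<Longrightarrow> kron (1\<^sub>m e) (r i) * z = colmat (unit_vec e i)"
    unfolding z_def[symmetric] by metis
  have surj: "\<exists>M\<in>carrier_mat n N. kron (1\<^sub>m e) M * z = u" if "u \<in> carrier_mat (e * n) 1" for u
    by (rule kron_rows_surj[where r = r, OF z _ _ that]) (use r in auto)
  let ?P = "\<lambda>H. plin (e * n) (e * N) T H * z"
  define K where "K = ?P ` mats n N g"
  have K: "colspace (e * n) K"
    unfolding colspace_def
  proof (intro conjI ballI allI)
    show "K \<subseteq> carrier_mat (e * n) 1" using zd by (auto simp: K_def intro!: carrier_matI)
    have "?P (single g n N g (0\<^sub>m n N)) = 0\<^sub>m (e * n) 1"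
      using plin_single[OF basic(4) zero_carrier_mat[of n N], of g] zd by (simp add: mm_zero_left)
    then show "0\<^sub>m (e * n) 1 \<in> K"
      unfolding K_def using single_mats[OF zero_carrier_mat[of n N], of g g] by (metis imageI)
  next
    fix x y assume "x \<in> K" "y \<in> K"
    then obtain H H' where H: "H \<in> mats n N g" "H' \<in> mats n N g" and xy: "x = ?P H" "y = ?P H'"
      unfolding K_def by blast
    have "x + y = ?P (map2 (+) H H')"
      unfolding xy plin_add[OF basic(4) H] using zd by (simp add: mm_add_left)
    moreover have "map2 (+) H H' \<in> mats n N g"
      by (rule matsI) (use matsD[OF H(1)] matsD[OF H(2)] in auto)
    ultimately show "x + y \<in> K" unfolding K_def by blast
  next
    fix c x assume "x \<in> K"
    then obtain H where H: "H \<in> mats n N g" and xy: "x = ?P H" unfolding K_def by blast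
    have "c \<cdot>\<^sub>m x = ?P (map (\<lambda>x. c \<cdot>\<^sub>m x) H)"
      unfolding xy plin_smult[OF basic(4) H] using zd by (simp add: mm_smult_left)
    moreover have "map (\<lambda>x. c \<cdot>\<^sub>m x) H \<in> mats n N g"
      by (rule matsI) (use matsD[OF H(1)] in auto)
    ultimately show "c \<cdot>\<^sub>m x \<in> K" unfolding K_def by blast
  qed
  \<comment> \<open>A direction with the single component \<open>M\<close> in slot \<open>i\<close>
    gives \<open>T_i \<otimes> 1\<close> applied to \<open>(1 \<otimes> M) z\<close>, and by
    \<open>surj\<close> the latter vector is arbitrary.\<close>
  have TK: "kron (T ! i) (1\<^sub>m n) * u \<in> K" if i: "i < g" and u: "u \<in> carrier_mat (e * n) 1" for i u
  proof -
    obtain M where M: "M \<in> carrier_mat n N" and Mz: "kron (1\<^sub>m e) M * z = u" using surj[OF u] by blast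
    note Td = carrier_matD[OF matsD(2)[OF basic(4) i]] carrier_matD[OF M]
    have "kron (T ! i) (1\<^sub>m n) * kron (1\<^sub>m e) M = kron (T ! i) M"
      using Td by (simp add: kron_mult mm_one_left mm_one_right)
    from mm_assoc_eq[OF this, of z] have "kron (T ! i) (1\<^sub>m n) * u = ?P (single g n N i M)"
      using Td zd i by (simp add: Mz plin_single[OF basic(4) M])
    then show ?thesis unfolding K_def using single_mats[OF M] by blast
  qed
  \<comment> \<open>The vectors \<open>w\<close> all of whose tensor products with columns
    \<open>u\<close> lie in \<open>K\<close> form a subspace that contains the ranges of the
    \<open>T_i\<close>, hence also their span.\<close>
  let ?N = "{w \<in> carrier_vec e. \<forall>u\<in>carrier_mat n 1. kron (colmat w) u \<in> K}"
  have Kz: "0\<^sub>m (e * n) 1 \<in> K" and Ka: "\<And>x y. x \<in> K \<Longrightarrow> y \<in> K \<Longrightarrow> x + y \<in> K"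
    and Ks: "\<And>c x. x \<in> K \<Longrightarrow> c \<cdot>\<^sub>m x \<in> K" using K by (auto simp: colspace_def)
  have "rangeT \<subseteq> ?N"
  proof (rule rangeT_minimal)
    show "(\<Union>M \<in> set T. mat_range M) \<subseteq> ?N"
    proof
      fix w assume "w \<in> (\<Union>M \<in> set T. mat_range M)"
      then obtain M y where MT: "M \<in> set T" and y0: "y \<in> carrier_vec (dim_col M)" and w0: "w = M *\<^sub>v y"
        unfolding mat_range_def by blast
      from MT obtain i where i: "i < g" and Mi: "M = T ! i"
        unfolding in_set_conv_nth matsD(1)[OF basic(4)] by blast
      have y: "dim_vec y = dim_col (T ! i)" and w: "w = T ! i *\<^sub>v y" using y0 w0 Mi by auto
      note Td = carrier_matD[OF matsD(2)[OF basic(4) i]]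
      show "w \<in> ?N"
      proof (intro CollectI conjI ballI)
        show "w \<in> carrier_vec e" using Td by (auto simp: w intro!: carrier_vecI)
        fix u :: "complex mat" assume u: "u \<in> carrier_mat n 1"
        note ud = carrier_matD[OF u]
        have "kron (colmat w) u = kron (T ! i) (1\<^sub>m n) * kron (colmat y) u"
          using Td y ud by (simp add: w colmat_mult kron_mult mm_one_left)
        moreover have "kron (colmat y) u \<in> carrier_mat (e * n) 1" by (rule carrier_matI) (use y Td ud in simp_all)
        ultimately show "kron (colmat w) u \<in> K" using TK[OF i] by simp
      qed
    qed
    show "?N \<subseteq> carrier_vec e" by blast
    have "kron (colmat (0\<^sub>v e)) u = 0\<^sub>m (e * n) 1" if "u \<in> carrier_mat n 1" for u
      using colmat_zero[of "0\<^sub>v e" e] that by auto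
    then show "0\<^sub>v e \<in> ?N" using Kz by auto
  next
    fix x y assume xy: "x \<in> ?N" "y \<in> ?N"
    have "kron (colmat (x + y)) u = kron (colmat x) u + kron (colmat y) u" if "u \<in> carrier_mat n 1" for u
    proof -
      have "colmat (x + y) = colmat x + colmat y" using xy by (intro eq_matI) (auto simp: colmat_def)
      moreover have "kron (colmat x + colmat y) u = kron (colmat x) u + kron (colmat y) u"
        by (rule kron_add_left) (use xy in auto)
      ultimately show ?thesis by simp
    qed
    then show "x + y \<in> ?N" using xy Ka by auto
  next
    fix c x assume x: "x \<in> ?N"
    have "colmat (c \<cdot>\<^sub>v x) = c \<cdot>\<^sub>m colmat x" by (intro eq_matI) (auto simp: colmat_def)
    then show "c \<cdot>\<^sub>v x \<in> ?N" using x Ks by (auto simp: kron_smult_left)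
  qed
  let ?V = "V_T R"
  let ?m = "dim_col ?V"
  note Vd = V_T_props(1)
  \<comment> \<open>On a unit vector, \<open>V \<otimes> 1\<close> gives the tensor product of a
    column of \<open>V\<close> with a unit vector, and the columns of \<open>V\<close> lie in the
    span just treated.\<close>
  have VK: "kron ?V (1\<^sub>m n) * x \<in> K" if x: "x \<in> carrier_mat (?m * n) 1" for x
  proof (rule colspace_columns[OF K _ _ x])
    show "kron ?V (1\<^sub>m n) \<in> carrier_mat (e * n) (?m * n)" using Vd by (auto intro!: carrier_matI)
    fix j assume j: "j < ?m * n"
    let ?w = "?V *\<^sub>v unit_vec ?m (j div n)" and ?u = "colmat (unit_vec n (j mod n))"
    have "?w \<in> mat_range ?V" unfolding mat_range_def by (rule imageI) (rule unit_vec_carrier)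
    then have "?w \<in> ?N" unfolding V_T_props(3) by (rule subsetD[OF \<open>rangeT \<subseteq> ?N\<close>])
    then have w: "u \<in> carrier_mat n 1 \<Longrightarrow> kron (colmat ?w) u \<in> K" for u by simp
    have "kron ?V (1\<^sub>m n) * colmat (unit_vec (?m * n) j) = kron (colmat ?w) ?u"
      unfolding kron_unit_vec[OF j, symmetric] by (simp add: kron_mult colmat_mult mm_one_left)
    moreover have "kron (colmat ?w) ?u \<in> K" by (rule w) (rule carrier_matI, simp_all)
    ultimately show "kron ?V (1\<^sub>m n) * colmat (unit_vec (?m * n) j) \<in> K" by simp
  qed
  have "(A, X) \<in> dom_r h g R n" using Dr AX n by (auto simp: nc_subset_def)
  then have A: "A \<in> herm_tuples n h" "X \<in> herm_tuples n g" and d1: "det (pen n A X) \<noteq> 0"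
    by (auto simp: dom_r_def nc_space_def)
  let ?M = "minv (pen n A X)"
  note Md = carrier_matD[OF minv_props(1)[OF pen_carrier d1]]
  have Mh: "adj ?M = ?M" by (rule hermitian_minv[OF pen_carrier d1 pen_herm[OF A]])
  have "psd (compressed ?V R n A X)"
    unfolding compressed_alt[OF Vd d1] psd_iff
  proof (intro conjI ballI)
    show "hermitian (adj (kron ?V (1\<^sub>m n)) * (?M * kron ?V (1\<^sub>m n)))"
      unfolding hermitian_iff using Md Vd Mh by (simp add: mm_assoc del: adj_kron)
    fix x :: "complex mat" assume "x \<in> carrier_mat (dim_row (adj (kron ?V (1\<^sub>m n)) * (?M * kron ?V (1\<^sub>m n)))) 1"
    then have x: "x \<in> carrier_mat (?m * n) 1" by simp
    obtain H where H: "H \<in> mats n N g" and eq: "kron ?V (1\<^sub>m n) * x = ?P H" using VK[OF x] unfolding K_def by blast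
    have "qf (adj (kron ?V (1\<^sub>m n)) * (?M * kron ?V (1\<^sub>m n))) x = qf ?M (?P H)"
      unfolding eq[symmetric] by (rule qf_cong_mult) (use Md Vd carrier_matD[OF x] in auto)
    then show "0 \<le> qf (adj (kron ?V (1\<^sub>m n)) * (?M * kron ?V (1\<^sub>m n))) x"
      using off_diagonal_positivity[OF D n N(1) AX BY H N(3)] by (simp add: z_def)
  qed
  then show ?thesis using d1 by (simp add: good_def)
qed

lemma full_domain_subset:
  assumes D: "full_vertebral_domain_of_convexity h g R D"
    and smr: "SMR h g rr R" "set_nc_expr rr \<subseteq> vars_ax h g"
  shows "nc_subset D (dom_ver_plus h g R)"
  unfolding nc_subset_def
proof (intro allI impI subrelI)
  fix n A X assume n: "1 \<le> n" and AX: "(A, X) \<in> D n"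
  obtain U where U: "free_set h g U" "nc_open h g U" "nc_subset U D" "U 1 \<noteq> {}"
    and Dv: "vertebral_domain_of_convexity h g R D"
    using D unfolding full_vertebral_domain_of_convexity_def by blast
  \<comment> \<open>As \<open>D\<close> is vertebral, the base point \<open>(A, 0)\<close> lies in
    \<open>D\<close>, and the same positivity argument applies to it.\<close>
  have A0: "(A, zero_tuple n g) \<in> D n"
    using Dv n AX unfolding vertebral_domain_of_convexity_def vertebral_def by blast
  have "(A, X) \<in> nc_space h g n"
    using Dv n AX unfolding vertebral_domain_of_convexity_def free_set_def nc_subset_def by blast
  then show "(A, X) \<in> dom_ver_plus h g R n"
    using domain_good[OF Dv U smr n AX] domain_good[OF Dv U smr n A0]
    by (simp add: dom_ver_plus_iff nc_space_def)
qed

text \<open>The free open set that makes \<open>D\<close> full lies in \<open>dom_ver_plus\<close>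
  by the inclusion just shown, so it serves as witness again.\<close>

lemma full_dom_ver_plus:
  assumes D: "full_vertebral_domain_of_convexity h g R D"
    and smr: "SMR h g rr R" "set_nc_expr rr \<subseteq> vars_ax h g"
  shows "full_vertebral_domain_of_convexity h g R (dom_ver_plus h g R)"
proof -
  interpret coisometry_real h g R "V_T R" "dim_col (V_T R)" by (rule coisometry_V_T)
  obtain U where U: "free_set h g U" "nc_open h g U" "nc_subset U D" "U 1 \<noteq> {}"
    using D unfolding full_vertebral_domain_of_convexity_def by blast
  have "nc_subset U (dom_ver_plus h g R)"
    using U(3) full_domain_subset[OF D smr] unfolding nc_subset_def by blast
  then show ?thesis
    unfolding full_vertebral_domain_of_convexity_def using U vertebral_domain_dom_ver_plus[OF refl] by blast
qed

end

theorem theorem1p2: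
  fixes h g :: nat and r :: "ax_var nc_expr" and R :: realization
  assumes "1 \<le> h" and "1 \<le> g"
    and "set_nc_expr r \<subseteq> vars_ax h g"
    and "nc_symmetric_ax h g r"
    and "regular_at_origin h g r"
    and "SMR h g r R"
  shows
    "vertebral_domain_of_convexity h g R (dom_ver_plus h g R) \<and>
     (\<forall>D. full_vertebral_domain_of_convexity h g R D \<longrightarrow>
        nc_subset D (dom_ver_plus h g R) \<and>
        full_vertebral_domain_of_convexity h g R (dom_ver_plus h g R)) \<and>
     (\<exists>k T' w.
        1 \<le> k \<and> length T' = g \<and> set T' \<subseteq> carrier_mat k k \<and>
        nc_mat_over (vars_a h) k k w \<and>
        nc_mat_symmetric_a h w \<and>
        (\<forall>n \<ge> 1. \<forall>A \<in> proj_a (dom_ver h g R) n. nc_mat_defined n (env_a A) w) \<and>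
        (\<forall>n \<ge> 1. dom_ver_plus h g R n =
           {(A, X) \<in> dom_ver h g R n.
              let W = nc_mat_eval n (env_a A) w in
              psd W \<and> pd (1\<^sub>m (k * n) - psd_sqrt W * lin_pencil k n T' X * psd_sqrt W)}) \<and>
        (\<exists>l f.
           nc_mat_over (vars_ax h g) k 1 l \<and>
           (\<forall>n \<ge> 1. \<forall>(A, X) \<in> dom_ver h g R n. nc_mat_defined n (env_ax A X) l) \<and>
           linear_in_x h g l \<and>
           set_nc_expr f \<subseteq> vars_ax h g \<and>
           nc_symmetric_ax h g f \<and>
           (\<forall>n \<ge> 1. \<forall>(A, X) \<in> dom_ver h g R n. nc_eval n (env_ax A X) f \<noteq> None) \<and>
           affine_in_x h g f \<and>
           (\<forall>n \<ge> 1. \<forall>(A, X) \<in> dom_ver_plus h g R n.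
              let W = nc_mat_eval n (env_a A) w; L = nc_mat_eval n (env_ax A X) l in
              realization_eval R n A X =
                mat_adjoint L * psd_sqrt W *
                  minv (1\<^sub>m (k * n) - psd_sqrt W * lin_pencil k n T' X * psd_sqrt W) *
                  psd_sqrt W * L
                + the (nc_eval n (env_ax A X) f))))"
proof -
  interpret wf_real h g R
    using \<open>SMR h g r R\<close> by unfold_locales (simp add: SMR_def symmetric_realization_def)
  interpret C: coisometry_real h g R "V_T R" "dim_col (V_T R)" by (rule coisometry_V_T)
  show ?thesis
    using C.vertebral_domain_dom_ver_plus[OF refl] C.parts_3_4[OF refl] full_domain_subset[OF _ \<open>SMR h g r R\<close> \<open>set_nc_expr r \<subseteq> vars_ax h g\<close>]
      full_dom_ver_plus[OF _ \<open>SMR h g r R\<close> \<open>set_nc_expr r \<subseteq> vars_ax h g\<close>]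
    by (intro conjI allI impI)
qed

end
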